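(* In the setting fixed in the context, let the boundary-condition parameters $\mathbf{G}_{\mathrm{bc}}=\{E_p,E_b,E_z\}$ be well-posed, let $\mathbf{G}_{\mathrm{pdde}}$ be the PDE parameters and $\boldsymbol\tau=(\tau_1,\dots,\tau_K)$ the delays, and let $\hat{\mathcal{T}},\hat{\mathcal{T}}_z,\hat{\mathcal{A}},\hat{\mathcal{B}}_z,\hat{\mathcal{C}}_w,\hat{\mathcal{D}}_{wz}$ be the operators defined in the context. Let $z:[0,\infty)\to\mathbb{R}^{n_z}$ be an input. Then, for every $\mathbf{v}_0\in L_2^{N}[a,b]$, $\boldsymbol\psi_0\in\bigl(L_2^{N}[[0,1]\times[a,b]]\times L_2^{n_z}[0,1]\bigr)^K$ (with $N=n_1+n_2+n_3$) and all functions $\mathbf{v},\boldsymbol\psi$ of $t\ge0$ with values in the same spaces, $\left(\begin{bmatrix}\mathbf{v}\\ \boldsymbol\psi\end{bmatrix},w\right)$ is a solution to the PIE $$\hat{\mathcal{T}}_z\dot z+\hat{\mathcal{T}}\begin{bmatrix}\mathbf{v}_t\\ \boldsymbol\psi_t\end{bmatrix}=\hat{\mathcal{A}}\begin{bmatrix}\mathbf{v}\\ \boldsymbol\psi\end{bmatrix}+\hat{\mathcal{B}}_zz,\qquad w=\hat{\mathcal{C}}_w\begin{bmatrix}\mathbf{v}\\ \boldsymbol\psi\end{bmatrix}+\hat{\mathcal{D}}_{wz}z$$ with initial conditions $(\mathbf{v}_0,\boldsymbol\psi_0)$ and input $z$ if and only if $\left(\begin{bmatrix}\mathbf{u}\\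 \boldsymbol\phi\end{bmatrix},w\right)$ with $\begin{bmatrix}\mathbf{u}\\ \boldsymbol\phi\end{bmatrix}=\hat{\mathcal{T}}\begin{bmatrix}\mathbf{v}\\ \boldsymbol\psi\end{bmatrix}+\hat{\mathcal{T}}_zz$ is a solution to the delayed PDE defined by $\{\mathbf{G}_{\mathrm{pdde}},\mathbf{G}_{\mathrm{bc}},\boldsymbol\tau\}$ with input $z$ and initial conditions $\begin{bmatrix}\mathbf{u}_0\\ \boldsymbol\phi_0\end{bmatrix}=\hat{\mathcal{T}}\begin{bmatrix}\mathbf{v}_0\\ \boldsymbol\psi_0\end{bmatrix}+\hat{\mathcal{T}}_zz(0)$.
   Context: Data. $a<b$; $n_1,n_2,n_3,n_z,n_w\in\mathbb{N}$, $K\ge1$, $N=n_1+n_2+n_3$, delays $0<\tau_1<\dots<\tau_K$. State space $U=L_2^{n_1}[a,b]\times H_1^{n_2}[a,b]\times H_2^{n_3}[a,b]$ (natural norm). For $\mathbf{u}=(\mathbf{u}_1,\mathbf{u}_2,\mathbf{u}_3)\in U$: $\mathscr{D}\mathbf{u}=(\mathbf{u}_1,\partial_x\mathbf{u}_2,\partial_x^2\mathbf{u}_3)$, $\mathscr{D}_{\rm int}\mathbf{u}=(\mathbf{u}_1,\mathbf{u}_2,\mathbf{u}_3,\partial_x\mathbf{u}_2,\partial_x\mathbf{u}_3,\partial_x^2\mathbf{u}_3)\in L_2^{n_{\rm int}}$ with $n_{\rm int}=n_1+2n_2+3n_3$, and $\Lambda_{\rm bf}\mathbf{u}=(\mathbf{u}_2(a),\mathbf{u}_3(a),\partial_x\mathbf{u}_3(a),\mathbf{u}_2(b),\mathbf{u}_3(b),\partial_x\mathbf{u}_3(b))\in\mathbb{R}^{n_{\rm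 bf}}$, $n_{\rm bf}=2(n_2+2n_3)$. The parameters $\mathbf{G}_{\rm pdde}$ are $A_p,A_b,B_z,C_{wp}$ and, for $j=1,\dots,K$, $A_{p,j},A_{b,j},B_{z,j},C_{wp,j}$ (matrix-valued $L_\infty$ functions of $x$), and constant matrices $C_{wb},D_{wz},C_{wb,j},D_{wz,j}$; the parameters $\mathbf{G}_{\rm bc}$ are $E_p\in L_\infty^{(n_2+2n_3)\times n_{\rm int}}[a,b]$ and constant matrices $E_b,E_z$ with $n_2+2n_3$ rows. All dimensions are compatible. Delayed PDE. With input $z(t)\in\mathbb{R}^{n_z}$ and output $w(t)\in\mathbb{R}^{n_w}$, it is $$\mathbf{u}_t(t)=A_p\mathscr{D}_{\rm int}\mathbf{u}(t)+A_b\Lambda_{\rm bf}\mathbf{u}(t)+B_zz(t)+\sum_j\bigl[A_{p,j}\mathscr{D}_{\rm int}\mathbf{u}+A_{b,j}\Lambda_{\rm bf}\mathbf{u}+B_{z,j}z\bigr](t-\tau_j),$$ $$w(t)=\int_a^bC_{wp}\mathscr{D}_{\rm int}\mathbf{u}(t)dx+C_{wb}\Lambda_{\rm bf}\mathbf{u}(t)+D_{wz}z(t)+\sum_j\Bigl[\int_a^bC_{wp,j}\mathscr{D}_{\rm int}\mathbf{u}\,dx+C_{wb,j}\Lambda_{\rm bf}\mathbf{u}+D_{wz,j}z\Bigr](t-\tau_j),$$ with boundary conditions $\mathbf{u}(t)\in X_{z(t)}$, where $X_z=\{\mathbf{u}\in U:\int_a^bE_p\mathscr{D}_{\rm int}\mathbf{u}\,dx+E_b\Lambda_{\rm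 bf}\mathbf{u}+E_zz=0\}$. It is understood through delayed states $\boldsymbol\phi_j(t,s)=(\boldsymbol\phi_{u,j},\boldsymbol\phi_{z,j})(t,s)$ representing $(\mathbf{u},z)(t-\tau_js)$, $s\in[0,1]$. Let $V$ be the space of $\boldsymbol\phi_u=(\boldsymbol\phi_1,\boldsymbol\phi_2,\boldsymbol\phi_3)$ on $[0,1]\times[a,b]$ with $\partial_s^\alpha\partial_x^\beta\boldsymbol\phi_i\in L_2^{n_i}$ for $0\le\alpha\le1$, $0\le\beta\le i-1$ (natural norm), and for $\mathbf{u}\in U$, $z\in\mathbb{R}^{n_z}$ let $$\mathbf{Y}_{(\mathbf{u},z)}=\{(\boldsymbol\phi_u,\boldsymbol\phi_z)\in V\times H_1^{n_z}[0,1]:\boldsymbol\phi_u(0)=\mathbf{u},\ \boldsymbol\phi_z(0)=z,\ \boldsymbol\phi_u(s)\in X_{\boldsymbol\phi_z(s)}\ \forall s\in[0,1]\}.$$ For a (differentiable) input $z$, $((\mathbf{u},\boldsymbol\phi),w)$ with $\boldsymbol\phi=(\boldsymbol\phi_1,\dots,\boldsymbol\phi_K)$ is a solution to the delayed PDE with initial conditions $\mathbf{u}_0\in X_{z(0)}$, $\boldsymbol\phi_0\in\mathbf{Y}_{(\mathbf{u}_0,z(0))}^K$ if $(\mathbf{u},\boldsymbol\phi)$ is Fréchet differentiable in $t\in[0,\infty)$ (in $U\times(V\times H_1^{n_z})^K$), takes the initial values at $t=0$, and for all $t\ge0$: $\mathbf{u}(t)\in X_{z(t)}$, $\boldsymbol\phi_j(t)\in\mathbf{Y}_{(\mathbf{u}(t),z(t))}$,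 $\partial_t\boldsymbol\phi_j=-\frac1{\tau_j}\partial_s\boldsymbol\phi_j$, and the two displayed equations hold with $(\mathscr{D}_{\rm int}\mathbf{u},\Lambda_{\rm bf}\mathbf{u},z)(t-\tau_j)$ replaced by $(\mathscr{D}_{\rm int}\boldsymbol\phi_{u,j}(t,1),\Lambda_{\rm bf}\boldsymbol\phi_{u,j}(t,1),\boldsymbol\phi_{z,j}(t,1))$. Operators. $\mathbf{G}_{\rm bc}$ is well-posed if for every $\mathbf{v}\in L_2^N[a,b]$ and $z\in\mathbb{R}^{n_z}$ there is a unique $\mathbf{u}\in X_z$ with $\mathscr{D}\mathbf{u}=\mathbf{v}$. Then this $\mathbf{u}$ is $\mathcal{T}\mathbf{v}+\mathcal{T}_zz$ for unique linear (partial integral) operators $\mathcal{T}:L_2^N\to U$, $\mathcal{T}_z:\mathbb{R}^{n_z}\to U$. Put $\mathcal{T}_{\rm int}=\mathscr{D}_{\rm int}\mathcal{T}$, $\mathcal{T}_{{\rm int},z}=\mathscr{D}_{\rm int}\mathcal{T}_z$, $\mathcal{T}_{\rm bf}=\Lambda_{\rm bf}\mathcal{T}$, $\mathcal{T}_{{\rm bf},z}=\Lambda_{\rm bf}\mathcal{T}_z$. Define $\mathcal{A}=A_p\mathcal{T}_{\rm int}+A_b\mathcal{T}_{\rm bf}$, $\mathcal{B}_z=B_z+A_p\mathcal{T}_{{\rm int},z}+A_b\mathcal{T}_{{\rm bf},z}$, $\mathcal{C}_w=\int_a^bC_{wp}\mathcal{T}_{\rm int}+C_{wb}\mathcal{T}_{\rm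 bf}$, $\mathcal{D}_{wz}=D_{wz}+\int_a^bC_{wp}\mathcal{T}_{{\rm int},z}+C_{wb}\mathcal{T}_{{\rm bf},z}$; $\mathcal{C}_q\mathbf{v}=(\mathcal{T}_{\rm int}\mathbf{v},\mathcal{T}_{\rm bf}\mathbf{v},0)$, $\mathcal{D}_{qz}z=(\mathcal{T}_{{\rm int},z}z,\mathcal{T}_{{\rm bf},z}z,z)$; for $r=(\mathbf{r}^1,r^2,r^3)\in L_2^{n_{\rm int}}\times\mathbb{R}^{n_{\rm bf}}\times\mathbb{R}^{n_z}$: $\mathcal{B}_{r,j}r=A_{p,j}\mathbf{r}^1+A_{b,j}r^2+B_{z,j}r^3$, $\mathcal{D}_{wr,j}r=\int_a^bC_{wp,j}\mathbf{r}^1dx+C_{wb,j}r^2+D_{wz,j}r^3$; and for $\boldsymbol\psi_j=(\boldsymbol\psi_{u,j},\boldsymbol\psi_{z,j})\in L_2^N[[0,1]\times[a,b]]\times L_2^{n_z}[0,1]$: $$(\bar{\mathcal{T}}_j\boldsymbol\psi_j)(s)=\int_0^s\begin{bmatrix}\mathcal{T}\boldsymbol\psi_{u,j}(\theta)+\mathcal{T}_z\boldsymbol\psi_{z,j}(\theta)\\ \boldsymbol\psi_{z,j}(\theta)\end{bmatrix}d\theta,\quad(\bar{\mathcal{A}}_j\boldsymbol\psi_j)(s)=-\frac1{\tau_j}\begin{bmatrix}\mathcal{T}\boldsymbol\psi_{u,j}(s)+\mathcal{T}_z\boldsymbol\psi_{z,j}(s)\\ \boldsymbol\psi_{z,j}(s)\end{bmatrix},$$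 $$\bar{\mathcal{C}}_j\boldsymbol\psi_j=\int_0^1\begin{bmatrix}\mathcal{T}_{\rm int}\boldsymbol\psi_{u,j}(s)+\mathcal{T}_{{\rm int},z}\boldsymbol\psi_{z,j}(s)\\ \mathcal{T}_{\rm bf}\boldsymbol\psi_{u,j}(s)+\mathcal{T}_{{\rm bf},z}\boldsymbol\psi_{z,j}(s)\\ \boldsymbol\psi_{z,j}(s)\end{bmatrix}ds.$$ Finally, for $\boldsymbol\psi=(\boldsymbol\psi_j)_{j=1}^K$ (functions not depending on $s$ are viewed as constant in $s$): $$\hat{\mathcal{T}}\begin{bmatrix}\mathbf{v}\\ \boldsymbol\psi\end{bmatrix}=\begin{bmatrix}\mathcal{T}\mathbf{v}\\ \bigl((\mathcal{T}\mathbf{v},0)+\bar{\mathcal{T}}_j\boldsymbol\psi_j\bigr)_{j=1}^K\end{bmatrix},\quad\hat{\mathcal{T}}_zz=\begin{bmatrix}\mathcal{T}_zz\\ \bigl((\mathcal{T}_zz,z)\bigr)_{j=1}^K\end{bmatrix},$$ $$\hat{\mathcal{A}}\begin{bmatrix}\mathbf{v}\\ \boldsymbol\psi\end{bmatrix}=\begin{bmatrix}\mathcal{A}\mathbf{v}+\sum_j\mathcal{B}_{r,j}(\mathcal{C}_q\mathbf{v}+\bar{\mathcal{C}}_j\boldsymbol\psi_j)\\ (\bar{\mathcal{A}}_j\boldsymbol\psi_j)_{j=1}^K\end{bmatrix},\quad\hat{\mathcal{B}}_zz=\begin{bmatrix}\mathcal{B}_zz+\sum_j\mathcal{B}_{r,j}\mathcal{D}_{qz}z\\0\end{bmatrix},$$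 $$\hat{\mathcal{C}}_w\begin{bmatrix}\mathbf{v}\\ \boldsymbol\psi\end{bmatrix}=\mathcal{C}_w\mathbf{v}+\sum_j\mathcal{D}_{wr,j}(\mathcal{C}_q\mathbf{v}+\bar{\mathcal{C}}_j\boldsymbol\psi_j),\quad\hat{\mathcal{D}}_{wz}=\mathcal{D}_{wz}+\sum_j\mathcal{D}_{wr,j}\mathcal{D}_{qz}.$$ A solution to the PIE with initial conditions $(\mathbf{v}_0,\boldsymbol\psi_0)$ and (differentiable) input $z$ is $((\mathbf{v},\boldsymbol\psi),w)$ with $(\mathbf{v},\boldsymbol\psi)$ Fréchet differentiable in $t\in[0,\infty)$ in the $L_2$ norms, taking the initial values at $t=0$, and satisfying the equations for all $t\ge0$. *)

theory Defs
  imports "HOL-Analysis.Analysis" "HOL-Library.Function_Algebras"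
begin

text \<open>
  Conventions. All dimensions are natural numbers, zero allowed. A vector in $R^n$ is a function
  on \<^typ>\<open>nat\<close> of which only the components \<open>i < n\<close> matter; a vector-valued function is
  \<open>f i x\<close> with component \<open>i\<close> and point \<open>x\<close>; a matrix-valued one is \<open>A i k x\<close> with row
  \<open>i\<close> and column \<open>k\<close>. Indices start at zero, except for the delays, which are numbered
  \<open>1, ..., K\<close>.

  An element of a Lebesgue or Sobolev space is given by a Borel measurable representative, and two
  representatives are identified when they agree almost everywhere. Everything below depends only
  on these classes: weak derivatives are defined up to null sets, and point values (and slices) are
  those of the continuous representative.
\<close>

type_synonym rvec = "nat \<Rightarrow> real"
type_synonym 'a vfun = "nat \<Rightarrow> 'a \<Rightarrow> real"
type_synonym rmat = "nat \<Rightarrow> nat \<Rightarrow> real"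
type_synonym rmatfun = "nat \<Rightarrow> nat \<Rightarrow> real \<Rightarrow> real"

instantiation "fun" :: (type, real_vector) real_vector
begin

definition scaleR_fun :: "real \<Rightarrow> ('a \<Rightarrow> 'b) \<Rightarrow> 'a \<Rightarrow> 'b"
  where "scaleR_fun r f = (\<lambda>x. r *\<^sub>R f x)"

instance
  by standard (simp_all add: scaleR_fun_def fun_eq_iff scaleR_add_right scaleR_add_left)

end

lemma scaleR_fun_apply [simp]: "(r *\<^sub>R f) x = r *\<^sub>R f x"
  by (simp add: scaleR_fun_def)


section \<open>Lebesgue spaces\<close>

abbreviation lborel_on :: "'a::euclidean_space set \<Rightarrow> 'a measure"
  where "lborel_on S \<equiv> restrict_space lborel S"

definition sqint :: "'a::euclidean_space set \<Rightarrow> ('a \<Rightarrow> real) set"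
  where "sqint S = {f. f \<in> borel_measurable (lborel_on S) \<and> integrable (lborel_on S) (\<lambda>x. (f x)\<^sup>2)}"

definition L2 :: "nat \<Rightarrow> 'a::euclidean_space set \<Rightarrow> 'a vfun set"
  where "L2 n S = {f. \<forall>i<n. f i \<in> sqint S}"

definition Linf :: "'a::euclidean_space set \<Rightarrow> ('a \<Rightarrow> real) set"
  where "Linf S = {f. f \<in> borel_measurable (lborel_on S) \<and> (\<exists>C. AE x in lborel_on S. \<bar>f x\<bar> \<le> C)}"

definition eqf :: "nat \<Rightarrow> 'a::euclidean_space set \<Rightarrow> 'a vfun \<Rightarrow> 'a vfun \<Rightarrow> bool"
  where "eqf n S f g \<longleftrightarrow> (\<forall>i<n. AE x in lborel_on S. f i x = g i x)"

definition eqv :: "nat \<Rightarrow> rvec \<Rightarrow> rvec \<Rightarrow> bool"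
  where "eqv n p q \<longleftrightarrow> (\<forall>i<n. p i = q i)"

definition normsq :: "'a::euclidean_space set \<Rightarrow> ('a \<Rightarrow> real) \<Rightarrow> real"
  where "normsq S f = (LINT x|lborel_on S. (f x)\<^sup>2)"


section \<open>Weak derivatives and Sobolev spaces\<close>

definition pd :: "'a::euclidean_space \<Rightarrow> ('a \<Rightarrow> real) \<Rightarrow> 'a \<Rightarrow> real"
  where "pd e f = (\<lambda>x. frechet_derivative f (at x) e)"

text \<open>Coinductively: differentiable, and all first partial derivatives are again smooth.\<close>

coinductive smooth :: "('a::euclidean_space \<Rightarrow> real) \<Rightarrow> bool" where
  "(\<And>x. f differentiable (at x)) \<Longrightarrow> (\<And>e. e \<in> Basis \<Longrightarrow> smooth (pd e f)) \<Longrightarrow> smooth f"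

definition test_function :: "'a::euclidean_space set \<Rightarrow> ('a \<Rightarrow> real) \<Rightarrow> bool"
  where "test_function S \<eta> \<longleftrightarrow> smooth \<eta> \<and>
    compact (closure {x. \<eta> x \<noteq> 0}) \<and> closure {x. \<eta> x \<noteq> 0} \<subseteq> interior S"

text \<open>A multi-index is a list of coordinate directions; the empty list is the derivative of
  order zero.\<close>

definition weak_pd ::
    "'a::euclidean_space set \<Rightarrow> 'a list \<Rightarrow> ('a \<Rightarrow> real) \<Rightarrow> ('a \<Rightarrow> real) \<Rightarrow> bool"
  where "weak_pd S ds f g \<longleftrightarrow> (\<forall>\<eta>. test_function S \<eta> \<longrightarrow>
    (LINT x|lborel_on S. f x * foldr pd ds \<eta> x) = (-1) ^ length ds * (LINT x|lborel_on S. g x * \<eta> x))"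

definition wpd :: "'a::euclidean_space set \<Rightarrow> 'a list \<Rightarrow> ('a \<Rightarrow> real) \<Rightarrow> 'a \<Rightarrow> real"
  where "wpd S ds f = (SOME g. g \<in> sqint S \<and> weak_pd S ds f g)"

definition sobolev :: "'a::euclidean_space set \<Rightarrow> 'a list set \<Rightarrow> ('a \<Rightarrow> real) set"
  where "sobolev S D = {f \<in> sqint S. \<forall>ds\<in>D. \<exists>g\<in>sqint S. weak_pd S ds f g}"

definition sobolev_normsq :: "'a::euclidean_space set \<Rightarrow> 'a list set \<Rightarrow> ('a \<Rightarrow> real) \<Rightarrow> real"
  where "sobolev_normsq S D f = (\<Sum>ds\<in>D. normsq S (wpd S ds f))"

text \<open>Orders up to \<open>k\<close> on an interval; on \<open>[0,1] \<times> [a,b]\<close> with points \<open>(s,x)\<close>, order at most one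
  in \<open>s\<close> and at most \<open>k\<close> in \<open>x\<close>.\<close>

definition ord1 :: "nat \<Rightarrow> real list set"
  where "ord1 k = (\<lambda>\<beta>. replicate \<beta> 1) ` {..k}"

definition ord2 :: "nat \<Rightarrow> (real \<times> real) list set"
  where "ord2 k = (\<lambda>(\<alpha>, \<beta>). replicate \<alpha> (1, 0) @ replicate \<beta> (0, 1)) ` ({..1} \<times> {..k})"

text \<open>On a nondegenerate interval every class in \<open>H\<^sub>1\<close> has exactly one continuous representative;
  point values refer to it.\<close>

definition cont_rep :: "real \<Rightarrow> real \<Rightarrow> (real \<Rightarrow> real) \<Rightarrow> real \<Rightarrow> real"
  where "cont_rep a b f =
    (SOME g. continuous_on {a..b} g \<and> (AE x in lborel_on {a..b}. g x = f x))"

text \<open>The slice \<open>\<phi>(s, \<cdot>)\<close> for every \<open>s\<close>: a class with a weak \<open>s\<close>-derivative is represented by a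
  curve that is continuous from \<open>[0,1]\<close> to \<open>L\<^sub>2[a,b]\<close>, unique as a curve of classes.\<close>

definition slice :: "real \<Rightarrow> real \<Rightarrow> (real \<times> real) vfun \<Rightarrow> real \<Rightarrow> real vfun"
  where "slice a b \<phi> s = (\<lambda>i. (SOME c.
    (\<forall>r\<in>{0..1}. c r \<in> sqint {a..b}) \<and>
    (\<forall>r\<in>{0..1}. ((\<lambda>r'. normsq {a..b} (c r' - c r)) \<longlongrightarrow> 0) (at r within {0..1})) \<and>
    (AE r in lborel_on {0..1}. AE x in lborel_on {a..b}. c r x = \<phi> i (r, x))) s)"

text \<open>The function on \<open>[0,1] \<times> [a,b]\<close> belonging to a curve \<open>F\<close> of classes on \<open>[a,b]\<close>. Since each
  \<open>F s\<close> is only a class, \<open>\<lambda>(s, x). F s i x\<close> itself need not be measurable; integrals of \<open>F\<close> over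
  \<open>s\<close> are taken through this function.\<close>

definition joint ::
    "nat \<Rightarrow> real \<Rightarrow> real \<Rightarrow> (real \<Rightarrow> real vfun) \<Rightarrow> (real \<times> real) vfun"
  where "joint n a b F = (SOME h. h \<in> L2 n ({0..1} \<times> {a..b}) \<and>
    (AE s in lborel_on {0..1}. eqf n {a..b} (\<lambda>i x. h i (s, x)) (F s)))"

definition section_at :: "'b vfun \<Rightarrow> 'b \<Rightarrow> rvec"
  where "section_at \<psi> s = (\<lambda>i. \<psi> i s)"

definition section2_at :: "(real \<times> real) vfun \<Rightarrow> real \<Rightarrow> real vfun"
  where "section2_at \<psi> s = (\<lambda>i x. \<psi> i (s, x))"


section \<open>Differentiability in time\<close>

text \<open>The Frechet derivative on \<open>[0,\<infinity>)\<close> (one-sided at zero) with respect to a given (semi)norm;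
  the lemma identifies it with the library notion in normed spaces.\<close>

definition frechet :: "('b::real_vector \<Rightarrow> real) \<Rightarrow> (real \<Rightarrow> 'b) \<Rightarrow> 'b \<Rightarrow> real \<Rightarrow> bool"
  where "frechet N f f' t \<longleftrightarrow>
    ((\<lambda>r. N (f r - f t - (r - t) *\<^sub>R f') / \<bar>r - t\<bar>) \<longlongrightarrow> 0) (at t within {0..})"

lemma frechet_norm_iff:
  fixes f :: "real \<Rightarrow> 'b::real_normed_vector"
  shows "frechet norm f f' t \<longleftrightarrow> (f has_vector_derivative f') (at t within {0..})"
proof -
  have "bounded_linear (\<lambda>x::real. x *\<^sub>R f')"
    by (rule bounded_linear_scaleR_left)
  then show ?thesis
    unfolding frechet_def has_vector_derivative_def has_derivative_iff_norm by simp
qed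

definition time_deriv :: "(real \<Rightarrow> rvec) \<Rightarrow> real \<Rightarrow> rvec"
  where "time_deriv z t = (\<lambda>i. vector_derivative (\<lambda>r. z r i) (at t within {0..}))"


section \<open>Parameters\<close>

text \<open>The suffix \<open>d\<close> marks the coefficients of the delayed terms; their first argument is the
  number of the delay.\<close>

record bc_data =
  lo :: real
  hi :: real
  n1 :: nat
  n2 :: nat
  n3 :: nat
  nz :: nat
  Ep :: rmatfun
  Eb :: rmat
  Ez :: rmat

record pdde_data = bc_data +
  nw :: nat
  delays :: nat
  tau :: "nat \<Rightarrow> real"
  Ap :: rmatfun
  Ab :: rmatfun
  Bz :: rmatfun
  Cwp :: rmatfun
  Cwb :: rmat
  Dwz :: rmat
  Apd :: "nat \<Rightarrow> rmatfun"
  Abd :: "nat \<Rightarrow> rmatfun"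
  Bzd :: "nat \<Rightarrow> rmatfun"
  Cwpd :: "nat \<Rightarrow> rmatfun"
  Cwbd :: "nat \<Rightarrow> rmat"
  Dwzd :: "nat \<Rightarrow> rmat"

abbreviation dom1 :: "('m) bc_data_scheme \<Rightarrow> real set"
  where "dom1 G \<equiv> {lo G..hi G}"

abbreviation dom2 :: "('m) bc_data_scheme \<Rightarrow> (real \<times> real) set"
  where "dom2 G \<equiv> {0..1} \<times> {lo G..hi G}"

abbreviation ntot :: "('m) bc_data_scheme \<Rightarrow> nat"
  where "ntot G \<equiv> n1 G + n2 G + n3 G"

abbreviation nint :: "('m) bc_data_scheme \<Rightarrow> nat"
  where "nint G \<equiv> n1 G + 2 * n2 G + 3 * n3 G"

abbreviation nbc :: "('m) bc_data_scheme \<Rightarrow> nat"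
  where "nbc G \<equiv> n2 G + 2 * n3 G"

abbreviation nbf :: "('m) bc_data_scheme \<Rightarrow> nat"
  where "nbf G \<equiv> 2 * (n2 G + 2 * n3 G)"

definition Linf_mat :: "('m) bc_data_scheme \<Rightarrow> nat \<Rightarrow> nat \<Rightarrow> rmatfun set"
  where "Linf_mat G m n = {A. \<forall>i<m. \<forall>k<n. A i k \<in> Linf (dom1 G)}"

definition admissible :: "pdde_data \<Rightarrow> bool"
  where "admissible G \<longleftrightarrow> lo G < hi G \<and>
    1 \<le> delays G \<and> (\<forall>j\<in>{1..delays G}. 0 < tau G j) \<and> strict_mono_on {1..delays G} (tau G) \<and>
    Ep G \<in> Linf_mat G (nbc G) (nint G) \<and>
    Ap G \<in> Linf_mat G (ntot G) (nint G) \<and>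
    Ab G \<in> Linf_mat G (ntot G) (nbf G) \<and>
    Bz G \<in> Linf_mat G (ntot G) (nz G) \<and>
    Cwp G \<in> Linf_mat G (nw G) (nint G) \<and>
    (\<forall>j\<in>{1..delays G}.
      Apd G j \<in> Linf_mat G (ntot G) (nint G) \<and>
      Abd G j \<in> Linf_mat G (ntot G) (nbf G) \<and>
      Bzd G j \<in> Linf_mat G (ntot G) (nz G) \<and>
      Cwpd G j \<in> Linf_mat G (nw G) (nint G))"

text \<open>Products of a matrix with \<open>n\<close> columns and a vector, in the four combinations that occur:
  matrix function times vector function, matrix function times constant vector, integral of the
  former, constant matrix times constant vector.\<close>

definition mult_ff :: "nat \<Rightarrow> rmatfun \<Rightarrow> real vfun \<Rightarrow> real vfun"
  where "mult_ff n A f = (\<lambda>i x. \<Sum>k<n. A i k x * f k x)"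

definition mult_fc :: "nat \<Rightarrow> rmatfun \<Rightarrow> rvec \<Rightarrow> real vfun"
  where "mult_fc n A p = (\<lambda>i x. \<Sum>k<n. A i k x * p k)"

definition mult_int :: "real set \<Rightarrow> nat \<Rightarrow> rmatfun \<Rightarrow> real vfun \<Rightarrow> rvec"
  where "mult_int S n A f = (\<lambda>i. LINT x|lborel_on S. (\<Sum>k<n. A i k x * f k x))"

definition mult_cc :: "nat \<Rightarrow> rmat \<Rightarrow> rvec \<Rightarrow> rvec"
  where "mult_cc n A p = (\<lambda>i. \<Sum>k<n. A i k * p k)"


section \<open>State space and boundary conditions\<close>

text \<open>Component \<open>i\<close> of the state lies in \<open>H\<close> of order \<open>reg G i\<close>: the blocks \<open>u\<^sub>1, u\<^sub>2, u\<^sub>3\<close> are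
  concatenated.\<close>

definition reg :: "('m) bc_data_scheme \<Rightarrow> nat \<Rightarrow> nat"
  where "reg G i = (if i < n1 G then 0 else if i < n1 G + n2 G then 1 else 2)"

definition U_space :: "('m) bc_data_scheme \<Rightarrow> real vfun set"
  where "U_space G = {u. \<forall>i<ntot G. u i \<in> sobolev (dom1 G) (ord1 (reg G i))}"

definition V_space :: "('m) bc_data_scheme \<Rightarrow> (real \<times> real) vfun set"
  where "V_space G = {\<phi>. \<forall>i<ntot G. \<phi> i \<in> sobolev (dom2 G) (ord2 (reg G i))}"

definition H1z_space :: "('m) bc_data_scheme \<Rightarrow> real vfun set"
  where "H1z_space G = {\<phi>. \<forall>i<nz G. \<phi> i \<in> sobolev {0..1} (ord1 1)}"

definition dx :: "('m) bc_data_scheme \<Rightarrow> nat \<Rightarrow> (real \<Rightarrow> real) \<Rightarrow> real \<Rightarrow> real"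
  where "dx G k f = wpd (dom1 G) (replicate k 1) f"

definition D_op :: "('m) bc_data_scheme \<Rightarrow> real vfun \<Rightarrow> real vfun"
  where "D_op G u = (\<lambda>i. dx G (reg G i) (u i))"

text \<open>\<open>(u\<^sub>1, u\<^sub>2, u\<^sub>3, \<partial>u\<^sub>2, \<partial>u\<^sub>3, \<partial>\<^sup>2u\<^sub>3)\<close>; the fourth and fifth block together are the first
  derivatives of the components from \<open>n1\<close> on.\<close>

definition D_int :: "('m) bc_data_scheme \<Rightarrow> real vfun \<Rightarrow> real vfun"
  where "D_int G u = (\<lambda>k.
    if k < ntot G then u k
    else if k < ntot G + n2 G + n3 G then dx G 1 (u (n1 G + (k - ntot G)))
    else dx G 2 (u (n1 G + n2 G + (k - (ntot G + n2 G + n3 G)))))"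

text \<open>\<open>(u\<^sub>2(c), u\<^sub>3(c), \<partial>u\<^sub>3(c))\<close>\<close>

definition bvals :: "('m) bc_data_scheme \<Rightarrow> real \<Rightarrow> real vfun \<Rightarrow> rvec"
  where "bvals G c u = (\<lambda>k.
    if k < n2 G + n3 G then cont_rep (lo G) (hi G) (u (n1 G + k)) c
    else cont_rep (lo G) (hi G) (dx G 1 (u (n1 G + n2 G + (k - (n2 G + n3 G))))) c)"

definition Lambda_bf :: "('m) bc_data_scheme \<Rightarrow> real vfun \<Rightarrow> rvec"
  where "Lambda_bf G u = (\<lambda>k.
    if k < nbc G then bvals G (lo G) u k else bvals G (hi G) u (k - nbc G))"

definition X_space :: "('m) bc_data_scheme \<Rightarrow> rvec \<Rightarrow> real vfun set"
  where "X_space G z = {u \<in> U_space G. eqv (nbc G)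
    (mult_int (dom1 G) (nint G) (Ep G) (D_int G u) + mult_cc (nbf G) (Eb G) (Lambda_bf G u)
      + mult_cc (nz G) (Ez G) z) 0}"

definition well_posed :: "('m) bc_data_scheme \<Rightarrow> bool"
  where "well_posed G \<longleftrightarrow> (\<forall>v\<in>L2 (ntot G) (dom1 G). \<forall>z.
    \<exists>u\<in>X_space G z. eqf (ntot G) (dom1 G) (D_op G u) v \<and>
      (\<forall>u'\<in>X_space G z. eqf (ntot G) (dom1 G) (D_op G u') v \<longrightarrow> eqf (ntot G) (dom1 G) u' u))"

definition Y_space ::
    "('m) bc_data_scheme \<Rightarrow> real vfun \<Rightarrow> rvec \<Rightarrow> ((real \<times> real) vfun \<times> real vfun) set"
  where "Y_space G u z = {(\<phi>u, \<phi>z). \<phi>u \<in> V_space G \<and> \<phi>z \<in> H1z_space G \<and>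
    eqf (ntot G) (dom1 G) (slice (lo G) (hi G) \<phi>u 0) u \<and>
    eqv (nz G) (\<lambda>i. cont_rep 0 1 (\<phi>z i) 0) z \<and>
    (\<forall>s\<in>{0..1}. slice (lo G) (hi G) \<phi>u s \<in> X_space G (\<lambda>i. cont_rep 0 1 (\<phi>z i) s))}"


section \<open>Operators\<close>

text \<open>The solution of \<open>D u = v\<close>, \<open>u \<in> X\<^sub>z\<close> is \<open>T v + T\<^sub>z z\<close> with linear \<open>T\<close> and \<open>T\<^sub>z\<close>; hence
  \<open>T v\<close> is the solution for \<open>(v, 0)\<close> and \<open>T\<^sub>z z\<close> the one for \<open>(0, z)\<close>.\<close>

definition bc_solution :: "('m) bc_data_scheme \<Rightarrow> real vfun \<Rightarrow> rvec \<Rightarrow> real vfun"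
  where "bc_solution G v z = (SOME u. u \<in> X_space G z \<and> eqf (ntot G) (dom1 G) (D_op G u) v)"

definition T_op :: "('m) bc_data_scheme \<Rightarrow> real vfun \<Rightarrow> real vfun"
  where "T_op G v = bc_solution G v 0"

definition Tz_op :: "('m) bc_data_scheme \<Rightarrow> rvec \<Rightarrow> real vfun"
  where "Tz_op G z = bc_solution G 0 z"

definition Tint_op :: "('m) bc_data_scheme \<Rightarrow> real vfun \<Rightarrow> real vfun"
  where "Tint_op G v = D_int G (T_op G v)"

definition Tintz_op :: "('m) bc_data_scheme \<Rightarrow> rvec \<Rightarrow> real vfun"
  where "Tintz_op G z = D_int G (Tz_op G z)"

definition Tbf_op :: "('m) bc_data_scheme \<Rightarrow> real vfun \<Rightarrow> rvec"
  where "Tbf_op G v = Lambda_bf G (T_op G v)"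

definition Tbfz_op :: "('m) bc_data_scheme \<Rightarrow> rvec \<Rightarrow> rvec"
  where "Tbfz_op G z = Lambda_bf G (Tz_op G z)"

definition A_op :: "pdde_data \<Rightarrow> real vfun \<Rightarrow> real vfun"
  where "A_op G v = mult_ff (nint G) (Ap G) (Tint_op G v) + mult_fc (nbf G) (Ab G) (Tbf_op G v)"

definition Bz_op :: "pdde_data \<Rightarrow> rvec \<Rightarrow> real vfun"
  where "Bz_op G z = mult_fc (nz G) (Bz G) z
    + mult_ff (nint G) (Ap G) (Tintz_op G z) + mult_fc (nbf G) (Ab G) (Tbfz_op G z)"

definition Cw_op :: "pdde_data \<Rightarrow> real vfun \<Rightarrow> rvec"
  where "Cw_op G v =
    mult_int (dom1 G) (nint G) (Cwp G) (Tint_op G v) + mult_cc (nbf G) (Cwb G) (Tbf_op G v)"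

definition Dwz_op :: "pdde_data \<Rightarrow> rvec \<Rightarrow> rvec"
  where "Dwz_op G z = mult_cc (nz G) (Dwz G) z
    + mult_int (dom1 G) (nint G) (Cwp G) (Tintz_op G z) + mult_cc (nbf G) (Cwb G) (Tbfz_op G z)"

definition Cq_op :: "('m) bc_data_scheme \<Rightarrow> real vfun \<Rightarrow> real vfun \<times> rvec \<times> rvec"
  where "Cq_op G v = (Tint_op G v, Tbf_op G v, 0)"

definition Dqz_op :: "('m) bc_data_scheme \<Rightarrow> rvec \<Rightarrow> real vfun \<times> rvec \<times> rvec"
  where "Dqz_op G z = (Tintz_op G z, Tbfz_op G z, z)"

definition Br_op :: "pdde_data \<Rightarrow> nat \<Rightarrow> real vfun \<times> rvec \<times> rvec \<Rightarrow> real vfun"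
  where "Br_op G j = (\<lambda>(r1, r2, r3). mult_ff (nint G) (Apd G j) r1
    + mult_fc (nbf G) (Abd G j) r2 + mult_fc (nz G) (Bzd G j) r3)"

definition Dwr_op :: "pdde_data \<Rightarrow> nat \<Rightarrow> real vfun \<times> rvec \<times> rvec \<Rightarrow> rvec"
  where "Dwr_op G j = (\<lambda>(r1, r2, r3). mult_int (dom1 G) (nint G) (Cwpd G j) r1
    + mult_cc (nbf G) (Cwbd G j) r2 + mult_cc (nz G) (Dwzd G j) r3)"

text \<open>\<open>(s, x) \<mapsto> (T \<psi>\<^sub>u(s) + T\<^sub>z \<psi>\<^sub>z(s))(x)\<close>, and likewise for the interior values below.\<close>

definition T_curve ::
    "('m) bc_data_scheme \<Rightarrow> (real \<times> real) vfun \<times> real vfun \<Rightarrow> (real \<times> real) vfun"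
  where "T_curve G = (\<lambda>(\<psi>u, \<psi>z). joint (ntot G) (lo G) (hi G)
    (\<lambda>s. T_op G (section2_at \<psi>u s) + Tz_op G (section_at \<psi>z s)))"

definition Tint_curve ::
    "('m) bc_data_scheme \<Rightarrow> (real \<times> real) vfun \<times> real vfun \<Rightarrow> (real \<times> real) vfun"
  where "Tint_curve G = (\<lambda>(\<psi>u, \<psi>z). joint (nint G) (lo G) (hi G)
    (\<lambda>s. Tint_op G (section2_at \<psi>u s) + Tintz_op G (section_at \<psi>z s)))"

definition Tbar_op :: "('m) bc_data_scheme \<Rightarrow> (real \<times> real) vfun \<times> real vfun
    \<Rightarrow> (real \<times> real) vfun \<times> real vfun"
  where "Tbar_op G = (\<lambda>(\<psi>u, \<psi>z).
    (\<lambda>i (s, x). LINT \<theta>|lborel_on {0..s}. T_curve G (\<psi>u, \<psi>z) i (\<theta>, x),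
     \<lambda>i s. LINT \<theta>|lborel_on {0..s}. \<psi>z i \<theta>))"

definition Abar_op :: "pdde_data \<Rightarrow> nat \<Rightarrow> (real \<times> real) vfun \<times> real vfun
    \<Rightarrow> (real \<times> real) vfun \<times> real vfun"
  where "Abar_op G j = (\<lambda>(\<psi>u, \<psi>z). (- 1 / tau G j) *\<^sub>R (T_curve G (\<psi>u, \<psi>z), \<psi>z))"

definition Cbar_op :: "('m) bc_data_scheme \<Rightarrow> (real \<times> real) vfun \<times> real vfun
    \<Rightarrow> real vfun \<times> rvec \<times> rvec"
  where "Cbar_op G = (\<lambda>(\<psi>u, \<psi>z).
    (\<lambda>i x. LINT s|lborel_on {0..1}. Tint_curve G (\<psi>u, \<psi>z) i (s, x),
     \<lambda>i. LINT s|lborel_on {0..1}.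
       (Tbf_op G (section2_at \<psi>u s) + Tbfz_op G (section_at \<psi>z s)) i,
     \<lambda>i. LINT s|lborel_on {0..1}. \<psi>z i s))"

type_synonym state = "real vfun \<times> (nat \<Rightarrow> (real \<times> real) vfun \<times> real vfun)"

definition const_in_s :: "real vfun \<Rightarrow> (real \<times> real) vfun"
  where "const_in_s f = (\<lambda>i (s, x). f i x)"

definition That_op :: "pdde_data \<Rightarrow> state \<Rightarrow> state"
  where "That_op G = (\<lambda>(v, \<psi>).
    (T_op G v, \<lambda>j. (const_in_s (T_op G v), 0) + Tbar_op G (\<psi> j)))"

definition Thatz_op :: "pdde_data \<Rightarrow> rvec \<Rightarrow> state"
  where "Thatz_op G z = (Tz_op G z, \<lambda>j. (const_in_s (Tz_op G z), \<lambda>i s. z i))"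

definition Ahat_op :: "pdde_data \<Rightarrow> state \<Rightarrow> state"
  where "Ahat_op G = (\<lambda>(v, \<psi>).
    (A_op G v + (\<Sum>j\<in>{1..delays G}. Br_op G j (Cq_op G v + Cbar_op G (\<psi> j))),
     \<lambda>j. Abar_op G j (\<psi> j)))"

definition Bhatz_op :: "pdde_data \<Rightarrow> rvec \<Rightarrow> state"
  where "Bhatz_op G z =
    (Bz_op G z + (\<Sum>j\<in>{1..delays G}. Br_op G j (Dqz_op G z)), 0)"

definition Chatw_op :: "pdde_data \<Rightarrow> state \<Rightarrow> rvec"
  where "Chatw_op G = (\<lambda>(v, \<psi>).
    Cw_op G v + (\<Sum>j\<in>{1..delays G}. Dwr_op G j (Cq_op G v + Cbar_op G (\<psi> j))))"

definition Dhatwz_op :: "pdde_data \<Rightarrow> rvec \<Rightarrow> rvec"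
  where "Dhatwz_op G z = Dwz_op G z + (\<Sum>j\<in>{1..delays G}. Dwr_op G j (Dqz_op G z))"


section \<open>Solutions\<close>

definition PIE_space :: "pdde_data \<Rightarrow> state set"
  where "PIE_space G = {(v, \<psi>). v \<in> L2 (ntot G) (dom1 G) \<and>
    (\<forall>j\<in>{1..delays G}. fst (\<psi> j) \<in> L2 (ntot G) (dom2 G) \<and> snd (\<psi> j) \<in> L2 (nz G) {0..1})}"

definition PIE_norm :: "pdde_data \<Rightarrow> state \<Rightarrow> real"
  where "PIE_norm G = (\<lambda>(v, \<psi>). sqrt ((\<Sum>i<ntot G. normsq (dom1 G) (v i)) +
    (\<Sum>j\<in>{1..delays G}. (\<Sum>i<ntot G. normsq (dom2 G) (fst (\<psi> j) i)) +
      (\<Sum>i<nz G. normsq {0..1} (snd (\<psi> j) i)))))"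

definition PDDE_space :: "pdde_data \<Rightarrow> state set"
  where "PDDE_space G = {(u, \<phi>). u \<in> U_space G \<and>
    (\<forall>j\<in>{1..delays G}. fst (\<phi> j) \<in> V_space G \<and> snd (\<phi> j) \<in> H1z_space G)}"

definition PDDE_norm :: "pdde_data \<Rightarrow> state \<Rightarrow> real"
  where "PDDE_norm G = (\<lambda>(u, \<phi>). sqrt (
    (\<Sum>i<ntot G. sobolev_normsq (dom1 G) (ord1 (reg G i)) (u i)) +
    (\<Sum>j\<in>{1..delays G}.
      (\<Sum>i<ntot G. sobolev_normsq (dom2 G) (ord2 (reg G i)) (fst (\<phi> j) i)) +
      (\<Sum>i<nz G. sobolev_normsq {0..1} (ord1 1) (snd (\<phi> j) i)))))"

definition eqhist :: "pdde_data \<Rightarrow> (real \<times> real) vfun \<times> real vfun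
    \<Rightarrow> (real \<times> real) vfun \<times> real vfun \<Rightarrow> bool"
  where "eqhist G p q \<longleftrightarrow>
    eqf (ntot G) (dom2 G) (fst p) (fst q) \<and> eqf (nz G) {0..1} (snd p) (snd q)"

definition eqstate :: "pdde_data \<Rightarrow> state \<Rightarrow> state \<Rightarrow> bool"
  where "eqstate G p q \<longleftrightarrow> eqf (ntot G) (dom1 G) (fst p) (fst q) \<and>
    (\<forall>j\<in>{1..delays G}. eqhist G (snd p j) (snd q j))"

definition PIE_solution ::
    "pdde_data \<Rightarrow> (real \<Rightarrow> rvec) \<Rightarrow> state \<Rightarrow> (real \<Rightarrow> state) \<Rightarrow> (real \<Rightarrow> rvec) \<Rightarrow> bool"
  where "PIE_solution G z y0 y w \<longleftrightarrow>
    y0 \<in> PIE_space G \<and> (\<forall>t\<ge>0. y t \<in> PIE_space G) \<and> eqstate G (y 0) y0 \<and>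
    (\<exists>y'. \<forall>t\<ge>0. y' t \<in> PIE_space G \<and> frechet (PIE_norm G) y (y' t) t \<and>
      eqstate G (Thatz_op G (time_deriv z t) + That_op G (y' t))
                (Ahat_op G (y t) + Bhatz_op G (z t)) \<and>
      eqv (nw G) (w t) (Chatw_op G (y t) + Dhatwz_op G (z t)))"

text \<open>\<open>- (1 / \<tau>\<^sub>j) \<partial>\<^sub>s \<phi>\<^sub>j\<close>\<close>

definition transport :: "pdde_data \<Rightarrow> nat \<Rightarrow> (real \<times> real) vfun \<times> real vfun
    \<Rightarrow> (real \<times> real) vfun \<times> real vfun"
  where "transport G j = (\<lambda>(\<phi>u, \<phi>z). (- 1 / tau G j) *\<^sub>R
    (\<lambda>i. wpd (dom2 G) [(1, 0)] (\<phi>u i), \<lambda>i. wpd {0..1} [1] (\<phi>z i)))"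

text \<open>The values \<open>(D\<^sub>i\<^sub>n\<^sub>t \<phi>\<^sub>u(1), \<Lambda>\<^sub>b\<^sub>f \<phi>\<^sub>u(1), \<phi>\<^sub>z(1))\<close> at the end of the delay.\<close>

definition delayed :: "pdde_data \<Rightarrow> (real \<times> real) vfun \<times> real vfun \<Rightarrow> real vfun \<times> rvec \<times> rvec"
  where "delayed G = (\<lambda>(\<phi>u, \<phi>z).
    (D_int G (slice (lo G) (hi G) \<phi>u 1), Lambda_bf G (slice (lo G) (hi G) \<phi>u 1),
     \<lambda>i. cont_rep 0 1 (\<phi>z i) 1))"

definition PDDE_rhs :: "pdde_data \<Rightarrow> rvec \<Rightarrow> state \<Rightarrow> real vfun"
  where "PDDE_rhs G z = (\<lambda>(u, \<phi>).
    mult_ff (nint G) (Ap G) (D_int G u) + mult_fc (nbf G) (Ab G) (Lambda_bf G u)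
    + mult_fc (nz G) (Bz G) z + (\<Sum>j\<in>{1..delays G}. Br_op G j (delayed G (\<phi> j))))"

definition PDDE_output :: "pdde_data \<Rightarrow> rvec \<Rightarrow> state \<Rightarrow> rvec"
  where "PDDE_output G z = (\<lambda>(u, \<phi>).
    mult_int (dom1 G) (nint G) (Cwp G) (D_int G u) + mult_cc (nbf G) (Cwb G) (Lambda_bf G u)
    + mult_cc (nz G) (Dwz G) z + (\<Sum>j\<in>{1..delays G}. Dwr_op G j (delayed G (\<phi> j))))"

definition compatible :: "pdde_data \<Rightarrow> rvec \<Rightarrow> state \<Rightarrow> bool"
  where "compatible G z = (\<lambda>(u, \<phi>). u \<in> X_space G z \<and>
    (\<forall>j\<in>{1..delays G}. \<phi> j \<in> Y_space G u z))"

definition PDDE_solution ::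
    "pdde_data \<Rightarrow> (real \<Rightarrow> rvec) \<Rightarrow> state \<Rightarrow> (real \<Rightarrow> state) \<Rightarrow> (real \<Rightarrow> rvec) \<Rightarrow> bool"
  where "PDDE_solution G z y0 y w \<longleftrightarrow>
    compatible G (z 0) y0 \<and> (\<forall>t\<ge>0. compatible G (z t) (y t)) \<and> eqstate G (y 0) y0 \<and>
    (\<exists>y'. \<forall>t\<ge>0. y' t \<in> PDDE_space G \<and> frechet (PDDE_norm G) y (y' t) t \<and>
      (\<forall>j\<in>{1..delays G}. eqhist G (snd (y' t) j) (transport G j (snd (y t) j))) \<and>
      eqf (ntot G) (dom1 G) (fst (y' t)) (PDDE_rhs G (z t) (y t)) \<and>
      eqv (nw G) (w t) (PDDE_output G (z t) (y t)))"

end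

theory Submission
  imports Defs
begin

text \<open>
  A state of the delayed equation is determined by its highest derivatives: well-posedness supplies
  the missing boundary values. The partial integral equation is the delayed equation written in
  these derivatives, \<open>v = D u\<close> and \<open>\<psi> = (D \<partial>\<^sub>s \<phi>\<^sub>u, \<partial>\<^sub>s \<phi>\<^sub>z)\<close>. Both directions of this change of variables
  have to be compatible with the norms, so that derivatives in time correspond, and with
  integration over the delay variable \<open>s\<close>.

  \<^bold>\<open>The solution operator.\<close> By the lemma of du Bois-Reymond, a function with a weak derivative of
  order \<open>r \<le> 2\<close> on an interval is an \<open>r\<close>-fold primitive of it plus a polynomial, whose coefficients are
  values at the left end (\<open>recon_complete\<close>). For given \<open>v\<close> and \<open>z\<close> the conditions \<open>u \<in> X\<^sub>z\<close> and
  \<open>D u = v\<close> therefore become a square linear system for the vector of left boundary values. The uniqueness in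
  well-posedness makes its matrix injective (\<open>bc_res_injective\<close>), so the boundary values are linear in
  \<open>z\<close> and in integrals of \<open>v\<close> against bounded functions (\<open>bc_data_exists\<close>). Hence \<open>T v + T\<^sub>z z\<close>, its
  derivatives and its boundary values all have one shape: a bounded multiplier plus an integral
  operator with bounded kernel plus a bounded combination of the components of \<open>z\<close> (\<open>pi_op\<close>,
  \<open>pi_fun\<close>).

  Two consequences of this shape carry the rest. Such operators are bounded between \<open>L\<^sub>2\<close> spaces, also
  when they act on each slice of a function of \<open>(s, x)\<close>, so they respect differentiability in time
  (\<open>pi_op_tdiff\<close>, \<open>pi_lift_tdiff\<close>). By Fubini's theorem they commute with integrals over \<open>s\<close>
  (\<open>pi_lift_time_integral\<close>, \<open>pi_fun_time_integral\<close>).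

  \<^bold>\<open>Histories.\<close> The commutation turns
  \<open>\<phi>\<^sub>u(s) = T v + T\<^sub>z z + \<integral>\<^sub>0\<^sup>s (T \<psi>\<^sub>u + T\<^sub>z \<psi>\<^sub>z)\<close> into \<open>T (v + \<integral>\<^sub>0\<^sup>s \<psi>\<^sub>u) + T\<^sub>z (z + \<integral>\<^sub>0\<^sup>s \<psi>\<^sub>z)\<close>
  (\<open>hist_section\<close>): every slice again solves the boundary value problem. So it satisfies the boundary
  conditions with input \<open>\<phi>\<^sub>z(s)\<close> (\<open>hist_Y_space\<close>), its \<open>x\<close>-derivatives come from the same family of
  operators (\<open>hist_u_weak_pd\<close>), and at \<open>s = 1\<close> it has the delayed values that enter the operators of the
  integral equation (\<open>hist_delayed\<close>). The two evolution equations and the two output equations are then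
  the same (\<open>evolution_iff\<close>, \<open>PDDE_output_state\<close>).

  \<^bold>\<open>Derivatives in time.\<close> If \<open>(v, \<psi>)\<close> is differentiable, then so is the state, by boundedness
  (\<open>frechet_state\<close>). Conversely \<open>(v, \<psi>)\<close> consists of top derivatives of the state, which depend continuously
  on it in the Sobolev norm (\<open>top_deriv_state\<close>, \<open>frechet_top_deriv\<close>). In that case the derivative of the
  state has the form \<open>T v' + T\<^sub>z z'\<close>, with hats, because a derivative is unique
  (\<open>frechet_PDDE_unique\<close>).
\<close>

section \<open>Smooth functions\<close>

lemma pd_eq: "(f has_derivative f') (at x) \<Longrightarrow> pd e f x = f' e"
  unfolding pd_def by (subst frechet_derivative_at[symmetric]) auto

lemma smooth_imp_differentiable: "smooth f \<Longrightarrow> f differentiable (at x)"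
  by (erule smooth.cases) simp

lemma smooth_pd: "smooth f \<Longrightarrow> e \<in> Basis \<Longrightarrow> smooth (pd e f)"
  by (erule smooth.cases) simp

lemma smooth_pd1: "smooth f \<Longrightarrow> smooth (pd (1::real) f)"
  by (rule smooth_pd) simp_all

lemma smooth_continuous: "smooth f \<Longrightarrow> continuous_on S f"
  by (intro continuous_at_imp_continuous_on ballI differentiable_imp_continuous_within smooth_imp_differentiable)

lemma pd_add:
  assumes "f differentiable (at x)" "g differentiable (at x)"
  shows "pd e (\<lambda>x. f x + g x) x = pd e f x + pd e g x"
proof -
  have "((\<lambda>x. f x + g x) has_derivative (\<lambda>h. frechet_derivative f (at x) h + frechet_derivative g (at x) h)) (at x)"
    using assms unfolding frechet_derivative_works by (rule has_derivative_add)
  from pd_eq[OF this] show ?thesis by (simp add: pd_def)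
qed

lemma pd_mult:
  fixes f g :: "'a::euclidean_space \<Rightarrow> real"
  assumes "f differentiable (at x)" "g differentiable (at x)"
  shows "pd e (\<lambda>x. f x * g x) x = f x * pd e g x + pd e f x * g x"
proof -
  have "((\<lambda>x. f x * g x) has_derivative (\<lambda>h. f x * frechet_derivative g (at x) h + frechet_derivative f (at x) h * g x)) (at x)"
    using assms unfolding frechet_derivative_works by (rule has_derivative_mult)
  from pd_eq[OF this] show ?thesis by (simp add: pd_def)
qed

text \<open>
  Differentiating a product of smooth functions leaves the products, but not the sums of products.
  This closure is stable under all partial derivatives, hence a witness for the coinduction.
\<close>

inductive smooth_alg :: "('a::euclidean_space \<Rightarrow> real) \<Rightarrow> bool" where
  base: "smooth f \<Longrightarrow> smooth_alg f"
| add: "smooth_alg f \<Longrightarrow> smooth_alg g \<Longrightarrow> smooth_alg (\<lambda>x. f x + g x)"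
| mult: "smooth_alg f \<Longrightarrow> smooth_alg g \<Longrightarrow> smooth_alg (\<lambda>x. f x * g x)"

lemma smooth_alg_step:
  "smooth_alg f \<Longrightarrow> (\<forall>x. f differentiable (at x)) \<and> (\<forall>e\<in>Basis. smooth_alg (pd e f))"
proof (induction rule: smooth_alg.induct)
  case (base f)
  then show ?case
    by (auto intro: smooth_imp_differentiable smooth_alg.base smooth_pd)
next
  case (add f g)
  then have "pd e (\<lambda>x. f x + g x) = (\<lambda>x. pd e f x + pd e g x)" for e
    by (intro ext pd_add) auto
  with add show ?case
    by (auto intro: smooth_alg.add)
next
  case (mult f g)
  then have "pd e (\<lambda>x. f x * g x) = (\<lambda>x. f x * pd e g x + pd e f x * g x)" for e
    by (intro ext pd_mult) auto
  with mult show ?case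
    by (auto intro!: smooth_alg.add smooth_alg.mult)
qed

lemma smooth_alg_imp_smooth: "smooth_alg f \<Longrightarrow> smooth f"
  by (coinduction arbitrary: f rule: smooth.coinduct) (use smooth_alg_step in blast)

lemma smooth_add: "smooth f \<Longrightarrow> smooth g \<Longrightarrow> smooth (\<lambda>x. f x + g x)"
  by (rule smooth_alg_imp_smooth, rule smooth_alg.add; rule smooth_alg.base)

lemma smooth_mult: "smooth f \<Longrightarrow> smooth g \<Longrightarrow> smooth (\<lambda>x. f x * g x)"
  by (rule smooth_alg_imp_smooth, rule smooth_alg.mult; rule smooth_alg.base)

lemma smooth_const: "smooth (\<lambda>x::'a::euclidean_space. c)"
proof -
  have "\<exists>c. f = (\<lambda>x. c) \<Longrightarrow> smooth f" for f :: "'a \<Rightarrow> real"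
  proof (coinduction arbitrary: f rule: smooth.coinduct)
    case smooth
    then obtain c where c: "f = (\<lambda>x. c)" by blast
    have "pd e f = (\<lambda>x. 0)" for e
      using pd_eq[of f "\<lambda>_. 0"] unfolding c by (auto simp: fun_eq_iff)
    with c show ?case by auto
  qed
  then show ?thesis by blast
qed

lemma smooth_cmult: "smooth f \<Longrightarrow> smooth (\<lambda>x. c * f x)"
  by (intro smooth_mult smooth_const)

lemma smooth_diff: "smooth f \<Longrightarrow> smooth g \<Longrightarrow> smooth (\<lambda>x. f x - g x)"
  using smooth_add[of f "\<lambda>x. - 1 * g x"] smooth_cmult[of g "-1"] by simp

lemma smooth_prod:
  assumes "finite I" "\<And>i. i \<in> I \<Longrightarrow> smooth (f i)"
  shows "smooth (\<lambda>x. \<Prod>i\<in>I. f i x)"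
  using assms by (induction I rule: finite_induct) (auto intro: smooth_const smooth_mult)

lemma has_derivative_of_smooth_real:
  fixes f :: "real \<Rightarrow> real"
  assumes "smooth f"
  shows "(f has_real_derivative pd 1 f x) (at x)"
proof -
  from smooth_imp_differentiable[OF assms] obtain D where D: "(f has_real_derivative D) (at x)"
    unfolding real_differentiable_def[symmetric] by (auto simp: real_differentiable_def)
  then have "pd 1 f x = D"
    using pd_eq[of f "\<lambda>h. D * h"] by (simp add: has_field_derivative_def)
  with D show ?thesis by simp
qed

lemma pd_real_eq: "(f has_real_derivative D) (at x) \<Longrightarrow> pd 1 f x = D"
  using pd_eq[of f "\<lambda>h. D * h"] by (simp add: has_field_derivative_def)

text \<open>
  The derivative of such a function is a constant times a function of the same kind, so the
  functions \<open>c f(\<alpha> x\<^sub>i + \<beta>)\<close> with all smooth \<open>f\<close> form the witness of the coinduction.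
\<close>

lemma smooth_coord:
  fixes f :: "real \<Rightarrow> real" and i :: "'a::euclidean_space"
  assumes "smooth f"
  shows "smooth (\<lambda>x::'a. f (\<alpha> * (x \<bullet> i) + \<beta>))"
proof -
  have "\<exists>f \<gamma>. smooth f \<and> h = (\<lambda>x. \<gamma> * f (\<alpha> * (x \<bullet> i) + \<beta>)) \<Longrightarrow> smooth h" for h :: "'a \<Rightarrow> real"
  proof (coinduction arbitrary: h rule: smooth.coinduct)
    case smooth
    then obtain f \<gamma> where f: "smooth f" and h: "h = (\<lambda>x. \<gamma> * f (\<alpha> * (x \<bullet> i) + \<beta>))" by blast
    have D: "(h has_derivative (\<lambda>e. \<gamma> * (pd 1 f (\<alpha> * (x \<bullet> i) + \<beta>) * (\<alpha> * (e \<bullet> i))))) (at x)" for x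
      unfolding h
      by (auto intro!: derivative_eq_intros has_derivative_of_smooth_real[OF f, THEN DERIV_compose_FDERIV])
    have "pd e h = (\<lambda>x. (\<gamma> * \<alpha> * (e \<bullet> i)) * pd 1 f (\<alpha> * (x \<bullet> i) + \<beta>))" for e
      using pd_eq[OF D] by (auto simp: fun_eq_iff algebra_simps)
    with D smooth_pd1[OF f] show ?case
      by (auto simp: differentiable_def)
  qed
  from this[OF exI[of _ f, OF exI[of _ 1]]] show ?thesis using assms by simp
qed

lemma pd_section:
  fixes \<eta> :: "real \<times> real \<Rightarrow> real"
  assumes "\<eta> differentiable (at (s, x))"
  shows "((\<lambda>x. \<eta> (s, x)) has_real_derivative pd (0, 1) \<eta> (s, x)) (at x)"
    and "((\<lambda>s. \<eta> (s, x)) has_real_derivative pd (1, 0) \<eta> (s, x)) (at s)"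
proof -
  let ?D = "frechet_derivative \<eta> (at (s, x))"
  have D: "(\<eta> has_derivative ?D) (at (s, x))"
    using assms by (simp add: frechet_derivative_works)
  have lin: "linear ?D" using D by (rule has_derivative_linear)
  have "((\<lambda>x. \<eta> (s, x)) has_derivative (\<lambda>h. ?D (0, h))) (at x)"
    by (rule has_derivative_compose[where g=\<eta> and f="\<lambda>x. (s, x)", OF _ D])
      (auto intro!: derivative_eq_intros)
  moreover have "?D (0, h) = pd (0, 1) \<eta> (s, x) * h" for h
    using linear_scale[OF lin, of h "(0, 1)"] by (simp add: pd_def)
  ultimately show "((\<lambda>x. \<eta> (s, x)) has_real_derivative pd (0, 1) \<eta> (s, x)) (at x)"
    by (simp add: has_field_derivative_def)
  have "((\<lambda>s. \<eta> (s, x)) has_derivative (\<lambda>h. ?D (h, 0))) (at s)"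
    by (rule has_derivative_compose[where g=\<eta> and f="\<lambda>s. (s, x)", OF _ D])
      (auto intro!: derivative_eq_intros)
  moreover have "?D (h, 0) = pd (1, 0) \<eta> (s, x) * h" for h
    using linear_scale[OF lin, of h "(1, 0)"] by (simp add: pd_def)
  ultimately show "((\<lambda>s. \<eta> (s, x)) has_real_derivative pd (1, 0) \<eta> (s, x)) (at s)"
    by (simp add: has_field_derivative_def)
qed

lemma Basis_prod_real: "(0::real, 1::real) \<in> Basis" "(1::real, 0::real) \<in> Basis"
  by (auto simp: Basis_prod_def)

lemma smooth_section:
  fixes \<eta> :: "real \<times> real \<Rightarrow> real"
  assumes "smooth \<eta>"
  shows "smooth (\<lambda>x. \<eta> (s, x))" "smooth (\<lambda>s. \<eta> (s, x))"
    "pd 1 (\<lambda>x. \<eta> (s, x)) = (\<lambda>x. pd (0, 1) \<eta> (s, x))"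
    "pd 1 (\<lambda>s. \<eta> (s, x)) = (\<lambda>s. pd (1, 0) \<eta> (s, x))"
proof -
  have p1: "pd 1 (\<lambda>x. \<eta> (s, x)) = (\<lambda>x. pd (0, 1) \<eta> (s, x))" if "smooth \<eta>" for \<eta> :: "real \<times> real \<Rightarrow> real" and s
    proof (rule ext)
    show "pd 1 (\<lambda>x. \<eta> (s, x)) x = pd (0, 1) \<eta> (s, x)" for x
      by (rule pd_real_eq[OF pd_section(1)[of \<eta> s x]]) (rule smooth_imp_differentiable[OF that])
  qed
  have p2: "pd 1 (\<lambda>s. \<eta> (s, x)) = (\<lambda>s. pd (1, 0) \<eta> (s, x))" if "smooth \<eta>" for \<eta> :: "real \<times> real \<Rightarrow> real" and x
    proof (rule ext)
    show "pd 1 (\<lambda>s. \<eta> (s, x)) s = pd (1, 0) \<eta> (s, x)" for s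
      by (rule pd_real_eq[OF pd_section(2)[of \<eta> s x]]) (rule smooth_imp_differentiable[OF that])
  qed
  have "\<exists>\<eta>. smooth \<eta> \<and> h = (\<lambda>x. \<eta> (s, x)) \<Longrightarrow> smooth h" for h :: "real \<Rightarrow> real" and s :: real
  proof (coinduction arbitrary: h rule: smooth.coinduct)
    case smooth
    then obtain \<eta> where \<eta>: "smooth \<eta>" "h = (\<lambda>x. \<eta> (s, x))" by blast
    have "h differentiable (at x)" for x
      unfolding \<eta>(2) real_differentiable_def
      using pd_section(1)[OF smooth_imp_differentiable[OF \<eta>(1), of "(s, x)"]] by blast
    with p1[OF \<eta>(1)] smooth_pd[OF \<eta>(1) Basis_prod_real(1)] \<eta>(2) show ?case by auto
  qed
  then show "smooth (\<lambda>x. \<eta> (s, x))" using assms by blast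
  have "\<exists>\<eta>. smooth \<eta> \<and> h = (\<lambda>s. \<eta> (s, x1)) \<Longrightarrow> smooth h" for h :: "real \<Rightarrow> real" and x1 :: real
  proof (coinduction arbitrary: h rule: smooth.coinduct)
    case smooth
    then obtain \<eta> where \<eta>: "smooth \<eta>" "h = (\<lambda>s. \<eta> (s, x1))" by blast
    have "h differentiable (at x)" for x
      unfolding \<eta>(2) real_differentiable_def
      using pd_section(2)[OF smooth_imp_differentiable[OF \<eta>(1), of "(x, x1)"]] by blast
    with p2[OF \<eta>(1)] smooth_pd[OF \<eta>(1) Basis_prod_real(2)] \<eta>(2) show ?case by auto
  qed
  then show "smooth (\<lambda>s. \<eta> (s, x))" using assms by blast
  show "pd 1 (\<lambda>x. \<eta> (s, x)) = (\<lambda>x. pd (0, 1) \<eta> (s, x))" "pd 1 (\<lambda>s. \<eta> (s, x)) = (\<lambda>s. pd (1, 0) \<eta> (s, x))"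
    using p1 p2 assms by auto
qed

lemma smooth_antiderivative:
  assumes "smooth g" "\<And>x. (f has_real_derivative g x) (at x)"
  shows "smooth f" "pd 1 f = g"
proof -
  show "pd 1 f = g" using assms(2) by (intro ext pd_real_eq)
  with assms show "smooth f"
    by (intro smooth.intros[of f]) (auto simp: real_differentiable_def)
qed

subsection \<open>Bump functions\<close>

text \<open>
  The function \<open>exp (- 1/x)\<close>, continued by zero, is flat at the origin. The polynomial factor makes the family closed under
  differentiation.
\<close>

definition flat_exp :: "real poly \<Rightarrow> real \<Rightarrow> real"
  where "flat_exp p x = (if x > 0 then poly p (1 / x) * exp (- (1 / x)) else 0)"

lemma poly_exp_tendsto_0: "((\<lambda>y. poly p y * exp (- y)) \<longlongrightarrow> 0) (at_top :: real filter)"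
proof -
  have "((\<lambda>y. \<Sum>i\<le>degree p. coeff p i * (y ^ i / exp y)) \<longlongrightarrow> (\<Sum>i\<le>degree p. coeff p i * 0)) at_top"
    by (intro tendsto_sum tendsto_mult tendsto_const tendsto_power_div_exp_0)
  then show ?thesis
    by (simp add: poly_altdef exp_minus sum_distrib_right divide_inverse mult.assoc)
qed

text \<open>The substitution \<open>y = 1/h\<close> turns the difference quotient at zero into a polynomial times \<open>exp (- y)\<close>.\<close>

lemma flat_exp_right_limit: "((\<lambda>h. flat_exp p h / h) \<longlongrightarrow> 0) (at_right 0)"
proof -
  have "((\<lambda>h. poly (pCons 0 p) (inverse h) * exp (- inverse h)) \<longlongrightarrow> 0) (at_right 0)"
    by (rule filterlim_compose[OF poly_exp_tendsto_0 filterlim_inverse_at_top_right])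
  then show ?thesis
    by (rule Lim_transform_eventually)
      (auto simp: flat_exp_def eventually_at_right_field field_simps intro!: exI[of _ 1])
qed

text \<open>With \<open>y = 1/x\<close> one has \<open>dy/dx = - y\<^sup>2\<close>, so that \<open>p(y) exp (- y)\<close> has the derivative \<open>y\<^sup>2 (p - p')(y) exp (- y)\<close>.\<close>

lemma flat_exp_derivative:
  "(flat_exp p has_real_derivative flat_exp ([:0, 0, 1:] * (p - pderiv p)) x) (at x)"
proof -
  consider "x > 0" | "x < 0" | "x = 0" by linarith
  then show ?thesis
  proof cases
    case 1
    have "((\<lambda>x. poly p (1 / x) * exp (- (1 / x))) has_real_derivative
        flat_exp ([:0, 0, 1:] * (p - pderiv p)) x) (at x)"
      using 1 by (auto intro!: derivative_eq_intros simp: flat_exp_def field_simps power2_eq_square)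
    then show ?thesis
      by (rule DERIV_cong_ev[THEN iffD1, OF refl _ refl, rotated])
        (use 1 in \<open>auto simp: flat_exp_def intro!: eventually_nhds_in_open[of "{0<..}", THEN eventually_mono]\<close>)
  next
    case 2
    have "((\<lambda>x. 0) has_real_derivative flat_exp ([:0, 0, 1:] * (p - pderiv p)) x) (at x)"
      using 2 by (auto simp: flat_exp_def)
    then show ?thesis
      by (rule DERIV_cong_ev[THEN iffD1, OF refl _ refl, rotated])
        (use 2 in \<open>auto simp: flat_exp_def intro!: eventually_nhds_in_open[of "{..<0}", THEN eventually_mono]\<close>)
  next
    case 3
    have "((\<lambda>h. flat_exp p h / h) \<longlongrightarrow> 0) (at_left 0)"
      by (rule Lim_transform_eventually[OF tendsto_const])
        (auto simp: flat_exp_def eventually_at_left_field intro!: exI[of _ "-1"])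
    with flat_exp_right_limit have "((\<lambda>h. flat_exp p h / h) \<longlongrightarrow> 0) (at 0)"
      by (simp add: filterlim_split_at)
    then show ?thesis unfolding 3 has_field_derivative_iff by (simp add: flat_exp_def)
  qed
qed

lemma smooth_flat_exp: "smooth (flat_exp p)"
proof -
  have "\<exists>p. h = flat_exp p \<Longrightarrow> smooth h" for h
  proof (coinduction arbitrary: h rule: smooth.coinduct)
    case smooth
    then obtain p where h: "h = flat_exp p" by blast
    then have "pd 1 h = flat_exp ([:0, 0, 1:] * (p - pderiv p))"
      using pd_real_eq[OF flat_exp_derivative] by blast
    with h flat_exp_derivative show ?case
      by (auto simp: real_differentiable_def)
  qed
  then show ?thesis by blast
qed

abbreviation flat_step :: "real \<Rightarrow> real"
  where "flat_step \<equiv> flat_exp 1"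

lemma flat_step_bounds: "0 \<le> flat_step x" "flat_step x \<le> 1"
  by (auto simp: flat_exp_def)

lemma flat_step_pos: "flat_step x \<noteq> 0 \<longleftrightarrow> x > 0"
  by (auto simp: flat_exp_def)

lemma flat_step_tendsto_1: "(flat_step \<longlongrightarrow> 1) at_top"
proof -
  have "((\<lambda>x::real. exp (- inverse x)) \<longlongrightarrow> exp (- 0)) at_top"
    by (intro tendsto_intros tendsto_inverse_0_at_top filterlim_ident)
  then show ?thesis
    by (auto simp: flat_exp_def inverse_eq_divide eventually_gt_at_top
        elim!: Lim_transform_eventually intro!: eventually_mono[OF eventually_gt_at_top[of 0]])
qed

text \<open>
  A product of smooth steps that tends to the indicator of the open box with corners \<open>c\<close> and \<open>d\<close>. The
  shift by one keeps the support at distance \<open>1/n\<close> from the boundary.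
\<close>

definition box_bump :: "'a::euclidean_space \<Rightarrow> 'a \<Rightarrow> real \<Rightarrow> 'a \<Rightarrow> real"
  where "box_bump c d n x = (\<Prod>i\<in>Basis. flat_step (n * (x \<bullet> i) + (- n * (c \<bullet> i) - 1))
    * flat_step (- n * (x \<bullet> i) + (n * (d \<bullet> i) - 1)))"

lemma smooth_box_bump: "smooth (box_bump c d n)"
  unfolding box_bump_def[abs_def]
  by (intro smooth_prod finite_Basis smooth_mult smooth_coord smooth_flat_exp)

lemma box_bump_bounds: "0 \<le> box_bump c d n x" "box_bump c d n x \<le> 1"
  unfolding box_bump_def
  by (intro prod_nonneg prod_le_1 conjI ballI mult_nonneg_nonneg mult_le_one flat_step_bounds)+

lemma box_bump_nonzero:
  "box_bump c d n x \<noteq> 0 \<longleftrightarrow> (\<forall>i\<in>Basis. 1 < n * (x \<bullet> i - c \<bullet> i) \<and> 1 < n * (d \<bullet> i - x \<bullet> i))"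
  by (auto simp: box_bump_def flat_step_pos algebra_simps)

lemma box_bump_support:
  assumes "n > 0"
  shows "compact (closure {x. box_bump c d n x \<noteq> 0})" "closure {x. box_bump c d n x \<noteq> 0} \<subseteq> box c d"
proof -
  let ?C = "cbox (c + (1 / n) *\<^sub>R One) (d - (1 / n) *\<^sub>R One)"
  have "{x. box_bump c d n x \<noteq> 0} \<subseteq> ?C"
    using assms by (force simp: box_bump_nonzero mem_box algebra_simps divide_simps)
  then have sub: "closure {x. box_bump c d n x \<noteq> 0} \<subseteq> ?C"
    by (rule closure_minimal) (rule closed_cbox)
  then show "compact (closure {x. box_bump c d n x \<noteq> 0})"
    by (meson bounded_cbox bounded_subset closed_closure compact_eq_bounded_closed)
  have "?C \<subseteq> box c d"
  proof
    fix x assume "x \<in> ?C"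
    then have "c \<bullet> i + 1 / n \<le> x \<bullet> i" "x \<bullet> i \<le> d \<bullet> i - 1 / n" if "i \<in> Basis" for i
      using that by (auto simp: mem_box inner_simps)
    moreover have "1 / n > 0" using assms by simp
    ultimately have "c \<bullet> i < x \<bullet> i \<and> x \<bullet> i < d \<bullet> i" if "i \<in> Basis" for i
      using that by (smt (verit))
    then show "x \<in> box c d" by (simp add: mem_box)
  qed
  with sub show "closure {x. box_bump c d n x \<noteq> 0} \<subseteq> box c d" by blast
qed

lemma box_bump_tendsto:
  "(\<lambda>n. box_bump c d (real n) x) \<longlonglongrightarrow> indicator (box c d) x"
proof (cases "x \<in> box c d")
  case True
  have "(\<lambda>n. box_bump c d (real n) x) \<longlonglongrightarrow> (\<Prod>i\<in>(Basis :: 'a set). 1 * 1)"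
    unfolding box_bump_def
  proof (intro tendsto_prod tendsto_mult)
    fix i :: 'a assume i: "i \<in> Basis"
    have lim: "(\<lambda>n. flat_step (y * real n - 1)) \<longlonglongrightarrow> 1" if "y > 0" for y
    proof (rule filterlim_compose[OF flat_step_tendsto_1])
      have "filterlim (\<lambda>n. - 1 + y * real n) at_top sequentially"
        by (intro filterlim_tendsto_add_at_top[OF tendsto_const]
            filterlim_tendsto_pos_mult_at_top[OF tendsto_const that] filterlim_real_sequentially)
      then show "filterlim (\<lambda>n. y * real n - 1) at_top sequentially" by simp
    qed
    show "(\<lambda>n. flat_step (real n * (x \<bullet> i) + (- real n * (c \<bullet> i) - 1))) \<longlonglongrightarrow> 1"
      using lim[of "x \<bullet> i - c \<bullet> i"] True i by (simp add: mem_box algebra_simps)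
    show "(\<lambda>n. flat_step (- real n * (x \<bullet> i) + (real n * (d \<bullet> i) - 1))) \<longlonglongrightarrow> 1"
      using lim[of "d \<bullet> i - x \<bullet> i"] True i by (simp add: mem_box algebra_simps)
  qed
  with True show ?thesis by simp
next
  case False
  then have "box_bump c d (real n) x = 0" for n
  proof -
    from False obtain i where i: "i \<in> Basis" "x \<bullet> i - c \<bullet> i \<le> 0 \<or> d \<bullet> i - x \<bullet> i \<le> 0"
      by (force simp: mem_box not_less)
    then have "\<not> (1 < real n * (x \<bullet> i - c \<bullet> i) \<and> 1 < real n * (d \<bullet> i - x \<bullet> i))"
      using mult_nonneg_nonpos[of "real n" "x \<bullet> i - c \<bullet> i"] mult_nonneg_nonpos[of "real n" "d \<bullet> i - x \<bullet> i"]
      by auto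
    with i(1) show ?thesis using box_bump_nonzero[of c d "real n" x] by blast
  qed
  with False show ?thesis by simp
qed

section \<open>The fundamental lemma of the calculus of variations\<close>

lemma test_function_box_bump:
  assumes "n > 0" "box c d \<subseteq> interior S"
  shows "test_function S (box_bump c d n)"
  using box_bump_support[OF assms(1), of c d] assms(2)
  by (auto simp: test_function_def smooth_box_bump)

text \<open>
  The positive and the negative part of \<open>g\<close> are densities of two finite measures that agree on all
  boxes. Boxes are stable under intersection and generate the Borel sets, so the measures are equal.
\<close>

lemma integral_boxes_zero_imp_AE_zero:
  fixes g :: "'a::euclidean_space \<Rightarrow> real"
  assumes g: "integrable lborel g"
    and zero: "\<And>c d. (LINT x|lborel. indicator (box c d) x * g x) = 0"
  shows "AE x in lborel. g x = 0"
proof -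
  let ?p = "\<lambda>x. max 0 (g x)" and ?m = "\<lambda>x. max 0 (- g x)"
  have [measurable]: "g \<in> borel_measurable lborel" using g by simp
  have int: "integrable lborel ?p" "integrable lborel ?m"
    using g by (auto intro!: integrable_max)
  have int_box: "integrable lborel (\<lambda>x. indicator (box c d) x * ?p x)"
    "integrable lborel (\<lambda>x. indicator (box c d) x * ?m x)" for c d
    using integrable_mult_indicator[of "box c d" lborel ?p] integrable_mult_indicator[of "box c d" lborel ?m]
      int by auto
  have emeas: "emeasure (density lborel h) (box c d) = ennreal (LINT x|lborel. indicator (box c d) x * h x)"
    if "integrable lborel (\<lambda>x. indicator (box c d) x * h x)" "h \<in> borel_measurable lborel" "\<And>x. 0 \<le> h x" for h c d
  proof -
    have "emeasure (density lborel h) (box c d) = (\<integral>\<^sup>+x. ennreal (indicator (box c d) x * h x) \<partial>lborel)"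
      using that(2) by (subst emeasure_density) (auto intro!: nn_integral_cong split: split_indicator)
    also have "\<dots> = ennreal (LINT x|lborel. indicator (box c d) x * h x)"
      using that by (intro nn_integral_eq_integral) auto
    finally show ?thesis .
  qed
  have eq: "emeasure (density lborel ?p) (box c d) = emeasure (density lborel ?m) (box c d)" for c d
  proof -
    have "(LINT x|lborel. indicator (box c d) x * ?p x) - (LINT x|lborel. indicator (box c d) x * ?m x)
        = (LINT x|lborel. indicator (box c d) x * g x)"
      by (subst Bochner_Integration.integral_diff[symmetric, OF int_box])
        (auto intro!: Bochner_Integration.integral_cong simp: max_def split: split_indicator)
    then show ?thesis using emeas[OF int_box(1), of c d] emeas[OF int_box(2), of c d] zero by simp
  qed
  have "density lborel ?p = density lborel ?m"
  proof (rule measure_eqI_generator_eq[where E="range (\<lambda>(a, b). box a b)" and \<Omega>=UNIV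
        and A="\<lambda>n. box (- (real n *\<^sub>R One)) (real n *\<^sub>R One)"])
    show "Int_stable (range (\<lambda>(a, b). box a b :: 'a set))"
      by (auto simp: Int_stable_def box_Int_box)
    show "sets (density lborel ?p) = sigma_sets UNIV (range (\<lambda>(a, b). box a b))"
      "sets (density lborel ?m) = sigma_sets UNIV (range (\<lambda>(a, b). box a b))"
      by (simp_all add: borel_eq_box)
    show "(\<Union>n. box (- (real n *\<^sub>R One)) (real n *\<^sub>R One)) = (UNIV :: 'a set)"
      using UN_box_eq_UNIV by simp
    show "emeasure (density lborel ?p) (box (- (real n *\<^sub>R One)) (real n *\<^sub>R One)) \<noteq> \<infinity>" for n
      using emeas[OF int_box(1)] by simp
  qed (use eq in auto)
  then have "AE x in lborel. ennreal (?p x) = ennreal (?m x)"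
    by (intro sigma_finite_measure.density_unique_iff[OF sigma_finite_lborel, THEN iffD1]) auto
  then show ?thesis
    by eventually_elim (auto simp: max_def split: if_splits)
qed

text \<open>
  Test functions approximate the indicators of open boxes boundedly, so the integral of \<open>g\<close> over every
  open box inside the cube vanishes.
\<close>

lemma fundamental_lemma:
  fixes g :: "'a::euclidean_space \<Rightarrow> real"
  assumes g: "integrable (lborel_on (cbox A B)) g"
    and zero: "\<And>\<eta>. test_function (cbox A B) \<eta> \<Longrightarrow> (LINT x|lborel_on (cbox A B). g x * \<eta> x) = 0"
  shows "AE x in lborel_on (cbox A B). g x = 0"
proof -
  let ?g = "\<lambda>x. indicator (cbox A B) x * g x"
  have gi: "integrable lborel ?g"
    using g by (simp add: integrable_restrict_space)
  have [measurable]: "?g \<in> borel_measurable lborel" using gi by simp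
  \<comment> \<open>The boundary of the cube is a null set, so that open boxes inside it suffice.\<close>
  have bdry: "AE x in lborel. x \<notin> cbox A B - box A B"
    by (rule AE_not_in) (auto simp: null_sets_def emeasure_Diff emeasure_lborel_cbox_eq emeasure_lborel_box_eq box_subset_cbox)
  have inner: "(LINT x|lborel. indicator (box c d) x * ?g x) = 0" if sub: "box c d \<subseteq> box A B" for c d
  proof -
    have "(\<lambda>n. LINT x|lborel. box_bump c d (real n) x * ?g x) \<longlonglongrightarrow> (LINT x|lborel. indicator (box c d) x * ?g x)"
    proof (rule integral_dominated_convergence[where w="\<lambda>x. \<bar>?g x\<bar>"])
      show "(\<lambda>x. box_bump c d (real n) x * ?g x) \<in> borel_measurable lborel" for n
      proof (rule borel_measurable_times)
        show "box_bump c d (real n) \<in> borel_measurable lborel"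
          unfolding measurable_lborel2
          by (rule borel_measurable_continuous_onI[OF smooth_continuous[OF smooth_box_bump]])
      qed fact
      show "AE x in lborel. (\<lambda>n. box_bump c d (real n) x * ?g x) \<longlonglongrightarrow> indicator (box c d) x * ?g x"
        by (intro AE_I2 tendsto_mult tendsto_const box_bump_tendsto)
      have "box_bump c d (real n) x * \<bar>?g x\<bar> \<le> 1 * \<bar>?g x\<bar>" for n x
        by (intro mult_right_mono box_bump_bounds) simp
      then show "AE x in lborel. norm (box_bump c d (real n) x * ?g x) \<le> \<bar>?g x\<bar>" for n
        by (intro AE_I2) (simp only: real_norm_def abs_mult abs_of_nonneg[OF box_bump_bounds(1)] mult_1)
    qed (use gi in auto)
    moreover have "(LINT x|lborel. box_bump c d (real n) x * ?g x) = 0" if "n > 0" for n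
    proof -
      have "test_function (cbox A B) (box_bump c d (real n))"
        using that sub by (intro test_function_box_bump) (auto simp: interior_cbox)
      from zero[OF this] show ?thesis
        by (simp add: integral_restrict_space mult_ac)
    qed
    then have "(\<lambda>n. LINT x|lborel. box_bump c d (real n) x * ?g x) \<longlonglongrightarrow> 0"
      by (intro tendsto_eventually) (auto intro: eventually_mono[OF eventually_gt_at_top[of 0]])
    ultimately show ?thesis by (rule LIMSEQ_unique)
  qed
  have "AE x in lborel. ?g x = 0"
  proof (rule integral_boxes_zero_imp_AE_zero[OF gi])
    fix c d :: 'a
    obtain c' d' where cd: "box c d \<inter> box A B = box c' d'" by (auto simp: box_Int_box)
    have "(LINT x|lborel. indicator (box c d) x * ?g x) = (LINT x|lborel. indicator (box c' d') x * ?g x)"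
      unfolding cd[symmetric]
    proof (rule integral_cong_AE)
      show "AE x in lborel. indicator (box c d) x * ?g x = indicator (box c d \<inter> box A B) x * ?g x"
        using bdry by eventually_elim (auto split: split_indicator)
    qed measurable
    also have "\<dots> = 0" using inner cd by blast
    finally show "(LINT x|lborel. indicator (box c d) x * ?g x) = 0" .
  qed
  then show ?thesis
    by (simp add: AE_restrict_space_iff) (auto elim!: eventually_mono split: split_indicator)
qed

section \<open>Square integrable functions\<close>

lemma space_lborel_on [simp]: "space (lborel_on S) = S"
  by (simp add: space_restrict_space)

lemma finite_measure_lborel_on: "compact S \<Longrightarrow> finite_measure (lborel_on S)"
  using emeasure_compact_finite[of S]
  by (intro finite_measureI) (auto simp: emeasure_restrict_space borel_compact)

lemma sqint_measurable: "f \<in> sqint S \<Longrightarrow> f \<in> borel_measurable (lborel_on S)"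
  by (simp add: sqint_def)

lemma sqint_integrable_sq: "f \<in> sqint S \<Longrightarrow> integrable (lborel_on S) (\<lambda>x. (f x)\<^sup>2)"
  by (simp add: sqint_def)

lemma sqint_bound:
  assumes "g \<in> borel_measurable (lborel_on S)" "integrable (lborel_on S) h"
    "\<And>x. x \<in> S \<Longrightarrow> (g x)\<^sup>2 \<le> h x"
  shows "g \<in> sqint S" "normsq S g \<le> (LINT x|lborel_on S. h x)"
proof -
  have i: "integrable (lborel_on S) (\<lambda>x. (g x)\<^sup>2)"
    by (rule Bochner_Integration.integrable_bound[OF assms(2)])
      (use assms order_trans[OF assms(3) abs_ge_self] in auto)
  with assms(1) show "g \<in> sqint S" by (simp add: sqint_def)
  show "normsq S g \<le> (LINT x|lborel_on S. h x)"
    unfolding normsq_def using i assms by (intro integral_mono) auto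
qed

lemma two_sq_sum: "(a + b)\<^sup>2 \<le> 2 * a\<^sup>2 + 2 * (b::real)\<^sup>2"
  using sum_squares_bound[of a b] by (simp add: power2_sum)

lemma
  assumes f: "f \<in> sqint S" and g: "g \<in> sqint S"
  shows sqint_add: "(\<lambda>x. f x + g x) \<in> sqint S"
    and normsq_add_le: "normsq S (\<lambda>x. f x + g x) \<le> 2 * normsq S f + 2 * normsq S g"
proof -
  have [measurable]: "f \<in> borel_measurable (lborel_on S)" "g \<in> borel_measurable (lborel_on S)"
    using f g by (auto intro: sqint_measurable)
  have i: "integrable (lborel_on S) (\<lambda>x. 2 * (f x)\<^sup>2 + 2 * (g x)\<^sup>2)"
    using sqint_integrable_sq[OF f] sqint_integrable_sq[OF g] by simp
  have m: "(\<lambda>x. f x + g x) \<in> borel_measurable (lborel_on S)" by measurable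
  from sqint_bound[OF m i two_sq_sum]
  show "(\<lambda>x. f x + g x) \<in> sqint S" "normsq S (\<lambda>x. f x + g x) \<le> 2 * normsq S f + 2 * normsq S g"
    using sqint_integrable_sq[OF f] sqint_integrable_sq[OF g] by (auto simp: normsq_def)
qed

lemma sqint_cmult: "f \<in> sqint S \<Longrightarrow> (\<lambda>x. c * f x) \<in> sqint S"
  by (auto simp: sqint_def power_mult_distrib)

lemma normsq_cmult: "normsq S (\<lambda>x. c * f x) = c\<^sup>2 * normsq S f"
  by (simp add: normsq_def power_mult_distrib)

lemma sqint_minus: "f \<in> sqint S \<Longrightarrow> (\<lambda>x. - f x) \<in> sqint S"
  using sqint_cmult[of f S "-1"] by simp

lemma sqint_diff: "f \<in> sqint S \<Longrightarrow> g \<in> sqint S \<Longrightarrow> (\<lambda>x. f x - g x) \<in> sqint S"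
  using sqint_add[OF _ sqint_minus, of f S g] by simp

lemma sqint_zero: "(\<lambda>x. 0) \<in> sqint S"
  by (simp add: sqint_def)

lemma sqint_sum: "(\<And>k. k \<in> I \<Longrightarrow> f k \<in> sqint S) \<Longrightarrow> (\<lambda>x. \<Sum>k\<in>I. f k x) \<in> sqint S"
  by (induction I rule: infinite_finite_induct) (auto intro: sqint_zero sqint_add)

lemma normsq_nonneg: "0 \<le> normsq S f"
  by (simp add: normsq_def)

lemma
  assumes "AE x in lborel_on S. f x = g x" "f \<in> sqint S" "g \<in> borel_measurable (lborel_on S)"
  shows sqint_cong_AE: "g \<in> sqint S" and normsq_cong_AE': "normsq S f = normsq S g"
proof -
  have m [measurable]: "f \<in> borel_measurable (lborel_on S)" "g \<in> borel_measurable (lborel_on S)"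
    using assms by (auto intro: sqint_measurable)
  have ae: "AE x in lborel_on S. (f x)\<^sup>2 = (g x)\<^sup>2" using assms(1) by auto
  have "integrable (lborel_on S) (\<lambda>x. (g x)\<^sup>2)"
    by (rule integrable_cong_AE_imp[OF sqint_integrable_sq[OF assms(2)]]) (use ae in auto)
  with assms show "g \<in> sqint S" by (simp add: sqint_def)
  show "normsq S f = normsq S g"
    unfolding normsq_def by (rule integral_cong_AE) (use ae in auto)
qed

lemma normsq_cong_AE:
  "AE x in lborel_on S. f x = g x \<Longrightarrow> f \<in> sqint S \<Longrightarrow> g \<in> sqint S \<Longrightarrow> normsq S f = normsq S g"
  by (rule normsq_cong_AE') (auto intro: sqint_measurable)

lemma normsq_zero_imp_AE: "f \<in> sqint S \<Longrightarrow> normsq S f = 0 \<Longrightarrow> AE x in lborel_on S. f x = 0"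
  unfolding normsq_def using integral_nonneg_eq_0_iff_AE[of "lborel_on S" "\<lambda>x. (f x)\<^sup>2"]
  by (simp add: sqint_integrable_sq)

lemma sqint_mult_integrable:
  assumes f: "f \<in> sqint S" and g: "g \<in> sqint S"
  shows "integrable (lborel_on S) (\<lambda>x. f x * g x)"
proof (rule Bochner_Integration.integrable_bound)
  show "integrable (lborel_on S) (\<lambda>x. (f x)\<^sup>2 + (g x)\<^sup>2)"
    using f g by (simp add: sqint_integrable_sq)
  show "(\<lambda>x. f x * g x) \<in> borel_measurable (lborel_on S)"
    using f[THEN sqint_measurable] g[THEN sqint_measurable] by simp
  have "\<bar>a * b\<bar> \<le> a\<^sup>2 + b\<^sup>2" for a b :: real
    using sum_squares_bound[of "\<bar>a\<bar>" "\<bar>b\<bar>"] abs_ge_zero[of "a * b"] unfolding abs_mult power2_abs by linarith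
  then show "AE x in lborel_on S. norm (f x * g x) \<le> norm ((f x)\<^sup>2 + (g x)\<^sup>2)"
    by (intro AE_I2) (metis abs_ge_self order_trans real_norm_def)
qed

text \<open>The squared norm of \<open>f + l g\<close> is a nonnegative polynomial in \<open>l\<close> of degree at most two.\<close>

lemma L2_Cauchy_Schwarz:
  assumes f: "f \<in> sqint S" and g: "g \<in> sqint S"
  shows "(LINT x|lborel_on S. f x * g x)\<^sup>2 \<le> normsq S f * normsq S g"
proof -
  let ?C = "LINT x|lborel_on S. f x * g x" and ?A = "normsq S f" and ?B = "normsq S g"
  have q: "0 \<le> ?A + 2 * l * ?C + l\<^sup>2 * ?B" for l
  proof -
    have "0 \<le> (LINT x|lborel_on S. (f x + l * g x)\<^sup>2)" by simp
    also have "\<dots> = (LINT x|lborel_on S. (f x)\<^sup>2 + 2 * l * (f x * g x) + l\<^sup>2 * (g x)\<^sup>2)"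
      by (simp add: power2_sum power_mult_distrib algebra_simps)
    also have "\<dots> = ?A + 2 * l * ?C + l\<^sup>2 * ?B"
      using sqint_integrable_sq[OF f] sqint_integrable_sq[OF g] sqint_mult_integrable[OF f g]
      by (simp add: normsq_def)
    finally show ?thesis .
  qed
  show ?thesis
  proof (cases "?B = 0")
    case True
    have "?C = 0"
    proof (rule ccontr)
      assume "?C \<noteq> 0"
      with q[of "- (?A + 1) / (2 * ?C)"] True show False by (simp add: field_simps)
    qed
    with True show ?thesis by simp
  next
    case False
    then have B: "?B > 0" using normsq_nonneg[of S g] by linarith
    have "0 \<le> ?A - ?C\<^sup>2 / ?B"
      using q[of "- ?C / ?B"] B by (simp add: field_simps power2_eq_square)
    with B show ?thesis by (simp add: field_simps)
  qed
qed

subsection \<open>Bounded functions\<close>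

text \<open>
  Everywhere bounded, in contrast to \<open>Linf\<close>: a kernel \<open>K\<close> with this property has bounded sections
  \<open>K(x, \<cdot>)\<close> at every \<open>x\<close>, whereas an essential bound only gives almost all of them.
\<close>

definition bddf :: "'a::euclidean_space set \<Rightarrow> ('a \<Rightarrow> real) set"
  where "bddf S = {f. f \<in> borel_measurable (lborel_on S) \<and> (\<exists>C. \<forall>x\<in>S. \<bar>f x\<bar> \<le> C)}"

lemma bddf_measurable: "f \<in> bddf S \<Longrightarrow> f \<in> borel_measurable (lborel_on S)"
  by (simp add: bddf_def)

lemma bddfE:
  assumes "f \<in> bddf S" obtains C where "0 \<le> C" "\<And>x. x \<in> S \<Longrightarrow> \<bar>f x\<bar> \<le> C"
proof -
  from assms obtain C where "\<forall>x\<in>S. \<bar>f x\<bar> \<le> C" by (auto simp: bddf_def)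
  then show thesis by (intro that[of "max 0 C"]) (auto simp: le_max_iff_disj)
qed

lemma bddf_const: "(\<lambda>x. c) \<in> bddf S"
  by (auto simp: bddf_def)

lemma bddf_add:
  assumes f: "f \<in> bddf S" and g: "g \<in> bddf S"
  shows "(\<lambda>x. f x + g x) \<in> bddf S"
proof -
  obtain C D where "\<And>x. x \<in> S \<Longrightarrow> \<bar>f x\<bar> \<le> C" "\<And>x. x \<in> S \<Longrightarrow> \<bar>g x\<bar> \<le> D"
    using f g by (auto elim!: bddfE)
  then have "\<forall>x\<in>S. \<bar>f x + g x\<bar> \<le> C + D"
    by (meson abs_triangle_ineq add_mono order_trans)
  with f[THEN bddf_measurable] g[THEN bddf_measurable] show ?thesis
    unfolding bddf_def by auto
qed

lemma bddf_mult:
  assumes f: "f \<in> bddf S" and g: "g \<in> bddf S"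
  shows "(\<lambda>x. f x * g x) \<in> bddf S"
proof -
  obtain C D where C: "0 \<le> C" "\<And>x. x \<in> S \<Longrightarrow> \<bar>f x\<bar> \<le> C" "\<And>x. x \<in> S \<Longrightarrow> \<bar>g x\<bar> \<le> D"
    using f g by (auto elim!: bddfE)
  have "\<forall>x\<in>S. \<bar>f x * g x\<bar> \<le> C * D"
    unfolding abs_mult using C by (auto intro!: mult_mono)
  with f[THEN bddf_measurable] g[THEN bddf_measurable] show ?thesis
    unfolding bddf_def by auto
qed

lemma bddf_continuous:
  assumes "continuous_on S f" "compact S"
  shows "f \<in> bddf S"
proof -
  have "f \<in> borel_measurable (lborel_on S)"
    using borel_measurable_continuous_on_restrict[OF assms(1)]
    by (simp add: measurable_cong_sets[OF sets_restrict_space_cong[OF sets_lborel] refl])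
  moreover have "bounded (f ` S)"
    using compact_continuous_image[OF assms] by (rule compact_imp_bounded)
  ultimately show ?thesis
    by (auto simp: bddf_def bounded_iff)
qed

lemma
  assumes f: "f \<in> bddf S" and g: "g \<in> sqint S"
  shows bddf_mult_sqint: "(\<lambda>x. f x * g x) \<in> sqint S"
    and normsq_bddf_mult_le: "(\<And>x. x \<in> S \<Longrightarrow> \<bar>f x\<bar> \<le> C) \<Longrightarrow> normsq S (\<lambda>x. f x * g x) \<le> C\<^sup>2 * normsq S g"
proof -
  have m: "(\<lambda>x. f x * g x) \<in> borel_measurable (lborel_on S)"
    using f[THEN bddf_measurable] g[THEN sqint_measurable] by simp
  have b: "(f x * g x)\<^sup>2 \<le> D\<^sup>2 * (g x)\<^sup>2" if "\<bar>f x\<bar> \<le> D" for x D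
    using that by (simp add: power_mult_distrib mult_right_mono abs_le_square_iff[symmetric])
  from f obtain D where "\<And>x. x \<in> S \<Longrightarrow> \<bar>f x\<bar> \<le> D" by (auto elim!: bddfE)
  with sqint_bound(1)[OF m, of "\<lambda>x. D\<^sup>2 * (g x)\<^sup>2"] sqint_integrable_sq[OF g] b
  show "(\<lambda>x. f x * g x) \<in> sqint S" by simp
  assume "\<And>x. x \<in> S \<Longrightarrow> \<bar>f x\<bar> \<le> C"
  with sqint_bound(2)[OF m, of "\<lambda>x. C\<^sup>2 * (g x)\<^sup>2"] sqint_integrable_sq[OF g] b
  show "normsq S (\<lambda>x. f x * g x) \<le> C\<^sup>2 * normsq S g" by (simp add: normsq_def)
qed

lemma bddf_integrable: "f \<in> bddf S \<Longrightarrow> compact S \<Longrightarrow> integrable (lborel_on S) f"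
  unfolding bddf_def
  by (auto intro!: finite_measure.integrable_const_bound[OF finite_measure_lborel_on] AE_I2)

lemma bddf_sqint: "f \<in> bddf S \<Longrightarrow> compact S \<Longrightarrow> f \<in> sqint S"
  using bddf_integrable[OF bddf_mult, of f S f] by (simp add: sqint_def bddf_measurable power2_eq_square)

lemma sqint_const: "compact S \<Longrightarrow> (\<lambda>x. c) \<in> sqint S"
  by (simp add: bddf_const bddf_sqint)

lemma sqint_integrable: "f \<in> sqint S \<Longrightarrow> compact S \<Longrightarrow> integrable (lborel_on S) f"
  using sqint_mult_integrable[OF _ sqint_const, of f S 1] by simp

lemma bddf_mult_integrable:
  assumes "f \<in> bddf S" "integrable (lborel_on S) g"
  shows "integrable (lborel_on S) (\<lambda>x. f x * g x)"
proof -
  from assms(1) obtain D where D: "\<And>x. x \<in> S \<Longrightarrow> \<bar>f x\<bar> \<le> D" by (auto elim!: bddfE)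
  show ?thesis
  proof (rule Bochner_Integration.integrable_bound)
    show "integrable (lborel_on S) (\<lambda>x. D * g x)" using assms by simp
    have "\<bar>f x * g x\<bar> \<le> \<bar>D * g x\<bar>" if "x \<in> S" for x
      using D[OF that] by (simp add: abs_mult mult_right_mono)
    then show "AE x in lborel_on S. norm (f x * g x) \<le> norm (D * g x)" by (intro AE_I2) simp
    show "(\<lambda>x. f x * g x) \<in> borel_measurable (lborel_on S)"
      using assms(1)[THEN bddf_measurable] assms(2) by (intro borel_measurable_times) auto
  qed
qed

text \<open>Cutting off at an essential bound changes a function only on a null set.\<close>

lemma Linf_bddf:
  assumes "f \<in> Linf S"
  obtains g where "g \<in> bddf S" "AE x in lborel_on S. f x = g x"
proof -
  from assms obtain C where C: "AE x in lborel_on S. \<bar>f x\<bar> \<le> C"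
    and [measurable]: "f \<in> borel_measurable (lborel_on S)" by (auto simp: Linf_def)
  have "(\<lambda>x. max (- \<bar>C\<bar>) (min \<bar>C\<bar> (f x))) \<in> bddf S"
    unfolding bddf_def by (auto intro!: exI[of _ "\<bar>C\<bar>"])
  moreover have "AE x in lborel_on S. f x = max (- \<bar>C\<bar>) (min \<bar>C\<bar> (f x))"
    using C by eventually_elim auto
  ultimately show ?thesis by (rule that)
qed

lemma Linf_mult_sqint:
  assumes "f \<in> Linf S" "g \<in> sqint S"
  shows "(\<lambda>x. f x * g x) \<in> sqint S"
proof -
  from Linf_bddf[OF assms(1)] obtain f' where f': "f' \<in> bddf S" "AE x in lborel_on S. f x = f' x" .
  have "(\<lambda>x. f x * g x) \<in> borel_measurable (lborel_on S)"
    using assms(1) assms(2)[THEN sqint_measurable] unfolding Linf_def by (auto intro: borel_measurable_times)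
  then show ?thesis
    by (rule sqint_cong_AE[rotated 2, where f="\<lambda>x. f' x * g x"])
      (use f' bddf_mult_sqint[OF f'(1) assms(2)] in auto)
qed

section \<open>Weak derivatives\<close>

lemma test_function_zero_outside:
  assumes "test_function S \<eta>" "x \<notin> interior S"
  shows "\<eta> x = 0"
  using assms closure_subset[of "{x. \<eta> x \<noteq> 0}"] by (auto simp: test_function_def)

lemma test_function_pd:
  assumes "test_function S \<eta>" "e \<in> Basis"
  shows "test_function S (pd e \<eta>)"
proof -
  have sub: "{x. pd e \<eta> x \<noteq> 0} \<subseteq> closure {x. \<eta> x \<noteq> 0}"
  proof (rule subsetI, rule ccontr)
    fix x assume x: "x \<in> {x. pd e \<eta> x \<noteq> 0}" "x \<notin> closure {x. \<eta> x \<noteq> 0}"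
    have "(\<eta> has_derivative (\<lambda>h. 0)) (at x)"
    proof (rule has_derivative_transform_within_open[where f="\<lambda>x. 0" and s="- closure {x. \<eta> x \<noteq> 0}"])
      show "\<And>y. y \<in> - closure {x. \<eta> x \<noteq> 0} \<Longrightarrow> 0 = \<eta> y"
        using closure_subset[of "{x. \<eta> x \<noteq> 0}"] by auto
    qed (use x in auto)
    from pd_eq[OF this, of e] x show False by simp
  qed
  then have "closure {x. pd e \<eta> x \<noteq> 0} \<subseteq> closure {x. \<eta> x \<noteq> 0}"
    by (simp add: closure_minimal)
  with assms show ?thesis
    unfolding test_function_def
    by (meson bounded_subset closed_closure compact_eq_bounded_closed order_trans smooth_pd)
qed

lemma test_function_foldr_pd:
  "test_function S \<eta> \<Longrightarrow> set ds \<subseteq> Basis \<Longrightarrow> test_function S (foldr pd ds \<eta>)"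
  by (induction ds) (auto intro: test_function_pd)

lemma test_function_bddf: "test_function S \<eta> \<Longrightarrow> compact S \<Longrightarrow> \<eta> \<in> bddf S"
  by (auto simp: test_function_def intro: bddf_continuous smooth_continuous)

lemma weak_pd_integrable:
  assumes "test_function S \<eta>" "set ds \<subseteq> Basis" "f \<in> sqint S" "compact S"
  shows "integrable (lborel_on S) (\<lambda>x. f x * foldr pd ds \<eta> x)"
  by (intro sqint_mult_integrable assms(3) bddf_sqint[OF _ assms(4)] test_function_bddf[OF _ assms(4)]
      test_function_foldr_pd[OF assms(1,2)])

text \<open>The difference of two weak derivatives annihilates all test functions.\<close>

lemma weak_pd_unique:
  assumes "g \<in> sqint (cbox A B)" "h \<in> sqint (cbox A B)"
    "weak_pd (cbox A B) ds f g" "weak_pd (cbox A B) ds f h"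
  shows "AE x in lborel_on (cbox A B). g x = h x"
proof -
  have "AE x in lborel_on (cbox A B). g x - h x = 0"
  proof (rule fundamental_lemma)
    show "integrable (lborel_on (cbox A B)) (\<lambda>x. g x - h x)"
      using assms by (simp add: sqint_integrable)
    fix \<eta> :: "'a \<Rightarrow> real" assume \<eta>: "test_function (cbox A B) \<eta>"
    have eq: "(LINT x|lborel_on (cbox A B). g x * \<eta> x) = (LINT x|lborel_on (cbox A B). h x * \<eta> x)"
      using assms(3,4) \<eta> by (auto simp: weak_pd_def)
    have "integrable (lborel_on (cbox A B)) (\<lambda>x. g x * \<eta> x)" "integrable (lborel_on (cbox A B)) (\<lambda>x. h x * \<eta> x)"
      using weak_pd_integrable[OF \<eta>, of "[]"] assms by simp_all
    with eq show "(LINT x|lborel_on (cbox A B). (g x - h x) * \<eta> x) = 0"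
      by (simp add: left_diff_distrib)
  qed
  then show ?thesis by eventually_elim simp
qed

lemma weak_pd_lin:
  assumes "weak_pd S ds f1 g1" "weak_pd S ds f2 g2" "set ds \<subseteq> Basis" "compact S"
    "f1 \<in> sqint S" "f2 \<in> sqint S" "g1 \<in> sqint S" "g2 \<in> sqint S"
  shows "weak_pd S ds (\<lambda>x. f1 x + c * f2 x) (\<lambda>x. g1 x + c * g2 x)"
  unfolding weak_pd_def
proof (intro allI impI)
  fix \<eta> :: "'a \<Rightarrow> real" assume \<eta>: "test_function S \<eta>"
  note i = weak_pd_integrable[OF \<eta> assms(3) _ assms(4)] weak_pd_integrable[OF \<eta>, of "[]", OF _ _ assms(4), simplified]
  have "(LINT x|lborel_on S. (f1 x + c * f2 x) * foldr pd ds \<eta> x)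
      = (LINT x|lborel_on S. f1 x * foldr pd ds \<eta> x) + c * (LINT x|lborel_on S. f2 x * foldr pd ds \<eta> x)"
    using i(1)[OF assms(5)] i(1)[OF assms(6)] by (simp add: distrib_right mult.assoc)
  moreover have "(LINT x|lborel_on S. (g1 x + c * g2 x) * \<eta> x)
      = (LINT x|lborel_on S. g1 x * \<eta> x) + c * (LINT x|lborel_on S. g2 x * \<eta> x)"
    using i(2)[OF assms(7)] i(2)[OF assms(8)] by (simp add: distrib_right mult.assoc)
  ultimately show "(LINT x|lborel_on S. (f1 x + c * f2 x) * foldr pd ds \<eta> x)
      = (- 1) ^ length ds * (LINT x|lborel_on S. (g1 x + c * g2 x) * \<eta> x)"
    using assms(1,2) \<eta> by (simp add: weak_pd_def algebra_simps)
qed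

lemma weak_pd_append:
  assumes "weak_pd S ds1 f h" "weak_pd S ds2 h g" "set ds2 \<subseteq> Basis"
  shows "weak_pd S (ds1 @ ds2) f g"
  using assms test_function_foldr_pd[OF _ assms(3)] unfolding weak_pd_def
  by (simp add: power_add mult.assoc)

lemma weak_pd_cong_left:
  assumes "AE x in lborel_on S. f x = f' x"
    "f \<in> borel_measurable (lborel_on S)" "f' \<in> borel_measurable (lborel_on S)"
    "set ds \<subseteq> Basis" "compact S"
  shows "weak_pd S ds f g \<longleftrightarrow> weak_pd S ds f' g"
proof -
  have "(LINT x|lborel_on S. f x * foldr pd ds \<eta> x) = (LINT x|lborel_on S. f' x * foldr pd ds \<eta> x)"
    if "test_function S \<eta>" for \<eta>
    using assms test_function_bddf[OF test_function_foldr_pd[OF that assms(4)] assms(5), THEN bddf_measurable]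
    by (intro integral_cong_AE) auto
  then show ?thesis by (simp add: weak_pd_def)
qed

lemma weak_pd_cong_right:
  assumes "AE x in lborel_on S. g x = g' x"
    "g \<in> borel_measurable (lborel_on S)" "g' \<in> borel_measurable (lborel_on S)" "compact S"
  shows "weak_pd S ds f g \<longleftrightarrow> weak_pd S ds f g'"
proof -
  have "(LINT x|lborel_on S. g x * \<eta> x) = (LINT x|lborel_on S. g' x * \<eta> x)"
    if "test_function S \<eta>" for \<eta>
    using assms test_function_bddf[OF that assms(4), THEN bddf_measurable]
    by (intro integral_cong_AE) auto
  then show ?thesis by (simp add: weak_pd_def)
qed

lemma weak_pd_Nil: "weak_pd S [] f f"
  by (simp add: weak_pd_def)

lemma wpd_spec:
  assumes "g \<in> sqint S" "weak_pd S ds f g"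
  shows "wpd S ds f \<in> sqint S" "weak_pd S ds f (wpd S ds f)"
  using someI[of "\<lambda>g. g \<in> sqint S \<and> weak_pd S ds f g" g] assms by (auto simp: wpd_def)

lemma wpd_eqI:
  assumes "g \<in> sqint (cbox A B)" "weak_pd (cbox A B) ds f g"
  shows "AE x in lborel_on (cbox A B). wpd (cbox A B) ds f x = g x"
  using wpd_spec[OF assms] assms by (intro weak_pd_unique[where f=f and ds=ds])

text \<open>
  The defining condition of the choice depends only on the class of the function, so even the chosen
  representatives are equal.
\<close>

lemma wpd_cong:
  assumes "AE x in lborel_on S. f x = f' x"
    "f \<in> borel_measurable (lborel_on S)" "f' \<in> borel_measurable (lborel_on S)"
    "set ds \<subseteq> Basis" "compact S"
  shows "wpd S ds f = wpd S ds f'"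
  unfolding wpd_def using weak_pd_cong_left[OF assms] by simp

lemma sobolev_sqint: "f \<in> sobolev S D \<Longrightarrow> f \<in> sqint S"
  by (simp add: sobolev_def)

lemma sobolev_wpd:
  assumes "f \<in> sobolev S D" "ds \<in> D"
  shows "wpd S ds f \<in> sqint S" "weak_pd S ds f (wpd S ds f)"
proof -
  from assms obtain g where "g \<in> sqint S" "weak_pd S ds f g" by (auto simp: sobolev_def)
  then show "wpd S ds f \<in> sqint S" "weak_pd S ds f (wpd S ds f)" by (rule wpd_spec)+
qed

lemma
  assumes "f \<in> sobolev S D" "g \<in> sobolev S D" "\<And>ds. ds \<in> D \<Longrightarrow> set ds \<subseteq> Basis" "compact S"
  shows sobolev_lin: "(\<lambda>x. f x + c * g x) \<in> sobolev S D"
    and sobolev_lin_weak_pd: "ds \<in> D \<Longrightarrow>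
      weak_pd S ds (\<lambda>x. f x + c * g x) (\<lambda>x. wpd S ds f x + c * wpd S ds g x)"
proof -
  have w: "weak_pd S ds (\<lambda>x. f x + c * g x) (\<lambda>x. wpd S ds f x + c * wpd S ds g x)" if "ds \<in> D" for ds
    using assms that by (intro weak_pd_lin sobolev_wpd[of _ _ D]) (auto intro: sobolev_sqint)
  then show "ds \<in> D \<Longrightarrow> weak_pd S ds (\<lambda>x. f x + c * g x) (\<lambda>x. wpd S ds f x + c * wpd S ds g x)" .
  show "(\<lambda>x. f x + c * g x) \<in> sobolev S D"
    unfolding sobolev_def
  proof (intro CollectI conjI ballI)
    show "(\<lambda>x. f x + c * g x) \<in> sqint S"
      using assms by (intro sqint_add sqint_cmult sobolev_sqint[of _ _ D])
    fix ds assume ds: "ds \<in> D"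
    have "(\<lambda>x. wpd S ds f x + c * wpd S ds g x) \<in> sqint S"
      using assms ds by (intro sqint_add sqint_cmult sobolev_wpd[of _ _ D])
    with w[OF ds] show "\<exists>h\<in>sqint S. weak_pd S ds (\<lambda>x. f x + c * g x) h" by blast
  qed
qed

section \<open>Rectangles as product spaces\<close>

lemma lborel_on_measurable: "f \<in> borel_measurable borel \<Longrightarrow> f \<in> borel_measurable (lborel_on S)"
  by (simp add: measurable_restrict_space1)

lemma ident_measurable_lborel_on: "(\<lambda>x. x) \<in> borel_measurable (lborel_on S)"
  by (simp add: measurable_restrict_space1)

text \<open>
  The form in which Fubini's theorem applies to \<open>[0,1] \<times> [a,b]\<close>: its measure is literally the product
  measure of the two intervals.
\<close>

lemma lborel_on_prod:
  fixes S :: "'a::euclidean_space set" and T :: "'b::euclidean_space set"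
  assumes "compact S" "compact T"
  shows "lborel_on (S \<times> T) = lborel_on S \<Otimes>\<^sub>M lborel_on T"
proof (rule pair_measure_eqI[symmetric])
  have S: "S \<in> sets borel" "T \<in> sets borel" "S \<times> T \<in> sets borel"
    using assms by (auto intro: borel_compact compact_Times)
  show "sigma_finite_measure (lborel_on S)" "sigma_finite_measure (lborel_on T)"
    using assms by (auto intro!: finite_measure.axioms(1) finite_measure_lborel_on)
  have prod_borel: "A \<times> B \<in> sets borel" if "A \<in> sets (borel :: 'a measure)" "B \<in> sets (borel :: 'b measure)" for A B
    using that unfolding borel_prod[symmetric] by (rule pair_measureI)
  show "sets (lborel_on S \<Otimes>\<^sub>M lborel_on T) = sets (lborel_on (S \<times> T))"
  proof
    show "sets (lborel_on S \<Otimes>\<^sub>M lborel_on T) \<subseteq> sets (lborel_on (S \<times> T))"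
    proof (rule sets_pair_in_sets)
      fix A B assume "A \<in> sets (lborel_on S)" "B \<in> sets (lborel_on T)"
      then have "A \<in> sets borel" "B \<in> sets borel" "A \<subseteq> S" "B \<subseteq> T"
        using S by (auto simp: sets_restrict_space_iff)
      then show "A \<times> B \<in> sets (lborel_on (S \<times> T))"
        using S prod_borel by (auto simp: sets_restrict_space_iff)
    qed
    show "sets (lborel_on (S \<times> T)) \<subseteq> sets (lborel_on S \<Otimes>\<^sub>M lborel_on T)"
    proof
      fix A assume "A \<in> sets (lborel_on (S \<times> T))"
      then have A: "A \<in> sets borel" "A \<subseteq> S \<times> T"
        using S by (auto simp: sets_restrict_space_iff)
      have "(\<lambda>p. (fst p, snd p)) \<in> lborel_on S \<Otimes>\<^sub>M lborel_on T \<rightarrow>\<^sub>M borel"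
        unfolding borel_prod[symmetric]
        by (intro measurable_Pair measurable_compose[OF measurable_fst ident_measurable_lborel_on]
            measurable_compose[OF measurable_snd ident_measurable_lborel_on])
      from measurable_sets[OF this A(1)] A(2)
      show "A \<in> sets (lborel_on S \<Otimes>\<^sub>M lborel_on T)"
        by (simp add: space_pair_measure vimage_def Int_absorb2)
    qed
  qed
  fix A B assume "A \<in> sets (lborel_on S)" "B \<in> sets (lborel_on T)"
  then have AB: "A \<in> sets borel" "B \<in> sets borel" "A \<subseteq> S" "B \<subseteq> T"
    using S by (auto simp: sets_restrict_space_iff)
  have "emeasure lborel (A \<times> B) = emeasure lborel A * emeasure lborel B"
    unfolding lborel_prod[symmetric] using AB by (intro lborel.emeasure_pair_measure_Times) auto
  moreover have "A \<times> B \<subseteq> S \<times> T" using AB by auto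
  ultimately show "emeasure (lborel_on S) A * emeasure (lborel_on T) B = emeasure (lborel_on (S \<times> T)) (A \<times> B)"
    using AB S prod_borel by (simp add: emeasure_restrict_space)
qed

lemma pair_sigma_finite_lborel_on:
  "compact S \<Longrightarrow> compact T \<Longrightarrow> pair_sigma_finite (lborel_on S) (lborel_on T)"
  by (simp add: pair_sigma_finite_def finite_measure_lborel_on finite_measure.axioms(1))

lemma sigma_finite_lborel_on: "compact S \<Longrightarrow> sigma_finite_measure (lborel_on S)"
  by (simp add: finite_measure_lborel_on finite_measure.axioms(1))

context
  fixes S :: "'a::euclidean_space set" and T :: "'b::euclidean_space set"
  assumes S: "compact S" and T: "compact T"
begin

lemma rect_swap:
  fixes f :: "'a \<times> 'b \<Rightarrow> 'c::topological_space"
  assumes "f \<in> borel_measurable (lborel_on (S \<times> T))"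
  shows "(\<lambda>(x, y). f (y, x)) \<in> borel_measurable (lborel_on (T \<times> S))"
  using assms unfolding lborel_on_prod[OF S T] lborel_on_prod[OF T S]
  by (rule measurable_pair_swap)

lemma rect_section1:
  assumes "f \<in> borel_measurable (lborel_on (S \<times> T))" "s \<in> S"
  shows "(\<lambda>x. f (s, x)) \<in> borel_measurable (lborel_on T)"
  using measurable_compose[OF measurable_Pair1' assms(1)[unfolded lborel_on_prod[OF S T]], of s] assms(2) by simp

lemma rect_section2:
  assumes "f \<in> borel_measurable (lborel_on (S \<times> T))" "x \<in> T"
  shows "(\<lambda>s. f (s, x)) \<in> borel_measurable (lborel_on S)"
  using measurable_compose[OF measurable_Pair2' assms(1)[unfolded lborel_on_prod[OF S T]], of x] assms(2) by simp

lemma rect_measurable_fst: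
  assumes "f \<in> borel_measurable (lborel_on S)"
  shows "(\<lambda>p. f (fst p)) \<in> borel_measurable (lborel_on (S \<times> T))"
  using measurable_compose[OF measurable_fst assms] by (simp add: lborel_on_prod S T)

lemma rect_measurable_snd:
  assumes "f \<in> borel_measurable (lborel_on T)"
  shows "(\<lambda>p. f (snd p)) \<in> borel_measurable (lborel_on (S \<times> T))"
  using measurable_compose[OF measurable_snd assms] by (simp add: lborel_on_prod S T)

lemma rect_integral_measurable1:
  fixes f :: "'a \<times> 'b \<Rightarrow> real"
  assumes "f \<in> borel_measurable (lborel_on (S \<times> T))"
  shows "(\<lambda>s. LINT x|lborel_on T. f (s, x)) \<in> borel_measurable (lborel_on S)"
  using assms unfolding lborel_on_prod[OF S T]
  by (intro sigma_finite_measure.borel_measurable_lebesgue_integral[OF sigma_finite_lborel_on[OF T]]) simp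

lemma
  fixes f :: "'a \<times> 'b \<Rightarrow> real"
  assumes f: "integrable (lborel_on (S \<times> T)) f"
  shows rect_AE_integrable1: "AE s in lborel_on S. integrable (lborel_on T) (\<lambda>x. f (s, x))"
    and rect_integrable1: "integrable (lborel_on S) (\<lambda>s. LINT x|lborel_on T. f (s, x))"
    and rect_integral1: "(LINT s|lborel_on S. LINT x|lborel_on T. f (s, x)) = (LINT p|lborel_on (S \<times> T). f p)"
    and rect_AE_integrable2: "AE x in lborel_on T. integrable (lborel_on S) (\<lambda>s. f (s, x))"
    and rect_integrable2: "integrable (lborel_on T) (\<lambda>x. LINT s|lborel_on S. f (s, x))"
    and rect_integral2: "(LINT x|lborel_on T. LINT s|lborel_on S. f (s, x)) = (LINT p|lborel_on (S \<times> T). f p)"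
proof -
  interpret pair_sigma_finite "lborel_on S" "lborel_on T"
    by (rule pair_sigma_finite_lborel_on[OF S T])
  have f': "integrable (lborel_on S \<Otimes>\<^sub>M lborel_on T) f" using f by (simp add: lborel_on_prod S T)
  have f'': "integrable (lborel_on S \<Otimes>\<^sub>M lborel_on T) (case_prod (\<lambda>s x. f (s, x)))" using f' by simp
  show "AE s in lborel_on S. integrable (lborel_on T) (\<lambda>x. f (s, x))"
    "integrable (lborel_on S) (\<lambda>s. LINT x|lborel_on T. f (s, x))"
    "(LINT s|lborel_on S. LINT x|lborel_on T. f (s, x)) = (LINT p|lborel_on (S \<times> T). f p)"
    using AE_integrable_fst'[OF f'] integrable_fst'[OF f'] integral_fst'[OF f'] by (simp_all add: lborel_on_prod S T)
  show "AE x in lborel_on T. integrable (lborel_on S) (\<lambda>s. f (s, x))"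
    "integrable (lborel_on T) (\<lambda>x. LINT s|lborel_on S. f (s, x))"
    "(LINT x|lborel_on T. LINT s|lborel_on S. f (s, x)) = (LINT p|lborel_on (S \<times> T). f p)"
    using AE_integrable_snd[OF f''] integrable_snd[OF f''] integral_snd[OF f''] by (simp_all add: lborel_on_prod S T)
qed

lemma
  assumes "AE p in lborel_on (S \<times> T). P p"
  shows rect_AE1: "AE s in lborel_on S. AE x in lborel_on T. P (s, x)"
    and rect_AE2: "AE x in lborel_on T. AE s in lborel_on S. P (s, x)"
proof -
  interpret pair_sigma_finite "lborel_on S" "lborel_on T"
    by (rule pair_sigma_finite_lborel_on[OF S T])
  interpret Q: pair_sigma_finite "lborel_on T" "lborel_on S"
    by (rule pair_sigma_finite_lborel_on[OF T S])
  have P: "AE p in lborel_on S \<Otimes>\<^sub>M lborel_on T. P p" using assms unfolding lborel_on_prod[OF S T] .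
  then show "AE s in lborel_on S. AE x in lborel_on T. P (s, x)" by (rule AE_pair)
  have "AE p in lborel_on T \<Otimes>\<^sub>M lborel_on S. P (snd p, fst p)"
  proof -
    have "AE p in distr (lborel_on T \<Otimes>\<^sub>M lborel_on S) (lborel_on S \<Otimes>\<^sub>M lborel_on T) (\<lambda>(x, y). (y, x)). P p"
      unfolding distr_pair_swap[symmetric] by (rule P)
    from AE_distrD[OF measurable_pair_swap' this] show ?thesis by (simp add: case_prod_beta)
  qed
  from Q.AE_pair[OF this] show "AE x in lborel_on T. AE s in lborel_on S. P (s, x)" by simp
qed

lemma rect_AE_eqI:
  fixes f g :: "'a \<times> 'b \<Rightarrow> real"
  assumes [measurable]: "f \<in> borel_measurable (lborel_on (S \<times> T))" "g \<in> borel_measurable (lborel_on (S \<times> T))"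
    and ae: "AE s in lborel_on S. AE x in lborel_on T. f (s, x) = g (s, x)"
  shows "AE p in lborel_on (S \<times> T). f p = g p"
proof -
  interpret pair_sigma_finite "lborel_on S" "lborel_on T"
    by (rule pair_sigma_finite_lborel_on[OF S T])
  have [measurable]: "f \<in> borel_measurable (lborel_on S \<Otimes>\<^sub>M lborel_on T)"
    "g \<in> borel_measurable (lborel_on S \<Otimes>\<^sub>M lborel_on T)"
    using assms(1,2) by (simp_all add: lborel_on_prod S T)
  have "{p \<in> space (lborel_on S \<Otimes>\<^sub>M lborel_on T). f p = g p} \<in> sets (lborel_on S \<Otimes>\<^sub>M lborel_on T)"
    by measurable
  from AE_pair_measure[OF this ae] show ?thesis unfolding lborel_on_prod[OF S T] .
qed

lemma
  assumes f: "f \<in> sqint (S \<times> T)"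
  shows rect_AE_sqint1: "AE s in lborel_on S. (\<lambda>x. f (s, x)) \<in> sqint T"
    and rect_AE_sqint2: "AE x in lborel_on T. (\<lambda>s. f (s, x)) \<in> sqint S"
    and rect_normsq1: "(LINT s|lborel_on S. normsq T (\<lambda>x. f (s, x))) = normsq (S \<times> T) f"
    and rect_normsq2: "(LINT x|lborel_on T. normsq S (\<lambda>s. f (s, x))) = normsq (S \<times> T) f"
    and rect_normsq_integrable1: "integrable (lborel_on S) (\<lambda>s. normsq T (\<lambda>x. f (s, x)))"
    and rect_normsq_integrable2: "integrable (lborel_on T) (\<lambda>x. normsq S (\<lambda>s. f (s, x)))"
proof -
  note i = sqint_integrable_sq[OF f] and m = sqint_measurable[OF f]
  have "AE s in lborel_on S. s \<in> S" "AE x in lborel_on T. x \<in> T"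
    by (auto intro: AE_I2)
  then show "AE s in lborel_on S. (\<lambda>x. f (s, x)) \<in> sqint T" "AE x in lborel_on T. (\<lambda>s. f (s, x)) \<in> sqint S"
    using rect_AE_integrable1[OF i] rect_AE_integrable2[OF i]
    by (auto simp: sqint_def rect_section1[OF m] rect_section2[OF m])
  show "(LINT s|lborel_on S. normsq T (\<lambda>x. f (s, x))) = normsq (S \<times> T) f"
    "(LINT x|lborel_on T. normsq S (\<lambda>s. f (s, x))) = normsq (S \<times> T) f"
    "integrable (lborel_on S) (\<lambda>s. normsq T (\<lambda>x. f (s, x)))"
    "integrable (lborel_on T) (\<lambda>x. normsq S (\<lambda>s. f (s, x)))"
    using rect_integral1[OF i] rect_integral2[OF i] rect_integrable1[OF i] rect_integrable2[OF i]
    by (simp_all add: normsq_def)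
qed

lemma rect_integrable_fst:
  fixes g :: "'a \<Rightarrow> real"
  assumes g: "integrable (lborel_on S) g"
  shows "integrable (lborel_on (S \<times> T)) (\<lambda>p. g (fst p))"
proof -
  interpret pair_sigma_finite "lborel_on S" "lborel_on T"
    by (rule pair_sigma_finite_lborel_on[OF S T])
  show ?thesis
    unfolding lborel_on_prod[OF S T]
  proof (rule Fubini_integrable)
    show "(\<lambda>p. g (fst p)) \<in> borel_measurable (lborel_on S \<Otimes>\<^sub>M lborel_on T)"
      by (rule measurable_compose[OF measurable_fst borel_measurable_integrable[OF g]])
    have "integrable (lborel_on S) (\<lambda>x. measure (lborel_on T) T * norm (g x))"
      by (intro integrable_mult_right integrable_norm g)
    then show "integrable (lborel_on S) (\<lambda>x. LINT y|lborel_on T. norm (g (fst (x, y))))"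
      by (simp only: fst_conv lebesgue_integral_const space_lborel_on real_scaleR_def)
    show "AE x in lborel_on S. integrable (lborel_on T) (\<lambda>y. g (fst (x, y)))"
      by (simp add: bddf_integrable[OF bddf_const T])
  qed
qed

lemma rect_integrable_snd:
  fixes g :: "'b \<Rightarrow> real"
  assumes g: "integrable (lborel_on T) g"
  shows "integrable (lborel_on (S \<times> T)) (\<lambda>p. g (snd p))"
proof -
  interpret pair_sigma_finite "lborel_on S" "lborel_on T"
    by (rule pair_sigma_finite_lborel_on[OF S T])
  show ?thesis
    unfolding lborel_on_prod[OF S T]
  proof (rule Fubini_integrable)
    show "(\<lambda>p. g (snd p)) \<in> borel_measurable (lborel_on S \<Otimes>\<^sub>M lborel_on T)"
      by (rule measurable_compose[OF measurable_snd borel_measurable_integrable[OF g]])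
    show "integrable (lborel_on S) (\<lambda>x. LINT y|lborel_on T. norm (g (snd (x, y))))"
      by (simp add: bddf_integrable[OF bddf_const S])
    show "AE x in lborel_on S. integrable (lborel_on T) (\<lambda>y. g (snd (x, y)))"
      using g by simp
  qed
qed

lemma rect_AE_fst:
  assumes "AE s in lborel_on S. P s"
  shows "AE p in lborel_on (S \<times> T). P (fst p)"
proof -
  obtain N where N: "{s \<in> S. \<not> P s} \<subseteq> N" "N \<in> sets (lborel_on S)" "emeasure (lborel_on S) N = 0"
    using assms by (auto elim!: AE_E)
  have "emeasure (lborel_on S \<Otimes>\<^sub>M lborel_on T) (N \<times> T) = 0"
    using sigma_finite_measure.emeasure_pair_measure_Times[OF sigma_finite_lborel_on[OF T] N(2), of T] N(3)
      sets.top[of "lborel_on T"] by simp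
  moreover have "N \<times> T \<in> sets (lborel_on S \<Otimes>\<^sub>M lborel_on T)"
    using N(2) sets.top[of "lborel_on T"] by (intro pair_measureI) simp_all
  ultimately have "N \<times> T \<in> null_sets (lborel_on (S \<times> T))"
    by (auto simp: null_sets_def lborel_on_prod S T)
  from AE_not_in[OF this] show ?thesis
    by (rule AE_mp) (use N(1) in \<open>auto intro!: AE_I2\<close>)
qed

lemma rect_bddf_section1: "f \<in> bddf (S \<times> T) \<Longrightarrow> s \<in> S \<Longrightarrow> (\<lambda>x. f (s, x)) \<in> bddf T"
  unfolding bddf_def using rect_section1 by blast

lemma rect_bddf_section2: "f \<in> bddf (S \<times> T) \<Longrightarrow> x \<in> T \<Longrightarrow> (\<lambda>s. f (s, x)) \<in> bddf S"
  unfolding bddf_def using rect_section2 by blast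

lemma rect_bddf_fst: "f \<in> bddf S \<Longrightarrow> (\<lambda>p. f (fst p)) \<in> bddf (S \<times> T)"
  unfolding bddf_def using rect_measurable_fst by auto

lemma rect_bddf_snd: "f \<in> bddf T \<Longrightarrow> (\<lambda>p. f (snd p)) \<in> bddf (S \<times> T)"
  unfolding bddf_def using rect_measurable_snd by auto

end

section \<open>Integral operators with bounded kernels\<close>

lemma sqint_bound_AE:
  assumes "g \<in> borel_measurable (lborel_on S)" "integrable (lborel_on S) h"
    "AE x in lborel_on S. (g x)\<^sup>2 \<le> h x"
  shows "g \<in> sqint S" "normsq S g \<le> (LINT x|lborel_on S. h x)"
proof -
  have i: "integrable (lborel_on S) (\<lambda>x. (g x)\<^sup>2)"
    by (rule Bochner_Integration.integrable_bound[OF assms(2)]) (use assms in auto)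
  with assms(1) show "g \<in> sqint S" by (simp add: sqint_def)
  show "normsq S g \<le> (LINT x|lborel_on S. h x)"
    unfolding normsq_def using i assms by (intro integral_mono_AE) auto
qed

definition kop :: "'b::euclidean_space set \<Rightarrow> ('a \<times> 'b \<Rightarrow> real) \<Rightarrow> ('b \<Rightarrow> real) \<Rightarrow> 'a \<Rightarrow> real"
  where "kop T K f x = (LINT y|lborel_on T. K (x, y) * f y)"

lemma kernel_times_integrable:
  "compact S \<Longrightarrow> compact T \<Longrightarrow> K \<in> bddf (S \<times> T) \<Longrightarrow> x \<in> S \<Longrightarrow> integrable (lborel_on T) f \<Longrightarrow>
    integrable (lborel_on T) (\<lambda>y. K (x, y) * f y)"
  by (intro bddf_mult_integrable rect_bddf_section1)

lemma kop_bddf: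
  assumes S: "compact S" and T: "compact T" and K: "K \<in> bddf (S \<times> T)" and f: "integrable (lborel_on T) f"
  shows "kop T K f \<in> bddf S"
proof -
  obtain C where C: "\<And>p. p \<in> S \<times> T \<Longrightarrow> \<bar>K p\<bar> \<le> C" using K by (auto elim!: bddfE)
  have "(\<lambda>p. K p * f (snd p)) \<in> borel_measurable (lborel_on (S \<times> T))"
    using rect_measurable_snd[OF S T, of f] f bddf_measurable[OF K] by (intro borel_measurable_times) auto
  from rect_integral_measurable1[OF S T this]
  have m: "kop T K f \<in> borel_measurable (lborel_on S)" by (simp add: kop_def[abs_def])
  have "\<bar>kop T K f x\<bar> \<le> (LINT y|lborel_on T. C * \<bar>f y\<bar>)" if x: "x \<in> S" for x
    unfolding kop_def using f kernel_times_integrable[OF S T K x f] C x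
    by (intro integral_abs_bound[THEN order_trans] integral_mono integrable_abs) (auto simp: abs_mult intro!: mult_right_mono)
  with m show ?thesis by (auto simp: bddf_def)
qed

text \<open>Pointwise in \<open>x\<close>, by the Cauchy-Schwarz inequality; this is the reason for kernels that are bounded everywhere.\<close>

lemma kop_sq_le:
  assumes "compact S" "compact T" "K \<in> bddf (S \<times> T)"
  shows "\<exists>C\<ge>0. \<forall>f\<in>sqint T. \<forall>x\<in>S. (kop T K f x)\<^sup>2 \<le> C * normsq T f"
proof -
  obtain D where D: "0 \<le> D" "\<And>p. p \<in> S \<times> T \<Longrightarrow> \<bar>K p\<bar> \<le> D" using assms(3) by (auto elim!: bddfE)
  \<comment> \<open>The squared bound of the kernel times the measure of \<open>T\<close>.\<close>
  let ?C = "D\<^sup>2 * normsq T (\<lambda>x. 1)"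
  show ?thesis
  proof (intro exI[of _ ?C] conjI ballI)
    show "0 \<le> ?C" by (simp add: normsq_nonneg)
    fix f x assume f: "f \<in> sqint T" and x: "x \<in> S"
    have b: "(\<lambda>y. K (x, y)) \<in> bddf T" using assms x by (intro rect_bddf_section1)
    have "(kop T K f x)\<^sup>2 \<le> normsq T (\<lambda>y. K (x, y)) * normsq T f"
      unfolding kop_def by (intro L2_Cauchy_Schwarz bddf_sqint b f assms)
    also have "normsq T (\<lambda>y. K (x, y)) \<le> ?C"
      using normsq_bddf_mult_le[OF b sqint_const[of T 1], of D] assms D x by simp
    finally show "(kop T K f x)\<^sup>2 \<le> ?C * normsq T f"
      by (simp add: mult_right_mono normsq_nonneg)
  qed
qed

lemma kop_L2_bounded:
  assumes S: "compact S" and T: "compact T" and K: "K \<in> bddf (S \<times> T)"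
  shows "\<exists>C. \<forall>f\<in>sqint T. normsq S (kop T K f) \<le> C * normsq T f"
proof -
  obtain C where "0 \<le> C" and C: "\<And>f x. f \<in> sqint T \<Longrightarrow> x \<in> S \<Longrightarrow> (kop T K f x)\<^sup>2 \<le> C * normsq T f"
    using kop_sq_le[OF assms] by auto
  have "normsq S (kop T K f) \<le> (measure (lborel_on S) S * C) * normsq T f" if f: "f \<in> sqint T" for f
    using sqint_bound(2)[of "kop T K f" S "\<lambda>x. C * normsq T f"] C[OF f]
      kop_bddf[OF S T K sqint_integrable[OF f T], THEN bddf_measurable] bddf_integrable[OF bddf_const S]
    by simp
  then show ?thesis by blast
qed

text \<open>
  The tensor product of the identity with the integral operator: the form in which the operator acts on
  histories.
\<close>

definition klift :: "'b::euclidean_space set \<Rightarrow> ('a \<times> 'b \<Rightarrow> real) \<Rightarrow> ('r \<times> 'b \<Rightarrow> real) \<Rightarrow> 'r \<times> 'a \<Rightarrow> real"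
  where "klift T K f = (\<lambda>(r, x). kop T K (\<lambda>y. f (r, y)) x)"

lemma klift_measurable:
  fixes f :: "'r::euclidean_space \<times> 'b::euclidean_space \<Rightarrow> real" and K :: "'a::euclidean_space \<times> 'b \<Rightarrow> real"
  assumes R: "compact R" and S: "compact S" and T: "compact T" and K: "K \<in> borel_measurable (lborel_on (S \<times> T))"
    and f: "f \<in> borel_measurable (lborel_on (R \<times> T))"
  shows "klift T K f \<in> borel_measurable (lborel_on (R \<times> S))"
proof -
  have [measurable]: "K \<in> borel_measurable (lborel_on S \<Otimes>\<^sub>M lborel_on T)"
    "f \<in> borel_measurable (lborel_on R \<Otimes>\<^sub>M lborel_on T)"
    using K f unfolding lborel_on_prod[OF S T] lborel_on_prod[OF R T] by auto
  have "(\<lambda>p. LINT y|lborel_on T. K (snd p, y) * f (fst p, y)) \<in> borel_measurable (lborel_on R \<Otimes>\<^sub>M lborel_on S)"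
    by (intro sigma_finite_measure.borel_measurable_lebesgue_integral[OF sigma_finite_lborel_on[OF T]]) measurable
  then show ?thesis
    unfolding lborel_on_prod[OF R S] klift_def kop_def[abs_def] by (simp add: case_prod_beta)
qed

lemma klift_L2:
  fixes K :: "'a::euclidean_space \<times> 'b::euclidean_space \<Rightarrow> real"
  assumes R: "compact (R :: 'r::euclidean_space set)" and S: "compact S" and T: "compact T"
    and K: "K \<in> bddf (S \<times> T)"
  shows "\<exists>C. \<forall>f\<in>sqint (R \<times> T). klift T K f \<in> sqint (R \<times> S) \<and> normsq (R \<times> S) (klift T K f) \<le> C * normsq (R \<times> T) f"
proof -
  obtain C where "0 \<le> C" and C: "\<And>f x. f \<in> sqint T \<Longrightarrow> x \<in> S \<Longrightarrow> (kop T K f x)\<^sup>2 \<le> C * normsq T f"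
    using kop_sq_le[OF S T K] by auto
  have "klift T K f \<in> sqint (R \<times> S) \<and>
      normsq (R \<times> S) (klift T K f) \<le> (measure (lborel_on S) S * C) * normsq (R \<times> T) f" if f: "f \<in> sqint (R \<times> T)" for f
  proof -
    let ?h = "\<lambda>p. C * normsq T (\<lambda>y. f (fst p, y))"
    have m: "klift T K f \<in> borel_measurable (lborel_on (R \<times> S))"
      using bddf_measurable[OF K] sqint_measurable[OF f] by (intro klift_measurable R S T)
    have hi: "integrable (lborel_on R) (\<lambda>r. C * normsq T (\<lambda>y. f (r, y)))"
      using rect_normsq_integrable1[OF R T f] by simp
    have h: "integrable (lborel_on (R \<times> S)) ?h"
      by (rule rect_integrable_fst[OF R S hi])
    have ae0: "AE p in lborel_on (R \<times> S). (\<lambda>y. f (fst p, y)) \<in> sqint T"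
      by (rule rect_AE_fst[OF R S rect_AE_sqint1[OF R T f]])
    have ae: "AE p in lborel_on (R \<times> S). (klift T K f p)\<^sup>2 \<le> ?h p"
    proof -
      have "AE p in lborel_on (R \<times> S). p \<in> R \<times> S" by (intro AE_I2) simp
      with ae0 show ?thesis by eventually_elim (auto simp: klift_def C)
    qed
    have eq: "(LINT p|lborel_on (R \<times> S). ?h p) = (measure (lborel_on S) S * C) * normsq (R \<times> T) f"
      using rect_integral1[OF R S h, symmetric] rect_normsq1[OF R T f] by (simp add: mult_ac)
    show ?thesis
      using sqint_bound_AE[OF m h ae] unfolding eq by blast
  qed
  then show ?thesis by blast
qed

text \<open>Fubini's theorem for \<open>\<rho>(x, y) K(y, w) f(w)\<close>; the product of two bounded kernels is a bounded kernel.\<close>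

lemma kernel_compose:
  fixes \<rho> :: "'c::euclidean_space \<times> 'a::euclidean_space \<Rightarrow> real" and K :: "'a \<times> 'b::euclidean_space \<Rightarrow> real"
  assumes R: "compact R" and S: "compact S" and T: "compact T"
    and \<rho>: "\<rho> \<in> bddf (R \<times> S)" and K: "K \<in> bddf (S \<times> T)"
  defines "L \<equiv> \<lambda>(x, w). LINT y|lborel_on S. \<rho> (x, y) * K (y, w)"
  shows "L \<in> bddf (R \<times> T)"
    and "\<And>f x. integrable (lborel_on T) f \<Longrightarrow> x \<in> R \<Longrightarrow> kop S \<rho> (kop T K f) x = kop T L f x"
proof -
  obtain C where C: "0 \<le> C" "\<And>p. p \<in> R \<times> S \<Longrightarrow> \<bar>\<rho> p\<bar> \<le> C" using \<rho> by (auto elim!: bddfE)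
  obtain D where D: "0 \<le> D" "\<And>p. p \<in> S \<times> T \<Longrightarrow> \<bar>K p\<bar> \<le> D" using K by (auto elim!: bddfE)
  have [measurable]: "K \<in> borel_measurable (lborel_on S \<Otimes>\<^sub>M lborel_on T)"
    "\<rho> \<in> borel_measurable (lborel_on R \<Otimes>\<^sub>M lborel_on S)"
    using \<rho>[THEN bddf_measurable] K[THEN bddf_measurable]
    unfolding lborel_on_prod[OF S T] lborel_on_prod[OF R S] by auto
  have "(\<lambda>p. LINT y|lborel_on S. \<rho> (fst p, y) * K (y, snd p)) \<in> borel_measurable (lborel_on R \<Otimes>\<^sub>M lborel_on T)"
    by (intro sigma_finite_measure.borel_measurable_lebesgue_integral[OF sigma_finite_lborel_on[OF S]]) measurable
  then have m: "L \<in> borel_measurable (lborel_on (R \<times> T))"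
    unfolding lborel_on_prod[OF R T] L_def by (simp add: case_prod_beta)
  have "\<bar>L p\<bar> \<le> (LINT y|lborel_on S. C * D)" if "p \<in> R \<times> T" for p
  proof -
    have "integrable (lborel_on S) (\<lambda>y. \<rho> (fst p, y) * K (y, snd p))"
      using that by (intro bddf_integrable bddf_mult rect_bddf_section1[OF R S \<rho>] rect_bddf_section2[OF S T K] S) auto
    then show ?thesis
      unfolding L_def case_prod_beta using that C D
      by (intro integral_abs_bound[THEN order_trans] integral_mono integrable_abs bddf_integrable[OF bddf_const S])
        (auto simp: abs_mult intro!: mult_mono)
  qed
  with m show "L \<in> bddf (R \<times> T)" by (auto simp: bddf_def)
  fix f :: "'b \<Rightarrow> real" and x assume f: "integrable (lborel_on T) f" and x: "x \<in> R"
  have fi: "integrable (lborel_on (S \<times> T)) (\<lambda>p. f (snd p))"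
    by (rule rect_integrable_snd[OF S T f])
  have b: "(\<lambda>p. \<rho> (x, fst p) * K p) \<in> bddf (S \<times> T)"
    using rect_bddf_fst[OF S T rect_bddf_section1[OF R S \<rho> x]] K by (intro bddf_mult) auto
  have i: "integrable (lborel_on (S \<times> T)) (\<lambda>p. (\<rho> (x, fst p) * K p) * f (snd p))"
    by (rule bddf_mult_integrable[OF b fi])
  have "kop S \<rho> (kop T K f) x = (LINT y|lborel_on S. LINT w|lborel_on T. (\<rho> (x, y) * K (y, w)) * f w)"
    unfolding kop_def by (simp add: mult.assoc)
  also have "\<dots> = (LINT w|lborel_on T. LINT y|lborel_on S. (\<rho> (x, y) * K (y, w)) * f w)"
    using rect_integral1[OF S T i] rect_integral2[OF S T i] by simp
  also have "\<dots> = kop T L f x"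
    by (simp add: kop_def L_def)
  finally show "kop S \<rho> (kop T K f) x = kop T L f x" .
qed

text \<open>
  Fubini's theorem for \<open>w(r) K(x, y) f(r, y)\<close>. It holds at every \<open>x\<close>, since the kernel is bounded
  everywhere.
\<close>

lemma integral_klift:
  fixes K :: "'a::euclidean_space \<times> 'b::euclidean_space \<Rightarrow> real"
  assumes R: "compact R" and S: "compact S" and T: "compact T"
    and K: "K \<in> bddf (S \<times> T)" and w: "w \<in> bddf R" and f: "integrable (lborel_on (R \<times> T)) f" and x: "x \<in> S"
  shows "(LINT r|lborel_on R. w r * klift T K f (r, x)) = kop T K (\<lambda>y. LINT r|lborel_on R. w r * f (r, y)) x"
    and "integrable (lborel_on R) (\<lambda>r. w r * klift T K f (r, x))"
proof -
  have b: "(\<lambda>p. w (fst p) * K (x, snd p)) \<in> bddf (R \<times> T)"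
    by (intro bddf_mult rect_bddf_fst[OF R T w] rect_bddf_snd[OF R T rect_bddf_section1[OF S T K x]])
  have i: "integrable (lborel_on (R \<times> T)) (\<lambda>p. (w (fst p) * K (x, snd p)) * f p)"
    by (rule bddf_mult_integrable[OF b f])
  have "(LINT r|lborel_on R. w r * klift T K f (r, x)) = (LINT r|lborel_on R. LINT y|lborel_on T. (w r * K (x, y)) * f (r, y))"
    unfolding klift_def kop_def by (simp add: mult.assoc)
  also have "\<dots> = (LINT y|lborel_on T. LINT r|lborel_on R. (w r * K (x, y)) * f (r, y))"
    using rect_integral1[OF R T i] rect_integral2[OF R T i] by simp
  also have "\<dots> = kop T K (\<lambda>y. LINT r|lborel_on R. w r * f (r, y)) x"
    unfolding kop_def by (simp add: integral_mult_right_zero[symmetric] mult_ac del: integral_mult_right_zero)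
  finally show "(LINT r|lborel_on R. w r * klift T K f (r, x)) = kop T K (\<lambda>y. LINT r|lborel_on R. w r * f (r, y)) x" .
  show "integrable (lborel_on R) (\<lambda>r. w r * klift T K f (r, x))"
    using rect_integrable1[OF R T i] unfolding klift_def kop_def by (simp add: mult.assoc)
qed

section \<open>Weak derivatives on an interval\<close>

lemma interval_cbox: "{a..b} = cbox a (b::real)"
  by (simp add: box_real)

lemma wpd_interval_eqI:
  "g \<in> sqint {a..b::real} \<Longrightarrow> weak_pd {a..b} ds f g \<Longrightarrow> AE x in lborel_on {a..b}. wpd {a..b} ds f x = g x"
  unfolding interval_cbox by (rule wpd_eqI)

text \<open>
  Test the derivative of order \<open>ds1 @ ds2\<close> against \<open>\<eta>\<close>, and the one of order \<open>ds1\<close> against the derivative of \<open>\<eta>\<close> of order \<open>ds2\<close>: the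
  left sides are the same.
\<close>

lemma weak_pd_append_cancel:
  assumes "weak_pd S (ds1 @ ds2) f g" "weak_pd S ds1 f h" "set ds2 \<subseteq> Basis"
  shows "weak_pd S ds2 h g"
  unfolding weak_pd_def
proof (intro allI impI)
  fix \<eta> :: "'a \<Rightarrow> real" assume \<eta>: "test_function S \<eta>"
  have "(LINT x|lborel_on S. f x * foldr pd ds1 (foldr pd ds2 \<eta>) x)
      = (-1) ^ length ds1 * (LINT x|lborel_on S. h x * foldr pd ds2 \<eta> x)"
    using assms(2) test_function_foldr_pd[OF \<eta> assms(3)] by (simp add: weak_pd_def)
  moreover have "(LINT x|lborel_on S. f x * foldr pd ds1 (foldr pd ds2 \<eta>) x)
      = (-1) ^ length ds1 * ((-1) ^ length ds2 * (LINT x|lborel_on S. g x * \<eta> x))"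
    using assms(1) \<eta> by (simp add: weak_pd_def power_add mult.assoc)
  ultimately show "(LINT x|lborel_on S. h x * foldr pd ds2 \<eta> x) = (-1) ^ length ds2 * (LINT x|lborel_on S. g x * \<eta> x)"
    by simp
qed

definition prim :: "real \<Rightarrow> (real \<Rightarrow> real) \<Rightarrow> real \<Rightarrow> real"
  where "prim a f x = (LINT y|lborel_on {a..x}. f y)"

text \<open>
  The kernel of the operator \<open>prim\<close>. Writing primitives as integral operators on the whole
  interval brings them under the results on bounded kernels.
\<close>

definition step_kernel :: "real \<times> real \<Rightarrow> real"
  where "step_kernel = (\<lambda>(x, y). if y \<le> x then 1 else 0)"

lemma step_kernel_bddf: "step_kernel \<in> bddf S"
proof -
  have "step_kernel = indicator {p. snd p \<le> fst p}"
    by (auto simp: step_kernel_def fun_eq_iff split: split_indicator)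
  moreover have "closed {p::real \<times> real. snd p \<le> fst p}"
    by (intro closed_Collect_le continuous_intros)
  ultimately have "step_kernel \<in> borel_measurable borel"
    by (metis borel_closed borel_measurable_indicator)
  then have "step_kernel \<in> borel_measurable (lborel_on S)"
    by (rule lborel_on_measurable)
  then show ?thesis
    by (auto simp: bddf_def step_kernel_def intro!: exI[of _ 1])
qed

lemma prim_kop:
  assumes "x \<in> {a..b}"
  shows "prim a f x = kop {a..b} step_kernel f x"
proof -
  have "(LINT y|lborel_on {a..x}. f y) = (LINT y|lborel. indicator {a..x} y *\<^sub>R f y)"
    by (subst integral_restrict_space) auto
  also have "\<dots> = (LINT y|lborel. indicator {a..b} y *\<^sub>R (step_kernel (x, y) * f y))"
    using assms by (intro Bochner_Integration.integral_cong) (auto simp: step_kernel_def split: split_indicator)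
  also have "\<dots> = (LINT y|lborel_on {a..b}. step_kernel (x, y) * f y)"
    by (subst integral_restrict_space) auto
  finally show ?thesis by (simp add: prim_def kop_def)
qed

lemma prim_bddf: "integrable (lborel_on {a..b}) f \<Longrightarrow> prim a f \<in> bddf {a..b}"
proof -
  assume f: "integrable (lborel_on {a..b}) f"
  have k: "kop {a..b} step_kernel f \<in> bddf {a..b}"
    by (rule kop_bddf[OF _ _ step_kernel_bddf f]) auto
  moreover have "prim a f \<in> borel_measurable (lborel_on {a..b}) \<longleftrightarrow> kop {a..b} step_kernel f \<in> borel_measurable (lborel_on {a..b})"
    by (rule measurable_cong) (simp add: prim_kop)
  moreover have "\<bar>prim a f x\<bar> = \<bar>kop {a..b} step_kernel f x\<bar>" if "x \<in> {a..b}" for x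
    by (simp only: prim_kop[OF that])
  ultimately show ?thesis unfolding bddf_def by auto
qed

lemma normsq_indicator_interval:
  assumes "a \<le> x" "x \<le> y" "y \<le> b"
  shows "(\<lambda>u. indicator {x<..y} u :: real) \<in> sqint {a..b}" "normsq {a..b} (\<lambda>u. indicator {x<..y} u) = y - x"
proof -
  have "(\<lambda>u. indicator {x<..y} u :: real) \<in> bddf {a..b}"
    by (auto simp: bddf_def intro!: exI[of _ 1] lborel_on_measurable split: split_indicator)
  then show "(\<lambda>u. indicator {x<..y} u :: real) \<in> sqint {a..b}" by (rule bddf_sqint) simp
  have "normsq {a..b} (\<lambda>u. indicator {x<..y} u) = (LINT u|lborel. indicator {x<..y} u)"
  proof -
    have "normsq {a..b} (\<lambda>u. indicator {x<..y} u) = (LINT u|lborel. indicator {a..b} u *\<^sub>R (indicator {x<..y} u)\<^sup>2)"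
      unfolding normsq_def by (subst integral_restrict_space) auto
    also have "\<dots> = (LINT u|lborel. indicator {x<..y} u)"
      using assms by (intro Bochner_Integration.integral_cong) (auto split: split_indicator)
    finally show ?thesis .
  qed
  then show "normsq {a..b} (\<lambda>u. indicator {x<..y} u) = y - x" using assms by simp
qed

lemma prim_diff:
  assumes f: "integrable (lborel_on {a..b}) f" and xy: "a \<le> x" "x \<le> y" "y \<le> b"
  shows "prim a f y - prim a f x = (LINT u|lborel_on {a..b}. indicator {x<..y} u * f u)"
proof -
  have "integrable (lborel_on {a..b}) (\<lambda>u. step_kernel (z, u) * f u)" if "z \<in> {a..b}" for z
    using that by (intro kernel_times_integrable[OF _ _ step_kernel_bddf, of "{a..b}" "{a..b}"] f) auto
  then have "prim a f y - prim a f x = (LINT u|lborel_on {a..b}. step_kernel (y, u) * f u - step_kernel (x, u) * f u)"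
    using xy by (simp add: prim_kop[of _ a b] kop_def)
  also have "\<dots> = (LINT u|lborel_on {a..b}. indicator {x<..y} u * f u)"
    using xy by (intro Bochner_Integration.integral_cong) (auto simp: step_kernel_def split: split_indicator)
  finally show ?thesis .
qed

text \<open>
  The increment is the integral of \<open>f\<close> against an indicator whose squared norm is the distance
  of the two points.
\<close>

lemma prim_holder:
  assumes f: "f \<in> sqint {a..b}" and "x \<in> {a..b}" "y \<in> {a..b}"
  shows "(prim a f y - prim a f x)\<^sup>2 \<le> \<bar>y - x\<bar> * normsq {a..b} f"
proof -
  have fi: "integrable (lborel_on {a..b}) f" using f by (simp add: sqint_integrable)
  have *: "(prim a f y - prim a f x)\<^sup>2 \<le> (y - x) * normsq {a..b} f" if "a \<le> x" "x \<le> y" "y \<le> b" for x y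
    using L2_Cauchy_Schwarz[OF normsq_indicator_interval(1)[OF that] f] that
    by (simp add: prim_diff[OF fi that] normsq_indicator_interval)
  show ?thesis
    using *[of x y] *[of y x] assms by (cases "x \<le> y") (auto simp: power2_commute)
qed

lemma continuous_on_square_dist:
  fixes g :: "real \<Rightarrow> real"
  assumes "\<And>x y. x \<in> S \<Longrightarrow> y \<in> S \<Longrightarrow> (g y - g x)\<^sup>2 \<le> C * \<bar>y - x\<bar>"
  shows "continuous_on S g"
  unfolding continuous_on_def
proof
  fix x assume x: "x \<in> S"
  have "((\<lambda>y. C * \<bar>y - x\<bar>) \<longlongrightarrow> C * \<bar>x - x\<bar>) (at x within S)" by (intro tendsto_intros)
  then have lim: "((\<lambda>y. C * \<bar>y - x\<bar>) \<longlongrightarrow> 0) (at x within S)" by simp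
  have "((\<lambda>y. (g y - g x)\<^sup>2) \<longlongrightarrow> 0) (at x within S)"
  proof (rule tendsto_sandwich[OF _ _ tendsto_const lim])
    show "eventually (\<lambda>y. (g y - g x)\<^sup>2 \<le> C * \<bar>y - x\<bar>) (at x within S)"
      using assms[OF x] by (auto simp: eventually_at_filter)
  qed (auto intro: always_eventually)
  then have "((\<lambda>y. \<bar>g y - g x\<bar>) \<longlongrightarrow> 0) (at x within S)"
    using tendsto_real_sqrt[of "\<lambda>y. (g y - g x)\<^sup>2" 0] by simp
  then show "(g \<longlongrightarrow> g x) (at x within S)"
    by (simp add: tendsto_rabs_zero_iff LIM_zero_iff)
qed

lemma prim_continuous: "f \<in> sqint {a..b} \<Longrightarrow> continuous_on {a..b} (prim a f)"
  by (rule continuous_on_square_dist[where C="normsq {a..b} f"]) (use prim_holder in \<open>simp add: mult.commute\<close>)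

lemma test_function_integral_pd:
  assumes \<eta>: "test_function {a..b} \<eta>" and y: "y \<in> {a..b}"
  shows "(LINT x|lborel_on {a..b}. step_kernel (x, y) * pd 1 \<eta> x) = - \<eta> y"
    and "(LINT x|lborel_on {a..b}. pd 1 \<eta> x) = 0"
proof -
  have sm: "smooth \<eta>" using \<eta> by (simp add: test_function_def)
  have ends: "\<eta> a = 0" "\<eta> b = 0"
    using test_function_zero_outside[OF \<eta>] by auto
  have *: "(LINT x|lborel. indicator {y..b} x *\<^sub>R pd 1 \<eta> x) = \<eta> b - \<eta> y" if "y \<in> {a..b}" for y
  proof (rule integral_FTC_Icc)
    show "y \<le> b" using that by simp
    show "(\<eta> has_vector_derivative pd 1 \<eta> x) (at x within {y..b})" for x
      using has_derivative_of_smooth_real[OF sm, of x]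
      by (simp add: has_real_derivative_iff_has_vector_derivative[symmetric] has_field_derivative_at_within)
    show "continuous_on {y..b} (pd 1 \<eta>)"
      by (rule smooth_continuous[OF smooth_pd1[OF sm]])
  qed
  have "(LINT x|lborel_on {a..b}. step_kernel (x, y) * pd 1 \<eta> x) = (LINT x|lborel. indicator {y..b} x *\<^sub>R pd 1 \<eta> x)"
    using y by (subst integral_restrict_space)
      (auto intro!: Bochner_Integration.integral_cong simp: step_kernel_def split: split_indicator)
  with *[OF y] ends show "(LINT x|lborel_on {a..b}. step_kernel (x, y) * pd 1 \<eta> x) = - \<eta> y" by simp
  have "(LINT x|lborel_on {a..b}. pd 1 \<eta> x) = (LINT x|lborel. indicator {a..b} x *\<^sub>R pd 1 \<eta> x)"
    by (subst integral_restrict_space) auto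
  with *[of a] y ends show "(LINT x|lborel_on {a..b}. pd 1 \<eta> x) = 0" by simp
qed

text \<open>After exchanging the order of integration, the inner integral of \<open>\<partial>\<eta>\<close> over \<open>[y, b]\<close> is \<open>- \<eta>(y)\<close>.\<close>

lemma weak_pd_prim:
  assumes g: "g \<in> sqint {a..b}"
  shows "weak_pd {a..b} [1] (\<lambda>x. c + prim a g x) g"
proof (cases "a \<le> b")
  case ab: True
  show ?thesis
  unfolding weak_pd_def
  proof (intro allI impI)
    fix \<eta> :: "real \<Rightarrow> real" assume \<eta>: "test_function {a..b} \<eta>"
    have gi: "integrable (lborel_on {a..b}) g" using g by (simp add: sqint_integrable)
    have e': "pd 1 \<eta> \<in> bddf {a..b}"
      by (rule test_function_bddf[OF test_function_pd[OF \<eta>]]) auto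
    have "(\<lambda>p. step_kernel p * pd 1 \<eta> (fst p)) \<in> bddf ({a..b} \<times> {a..b})"
      by (intro bddf_mult step_kernel_bddf rect_bddf_fst e') auto
    from bddf_mult_integrable[OF this rect_integrable_snd[OF _ _ gi]]
    have i: "integrable (lborel_on ({a..b} \<times> {a..b})) (\<lambda>p. step_kernel p * pd 1 \<eta> (fst p) * g (snd p))"
      by simp
    have "(LINT x|lborel_on {a..b}. prim a g x * pd 1 \<eta> x)
        = (LINT x|lborel_on {a..b}. LINT y|lborel_on {a..b}. step_kernel (x, y) * pd 1 \<eta> x * g y)"
    proof (rule Bochner_Integration.integral_cong[OF refl])
      fix x assume "x \<in> space (lborel_on {a..b})"
      then have "prim a g x = kop {a..b} step_kernel g x" by (intro prim_kop) simp
      then have "prim a g x * pd 1 \<eta> x = (LINT y|lborel_on {a..b}. (step_kernel (x, y) * g y) * pd 1 \<eta> x)"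
        by (simp add: kop_def)
      then show "prim a g x * pd 1 \<eta> x = (LINT y|lborel_on {a..b}. step_kernel (x, y) * pd 1 \<eta> x * g y)"
        by (simp only: mult_ac)
    qed
    also have "\<dots> = (LINT y|lborel_on {a..b}. LINT x|lborel_on {a..b}. step_kernel (x, y) * pd 1 \<eta> x * g y)"
      using rect_integral1[OF _ _ i] rect_integral2[OF _ _ i] by simp
    also have "\<dots> = (LINT y|lborel_on {a..b}. - \<eta> y * g y)"
      using test_function_integral_pd(1)[OF \<eta>] by (intro Bochner_Integration.integral_cong) auto
    finally have 1: "(LINT x|lborel_on {a..b}. prim a g x * pd 1 \<eta> x) = - (LINT y|lborel_on {a..b}. g y * \<eta> y)"
      by (simp add: mult.commute)
    have "integrable (lborel_on {a..b}) (\<lambda>x. prim a g x * pd 1 \<eta> x)"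
      by (intro bddf_integrable bddf_mult prim_bddf gi e') simp
    then have "(LINT x|lborel_on {a..b}. (c + prim a g x) * pd 1 \<eta> x) = c * (LINT x|lborel_on {a..b}. pd 1 \<eta> x) + (LINT x|lborel_on {a..b}. prim a g x * pd 1 \<eta> x)"
      using bddf_integrable[OF e'] by (simp add: distrib_right)
    with 1 test_function_integral_pd(2)[OF \<eta>, of a] ab
    show "(LINT x|lborel_on {a..b}. (c + prim a g x) * foldr pd [1] \<eta> x) = (- 1) ^ length [1::real] * (LINT x|lborel_on {a..b}. g x * \<eta> x)"
      by simp
  qed
next
  case False
  have "(LINT x|lborel_on {a..b}. h x) = (LINT x|lborel_on {a..b}. 0)" for h :: "real \<Rightarrow> real"
    using False by (intro Bochner_Integration.integral_cong) auto
  then show ?thesis by (simp add: weak_pd_def)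
qed

subsection \<open>The lemma of du Bois-Reymond\<close>

lemma test_function_lin:
  fixes \<eta> \<theta> :: "'a::euclidean_space \<Rightarrow> real"
  assumes "test_function S \<eta>" "test_function S \<theta>"
  shows "test_function S (\<lambda>x. \<eta> x - c * \<theta> x)"
proof -
  let ?K = "closure {x. \<eta> x \<noteq> 0} \<union> closure {x. \<theta> x \<noteq> 0}"
  have "closure {x. \<eta> x - c * \<theta> x \<noteq> 0} \<subseteq> ?K"
  proof (rule closure_minimal)
    show "{x. \<eta> x - c * \<theta> x \<noteq> 0} \<subseteq> ?K"
    proof
      fix x assume "x \<in> {x. \<eta> x - c * \<theta> x \<noteq> 0}"
      then have "x \<in> {x. \<eta> x \<noteq> 0} \<union> {x. \<theta> x \<noteq> 0}" by auto
      then show "x \<in> ?K"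
        by (elim UnE) (rule UnI1, erule subsetD[OF closure_subset], rule UnI2, erule subsetD[OF closure_subset])
    qed
  qed auto
  moreover have "compact ?K" "?K \<subseteq> interior S"
    using assms by (auto simp: test_function_def)
  ultimately show ?thesis
    using assms compact_Int_closed[OF _ closed_closure, of ?K "{x. \<eta> x - c * \<theta> x \<noteq> 0}"]
    unfolding test_function_def by (auto simp: Int_absorb1 intro!: smooth_diff smooth_cmult)
qed

lemma test_function_nonzero_integral:
  assumes "a < (b::real)"
  obtains \<eta> where "test_function {a..b} \<eta>" "(LINT x|lborel_on {a..b}. \<eta> x) \<noteq> 0"
proof -
  have "(\<lambda>n. LINT x|lborel_on {a..b}. box_bump a b (real n) x) \<longlonglongrightarrow> (LINT x|lborel_on {a..b}. indicator (box a b) x)"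
  proof (rule integral_dominated_convergence[where w="\<lambda>x. 1"])
    show "AE x in lborel_on {a..b}. (\<lambda>n. box_bump a b (real n) x) \<longlonglongrightarrow> indicator (box a b) x"
      by (intro AE_I2 box_bump_tendsto)
    show "AE x in lborel_on {a..b}. norm (box_bump a b (real n) x) \<le> 1" for n
      using box_bump_bounds[of a b "real n"] by (intro AE_I2) simp
    show "box_bump a b (real n) \<in> borel_measurable (lborel_on {a..b})" for n
      using bddf_measurable[OF bddf_continuous[OF smooth_continuous[OF smooth_box_bump[of a b "real n"]] compact_Icc]] .
    show "indicator (box a b) \<in> borel_measurable (lborel_on {a..b})"
      by (intro lborel_on_measurable) auto
  qed (simp add: bddf_integrable bddf_const)
  moreover have "(LINT x|lborel_on {a..b}. indicator (box a b) x) = (LINT x|lborel. indicator {a<..<b} x :: real)"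
  proof -
    have "(LINT x|lborel_on {a..b}. indicator (box a b) x) = (LINT x|lborel. indicator {a..b} x *\<^sub>R (indicator (box a b) x :: real))"
      by (subst integral_restrict_space) auto
    also have "\<dots> = (LINT x|lborel. indicator {a<..<b} x :: real)"
      by (intro Bochner_Integration.integral_cong) (auto split: split_indicator)
    finally show ?thesis .
  qed
  ultimately have "(\<lambda>n. LINT x|lborel_on {a..b}. box_bump a b (real n) x) \<longlonglongrightarrow> b - a"
    using assms by simp
  then have "eventually (\<lambda>n. (LINT x|lborel_on {a..b}. box_bump a b (real n) x) > 0) sequentially"
    using assms by (intro order_tendstoD(1)) auto
  then obtain n where "n > 0" "(LINT x|lborel_on {a..b}. box_bump a b (real n) x) > 0"
    using eventually_gt_at_top[of "0::nat"] by (metis (mono_tags, lifting) eventually_conj eventually_happens sequentially_bot)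
  with test_function_box_bump[of "real n" a b "{a..b}"] that show thesis by auto
qed

lemma test_function_support_interval:
  assumes "test_function {a..b::real} \<theta>" "a < b"
  obtains p q where "a < p" "p < q" "q < b" "\<And>x. x \<le> p \<Longrightarrow> \<theta> x = 0" "\<And>x. q \<le> x \<Longrightarrow> \<theta> x = 0"
proof -
  let ?K = "closure {x. \<theta> x \<noteq> 0}"
  have K: "compact ?K" "?K \<subseteq> {a<..<b}" using assms by (auto simp: test_function_def)
  have nz: "x \<in> ?K" if "\<theta> x \<noteq> 0" for x using closure_subset[of "{x. \<theta> x \<noteq> 0}"] that by auto
  show thesis
  proof (cases "?K = {}")
    case True
    \<comment> \<open>Any two interior points will do when the function vanishes.\<close>
    with nz assms show thesis by (intro that[of "(2 * a + b) / 3" "(a + 2 * b) / 3"]) auto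
  next
    case False
    obtain p q where pq: "p \<in> ?K" "\<And>x. x \<in> ?K \<Longrightarrow> p \<le> x" "q \<in> ?K" "\<And>x. x \<in> ?K \<Longrightarrow> x \<le> q"
      using compact_attains_inf[OF K(1) False] compact_attains_sup[OF K(1) False] by blast
    then have "a < p" "p \<le> q" "q < b" using K by auto
    then show thesis
      using nz pq by (intro that[of "(a + p) / 2" "(q + b) / 2"]) force+
  qed
qed

text \<open>
  The primitive that starts at \<open>a\<close> vanishes to the left of the support, and to the right of it because
  the total integral is zero.
\<close>

lemma test_function_antiderivative:
  assumes \<theta>: "test_function {a..b::real} \<theta>" and ab: "a < b" and zero: "(LINT x|lborel_on {a..b}. \<theta> x) = 0"
  obtains \<zeta> where "test_function {a..b} \<zeta>" "pd 1 \<zeta> = \<theta>"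
proof -
  obtain p q where pq: "a < p" "p < q" "q < b" and le: "\<And>x. x \<le> p \<Longrightarrow> \<theta> x = 0" and ge: "\<And>x. q \<le> x \<Longrightarrow> \<theta> x = 0"
    using test_function_support_interval[OF \<theta> ab] by blast
  have sm: "smooth \<theta>" using \<theta> by (simp add: test_function_def)
  define \<zeta> where "\<zeta> x = integral {a..x} \<theta>" for x
  have cont: "continuous_on S \<theta>" for S by (rule smooth_continuous[OF sm])
  have lo: "\<zeta> x = 0" if "x \<le> p" for x
  proof -
    have "integral {a..x} \<theta> = integral {a..x} (\<lambda>x. 0)"
      using le that by (intro Henstock_Kurzweil_Integration.integral_cong) auto
    then show ?thesis by (simp add: \<zeta>_def)
  qed
  have si: "set_integrable lborel {a..b} \<theta>"
    by (rule borel_integrable_atLeastAtMost') (rule cont)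
  have "integral {a..b} \<theta> = (LINT x|lborel_on {a..b}. \<theta> x)"
    using set_borel_integral_eq_integral(2)[OF si] unfolding set_lebesgue_integral_def
    by (subst integral_restrict_space) auto
  with zero have total: "\<zeta> b = 0" by (simp add: \<zeta>_def)
  have diff: "\<zeta> y - \<zeta> x = integral {x..y} \<theta>" if "a \<le> x" "x \<le> y" for x y
    unfolding \<zeta>_def using Henstock_Kurzweil_Integration.integral_combine[of a x y \<theta>] that
      integrable_continuous_real[OF cont] by (smt (verit))
  have zz: "integral {x..y} \<theta> = 0" if "q \<le> x" for x y
  proof -
    have "integral {x..y} \<theta> = integral {x..y} (\<lambda>x. 0)"
      using ge that by (intro Henstock_Kurzweil_Integration.integral_cong) auto
    then show ?thesis by simp
  qed
  have hi: "\<zeta> x = 0" if "x \<ge> q" for x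
    using diff[of x b] diff[of b x] zz[of x b] zz[of b x] that pq total by (cases "x \<le> b") auto
  have D: "(\<zeta> has_real_derivative \<theta> x) (at x)" for x
  proof (cases "x < p")
    case True
    have "((\<lambda>x. 0) has_real_derivative \<theta> x) (at x)" using le True by simp
    then show ?thesis
      by (rule DERIV_cong_ev[THEN iffD1, OF refl _ refl, rotated])
        (use True lo in \<open>auto intro!: eventually_nhds_in_open[of "{..<p}", THEN eventually_mono]\<close>)
  next
    case False
    with pq have x: "a < x" by simp
    have "(\<zeta> has_real_derivative \<theta> x) (at x within {a..x + 1})"
      unfolding \<zeta>_def[abs_def] using x by (intro integral_has_real_derivative cont) auto
    moreover have "at x within {a..x + 1} = at x"
      using x by (intro at_within_interior) auto
    ultimately show ?thesis by simp
  qed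
  have "closure {x. \<zeta> x \<noteq> 0} \<subseteq> {p..q}"
    using lo hi by (intro closure_minimal) (auto, (meson linear)+)
  moreover from this have "compact (closure {x. \<zeta> x \<noteq> 0})"
    by (meson bounded_closed_interval bounded_subset closed_closure compact_eq_bounded_closed)
  moreover have "{p..q} \<subseteq> interior {a..b}" using pq by auto
  ultimately have "test_function {a..b} \<zeta>"
    using smooth_antiderivative(1)[OF sm D] by (auto simp: test_function_def)
  with smooth_antiderivative(2)[OF sm D] show thesis by (rule that[rotated])
qed

text \<open>
  Subtracting from a test function \<open>\<eta>\<close> the multiple of a fixed \<open>\<eta>\<^sub>0\<close> with the same integral leaves the
  derivative of a test function, which \<open>f\<close> annihilates. Hence the pairing of \<open>f\<close> with \<open>\<eta>\<close> is a constant times the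
  integral of \<open>\<eta>\<close>.
\<close>

lemma du_Bois_Reymond:
  assumes ab: "a < (b::real)" and f: "f \<in> sqint {a..b}" and w: "weak_pd {a..b} [1] f (\<lambda>x. 0)"
  obtains c where "AE x in lborel_on {a..b}. f x = c"
proof -
  obtain \<eta>0 where \<eta>0: "test_function {a..b} \<eta>0" "(LINT x|lborel_on {a..b}. \<eta>0 x) \<noteq> 0"
    using test_function_nonzero_integral[OF ab] .
  let ?L = "\<lambda>g. LINT x|lborel_on {a..b}. g x"
  define c where "c = ?L (\<lambda>x. f x * \<eta>0 x) / ?L \<eta>0"
  have "AE x in lborel_on {a..b}. f x - c = 0"
  proof (rule fundamental_lemma[of a b, unfolded interval_cbox[symmetric]])
    show "integrable (lborel_on {a..b}) (\<lambda>x. f x - c)"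
      using f by (simp add: sqint_integrable bddf_integrable bddf_const)
    fix \<eta> assume \<eta>: "test_function {a..b} \<eta>"
    \<comment> \<open>Chosen so that \<open>\<eta> - k \<eta>0\<close> has integral zero.\<close>
    define k where "k = ?L \<eta> / ?L \<eta>0"
    have i: "integrable (lborel_on {a..b}) \<eta>" "integrable (lborel_on {a..b}) (\<lambda>x. f x * \<eta> x)"
      if "test_function {a..b} \<eta>" for \<eta>
      using that bddf_integrable[OF test_function_bddf[OF that]] weak_pd_integrable[OF that, of "[]" f] f by auto
    have \<theta>: "test_function {a..b} (\<lambda>x. \<eta> x - k * \<eta>0 x)"
      by (rule test_function_lin[OF \<eta> \<eta>0(1)])
    have "?L (\<lambda>x. \<eta> x - k * \<eta>0 x) = 0"
      using i[OF \<eta>] i[OF \<eta>0(1)] \<eta>0(2) by (simp add: k_def)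
    then obtain \<zeta> where \<zeta>: "test_function {a..b} \<zeta>" "pd 1 \<zeta> = (\<lambda>x. \<eta> x - k * \<eta>0 x)"
      using test_function_antiderivative[OF \<theta> ab] by blast
    have "?L (\<lambda>x. f x * (\<eta> x - k * \<eta>0 x)) = 0"
      using w[unfolded weak_pd_def, rule_format, OF \<zeta>(1)] \<zeta>(2) by simp
    then have "?L (\<lambda>x. f x * \<eta> x) = k * ?L (\<lambda>x. f x * \<eta>0 x)"
      using i[OF \<eta>] i[OF \<eta>0(1)] by (simp add: right_diff_distrib mult.left_commute)
    also have "\<dots> = c * ?L \<eta>" using \<eta>0(2) by (simp add: k_def c_def)
    finally show "?L (\<lambda>x. (f x - c) * \<eta> x) = 0"
      using i[OF \<eta>] by (simp add: left_diff_distrib)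
  qed
  then have "AE x in lborel_on {a..b}. f x = c" by eventually_elim simp
  then show thesis by (rule that)
qed

text \<open>The difference of \<open>f\<close> and the primitive of \<open>g\<close> has weak derivative zero.\<close>

lemma weak_pd_imp_prim:
  assumes ab: "a < (b::real)" and f: "f \<in> sqint {a..b}" and g: "g \<in> sqint {a..b}" and w: "weak_pd {a..b} [1] f g"
  obtains c where "AE x in lborel_on {a..b}. f x = c + prim a g x"
proof -
  have p: "prim a g \<in> sqint {a..b}"
    using sqint_integrable[OF g] by (intro bddf_sqint prim_bddf) auto
  \<comment> \<open>Written with the factor \<open>-1\<close> to match linearity in the form \<open>f + c g\<close>.\<close>
  have "weak_pd {a..b} [1] (\<lambda>x. f x + (-1) * prim a g x) (\<lambda>x. g x + (-1) * g x)"
    using weak_pd_prim[OF g, of 0] by (intro weak_pd_lin w p f g) auto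
  then have "weak_pd {a..b} [1] (\<lambda>x. f x - prim a g x) (\<lambda>x. 0)" by simp
  from du_Bois_Reymond[OF ab sqint_diff[OF f p] this] obtain c
    where "AE x in lborel_on {a..b}. f x - prim a g x = c" .
  then have "AE x in lborel_on {a..b}. f x = c + prim a g x" by eventually_elim simp
  then show thesis by (rule that)
qed

subsection \<open>Continuous representatives\<close>

text \<open>A continuous nonnegative function with integral zero vanishes.\<close>

lemma continuous_AE_eq_imp_eq:
  fixes g h :: "real \<Rightarrow> real"
  assumes ab: "a < b" and g: "continuous_on {a..b} g" and h: "continuous_on {a..b} h"
    and ae: "AE x in lborel_on {a..b}. g x = h x" and x: "x \<in> {a..b}"
  shows "g x = h x"
proof -
  have c: "continuous_on {a..b} (\<lambda>x. \<bar>g x - h x\<bar>)" by (intro continuous_intros g h)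
  have si: "set_integrable lborel {a..b} (\<lambda>x. \<bar>g x - h x\<bar>)"
    by (rule borel_integrable_atLeastAtMost'[OF c])
  have "integral {a..b} (\<lambda>x. \<bar>g x - h x\<bar>) = (LINT x|lborel_on {a..b}. \<bar>g x - h x\<bar>)"
    using set_borel_integral_eq_integral(2)[OF si] unfolding set_lebesgue_integral_def
    by (subst integral_restrict_space) auto
  also have "\<dots> = 0"
    by (rule integral_eq_zero_AE) (use ae in auto)
  finally have "((\<lambda>x. \<bar>g x - h x\<bar>) has_integral 0) {a..b}"
    using integrable_integral[OF integrable_continuous_real[OF c]] by simp
  then have "\<bar>g x - h x\<bar> = 0"
    using has_integral_0_cbox_imp_0[of a b "\<lambda>x. \<bar>g x - h x\<bar>" x] c ab x by (auto simp: box_real)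
  then show ?thesis by simp
qed

lemma cont_rep_eq:
  assumes "a < b" "continuous_on {a..b} h" "AE x in lborel_on {a..b}. f x = h x" "x \<in> {a..b}"
  shows "cont_rep a b f x = h x"
proof -
  have "AE x in lborel_on {a..b}. h x = f x" using assms(3) by eventually_elim simp
  with assms(2) have *: "continuous_on {a..b} (cont_rep a b f)" "AE x in lborel_on {a..b}. cont_rep a b f x = f x"
    using someI[of "\<lambda>g. continuous_on {a..b} g \<and> (AE x in lborel_on {a..b}. g x = f x)" h]
    by (auto simp: cont_rep_def)
  have "AE x in lborel_on {a..b}. cont_rep a b f x = h x"
    using *(2) assms(3) by eventually_elim simp
  with assms * show ?thesis by (intro continuous_AE_eq_imp_eq[of a b])
qed

section \<open>Differentiability in time with values in a space of square integrable functions\<close>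

text \<open>
  Differentiability of a curve of square integrable functions in the \<open>L\<^sub>2\<close> norm, one-sided at time zero.
  The squared norm avoids square roots; the product norms of states split into conditions of
  this form.
\<close>

definition tdiff :: "'a::euclidean_space set \<Rightarrow> (real \<Rightarrow> 'a \<Rightarrow> real) \<Rightarrow> ('a \<Rightarrow> real) \<Rightarrow> real \<Rightarrow> bool"
  where "tdiff S f f' t \<longleftrightarrow>
    ((\<lambda>r. normsq S (\<lambda>x. f r x - f t x - (r - t) * f' x) / (r - t)\<^sup>2) \<longlongrightarrow> 0) (at t within {0..})"

lemma eventually_time: "eventually (\<lambda>r::real. 0 \<le> r \<and> r \<noteq> t) (at t within {0..})"
  by (auto simp: eventually_at_filter)

lemma sqint_increment:
  "f r \<in> sqint S \<Longrightarrow> f t \<in> sqint S \<Longrightarrow> f' \<in> sqint S \<Longrightarrow> (\<lambda>x. f r x - f t x - c * f' x) \<in> sqint S"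
  by (intro sqint_diff sqint_cmult)

lemma tendsto_0_squeeze:
  fixes f g :: "real \<Rightarrow> real"
  assumes "(g \<longlongrightarrow> 0) (at t within {0..})" "\<And>r. 0 \<le> r \<Longrightarrow> r \<noteq> t \<Longrightarrow> 0 \<le> f r" "\<And>r. 0 \<le> r \<Longrightarrow> r \<noteq> t \<Longrightarrow> f r \<le> C * g r"
  shows "(f \<longlongrightarrow> 0) (at t within {0..})"
proof (rule tendsto_sandwich[OF _ _ tendsto_const, where h="\<lambda>r. C * g r"])
  show "((\<lambda>r. C * g r) \<longlongrightarrow> 0) (at t within {0..})" using tendsto_mult_right_zero[OF assms(1)] by simp
qed (use eventually_mono[OF eventually_time[of t]] assms(2,3) in auto)

lemma tdiff_cong_AE:
  assumes "tdiff S f f' t" "0 \<le> t"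
    and "\<And>r. 0 \<le> r \<Longrightarrow> f r \<in> sqint S" "f' \<in> sqint S" "\<And>r. 0 \<le> r \<Longrightarrow> g r \<in> sqint S" "g' \<in> sqint S"
    and "\<And>r. 0 \<le> r \<Longrightarrow> AE x in lborel_on S. f r x = g r x" "AE x in lborel_on S. f' x = g' x"
  shows "tdiff S g g' t"
  unfolding tdiff_def
proof (rule tendsto_0_squeeze[OF assms(1)[unfolded tdiff_def]])
  fix r :: real assume r: "0 \<le> r" "r \<noteq> t"
  have "AE x in lborel_on S. g r x - g t x - (r - t) * g' x = f r x - f t x - (r - t) * f' x"
    using assms(7)[OF r(1)] assms(7)[OF assms(2)] assms(8) by eventually_elim simp
  then have "normsq S (\<lambda>x. g r x - g t x - (r - t) * g' x) = normsq S (\<lambda>x. f r x - f t x - (r - t) * f' x)"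
    using assms r by (intro normsq_cong_AE sqint_increment)
  then show "normsq S (\<lambda>x. g r x - g t x - (r - t) * g' x) / (r - t)\<^sup>2
      \<le> 1 * (normsq S (\<lambda>x. f r x - f t x - (r - t) * f' x) / (r - t)\<^sup>2)" by simp
qed (simp add: normsq_nonneg)

text \<open>
  The increment of the image is the image of the increment. Linearity is needed only up to null
  sets, which allows operators that are defined through integrals of sections.
\<close>

lemma tdiff_bounded:
  assumes d: "tdiff S f f' t" and t: "0 \<le> t"
    and f: "\<And>r. 0 \<le> r \<Longrightarrow> f r \<in> sqint S" "f' \<in> sqint S"
    and K: "\<And>g. g \<in> sqint S \<Longrightarrow> K g \<in> sqint S'" "\<And>g. g \<in> sqint S \<Longrightarrow> normsq S' (K g) \<le> C * normsq S g"
    and lin: "\<And>g h c. g \<in> sqint S \<Longrightarrow> h \<in> sqint S \<Longrightarrow> AE x in lborel_on S'. K (\<lambda>x. g x + c * h x) x = K g x + c * K h x"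
  shows "tdiff S' (\<lambda>r. K (f r)) (K f') t"
  unfolding tdiff_def
proof (rule tendsto_0_squeeze[OF d[unfolded tdiff_def]])
  fix r :: real assume r: "0 \<le> r" "r \<noteq> t"
  let ?g = "\<lambda>x. f r x - f t x - (r - t) * f' x"
  have g: "?g \<in> sqint S" using f r t by (intro sqint_increment)
  have 1: "(\<lambda>x. f r x + (- 1) * f t x) \<in> sqint S" using f r t by (intro sqint_add sqint_cmult)
  have "AE x in lborel_on S'. K (\<lambda>x. (f r x + (-1) * f t x) + (- (r - t)) * f' x) x
      = K (\<lambda>x. f r x + (-1) * f t x) x + (- (r - t)) * K f' x"
    by (rule lin[OF 1 f(2)])
  moreover have "AE x in lborel_on S'. K (\<lambda>x. f r x + (-1) * f t x) x = K (f r) x + (-1) * K (f t) x"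
    by (rule lin) (use f r t in auto)
  ultimately have "AE x in lborel_on S'. K (f r) x - K (f t) x - (r - t) * K f' x = K ?g x"
    by eventually_elim (simp add: algebra_simps)
  then have "normsq S' (\<lambda>x. K (f r) x - K (f t) x - (r - t) * K f' x) = normsq S' (K ?g)"
    using f r t g K(1) by (intro normsq_cong_AE sqint_diff sqint_cmult) auto
  also have "\<dots> \<le> C * normsq S ?g" by (rule K(2)[OF g])
  finally show "normsq S' (\<lambda>x. K (f r) x - K (f t) x - (r - t) * K f' x) / (r - t)\<^sup>2 \<le> C * (normsq S ?g / (r - t)\<^sup>2)"
    by (simp add: divide_right_mono)
qed (simp add: normsq_nonneg)

lemma tdiff_bddf_mult:
  assumes R: "R \<in> bddf S" and d: "tdiff S f f' t" and t: "0 \<le> t"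
    and f: "\<And>r. 0 \<le> r \<Longrightarrow> f r \<in> sqint S" "f' \<in> sqint S"
  shows "tdiff S (\<lambda>r x. R x * f r x) (\<lambda>x. R x * f' x) t"
proof -
  obtain C where C: "\<And>x. x \<in> S \<Longrightarrow> \<bar>R x\<bar> \<le> C" using R unfolding bddf_def by blast
  show ?thesis
  proof (rule tdiff_bounded[OF d t f, where C="C\<^sup>2" and K="\<lambda>g x. R x * g x"])
    show "(\<lambda>x. R x * g x) \<in> sqint S" if "g \<in> sqint S" for g
      by (rule bddf_mult_sqint[OF R that])
    show "normsq S (\<lambda>x. R x * g x) \<le> C\<^sup>2 * normsq S g" if "g \<in> sqint S" for g
      by (rule normsq_bddf_mult_le[OF R that C])
  qed (auto intro!: AE_I2 simp: algebra_simps)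
qed

lemma tdiff_add:
  assumes "tdiff S f f' t" "tdiff S g g' t" "0 \<le> t"
    and "\<And>r. 0 \<le> r \<Longrightarrow> f r \<in> sqint S" "f' \<in> sqint S" "\<And>r. 0 \<le> r \<Longrightarrow> g r \<in> sqint S" "g' \<in> sqint S"
  shows "tdiff S (\<lambda>r x. f r x + g r x) (\<lambda>x. f' x + g' x) t"
proof -
  have lim: "((\<lambda>r. normsq S (\<lambda>x. f r x - f t x - (r - t) * f' x) / (r - t)\<^sup>2
      + normsq S (\<lambda>x. g r x - g t x - (r - t) * g' x) / (r - t)\<^sup>2) \<longlongrightarrow> 0) (at t within {0..})"
    using tendsto_add[OF assms(1,2)[unfolded tdiff_def]] by simp
  show ?thesis
    unfolding tdiff_def
  proof (rule tendsto_0_squeeze[OF lim])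
    fix r :: real assume r: "0 \<le> r" "r \<noteq> t"
    let ?F = "\<lambda>x. f r x - f t x - (r - t) * f' x" and ?G = "\<lambda>x. g r x - g t x - (r - t) * g' x"
    have "normsq S (\<lambda>x. ?F x + ?G x) \<le> 2 * normsq S ?F + 2 * normsq S ?G"
      using assms r by (intro normsq_add_le sqint_increment)
    moreover have "(\<lambda>x. f r x + g r x - (f t x + g t x) - (r - t) * (f' x + g' x)) = (\<lambda>x. ?F x + ?G x)"
      by (simp add: fun_eq_iff algebra_simps)
    ultimately have "normsq S (\<lambda>x. f r x + g r x - (f t x + g t x) - (r - t) * (f' x + g' x)) / (r - t)\<^sup>2
        \<le> (2 * normsq S ?F + 2 * normsq S ?G) / (r - t)\<^sup>2"
      by (simp add: divide_right_mono)
    then show "normsq S (\<lambda>x. f r x + g r x - (f t x + g t x) - (r - t) * (f' x + g' x)) / (r - t)\<^sup>2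
        \<le> 2 * (normsq S ?F / (r - t)\<^sup>2 + normsq S ?G / (r - t)\<^sup>2)"
      by (simp add: add_divide_distrib)
  qed (simp add: normsq_nonneg)
qed

lemma tdiff_sum:
  assumes "\<And>k. k \<in> I \<Longrightarrow> tdiff S (\<lambda>r. f r k) (f' k) t" "0 \<le> t"
    and "\<And>r k. 0 \<le> r \<Longrightarrow> k \<in> I \<Longrightarrow> f r k \<in> sqint S" "\<And>k. k \<in> I \<Longrightarrow> f' k \<in> sqint S"
  shows "tdiff S (\<lambda>r x. \<Sum>k\<in>I. f r k x) (\<lambda>x. \<Sum>k\<in>I. f' k x) t"
  using assms
proof (induction I rule: infinite_finite_induct)
  case (insert k I)
  then have "tdiff S (\<lambda>r x. f r k x + (\<Sum>k\<in>I. f r k x)) (\<lambda>x. f' k x + (\<Sum>k\<in>I. f' k x)) t"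
    by (intro tdiff_add sqint_sum) auto
  with insert show ?case by simp
qed (simp_all add: tdiff_def normsq_def)

lemma tdiff_scalar:
  assumes c: "(c has_vector_derivative c') (at t within {0..})" and g: "g \<in> sqint S"
  shows "tdiff S (\<lambda>r x. c r * g x) (\<lambda>x. c' * g x) t"
proof -
  have "((\<lambda>r. \<bar>c r - c t - (r - t) * c'\<bar> / \<bar>r - t\<bar>) \<longlongrightarrow> 0) (at t within {0..})"
    using c frechet_norm_iff[of c c' t] by (simp add: frechet_def)
  from tendsto_mult[OF tendsto_power[OF this, of 2] tendsto_const[of "normsq S g"]]
  have "((\<lambda>r. (\<bar>c r - c t - (r - t) * c'\<bar> / \<bar>r - t\<bar>)\<^sup>2 * normsq S g) \<longlongrightarrow> 0) (at t within {0..})" by simp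
  moreover have "normsq S (\<lambda>x. c r * g x - c t * g x - (r - t) * (c' * g x)) / (r - t)\<^sup>2
      = (\<bar>c r - c t - (r - t) * c'\<bar> / \<bar>r - t\<bar>)\<^sup>2 * normsq S g" for r
  proof -
    have "(\<lambda>x. c r * g x - c t * g x - (r - t) * (c' * g x)) = (\<lambda>x. (c r - c t - (r - t) * c') * g x)"
      by (simp add: fun_eq_iff algebra_simps)
    then show ?thesis by (simp add: normsq_cmult power_divide)
  qed
  ultimately show ?thesis by (simp add: tdiff_def)
qed

lemma at_time_nontrivial:
  assumes "0 \<le> (t::real)"
  shows "at t within {0..} \<noteq> bot"
proof -
  have "t islimpt {0..}"
    unfolding islimpt_approachable
  proof (intro allI impI)
    fix e :: real assume "0 < e"
    with assms show "\<exists>x'\<in>{0..}. x' \<noteq> t \<and> dist x' t < e"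
      by (intro bexI[of _ "t + e / 2"]) (auto simp: dist_real_def)
  qed
  then show ?thesis by (simp add: trivial_limit_within)
qed

text \<open>
  By \<open>(f' - g') (r - t) = G - F\<close> for the two remainders \<open>F\<close> and \<open>G\<close>, the squared distance of \<open>f'\<close> and \<open>g'\<close> is at
  most twice the sum of two quantities that tend to zero.
\<close>

lemma tdiff_unique:
  assumes d: "tdiff S f f' t" "tdiff S f g' t" and t: "0 \<le> t"
    and f: "\<And>r. 0 \<le> r \<Longrightarrow> f r \<in> sqint S" "f' \<in> sqint S" "g' \<in> sqint S"
  shows "AE x in lborel_on S. f' x = g' x"
proof -
  let ?N = "normsq S (\<lambda>x. f' x - g' x)"
  have lim: "((\<lambda>r. normsq S (\<lambda>x. f r x - f t x - (r - t) * f' x) / (r - t)\<^sup>2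
      + normsq S (\<lambda>x. f r x - f t x - (r - t) * g' x) / (r - t)\<^sup>2) \<longlongrightarrow> 0) (at t within {0..})"
    using tendsto_add[OF d[unfolded tdiff_def]] by simp
  have "((\<lambda>r. ?N) \<longlongrightarrow> 0) (at t within {0..})"
  proof (rule tendsto_0_squeeze[OF lim, where C=2])
    fix r :: real assume r: "0 \<le> r" "r \<noteq> t"
    let ?F = "\<lambda>x. f r x - f t x - (r - t) * f' x" and ?G = "\<lambda>x. f r x - f t x - (r - t) * g' x"
    have s: "?F \<in> sqint S" "?G \<in> sqint S" using f r t by (auto intro!: sqint_increment)
    have "(r - t)\<^sup>2 * ?N = normsq S (\<lambda>x. ?G x + (- 1) * ?F x)"
      unfolding normsq_cmult[symmetric] by (simp add: algebra_simps)
    also have "\<dots> \<le> 2 * normsq S ?G + 2 * normsq S (\<lambda>x. (-1) * ?F x)"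
      by (intro normsq_add_le sqint_cmult s)
    also have "normsq S (\<lambda>x. (-1) * ?F x) = normsq S ?F"
      by (subst normsq_cmult) simp
    finally have "?N \<le> (2 * normsq S ?G + 2 * normsq S ?F) / (r - t)\<^sup>2"
      using r by (simp add: field_simps)
    then show "?N \<le> 2 * (normsq S ?F / (r - t)\<^sup>2 + normsq S ?G / (r - t)\<^sup>2)"
      by (simp add: add_divide_distrib)
  qed (simp add: normsq_nonneg)
  then have "?N = 0"
    by (simp add: tendsto_const_iff at_time_nontrivial[OF t])
  then have "AE x in lborel_on S. f' x - g' x = 0"
    using f by (intro normsq_zero_imp_AE sqint_diff)
  then show ?thesis by eventually_elim simp
qed

section \<open>Partial integral operators\<close>

text \<open>
  The action of a multiplier \<open>R\<close>, a kernel \<open>K\<close> and input coefficients \<open>Z\<close> on \<open>(v, z)\<close>. A partial integral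
  operator usually has separate kernels below and above the diagonal; here they are one kernel,
  discontinuous across it.
\<close>

definition pi_val :: "real \<Rightarrow> real \<Rightarrow> nat \<Rightarrow> nat \<Rightarrow> (nat \<Rightarrow> real \<Rightarrow> real) \<times> (nat \<Rightarrow> real \<times> real \<Rightarrow> real) \<times> (nat \<Rightarrow> real \<Rightarrow> real)
    \<Rightarrow> real vfun \<Rightarrow> rvec \<Rightarrow> real \<Rightarrow> real"
  where "pi_val a b n m = (\<lambda>(R, K, Z) v z x.
    (\<Sum>k<n. R k x * v k x) + (\<Sum>k<n. kop {a..b} (K k) (v k) x) + (\<Sum>k<m. Z k x * z k))"

definition pi_coeffs :: "real \<Rightarrow> real \<Rightarrow> nat \<Rightarrow> nat
    \<Rightarrow> ((nat \<Rightarrow> real \<Rightarrow> real) \<times> (nat \<Rightarrow> real \<times> real \<Rightarrow> real) \<times> (nat \<Rightarrow> real \<Rightarrow> real)) set"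
  where "pi_coeffs a b n m = {(R, K, Z). (\<forall>k<n. R k \<in> bddf {a..b} \<and> K k \<in> bddf ({a..b} \<times> {a..b})) \<and>
    (\<forall>k<m. Z k \<in> bddf {a..b})}"

text \<open>
  Equality is demanded at every point, not just almost everywhere, so that compositions and boundary
  values can be computed pointwise.
\<close>

definition pi_repr where
  "pi_repr a b n m Op c \<longleftrightarrow> c \<in> pi_coeffs a b n m \<and>
    (\<forall>v\<in>L2 n {a..b}. \<forall>z. \<forall>x\<in>{a..b}. Op v z x = pi_val a b n m c v z x)"

definition pi_op :: "real \<Rightarrow> real \<Rightarrow> nat \<Rightarrow> nat \<Rightarrow> (real vfun \<Rightarrow> rvec \<Rightarrow> real \<Rightarrow> real) \<Rightarrow> bool"
  where "pi_op a b n m Op \<longleftrightarrow> (\<exists>c. pi_repr a b n m Op c)"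

text \<open>The scalar companion: functionals of \<open>(v, z)\<close> such as boundary values.\<close>

definition pi_fun :: "real \<Rightarrow> real \<Rightarrow> nat \<Rightarrow> nat \<Rightarrow> (real vfun \<Rightarrow> rvec \<Rightarrow> real) \<Rightarrow> bool"
  where "pi_fun a b n m F \<longleftrightarrow> (\<exists>\<kappa> \<zeta>. (\<forall>k<n. \<kappa> k \<in> bddf {a..b}) \<and>
    (\<forall>v\<in>L2 n {a..b}. \<forall>z. F v z = (\<Sum>k<n. LINT y|lborel_on {a..b}. \<kappa> k y * v k y) + (\<Sum>k<m. \<zeta> k * z k)))"

lemma L2_sqint: "v \<in> L2 n S \<Longrightarrow> k < n \<Longrightarrow> v k \<in> sqint S"
  by (simp add: L2_def)

lemma L2_integrable: "v \<in> L2 n S \<Longrightarrow> k < n \<Longrightarrow> compact S \<Longrightarrow> integrable (lborel_on S) (v k)"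
  by (simp add: L2_def sqint_integrable)

lemma pi_opI:
  assumes "\<And>k. k < n \<Longrightarrow> R k \<in> bddf {a..b}" "\<And>k. k < n \<Longrightarrow> K k \<in> bddf ({a..b} \<times> {a..b})" "\<And>k. k < m \<Longrightarrow> Z k \<in> bddf {a..b}"
    and "\<And>v z x. v \<in> L2 n {a..b} \<Longrightarrow> x \<in> {a..b} \<Longrightarrow> Op v z x =
      (\<Sum>k<n. R k x * v k x) + (\<Sum>k<n. kop {a..b} (K k) (v k) x) + (\<Sum>k<m. Z k x * z k)"
  shows "pi_op a b n m Op"
  unfolding pi_op_def pi_repr_def pi_coeffs_def using assms
  by (intro exI[of _ "(R, K, Z)"]) (simp add: pi_val_def)

lemma pi_opE:
  assumes "pi_op a b n m Op"
  obtains R K Z where "\<And>k. k < n \<Longrightarrow> R k \<in> bddf {a..b}" "\<And>k. k < n \<Longrightarrow> K k \<in> bddf ({a..b} \<times> {a..b})" "\<And>k. k < m \<Longrightarrow> Z k \<in> bddf {a..b}"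
    "\<And>v z x. v \<in> L2 n {a..b} \<Longrightarrow> x \<in> {a..b} \<Longrightarrow> Op v z x =
      (\<Sum>k<n. R k x * v k x) + (\<Sum>k<n. kop {a..b} (K k) (v k) x) + (\<Sum>k<m. Z k x * z k)"
proof -
  from assms obtain c where c: "pi_repr a b n m Op c" by (auto simp: pi_op_def)
  obtain R K Z where RKZ: "c = (R, K, Z)" by (cases c)
  show thesis
    by (rule that[of R K Z]) (use c in \<open>auto simp: pi_repr_def pi_coeffs_def pi_val_def RKZ\<close>)
qed

lemma pi_op_proj:
  assumes "i < n"
  shows "pi_op a b n m (\<lambda>v z. v i)"
proof (rule pi_opI[where R="\<lambda>k x. if k = i then 1 else 0" and K="\<lambda>k x. 0" and Z="\<lambda>k x. 0"])
  fix v :: "real vfun" and z :: rvec and x :: real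
  have "(\<Sum>k<n. (if k = i then 1 else 0) * v k x) = (\<Sum>k<n. if k = i then v k x else 0)"
    by (intro sum.cong) auto
  with assms show "v i x = (\<Sum>k<n. (if k = i then 1 else 0) * v k x) + (\<Sum>k<n. kop {a..b} (\<lambda>x. 0) (v k) x) + (\<Sum>k<m. 0 * z k)"
    by (simp add: kop_def)
qed (auto intro: bddf_const)

lemma pi_op_zero: "pi_op a b n m (\<lambda>v z x. 0)"
  by (rule pi_opI[where R="\<lambda>k x. 0" and K="\<lambda>k x. 0" and Z="\<lambda>k x. 0"]) (auto intro: bddf_const simp: kop_def)

lemma kop_add_kernel:
  fixes K L :: "real \<times> real \<Rightarrow> real"
  assumes "K \<in> bddf ({a..b} \<times> {a..b})" "L \<in> bddf ({a..b} \<times> {a..b})" "integrable (lborel_on {a..b}) f" "x \<in> {a..b}"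
  shows "kop {a..b} (\<lambda>p. K p + L p) f x = kop {a..b} K f x + kop {a..b} L f x"
  unfolding kop_def using assms kernel_times_integrable[of "{a..b}" "{a..b}" K x f] kernel_times_integrable[of "{a..b}" "{a..b}" L x f]
  by (simp add: distrib_right)

lemma pi_op_add:
  assumes "pi_op a b n m Op1" "pi_op a b n m Op2"
  shows "pi_op a b n m (\<lambda>v z x. Op1 v z x + Op2 v z x)"
proof -
  obtain R K Z where 1: "\<And>k. k < n \<Longrightarrow> R k \<in> bddf {a..b}" "\<And>k. k < n \<Longrightarrow> K k \<in> bddf ({a..b} \<times> {a..b})" "\<And>k. k < m \<Longrightarrow> Z k \<in> bddf {a..b}"
    "\<And>v z x. v \<in> L2 n {a..b} \<Longrightarrow> x \<in> {a..b} \<Longrightarrow> Op1 v z x =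
      (\<Sum>k<n. R k x * v k x) + (\<Sum>k<n. kop {a..b} (K k) (v k) x) + (\<Sum>k<m. Z k x * z k)"
    by (rule pi_opE[OF assms(1)]) blast
  obtain R' K' Z' where 2: "\<And>k. k < n \<Longrightarrow> R' k \<in> bddf {a..b}" "\<And>k. k < n \<Longrightarrow> K' k \<in> bddf ({a..b} \<times> {a..b})" "\<And>k. k < m \<Longrightarrow> Z' k \<in> bddf {a..b}"
    "\<And>v z x. v \<in> L2 n {a..b} \<Longrightarrow> x \<in> {a..b} \<Longrightarrow> Op2 v z x =
      (\<Sum>k<n. R' k x * v k x) + (\<Sum>k<n. kop {a..b} (K' k) (v k) x) + (\<Sum>k<m. Z' k x * z k)"
    by (rule pi_opE[OF assms(2)]) blast
  show ?thesis
  proof (rule pi_opI[where R="\<lambda>k x. R k x + R' k x" and K="\<lambda>k x. K k x + K' k x" and Z="\<lambda>k x. Z k x + Z' k x"])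
    fix v :: "real vfun" and z :: rvec and x :: real assume v: "v \<in> L2 n {a..b}" and x: "x \<in> {a..b}"
    have "(\<Sum>k<n. kop {a..b} (\<lambda>x. K k x + K' k x) (v k) x) = (\<Sum>k<n. kop {a..b} (K k) (v k) x + kop {a..b} (K' k) (v k) x)"
      using 1 2 L2_integrable[OF v] x by (intro sum.cong kop_add_kernel) auto
    then show "Op1 v z x + Op2 v z x = (\<Sum>k<n. (R k x + R' k x) * v k x)
        + (\<Sum>k<n. kop {a..b} (\<lambda>x. K k x + K' k x) (v k) x) + (\<Sum>k<m. (Z k x + Z' k x) * z k)"
      using 1(4)[OF v x] 2(4)[OF v x] by (simp add: sum.distrib distrib_right)
  qed (use 1 2 in \<open>auto intro: bddf_add\<close>)
qed

lemma pi_op_bddf_mult: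
  assumes "pi_op a b n m Op" and \<rho>: "\<rho> \<in> bddf {a..b}"
  shows "pi_op a b n m (\<lambda>v z x. \<rho> x * Op v z x)"
proof -
  obtain R K Z where 1: "\<And>k. k < n \<Longrightarrow> R k \<in> bddf {a..b}" "\<And>k. k < n \<Longrightarrow> K k \<in> bddf ({a..b} \<times> {a..b})" "\<And>k. k < m \<Longrightarrow> Z k \<in> bddf {a..b}"
    "\<And>v z x. v \<in> L2 n {a..b} \<Longrightarrow> x \<in> {a..b} \<Longrightarrow> Op v z x =
      (\<Sum>k<n. R k x * v k x) + (\<Sum>k<n. kop {a..b} (K k) (v k) x) + (\<Sum>k<m. Z k x * z k)"
    by (rule pi_opE[OF assms(1)]) blast
  show ?thesis
  proof (rule pi_opI[where R="\<lambda>k x. \<rho> x * R k x" and K="\<lambda>k p. \<rho> (fst p) * K k p" and Z="\<lambda>k x. \<rho> x * Z k x"])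
    fix v :: "real vfun" and z :: rvec and x :: real assume v: "v \<in> L2 n {a..b}" and x: "x \<in> {a..b}"
    show "\<rho> x * Op v z x = (\<Sum>k<n. (\<rho> x * R k x) * v k x)
        + (\<Sum>k<n. kop {a..b} (\<lambda>p. \<rho> (fst p) * K k p) (v k) x) + (\<Sum>k<m. (\<rho> x * Z k x) * z k)"
      using 1(4)[OF v x] by (simp add: sum_distrib_left distrib_left mult.assoc kop_def)
  next
    show "(\<lambda>p. \<rho> (fst p) * K k p) \<in> bddf ({a..b} \<times> {a..b})" if "k < n" for k
      using 1(2)[OF that] rect_bddf_fst[OF compact_Icc compact_Icc \<rho>] by (intro bddf_mult)
  qed (use 1 \<rho> in \<open>auto intro: bddf_mult\<close>)
qed

lemma pi_op_sum:
  "finite I \<Longrightarrow> (\<And>i. i \<in> I \<Longrightarrow> pi_op a b n m (Op i)) \<Longrightarrow> pi_op a b n m (\<lambda>v z x. \<Sum>i\<in>I. Op i v z x)"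
  by (induction I rule: finite_induct) (auto intro: pi_op_zero pi_op_add)

lemma pi_op_sqint:
  assumes "pi_op a b n m Op" and v: "v \<in> L2 n {a..b}"
  shows "Op v z \<in> sqint {a..b}"
proof -
  obtain R K Z where 1: "\<And>k. k < n \<Longrightarrow> R k \<in> bddf {a..b}" "\<And>k. k < n \<Longrightarrow> K k \<in> bddf ({a..b} \<times> {a..b})" "\<And>k. k < m \<Longrightarrow> Z k \<in> bddf {a..b}"
    "\<And>v z x. v \<in> L2 n {a..b} \<Longrightarrow> x \<in> {a..b} \<Longrightarrow> Op v z x =
      (\<Sum>k<n. R k x * v k x) + (\<Sum>k<n. kop {a..b} (K k) (v k) x) + (\<Sum>k<m. Z k x * z k)"
    by (rule pi_opE[OF assms(1)]) blast
  let ?h = "\<lambda>x. (\<Sum>k<n. R k x * v k x) + (\<Sum>k<n. kop {a..b} (K k) (v k) x) + (\<Sum>k<m. Z k x * z k)"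
  have h: "?h \<in> sqint {a..b}"
    using 1 L2_sqint[OF v] L2_integrable[OF v]
    by (intro sqint_add sqint_sum bddf_mult_sqint bddf_sqint[OF kop_bddf] bddf_sqint[OF bddf_mult] bddf_const) auto
  have eq: "?h x = Op v z x" if "x \<in> space (lborel_on {a..b})" for x
    using 1(4)[OF v, of x z] that by simp
  have "Op v z \<in> borel_measurable (lborel_on {a..b})"
    by (rule measurable_cong[THEN iffD1, OF eq sqint_measurable[OF h]])
  from sqint_cong_AE[OF AE_I2[OF eq] h this] show ?thesis .
qed

text \<open>
  The multiplier part is absorbed into the kernel, and the kernel part is composed by Fubini's theorem;
  so no multiplier remains in the composition.
\<close>

lemma pi_op_kop:
  assumes "pi_op a b n m Op" and \<rho>: "\<rho> \<in> bddf ({a..b} \<times> {a..b})"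
  shows "\<exists>K Z. (\<forall>k<n. K k \<in> bddf ({a..b} \<times> {a..b})) \<and> (\<forall>k<m. Z k \<in> bddf {a..b}) \<and>
    (\<forall>v\<in>L2 n {a..b}. \<forall>z. \<forall>x\<in>{a..b}. kop {a..b} \<rho> (Op v z) x = (\<Sum>k<n. kop {a..b} (K k) (v k) x) + (\<Sum>k<m. Z k x * z k))"
proof -
  obtain R K Z where 1: "\<And>k. k < n \<Longrightarrow> R k \<in> bddf {a..b}" "\<And>k. k < n \<Longrightarrow> K k \<in> bddf ({a..b} \<times> {a..b})" "\<And>k. k < m \<Longrightarrow> Z k \<in> bddf {a..b}"
    "\<And>v z x. v \<in> L2 n {a..b} \<Longrightarrow> x \<in> {a..b} \<Longrightarrow> Op v z x =
      (\<Sum>k<n. R k x * v k x) + (\<Sum>k<n. kop {a..b} (K k) (v k) x) + (\<Sum>k<m. Z k x * z k)"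
    by (rule pi_opE[OF assms(1)]) blast
  define L where "L k = (\<lambda>(x, w). LINT y|lborel_on {a..b}. \<rho> (x, y) * K k (y, w))" for k
  note comp = kernel_compose[OF compact_Icc compact_Icc compact_Icc \<rho> 1(2), folded L_def]
  define K' where "K' k = (\<lambda>p. \<rho> p * R k (snd p) + L k p)" for k
  define Z' where "Z' k x = kop {a..b} \<rho> (Z k) x" for k x
  have rho_int: "integrable (lborel_on {a..b}) (\<lambda>y. \<rho> (x, y) * g y)" if "x \<in> {a..b}" "integrable (lborel_on {a..b}) g" for x g
    using that by (intro kernel_times_integrable[OF _ _ \<rho>]) auto
  have b1: "(\<lambda>p. \<rho> p * R k (snd p)) \<in> bddf ({a..b} \<times> {a..b})" if "k < n" for k
    using that by (intro bddf_mult \<rho> rect_bddf_snd 1) auto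
  have "kop {a..b} \<rho> (Op v z) x = (\<Sum>k<n. kop {a..b} (K' k) (v k) x) + (\<Sum>k<m. Z' k x * z k)"
    if v: "v \<in> L2 n {a..b}" and x: "x \<in> {a..b}" for v z x
  proof -
    note vi = L2_integrable[OF v _ compact_Icc]
    have i1: "integrable (lborel_on {a..b}) (\<lambda>y. \<rho> (x, y) * (R k y * v k y))" if "k < n" for k
      by (intro rho_int x bddf_mult_integrable 1 vi that)
    have i2: "integrable (lborel_on {a..b}) (\<lambda>y. \<rho> (x, y) * kop {a..b} (K k) (v k) y)" if "k < n" for k
      by (intro rho_int x bddf_integrable[OF kop_bddf] 1 vi that) auto
    have i3: "integrable (lborel_on {a..b}) (\<lambda>y. \<rho> (x, y) * (Z k y * z k))" if "k < m" for k
      by (intro rho_int x integrable_mult_left bddf_integrable 1 that) auto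
    have "kop {a..b} \<rho> (Op v z) x = (LINT y|lborel_on {a..b}. (\<Sum>k<n. \<rho> (x, y) * (R k y * v k y))
        + (\<Sum>k<n. \<rho> (x, y) * kop {a..b} (K k) (v k) y) + (\<Sum>k<m. \<rho> (x, y) * (Z k y * z k)))"
      unfolding kop_def[of _ \<rho>] using 1(4)[OF v]
      by (intro Bochner_Integration.integral_cong) (auto simp: distrib_left sum_distrib_left)
    also have "\<dots> = (\<Sum>k<n. LINT y|lborel_on {a..b}. \<rho> (x, y) * (R k y * v k y))
        + (\<Sum>k<n. LINT y|lborel_on {a..b}. \<rho> (x, y) * kop {a..b} (K k) (v k) y)
        + (\<Sum>k<m. LINT y|lborel_on {a..b}. \<rho> (x, y) * (Z k y * z k))"
    proof -
      have s: "integrable (lborel_on {a..b}) (\<lambda>y. \<Sum>k<n. \<rho> (x, y) * (R k y * v k y))"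
        "integrable (lborel_on {a..b}) (\<lambda>y. \<Sum>k<n. \<rho> (x, y) * kop {a..b} (K k) (v k) y)"
        "integrable (lborel_on {a..b}) (\<lambda>y. \<Sum>k<m. \<rho> (x, y) * (Z k y * z k))"
        using i1 i2 i3 by (auto intro!: Bochner_Integration.integrable_sum)
      show ?thesis
        unfolding Bochner_Integration.integral_add[OF Bochner_Integration.integrable_add[OF s(1,2)] s(3)]
          Bochner_Integration.integral_add[OF s(1,2)]
        using i1 i2 i3 by (subst (1 2 3) Bochner_Integration.integral_sum) auto
    qed
    also have "(\<Sum>k<n. LINT y|lborel_on {a..b}. \<rho> (x, y) * (R k y * v k y)) = (\<Sum>k<n. kop {a..b} (\<lambda>p. \<rho> p * R k (snd p)) (v k) x)"
      by (simp add: kop_def mult.assoc)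
    also have "(\<Sum>k<n. LINT y|lborel_on {a..b}. \<rho> (x, y) * kop {a..b} (K k) (v k) y) = (\<Sum>k<n. kop {a..b} (L k) (v k) x)"
      using comp(2)[OF _ vi x] by (intro sum.cong) (auto simp: kop_def)
    also have "(\<Sum>k<m. LINT y|lborel_on {a..b}. \<rho> (x, y) * (Z k y * z k)) = (\<Sum>k<m. Z' k x * z k)"
      by (simp add: Z'_def kop_def mult.assoc[symmetric])
    also have "(\<Sum>k<n. kop {a..b} (\<lambda>p. \<rho> p * R k (snd p)) (v k) x) + (\<Sum>k<n. kop {a..b} (L k) (v k) x) = (\<Sum>k<n. kop {a..b} (K' k) (v k) x)"
      unfolding sum.distrib[symmetric] K'_def
      by (intro sum.cong refl kop_add_kernel[symmetric] b1 comp(1) vi x) auto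
    finally show ?thesis .
  qed
  moreover have "\<forall>k<n. K' k \<in> bddf ({a..b} \<times> {a..b})"
    unfolding K'_def by (intro allI impI bddf_add b1 comp(1))
  moreover have "\<forall>k<m. Z' k \<in> bddf {a..b}"
    unfolding Z'_def[abs_def] by (intro allI impI kop_bddf[OF _ _ \<rho>] bddf_integrable 1) auto
  ultimately show ?thesis by blast
qed

lemma pi_op_prim:
  assumes "pi_op a b n m Op"
  shows "pi_op a b n m (\<lambda>v z. prim a (Op v z))"
proof -
  obtain K Z where 1: "\<forall>k<n. K k \<in> bddf ({a..b} \<times> {a..b})" "\<forall>k<m. Z k \<in> bddf {a..b}"
    "\<And>v z x. v\<in>L2 n {a..b} \<Longrightarrow> x\<in>{a..b} \<Longrightarrow> kop {a..b} step_kernel (Op v z) x = (\<Sum>k<n. kop {a..b} (K k) (v k) x) + (\<Sum>k<m. Z k x * z k)"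
    using pi_op_kop[OF assms step_kernel_bddf] by blast
  then show ?thesis
    by (intro pi_opI[where R="\<lambda>k x. 0" and K=K and Z=Z]) (auto simp: prim_kop[of _ a b] bddf_const)
qed

lemma pi_fun_zero: "pi_fun a b n m (\<lambda>v z. 0)"
  unfolding pi_fun_def by (intro exI[of _ "\<lambda>k y. 0"] exI[of _ "\<lambda>k. 0"]) (auto intro: bddf_const)

lemma pi_fun_coord: "i < m \<Longrightarrow> pi_fun a b n m (\<lambda>v z. z i)"
proof -
  assume i: "i < m"
  have "z i = (\<Sum>k<m. (if k = i then 1 else 0) * z k)" for z :: rvec
  proof -
    have "(\<Sum>k<m. (if k = i then 1 else 0) * z k) = (\<Sum>k<m. if k = i then z k else 0)"
      by (intro sum.cong) auto
    with i show ?thesis by simp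
  qed
  then show ?thesis
    unfolding pi_fun_def by (intro exI[of _ "\<lambda>k y. 0"] exI[of _ "\<lambda>k. if k = i then 1 else 0"]) (auto intro: bddf_const)
qed

lemma pi_fun_add:
  assumes "pi_fun a b n m F" "pi_fun a b n m G"
  shows "pi_fun a b n m (\<lambda>v z. F v z + G v z)"
proof -
  obtain \<kappa> \<zeta> where 1: "\<And>k. k < n \<Longrightarrow> \<kappa> k \<in> bddf {a..b}"
    "\<And>v z. v\<in>L2 n {a..b} \<Longrightarrow> F v z = (\<Sum>k<n. LINT y|lborel_on {a..b}. \<kappa> k y * v k y) + (\<Sum>k<m. \<zeta> k * z k)"
    using assms(1) unfolding pi_fun_def by blast
  obtain \<kappa>' \<zeta>' where 2: "\<And>k. k < n \<Longrightarrow> \<kappa>' k \<in> bddf {a..b}"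
    "\<And>v z. v\<in>L2 n {a..b} \<Longrightarrow> G v z = (\<Sum>k<n. LINT y|lborel_on {a..b}. \<kappa>' k y * v k y) + (\<Sum>k<m. \<zeta>' k * z k)"
    using assms(2) unfolding pi_fun_def by blast
  have "F v z + G v z = (\<Sum>k<n. LINT y|lborel_on {a..b}. (\<kappa> k y + \<kappa>' k y) * v k y) + (\<Sum>k<m. (\<zeta> k + \<zeta>' k) * z k)"
    if v: "v \<in> L2 n {a..b}" for v z
  proof -
    have "(LINT y|lborel_on {a..b}. (\<kappa> k y + \<kappa>' k y) * v k y)
        = (LINT y|lborel_on {a..b}. \<kappa> k y * v k y) + (LINT y|lborel_on {a..b}. \<kappa>' k y * v k y)" if "k < n" for k
      using 1(1)[OF that] 2(1)[OF that] L2_integrable[OF v that compact_Icc]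
      by (simp add: distrib_right bddf_mult_integrable)
    then show ?thesis using 1(2)[OF v] 2(2)[OF v] by (simp add: sum.distrib distrib_right)
  qed
  with 1(1) 2(1) show ?thesis
    unfolding pi_fun_def
    by (intro exI[of _ "\<lambda>k y. \<kappa> k y + \<kappa>' k y"] exI[of _ "\<lambda>k. \<zeta> k + \<zeta>' k"]) (auto intro: bddf_add)
qed

lemma pi_fun_cmult:
  assumes "pi_fun a b n m F"
  shows "pi_fun a b n m (\<lambda>v z. c * F v z)"
proof -
  obtain \<kappa> \<zeta> where 1: "\<And>k. k < n \<Longrightarrow> \<kappa> k \<in> bddf {a..b}"
    "\<And>v z. v\<in>L2 n {a..b} \<Longrightarrow> F v z = (\<Sum>k<n. LINT y|lborel_on {a..b}. \<kappa> k y * v k y) + (\<Sum>k<m. \<zeta> k * z k)"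
    using assms(1) unfolding pi_fun_def by blast
  then show ?thesis
    unfolding pi_fun_def
    by (intro exI[of _ "\<lambda>k y. c * \<kappa> k y"] exI[of _ "\<lambda>k. c * \<zeta> k"])
      (auto intro: bddf_mult bddf_const simp: distrib_left sum_distrib_left mult.assoc)
qed

lemma pi_fun_sum:
  "finite I \<Longrightarrow> (\<And>i. i \<in> I \<Longrightarrow> pi_fun a b n m (F i)) \<Longrightarrow> pi_fun a b n m (\<lambda>v z. \<Sum>i\<in>I. F i v z)"
  by (induction I rule: finite_induct) (auto intro: pi_fun_zero pi_fun_add)

lemma pi_fun_cong:
  assumes "pi_fun a b n m F" "\<And>v z. v \<in> L2 n {a..b} \<Longrightarrow> F' v z = F v z"
  shows "pi_fun a b n m F'"
  using assms unfolding pi_fun_def by auto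

lemma pi_fun_imp_op:
  assumes "pi_fun a b n m F"
  shows "pi_op a b n m (\<lambda>v z x. F v z)"
proof -
  obtain \<kappa> \<zeta> where 1: "\<And>k. k < n \<Longrightarrow> \<kappa> k \<in> bddf {a..b}"
    "\<And>v z. v\<in>L2 n {a..b} \<Longrightarrow> F v z = (\<Sum>k<n. LINT y|lborel_on {a..b}. \<kappa> k y * v k y) + (\<Sum>k<m. \<zeta> k * z k)"
    using assms(1) unfolding pi_fun_def by blast
  show ?thesis
    by (rule pi_opI[where R="\<lambda>k x. 0" and K="\<lambda>k p. \<kappa> k (snd p)" and Z="\<lambda>k x. \<zeta> k"])
      (use 1 in \<open>auto simp: kop_def bddf_const intro: rect_bddf_snd\<close>)
qed

text \<open>
  An instance of composition with an integral operator: the integral is the value at one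
  point of the operator whose kernel does not depend on that point.
\<close>

lemma pi_fun_integral:
  assumes ab: "a \<le> b" and "pi_op a b n m Op" and \<rho>: "\<rho> \<in> bddf {a..b}"
  shows "pi_fun a b n m (\<lambda>v z. LINT y|lborel_on {a..b}. \<rho> y * Op v z y)"
proof -
  have "(\<lambda>p. \<rho> (snd p)) \<in> bddf ({a..b} \<times> {a..b})" by (intro rect_bddf_snd \<rho>) auto
  from pi_op_kop[OF assms(2) this] obtain K Z where
    1: "\<forall>k<n. K k \<in> bddf ({a..b} \<times> {a..b})"
    "\<And>v z x. v\<in>L2 n {a..b} \<Longrightarrow> x\<in>{a..b} \<Longrightarrow> kop {a..b} (\<lambda>p. \<rho> (snd p)) (Op v z) x = (\<Sum>k<n. kop {a..b} (K k) (v k) x) + (\<Sum>k<m. Z k x * z k)"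
    by blast
  have "(LINT y|lborel_on {a..b}. \<rho> y * Op v z y) = (\<Sum>k<n. LINT y|lborel_on {a..b}. K k (a, y) * v k y) + (\<Sum>k<m. Z k a * z k)"
    if "v \<in> L2 n {a..b}" for v z
    using 1(2)[OF that, of a z] ab by (simp add: kop_def)
  moreover have "(\<lambda>y. K k (a, y)) \<in> bddf {a..b}" if "k < n" for k
    using 1(1) that ab by (intro rect_bddf_section1[OF compact_Icc compact_Icc]) auto
  ultimately show ?thesis
    unfolding pi_fun_def by (intro exI[of _ "\<lambda>k y. K k (a, y)"] exI[of _ "\<lambda>k. Z k a"]) auto
qed

lemma pi_op_lin:
  assumes "pi_op a b n m Op" and v: "v \<in> L2 n {a..b}" "v' \<in> L2 n {a..b}" and x: "x \<in> {a..b}"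
  shows "Op (\<lambda>k x. v k x + c * v' k x) (\<lambda>k. z k + c * z' k) x = Op v z x + c * Op v' z' x"
proof -
  obtain R K Z where 1: "\<And>k. k < n \<Longrightarrow> R k \<in> bddf {a..b}" "\<And>k. k < n \<Longrightarrow> K k \<in> bddf ({a..b} \<times> {a..b})" "\<And>k. k < m \<Longrightarrow> Z k \<in> bddf {a..b}"
    "\<And>v z x. v \<in> L2 n {a..b} \<Longrightarrow> x \<in> {a..b} \<Longrightarrow> Op v z x =
      (\<Sum>k<n. R k x * v k x) + (\<Sum>k<n. kop {a..b} (K k) (v k) x) + (\<Sum>k<m. Z k x * z k)"
    by (rule pi_opE[OF assms(1)]) blast
  have l2: "(\<lambda>k x. v k x + c * v' k x) \<in> L2 n {a..b}"
    using v unfolding L2_def by (auto intro!: sqint_add sqint_cmult)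
  have "kop {a..b} (K k) (\<lambda>x. v k x + c * v' k x) x = kop {a..b} (K k) (v k) x + c * kop {a..b} (K k) (v' k) x" if "k < n" for k
  proof -
    have "integrable (lborel_on {a..b}) (\<lambda>y. K k (x, y) * v k y)" "integrable (lborel_on {a..b}) (\<lambda>y. K k (x, y) * v' k y)"
      using L2_integrable[OF v(1) that] L2_integrable[OF v(2) that] 1(2)[OF that] x
      by (auto intro!: kernel_times_integrable[of "{a..b}"])
    then show ?thesis by (simp add: kop_def distrib_left mult.left_commute[of _ c])
  qed
  then show ?thesis
    using 1(4)[OF l2 x] 1(4)[OF v(1) x] 1(4)[OF v(2) x]
    by (simp add: sum.distrib distrib_left sum_distrib_left mult.left_commute[of _ c])
qed

lemma pi_fun_lin:
  assumes "pi_fun a b n m F" and v: "v \<in> L2 n {a..b}" "v' \<in> L2 n {a..b}" and ab: "a \<le> b"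
  shows "F (\<lambda>k x. v k x + c * v' k x) (\<lambda>k. z k + c * z' k) = F v z + c * F v' z'"
  using pi_op_lin[OF pi_fun_imp_op[OF assms(1)] v, of a c z z'] ab by simp

text \<open>Multipliers act pointwise, and an integral depends only on the class of its integrand.\<close>

lemma pi_op_cong_AE:
  assumes "pi_op a b n m Op" and v: "v \<in> L2 n {a..b}" "v' \<in> L2 n {a..b}"
    and eq: "eqf n {a..b} v v'" "eqv m z z'"
  shows "AE x in lborel_on {a..b}. Op v z x = Op v' z' x"
proof -
  obtain R K Z where 1: "\<And>k. k < n \<Longrightarrow> R k \<in> bddf {a..b}" "\<And>k. k < n \<Longrightarrow> K k \<in> bddf ({a..b} \<times> {a..b})" "\<And>k. k < m \<Longrightarrow> Z k \<in> bddf {a..b}"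
    "\<And>v z x. v \<in> L2 n {a..b} \<Longrightarrow> x \<in> {a..b} \<Longrightarrow> Op v z x =
      (\<Sum>k<n. R k x * v k x) + (\<Sum>k<n. kop {a..b} (K k) (v k) x) + (\<Sum>k<m. Z k x * z k)"
    by (rule pi_opE[OF assms(1)]) blast
  have ae: "AE x in lborel_on {a..b}. \<forall>k\<in>{..<n}. v k x = v' k x"
    using eq(1) by (intro AE_finite_allI) (auto simp: eqf_def)
  have kop: "kop {a..b} (K k) (v k) x = kop {a..b} (K k) (v' k) x" if "k < n" "x \<in> {a..b}" for k x
    unfolding kop_def
  proof (rule integral_cong_AE)
    show "(\<lambda>y. K k (x, y) * v k y) \<in> borel_measurable (lborel_on {a..b})"
      "(\<lambda>y. K k (x, y) * v' k y) \<in> borel_measurable (lborel_on {a..b})"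
      using kernel_times_integrable[OF compact_Icc compact_Icc 1(2)[OF that(1)] that(2)]
        L2_integrable[OF v(1) that(1)] L2_integrable[OF v(2) that(1)] by auto
    show "AE y in lborel_on {a..b}. K k (x, y) * v k y = K k (x, y) * v' k y"
      using eq(1) that by (auto simp: eqf_def)
  qed
  have "AE x in lborel_on {a..b}. x \<in> {a..b}" by (intro AE_I2) simp
  with ae show ?thesis
    by eventually_elim (use 1(4)[OF v(1)] 1(4)[OF v(2)] kop eq(2) in \<open>simp add: eqv_def\<close>)
qed

lemma pi_op_tdiff:
  assumes "pi_op a b n m Op" and t: "0 \<le> t"
    and v: "\<And>r. 0 \<le> r \<Longrightarrow> v r \<in> L2 n {a..b}" "v' \<in> L2 n {a..b}"
    and dv: "\<And>k. k < n \<Longrightarrow> tdiff {a..b} (\<lambda>r. v r k) (v' k) t"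
    and dz: "\<And>k. k < m \<Longrightarrow> ((\<lambda>r. z r k) has_vector_derivative z' k) (at t within {0..})"
  shows "tdiff {a..b} (\<lambda>r. Op (v r) (z r)) (Op v' z') t"
proof -
  obtain R K Z where 1: "\<And>k. k < n \<Longrightarrow> R k \<in> bddf {a..b}" "\<And>k. k < n \<Longrightarrow> K k \<in> bddf ({a..b} \<times> {a..b})" "\<And>k. k < m \<Longrightarrow> Z k \<in> bddf {a..b}"
    "\<And>v z x. v \<in> L2 n {a..b} \<Longrightarrow> x \<in> {a..b} \<Longrightarrow> Op v z x =
      (\<Sum>k<n. R k x * v k x) + (\<Sum>k<n. kop {a..b} (K k) (v k) x) + (\<Sum>k<m. Z k x * z k)"
    by (rule pi_opE[OF assms(1)]) blast
  let ?h = "\<lambda>v z x. (\<Sum>k<n. R k x * v k x) + (\<Sum>k<n. kop {a..b} (K k) (v k) x) + (\<Sum>k<m. z k * Z k x)"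
  have s: "(\<lambda>x. R k x * v k x) \<in> sqint {a..b}" "kop {a..b} (K k) (v k) \<in> sqint {a..b}" if "v \<in> L2 n {a..b}" "k < n" for v k
    using 1 L2_sqint[OF that] L2_integrable[OF that] that
    by (auto intro!: bddf_mult_sqint bddf_sqint[OF kop_bddf])
  have sz: "(\<lambda>x. y * Z k x) \<in> sqint {a..b}" if "k < m" for y k
    using 1 that by (intro sqint_cmult bddf_sqint) auto
  have hs: "?h v z \<in> sqint {a..b}" if "v \<in> L2 n {a..b}" for v z
    by (intro sqint_add sqint_sum s sz that) auto
  have d1: "tdiff {a..b} (\<lambda>r x. R k x * v r k x) (\<lambda>x. R k x * v' k x) t" if k: "k < n" for k
    by (rule tdiff_bddf_mult[OF 1(1)[OF k] dv[OF k] t L2_sqint[OF v(1) k] L2_sqint[OF v(2) k]])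
  have d2: "tdiff {a..b} (\<lambda>r. kop {a..b} (K k) (v r k)) (kop {a..b} (K k) (v' k)) t" if k: "k < n" for k
  proof -
    obtain C where C: "\<forall>f\<in>sqint {a..b}. normsq {a..b} (kop {a..b} (K k) f) \<le> C * normsq {a..b} f"
      using kop_L2_bounded[OF compact_Icc compact_Icc 1(2)[OF k]] by blast
    show ?thesis
    proof (rule tdiff_bounded[OF dv[OF k] t, where C=C and K="kop {a..b} (K k)"])
      fix g h c assume g: "g \<in> sqint {a..b}" and h: "h \<in> sqint {a..b}"
      have "kop {a..b} (K k) (\<lambda>x. g x + c * h x) x = kop {a..b} (K k) g x + c * kop {a..b} (K k) h x" if x: "x \<in> {a..b}" for x
      proof -
        have "integrable (lborel_on {a..b}) (\<lambda>y. K k (x, y) * g y)" "integrable (lborel_on {a..b}) (\<lambda>y. K k (x, y) * h y)"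
          using sqint_integrable[OF g] sqint_integrable[OF h] 1(2)[OF k] x
          by (auto intro!: kernel_times_integrable[of "{a..b}"])
        then show ?thesis by (simp add: kop_def distrib_left mult.left_commute[of _ c])
      qed
      then show "AE x in lborel_on {a..b}. kop {a..b} (K k) (\<lambda>x. g x + c * h x) x = kop {a..b} (K k) g x + c * kop {a..b} (K k) h x"
        by (intro AE_I2) simp
    next
      fix g assume "g \<in> sqint {a..b}"
      then show "kop {a..b} (K k) g \<in> sqint {a..b}"
        using 1(2)[OF k] by (intro bddf_sqint kop_bddf) (auto simp: sqint_integrable)
    qed (use C L2_sqint[OF v(1) k] L2_sqint[OF v(2) k] in auto)
  qed
  have d3: "tdiff {a..b} (\<lambda>r x. z r k * Z k x) (\<lambda>x. z' k * Z k x) t" if k: "k < m" for k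
    by (rule tdiff_scalar[OF dz[OF k]]) (use 1(3)[OF k] in \<open>auto intro: bddf_sqint\<close>)
  have "tdiff {a..b} (\<lambda>r. ?h (v r) (z r)) (?h v' z') t"
    using v by (intro tdiff_add tdiff_sum d1 d2 d3 t sqint_add sqint_sum s sz) auto
  then show ?thesis
    by (rule tdiff_cong_AE[OF _ t])
      (use hs v pi_op_sqint[OF assms(1)] 1(4) in \<open>auto intro!: AE_I2 simp: mult.commute[of "Z _ _"]\<close>)
qed

section \<open>Functions of two variables\<close>

lemma
  assumes S: "compact (S :: 'a::euclidean_space set)" and T: "compact (T :: 'b::euclidean_space set)" and f: "f \<in> sqint (S \<times> T)"
  shows sqint_swap: "(\<lambda>(y, x). f (x, y)) \<in> sqint (T \<times> S)"
    and normsq_swap: "normsq (T \<times> S) (\<lambda>(y, x). f (x, y)) = normsq (S \<times> T) f"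
proof -
  interpret pair_sigma_finite "lborel_on S" "lborel_on T"
    by (rule pair_sigma_finite_lborel_on[OF S T])
  have "integrable (lborel_on S \<Otimes>\<^sub>M lborel_on T) (\<lambda>p. (f p)\<^sup>2)"
    using sqint_integrable_sq[OF f] unfolding lborel_on_prod[OF S T] .
  from integrable_product_swap[OF this]
  have "integrable (lborel_on (T \<times> S)) (\<lambda>p. ((\<lambda>(y, x). f (x, y)) p)\<^sup>2)"
    unfolding lborel_on_prod[OF T S] by (simp add: case_prod_beta')
  with rect_swap[OF S T sqint_measurable[OF f]]
  show s: "(\<lambda>(y, x). f (x, y)) \<in> sqint (T \<times> S)" by (simp add: sqint_def)
  show "normsq (T \<times> S) (\<lambda>(y, x). f (x, y)) = normsq (S \<times> T) f"
    using rect_normsq1[OF T S s] rect_normsq2[OF S T f] by simp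
qed

lemma
  assumes S: "compact (S :: 'a::euclidean_space set)" and T: "compact (T :: 'b::euclidean_space set)" and f: "f \<in> sqint S"
  shows sqint_rect_fst: "(\<lambda>p. f (fst p)) \<in> sqint (S \<times> T)"
    and normsq_rect_fst: "normsq (S \<times> T) (\<lambda>p. f (fst p)) = measure (lborel_on T) T * normsq S f"
proof -
  have i: "integrable (lborel_on (S \<times> T)) (\<lambda>p. (f (fst p))\<^sup>2)"
    by (rule rect_integrable_fst[OF S T sqint_integrable_sq[OF f]])
  with rect_measurable_fst[OF S T sqint_measurable[OF f]]
  show "(\<lambda>p. f (fst p)) \<in> sqint (S \<times> T)" by (simp add: sqint_def)
  show "normsq (S \<times> T) (\<lambda>p. f (fst p)) = measure (lborel_on T) T * normsq S f"
    using rect_integral1[OF S T i, symmetric] by (simp add: normsq_def)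
qed

lemma
  assumes S: "compact (S :: 'a::euclidean_space set)" and T: "compact (T :: 'b::euclidean_space set)" and f: "f \<in> sqint T"
  shows sqint_rect_snd: "(\<lambda>p. f (snd p)) \<in> sqint (S \<times> T)"
    and normsq_rect_snd: "normsq (S \<times> T) (\<lambda>p. f (snd p)) = measure (lborel_on S) S * normsq T f"
proof -
  have i: "integrable (lborel_on (S \<times> T)) (\<lambda>p. (f (snd p))\<^sup>2)"
    by (rule rect_integrable_snd[OF S T sqint_integrable_sq[OF f]])
  with rect_measurable_snd[OF S T sqint_measurable[OF f]]
  show "(\<lambda>p. f (snd p)) \<in> sqint (S \<times> T)" by (simp add: sqint_def)
  show "normsq (S \<times> T) (\<lambda>p. f (snd p)) = measure (lborel_on S) S * normsq T f"
    using rect_integral1[OF S T i, symmetric] by (simp add: normsq_def)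
qed

lemma tdiff_rect_fst:
  assumes "compact (S :: 'a::euclidean_space set)" "compact (T :: 'b::euclidean_space set)" "tdiff S f f' t" "0 \<le> t"
    "\<And>r. 0 \<le> r \<Longrightarrow> f r \<in> sqint S" "f' \<in> sqint S"
  shows "tdiff (S \<times> T) (\<lambda>r p. f r (fst p)) (\<lambda>p. f' (fst p)) t"
  by (rule tdiff_bounded[OF assms(3-6), where K="\<lambda>g p. g (fst p)" and C="measure (lborel_on T) T"])
    (auto simp: sqint_rect_fst normsq_rect_fst assms)

lemma tdiff_rect_snd:
  assumes "compact (S :: 'a::euclidean_space set)" "compact (T :: 'b::euclidean_space set)" "tdiff T f f' t" "0 \<le> t"
    "\<And>r. 0 \<le> r \<Longrightarrow> f r \<in> sqint T" "f' \<in> sqint T"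
  shows "tdiff (S \<times> T) (\<lambda>r p. f r (snd p)) (\<lambda>p. f' (snd p)) t"
  by (rule tdiff_bounded[OF assms(3-6), where K="\<lambda>g p. g (snd p)" and C="measure (lborel_on S) S"])
    (auto simp: sqint_rect_snd normsq_rect_snd assms)

lemma klift_lin_AE:
  fixes K :: "'a::euclidean_space \<times> 'b::euclidean_space \<Rightarrow> real"
  assumes R: "compact (R :: 'r::euclidean_space set)" and S: "compact S" and T: "compact T"
    and K: "K \<in> bddf (S \<times> T)" and g: "g \<in> sqint (R \<times> T)" and h: "h \<in> sqint (R \<times> T)"
  shows "AE p in lborel_on (R \<times> S). klift T K (\<lambda>p. g p + c * h p) p = klift T K g p + c * klift T K h p"
proof -
  have "AE r in lborel_on R. (\<lambda>y. g (r, y)) \<in> sqint T \<and> (\<lambda>y. h (r, y)) \<in> sqint T"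
    using rect_AE_sqint1[OF R T g] rect_AE_sqint1[OF R T h] by eventually_elim simp
  from rect_AE_fst[OF R S this]
  have "AE p in lborel_on (R \<times> S). (\<lambda>y. g (fst p, y)) \<in> sqint T \<and> (\<lambda>y. h (fst p, y)) \<in> sqint T" .
  moreover have "AE p in lborel_on (R \<times> S). snd p \<in> S" by (intro AE_I2) auto
  ultimately show ?thesis
  proof eventually_elim
    case (elim p)
    then have "integrable (lborel_on T) (\<lambda>y. K (snd p, y) * g (fst p, y))" "integrable (lborel_on T) (\<lambda>y. K (snd p, y) * h (fst p, y))"
      using K S T by (auto intro!: kernel_times_integrable[of S] simp: sqint_integrable)
    then show ?case
      by (simp add: klift_def kop_def case_prod_beta distrib_left mult.left_commute[of _ c])
  qed
qed

lemma tdiff_klift: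
  fixes K :: "'a::euclidean_space \<times> 'b::euclidean_space \<Rightarrow> real"
  assumes R: "compact (R :: 'r::euclidean_space set)" and S: "compact S" and T: "compact T"
    and K: "K \<in> bddf (S \<times> T)"
    and d: "tdiff (R \<times> T) f f' t" "0 \<le> t" "\<And>r. 0 \<le> r \<Longrightarrow> f r \<in> sqint (R \<times> T)" "f' \<in> sqint (R \<times> T)"
  shows "tdiff (R \<times> S) (\<lambda>r. klift T K (f r)) (klift T K f') t"
proof -
  obtain C where C: "\<forall>f\<in>sqint (R \<times> T). klift T K f \<in> sqint (R \<times> S) \<and> normsq (R \<times> S) (klift T K f) \<le> C * normsq (R \<times> T) f"
    using klift_L2[OF R S T K] by blast
  show ?thesis
    by (rule tdiff_bounded[OF d, where K="klift T K" and C=C]) (use C klift_lin_AE[OF R S T K] in auto)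
qed

lemma klift_sqint:
  fixes K :: "'a::euclidean_space \<times> 'b::euclidean_space \<Rightarrow> real"
  assumes "compact (R :: 'r::euclidean_space set)" "compact S" "compact T" "K \<in> bddf (S \<times> T)" "f \<in> sqint (R \<times> T)"
  shows "klift T K f \<in> sqint (R \<times> S)"
  using klift_L2[OF assms(1-4)] assms(5) by blast

subsection \<open>The primitive in the first variable\<close>

definition tprim :: "(real \<times> real \<Rightarrow> real) \<Rightarrow> real \<times> real \<Rightarrow> real"
  where "tprim f = (\<lambda>(s, x). LINT \<theta>|lborel_on {0..s}. f (\<theta>, x))"

lemma tprim_prim: "tprim f (s, x) = prim 0 (\<lambda>\<theta>. f (\<theta>, x)) s"
  by (simp add: tprim_def prim_def)

lemma tprim_kop: "s \<in> {0..1} \<Longrightarrow> tprim f (s, x) = kop {0..1} step_kernel (\<lambda>\<theta>. f (\<theta>, x)) s"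
  unfolding tprim_prim by (rule prim_kop)

lemma tprim_weight: "s \<in> {0..1} \<Longrightarrow> tprim f (s, x) = (LINT r|lborel_on {0..1}. step_kernel (s, r) * f (r, x))"
  by (simp add: tprim_kop kop_def)

lemma prim_weight: "s \<in> {0..1} \<Longrightarrow> prim 0 f s = (LINT r|lborel_on {0..1}. step_kernel (s, r) * f r)"
  by (simp add: prim_kop[of _ 0 1] kop_def)

lemma step_weight_bddf: "(\<lambda>r. step_kernel (s, r)) \<in> bddf {0..1}"
proof -
  have "(\<lambda>r. step_kernel (s, r)) = indicator {..s}"
    by (auto simp: step_kernel_def fun_eq_iff split: split_indicator)
  then have "(\<lambda>r. step_kernel (s, r)) \<in> borel_measurable (lborel_on {0..1})"
    by (auto intro!: lborel_on_measurable)
  then show ?thesis by (auto simp: bddf_def step_kernel_def intro!: exI[of _ 1])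
qed

lemma tprim_swap:
  "s \<in> {0..1} \<Longrightarrow> tprim f (s, x) = (\<lambda>(s, x). klift {0..1} step_kernel (\<lambda>(x, \<theta>). f (\<theta>, x)) (x, s)) (s, x)"
  by (simp add: tprim_kop klift_def)

text \<open>
  With the variables exchanged, the primitive in \<open>s\<close> is an integral operator in the second variable,
  so the bounds for \<open>klift\<close> apply to it.
\<close>

lemma
  assumes f: "f \<in> sqint ({0..1} \<times> {a..b})"
  shows tprim_sqint: "tprim f \<in> sqint ({0..1} \<times> {a..b})"
    and tprim_AE_swap: "AE p in lborel_on ({0..1} \<times> {a..b}).
      (\<lambda>(s, x). klift {0..1} step_kernel (\<lambda>(x, \<theta>). f (\<theta>, x)) (x, s)) p = tprim f p"
proof -
  have s: "(\<lambda>(s, x). klift {0..1} step_kernel (\<lambda>(x, \<theta>). f (\<theta>, x)) (x, s)) \<in> sqint ({0..1} \<times> {a..b})"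
    by (intro sqint_swap klift_sqint f step_kernel_bddf) auto
  have eq: "(\<lambda>(s, x). klift {0..1} step_kernel (\<lambda>(x, \<theta>). f (\<theta>, x)) (x, s)) p = tprim f p"
    if "p \<in> space (lborel_on ({0..1} \<times> {a..b}))" for p
    using that by (cases p) (auto simp: tprim_swap)
  have m: "tprim f \<in> borel_measurable (lborel_on ({0..1} \<times> {a..b}))"
    by (rule measurable_cong[THEN iffD1, OF eq sqint_measurable[OF s]])
  show "tprim f \<in> sqint ({0..1} \<times> {a..b})"
    by (rule sqint_cong_AE[OF AE_I2[OF eq] s m])
  show "AE p in lborel_on ({0..1} \<times> {a..b}).
      (\<lambda>(s, x). klift {0..1} step_kernel (\<lambda>(x, \<theta>). f (\<theta>, x)) (x, s)) p = tprim f p"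
    by (rule AE_I2[OF eq])
qed

lemma tprim_tdiff:
  assumes d: "tdiff ({0..1} \<times> {a..b}) f f' t" and t: "0 \<le> t"
    and f: "\<And>r. 0 \<le> r \<Longrightarrow> f r \<in> sqint ({0..1} \<times> {a..b})" "f' \<in> sqint ({0..1} \<times> {a..b})"
  shows "tdiff ({0..1} \<times> {a..b}) (\<lambda>r. tprim (f r)) (tprim f') t"
proof -
  have *: "tdiff (A \<times> B) (\<lambda>r. \<lambda>(y, x). g r (x, y)) (\<lambda>(y, x). g' (x, y)) t"
    if "tdiff (B \<times> A) g g' t" "compact A" "compact B" "\<And>r. 0 \<le> r \<Longrightarrow> g r \<in> sqint (B \<times> A)" "g' \<in> sqint (B \<times> A)"
    for A B :: "real set" and g g'
    by (rule tdiff_bounded[OF that(1) t that(4,5), where K="\<lambda>g. \<lambda>(y, x). g (x, y)" and C=1])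
      (auto simp: sqint_swap normsq_swap that)
  have s: "(\<lambda>(x, \<theta>). f r (\<theta>, x)) \<in> sqint ({a..b} \<times> {0..1})" "(\<lambda>(x, \<theta>). f' (\<theta>, x)) \<in> sqint ({a..b} \<times> {0..1})" if "0 \<le> r" for r
    using f that by (auto intro!: sqint_swap)
  have 1: "tdiff ({a..b} \<times> {0..1}) (\<lambda>r. \<lambda>(x, \<theta>). f r (\<theta>, x)) (\<lambda>(x, \<theta>). f' (\<theta>, x)) t"
    by (rule *) (use d f in auto)
  have 2: "tdiff ({a..b} \<times> {0..1}) (\<lambda>r. klift {0..1} step_kernel (\<lambda>(x, \<theta>). f r (\<theta>, x))) (klift {0..1} step_kernel (\<lambda>(x, \<theta>). f' (\<theta>, x))) t"
    by (rule tdiff_klift[OF _ _ _ step_kernel_bddf 1 t]) (use s t in auto)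
  have 3: "tdiff ({0..1} \<times> {a..b}) (\<lambda>r. \<lambda>(s, x). klift {0..1} step_kernel (\<lambda>(x, \<theta>). f r (\<theta>, x)) (x, s))
      (\<lambda>(s, x). klift {0..1} step_kernel (\<lambda>(x, \<theta>). f' (\<theta>, x)) (x, s)) t"
    by (rule *[OF 2]) (use s t in \<open>auto intro!: klift_sqint step_kernel_bddf\<close>)
  show ?thesis
    by (rule tdiff_cong_AE[OF 3 t])
      (use s t f in \<open>auto intro!: sqint_swap klift_sqint step_kernel_bddf tprim_sqint tprim_AE_swap\<close>)
qed

lemma rect_AE_integrable_time:
  assumes "f \<in> sqint ({0..1} \<times> {a..b::real})"
  shows "AE x in lborel_on {a..b}. integrable (lborel_on {0..1::real}) (\<lambda>r. f (r, x))"
  using rect_AE_integrable2[of "{0..1}" "{a..b}" f] assms by (simp add: sqint_integrable compact_Times)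

text \<open>The exceptional null set of \<open>x\<close> does not depend on \<open>s\<close>, which allows evaluation at particular \<open>s\<close>.\<close>

lemma tprim_cong_AE:
  assumes f: "f \<in> sqint ({0..1} \<times> {a..b})" and g: "g \<in> sqint ({0..1} \<times> {a..b})"
    and ae: "AE p in lborel_on ({0..1} \<times> {a..b}). f p = g p"
  shows "AE p in lborel_on ({0..1} \<times> {a..b}). tprim f p = tprim g p"
    and "AE x in lborel_on {a..b}. \<forall>s\<in>{0..1}. tprim f (s, x) = tprim g (s, x)"
proof -
  have "AE x in lborel_on {a..b}. AE \<theta> in lborel_on {0..1}. f (\<theta>, x) = g (\<theta>, x)"
    by (rule rect_AE2[OF _ _ ae]) auto
  with rect_AE_integrable_time[OF f] rect_AE_integrable_time[OF g]
  show 1: "AE x in lborel_on {a..b}. \<forall>s\<in>{0..1}. tprim f (s, x) = tprim g (s, x)"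
  proof eventually_elim
    case (elim x)
    show ?case
    proof
      fix s :: real assume "s \<in> {0..1}"
      then show "tprim f (s, x) = tprim g (s, x)"
        using elim bddf_mult_integrable[OF step_weight_bddf elim(1), of s] bddf_mult_integrable[OF step_weight_bddf elim(2), of s]
        by (simp only: tprim_weight) (intro integral_cong_AE; auto)
    qed
  qed
  have "AE s in lborel_on {0..1}. AE x in lborel_on {a..b}. tprim f (s, x) = tprim g (s, x)"
  proof (rule AE_I2)
    fix s :: real assume "s \<in> space (lborel_on {0..1})"
    with 1 show "AE x in lborel_on {a..b}. tprim f (s, x) = tprim g (s, x)"
      by (auto elim: eventually_mono)
  qed
  then show "AE p in lborel_on ({0..1} \<times> {a..b}). tprim f p = tprim g p"
    by (rule rect_AE_eqI[rotated 4]) (use f g in \<open>auto intro!: sqint_measurable tprim_sqint\<close>)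
qed

text \<open>The Cauchy-Schwarz inequality in \<open>s\<close>, for almost every \<open>x\<close>.\<close>

lemma weighted_time_integral_sqint:
  assumes f: "f \<in> sqint ({0..1} \<times> {a..b::real})" and w: "w \<in> bddf {0..1::real}"
  shows "(\<lambda>y. LINT r|lborel_on {0..1}. w r * f (r, y)) \<in> sqint {a..b}"
    and "normsq {a..b} (\<lambda>y. LINT r|lborel_on {0..1}. w r * f (r, y)) \<le> normsq {0..1} w * normsq ({0..1} \<times> {a..b}) f"
proof -
  let ?g = "\<lambda>y. LINT r|lborel_on {0..1}. w r * f (r, y)"
  have "(\<lambda>p. w (fst p) * f p) \<in> borel_measurable (lborel_on ({0..1} \<times> {a..b}))"
    using rect_measurable_fst[OF compact_Icc compact_Icc bddf_measurable[OF w]] sqint_measurable[OF f]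
    by (intro borel_measurable_times)
  from rect_swap[OF compact_Icc compact_Icc this]
  have "(\<lambda>(y, r). w r * f (r, y)) \<in> borel_measurable (lborel_on ({a..b} \<times> {0..1}))" by simp
  from rect_integral_measurable1[OF compact_Icc compact_Icc this]
  have m: "?g \<in> borel_measurable (lborel_on {a..b})" by simp
  have i: "integrable (lborel_on {a..b}) (\<lambda>y. normsq {0..1} w * normsq {0..1} (\<lambda>r. f (r, y)))"
    using rect_normsq_integrable2[OF compact_Icc compact_Icc f] by simp
  have ae: "AE y in lborel_on {a..b}. (?g y)\<^sup>2 \<le> normsq {0..1} w * normsq {0..1} (\<lambda>r. f (r, y))"
    using rect_AE_sqint2[OF compact_Icc compact_Icc f]
    by eventually_elim (rule L2_Cauchy_Schwarz[OF bddf_sqint[OF w compact_Icc]])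
  show "?g \<in> sqint {a..b}" by (rule sqint_bound_AE(1)[OF m i ae])
  show "normsq {a..b} ?g \<le> normsq {0..1} w * normsq ({0..1} \<times> {a..b}) f"
    using sqint_bound_AE(2)[OF m i ae] rect_normsq2[OF compact_Icc compact_Icc f] by simp
qed

lemma tprim_section_sqint:
  assumes "f \<in> sqint ({0..1} \<times> {a..b})" "s \<in> {0..1}"
  shows "(\<lambda>x. tprim f (s, x)) \<in> sqint {a..b}"
  using weighted_time_integral_sqint(1)[OF assms(1) step_weight_bddf, of s] assms(2) by (simp add: tprim_weight)

text \<open>
  A history that is a primitive in \<open>s\<close> is a Hoelder continuous curve in \<open>L\<^sub>2\<close>. This is what identifies
  its slices.
\<close>

lemma tprim_section_continuous:
  assumes f: "f \<in> sqint ({0..1} \<times> {a..b})" and "r \<in> {0..1}" "s \<in> {0..1}"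
  shows "normsq {a..b} (\<lambda>x. tprim f (s, x) - tprim f (r, x)) \<le> \<bar>s - r\<bar> * normsq ({0..1} \<times> {a..b}) f"
proof -
  have *: "normsq {a..b} (\<lambda>x. tprim f (s, x) - tprim f (r, x)) \<le> (s - r) * normsq ({0..1} \<times> {a..b}) f"
    if rs: "0 \<le> r" "r \<le> s" "s \<le> 1" for r s
  proof -
    \<comment> \<open>The increment is the time integral with the indicator of \<open>(r, s]\<close> as weight.\<close>
    have w: "(\<lambda>u. indicator {r<..s} u :: real) \<in> bddf {0..1}"
      by (auto simp: bddf_def intro!: exI[of _ 1] lborel_on_measurable split: split_indicator)
    have "AE x in lborel_on {a..b}. (LINT u|lborel_on {0..1}. indicator {r<..s} u * f (u, x)) = tprim f (s, x) - tprim f (r, x)"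
      using rect_AE_integrable_time[OF f]
      by eventually_elim (simp only: tprim_prim prim_diff[OF _ rs])
    then have "normsq {a..b} (\<lambda>x. LINT u|lborel_on {0..1}. indicator {r<..s} u * f (u, x)) = normsq {a..b} (\<lambda>x. tprim f (s, x) - tprim f (r, x))"
      using rs by (intro normsq_cong_AE weighted_time_integral_sqint(1)[OF f w] sqint_diff tprim_section_sqint[OF f]) auto
    with weighted_time_integral_sqint(2)[OF f w] normsq_indicator_interval(2)[OF rs] show ?thesis by simp
  qed
  show ?thesis
  proof (cases "r \<le> s")
    case True
    with *[of r s] assms show ?thesis by simp
  next
    case False
    have "normsq {a..b} (\<lambda>x. tprim f (s, x) - tprim f (r, x)) = normsq {a..b} (\<lambda>x. tprim f (r, x) - tprim f (s, x))"
      by (simp add: normsq_def power2_commute)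
    with False *[of s r] assms show ?thesis by simp
  qed
qed

section \<open>Partial integral operators acting on histories\<close>

text \<open>
  The operator acting on each slice \<open>(\<psi>\<^sub>u(s), \<psi>\<^sub>z(s))\<close>. The slices of a square integrable function
  need not all be square integrable, and on those an operator is not determined by its representation; using the
  coefficients themselves makes the result a measurable function of \<open>(s, x)\<close>.
\<close>

definition pi_lift :: "real \<Rightarrow> real \<Rightarrow> nat \<Rightarrow> nat \<Rightarrow> (real vfun \<Rightarrow> rvec \<Rightarrow> real \<Rightarrow> real)
    \<Rightarrow> (real \<times> real) vfun \<Rightarrow> real vfun \<Rightarrow> real \<times> real \<Rightarrow> real"
  where "pi_lift a b n m Op \<psi>u \<psi>z = (\<lambda>(s, x).
    pi_val a b n m (SOME c. pi_repr a b n m Op c) (section2_at \<psi>u s) (section_at \<psi>z s) x)"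

lemma pi_liftE:
  assumes "pi_op a b n m Op"
  obtains R K Z where "\<And>k. k < n \<Longrightarrow> R k \<in> bddf {a..b}" "\<And>k. k < n \<Longrightarrow> K k \<in> bddf ({a..b} \<times> {a..b})" "\<And>k. k < m \<Longrightarrow> Z k \<in> bddf {a..b}"
    "\<And>v z x. v \<in> L2 n {a..b} \<Longrightarrow> x \<in> {a..b} \<Longrightarrow> Op v z x =
      (\<Sum>k<n. R k x * v k x) + (\<Sum>k<n. kop {a..b} (K k) (v k) x) + (\<Sum>k<m. Z k x * z k)"
    "\<And>\<psi>u \<psi>z. pi_lift a b n m Op \<psi>u \<psi>z = (\<lambda>p. (\<Sum>k<n. R k (snd p) * \<psi>u k p) + (\<Sum>k<n. klift {a..b} (K k) (\<psi>u k) p) + (\<Sum>k<m. Z k (snd p) * \<psi>z k (fst p)))"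
proof -
  define c where "c = (SOME c. pi_repr a b n m Op c)"
  have c: "pi_repr a b n m Op c"
    using assms unfolding pi_op_def c_def by (rule someI_ex)
  obtain R K Z where RKZ: "c = (R, K, Z)" by (cases c)
  have L: "pi_lift a b n m Op \<psi>u \<psi>z = (\<lambda>(s, x). pi_val a b n m c (section2_at \<psi>u s) (section_at \<psi>z s) x)" for \<psi>u \<psi>z
    unfolding pi_lift_def c_def ..
  show thesis
    by (rule that[of R K Z])
      (use c in \<open>auto simp: pi_repr_def pi_coeffs_def pi_val_def RKZ L fun_eq_iff
        klift_def section2_at_def section_at_def\<close>)
qed

lemma pi_lift_section:
  assumes "pi_op a b n m Op" "section2_at \<psi>u s \<in> L2 n {a..b}" "x \<in> {a..b}"
  shows "pi_lift a b n m Op \<psi>u \<psi>z (s, x) = Op (section2_at \<psi>u s) (section_at \<psi>z s) x"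
proof -
  have "pi_repr a b n m Op (SOME c. pi_repr a b n m Op c)"
    using assms(1) unfolding pi_op_def by (rule someI_ex)
  with assms show ?thesis by (simp add: pi_lift_def pi_repr_def)
qed

lemma section_L2:
  assumes "\<psi>u \<in> L2 n ({0..1} \<times> {a..b::real})"
  shows "AE s in lborel_on {0..1::real}. section2_at \<psi>u s \<in> L2 n {a..b}"
proof -
  have "AE s in lborel_on {0..1::real}. \<forall>k\<in>{..<n}. (\<lambda>x. \<psi>u k (s, x)) \<in> sqint {a..b}"
    using assms by (intro AE_finite_allI rect_AE_sqint1[OF compact_Icc compact_Icc]) (auto simp: L2_def)
  then show ?thesis
    by eventually_elim (simp add: L2_def section2_at_def)
qed

lemma pi_lift_sqint:
  assumes "pi_op a b n m Op" and \<psi>: "\<psi>u \<in> L2 n ({0..1} \<times> {a..b})" "\<psi>z \<in> L2 m {0..1}"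
  shows "pi_lift a b n m Op \<psi>u \<psi>z \<in> sqint ({0..1} \<times> {a..b})"
proof -
  obtain R K Z where 1: "\<And>k. k < n \<Longrightarrow> R k \<in> bddf {a..b}" "\<And>k. k < n \<Longrightarrow> K k \<in> bddf ({a..b} \<times> {a..b})" "\<And>k. k < m \<Longrightarrow> Z k \<in> bddf {a..b}"
    "\<And>\<psi>u \<psi>z. pi_lift a b n m Op \<psi>u \<psi>z = (\<lambda>p. (\<Sum>k<n. R k (snd p) * \<psi>u k p) + (\<Sum>k<n. klift {a..b} (K k) (\<psi>u k) p) + (\<Sum>k<m. Z k (snd p) * \<psi>z k (fst p)))"
    by (rule pi_liftE[OF assms(1)]) blast
  have "(\<lambda>p. R k (snd p) * \<psi>u k p) \<in> sqint ({0..1} \<times> {a..b})" "klift {a..b} (K k) (\<psi>u k) \<in> sqint ({0..1} \<times> {a..b})" if "k < n" for k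
    using 1(1)[OF that] 1(2)[OF that] L2_sqint[OF \<psi>(1) that]
    by (auto intro!: bddf_mult_sqint klift_sqint rect_bddf_snd)
  moreover have "(\<lambda>p. Z k (snd p) * \<psi>z k (fst p)) \<in> sqint ({0..1} \<times> {a..b})" if "k < m" for k
    using 1(3)[OF that] L2_sqint[OF \<psi>(2) that]
    by (auto intro!: bddf_mult_sqint rect_bddf_snd sqint_rect_fst)
  ultimately show ?thesis
    unfolding 1(4) by (intro sqint_add sqint_sum) auto
qed

lemma pi_lift_cong_AE:
  assumes op: "pi_op a b n m Op"
    and \<psi>: "\<psi>u \<in> L2 n ({0..1} \<times> {a..b})" "\<psi>z \<in> L2 m {0..1}" "\<phi>u \<in> L2 n ({0..1} \<times> {a..b})" "\<phi>z \<in> L2 m {0..1}"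
    and eq: "eqf n ({0..1} \<times> {a..b}) \<psi>u \<phi>u" "eqf m {0..1} \<psi>z \<phi>z"
  shows "AE p in lborel_on ({0..1} \<times> {a..b}). pi_lift a b n m Op \<psi>u \<psi>z p = pi_lift a b n m Op \<phi>u \<phi>z p"
proof (rule rect_AE_eqI)
  have "AE s in lborel_on {0..1}. \<forall>k\<in>{..<n}. AE x in lborel_on {a..b}. \<psi>u k (s, x) = \<phi>u k (s, x)"
    using eq(1) by (intro AE_finite_allI rect_AE1) (auto simp: eqf_def)
  moreover have "AE s in lborel_on {0..1}. \<forall>k\<in>{..<m}. \<psi>z k s = \<phi>z k s"
    using eq(2) by (intro AE_finite_allI) (auto simp: eqf_def)
  moreover note section_L2[OF \<psi>(1)] section_L2[OF \<psi>(3)]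
  ultimately show "AE s in lborel_on {0..1}. AE x in lborel_on {a..b}.
      pi_lift a b n m Op \<psi>u \<psi>z (s, x) = pi_lift a b n m Op \<phi>u \<phi>z (s, x)"
  proof eventually_elim
    case (elim s)
    have "AE x in lborel_on {a..b}. Op (section2_at \<psi>u s) (section_at \<psi>z s) x = Op (section2_at \<phi>u s) (section_at \<phi>z s) x"
      by (rule pi_op_cong_AE[OF op])
        (use elim in \<open>auto simp: eqf_def eqv_def section2_at_def section_at_def\<close>)
    moreover have "AE x in lborel_on {a..b}. x \<in> {a..b}" by (intro AE_I2) simp
    ultimately show ?case
      by eventually_elim (simp add: pi_lift_section[OF op] elim)
  qed
qed (use pi_lift_sqint[OF op] \<psi> in \<open>auto intro!: sqint_measurable\<close>)

lemma pi_lift_tdiff: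
  assumes op: "pi_op a b n m Op" and t: "0 \<le> t"
    and \<psi>: "\<And>r. 0 \<le> r \<Longrightarrow> \<psi>u r \<in> L2 n ({0..1} \<times> {a..b})" "\<psi>u' \<in> L2 n ({0..1} \<times> {a..b})"
      "\<And>r. 0 \<le> r \<Longrightarrow> \<psi>z r \<in> L2 m {0..1}" "\<psi>z' \<in> L2 m {0..1}"
    and d: "\<And>k. k < n \<Longrightarrow> tdiff ({0..1} \<times> {a..b}) (\<lambda>r. \<psi>u r k) (\<psi>u' k) t"
      "\<And>k. k < m \<Longrightarrow> tdiff {0..1} (\<lambda>r. \<psi>z r k) (\<psi>z' k) t"
  shows "tdiff ({0..1} \<times> {a..b}) (\<lambda>r. pi_lift a b n m Op (\<psi>u r) (\<psi>z r)) (pi_lift a b n m Op \<psi>u' \<psi>z') t"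
proof -
  obtain R K Z where 1: "\<And>k. k < n \<Longrightarrow> R k \<in> bddf {a..b}" "\<And>k. k < n \<Longrightarrow> K k \<in> bddf ({a..b} \<times> {a..b})" "\<And>k. k < m \<Longrightarrow> Z k \<in> bddf {a..b}"
    "\<And>\<psi>u \<psi>z. pi_lift a b n m Op \<psi>u \<psi>z = (\<lambda>p. (\<Sum>k<n. R k (snd p) * \<psi>u k p) + (\<Sum>k<n. klift {a..b} (K k) (\<psi>u k) p) + (\<Sum>k<m. Z k (snd p) * \<psi>z k (fst p)))"
    by (rule pi_liftE[OF op]) blast
  let ?Q = "{0..1::real} \<times> {a..b}"
  have R: "(\<lambda>p. R k (snd p)) \<in> bddf ?Q" if "k < n" for k
    using 1(1)[OF that] by (intro rect_bddf_snd) auto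
  have Z: "(\<lambda>p. Z k (snd p)) \<in> bddf ?Q" if "k < m" for k
    using 1(3)[OF that] by (intro rect_bddf_snd) auto
  note c = compact_Icc compact_Icc
  have s: "\<psi>u r k \<in> sqint ?Q" "\<psi>u' k \<in> sqint ?Q" if "0 \<le> r" "k < n" for r k
    using L2_sqint[OF \<psi>(1)[OF that(1)] that(2)] L2_sqint[OF \<psi>(2) that(2)] by auto
  have z: "(\<lambda>p. \<psi>z r k (fst p)) \<in> sqint ?Q" "(\<lambda>p. \<psi>z' k (fst p)) \<in> sqint ?Q" if "0 \<le> r" "k < m" for r k
    using L2_sqint[OF \<psi>(3)[OF that(1)] that(2)] L2_sqint[OF \<psi>(4) that(2)] by (auto intro!: sqint_rect_fst)
  have d1: "tdiff ?Q (\<lambda>r p. R k (snd p) * \<psi>u r k p) (\<lambda>p. R k (snd p) * \<psi>u' k p) t" if "k < n" for k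
    by (rule tdiff_bddf_mult[OF R[OF that] d(1)[OF that] t]) (use s t that in auto)
  have d2: "tdiff ?Q (\<lambda>r. klift {a..b} (K k) (\<psi>u r k)) (klift {a..b} (K k) (\<psi>u' k)) t" if "k < n" for k
    by (rule tdiff_klift[OF _ _ _ 1(2)[OF that] d(1)[OF that] t]) (use s t that in auto)
  have d3: "tdiff ?Q (\<lambda>r p. Z k (snd p) * \<psi>z r k (fst p)) (\<lambda>p. Z k (snd p) * \<psi>z' k (fst p)) t" if "k < m" for k
  proof -
    have "tdiff ?Q (\<lambda>r p. \<psi>z r k (fst p)) (\<lambda>p. \<psi>z' k (fst p)) t"
      by (rule tdiff_rect_fst[OF c d(2)[OF that] t L2_sqint[OF \<psi>(3) that] L2_sqint[OF \<psi>(4) that]])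
    then show ?thesis
      by (rule tdiff_bddf_mult[OF Z[OF that] _ t]) (use z t that in auto)
  qed
  have k: "klift {a..b} (K k) (\<psi>u r k) \<in> sqint ?Q" "klift {a..b} (K k) (\<psi>u' k) \<in> sqint ?Q" if "0 \<le> r" "k < n" for r k
    using klift_sqint[OF compact_Icc compact_Icc compact_Icc 1(2)] s that by auto
  show ?thesis
    unfolding 1(4)
    by (intro tdiff_add tdiff_sum d1 d2 d3 t sqint_add sqint_sum bddf_mult_sqint R Z s z k) auto
qed

lemma time_integral_L2:
  assumes "\<psi>u \<in> L2 n ({0..1} \<times> {a..b::real})" "w \<in> bddf {0..1::real}"
  shows "(\<lambda>k y. LINT r|lborel_on {0..1}. w r * \<psi>u k (r, y)) \<in> L2 n {a..b}"
  using assms by (auto simp: L2_def intro!: weighted_time_integral_sqint)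

text \<open>
  Multipliers and input coefficients do not depend on the delay variable, and for the kernel part this
  is Fubini's theorem. The weight \<open>w\<close> will be the step at \<open>s\<close>, which gives the integral up to \<open>s\<close>.
\<close>

lemma pi_lift_time_integral:
  assumes op: "pi_op a b n m Op" and \<psi>: "\<psi>u \<in> L2 n ({0..1} \<times> {a..b})" "\<psi>z \<in> L2 m {0..1}" and w: "w \<in> bddf {0..1}"
  shows "AE x in lborel_on {a..b}. (LINT r|lborel_on {0..1}. w r * pi_lift a b n m Op \<psi>u \<psi>z (r, x))
    = Op (\<lambda>k y. LINT r|lborel_on {0..1}. w r * \<psi>u k (r, y)) (\<lambda>k. LINT r|lborel_on {0..1}. w r * \<psi>z k r) x"
proof -
  obtain R K Z where 1: "\<And>k. k < n \<Longrightarrow> R k \<in> bddf {a..b}" "\<And>k. k < n \<Longrightarrow> K k \<in> bddf ({a..b} \<times> {a..b})" "\<And>k. k < m \<Longrightarrow> Z k \<in> bddf {a..b}"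
    "\<And>v z x. v \<in> L2 n {a..b} \<Longrightarrow> x \<in> {a..b} \<Longrightarrow> Op v z x =
      (\<Sum>k<n. R k x * v k x) + (\<Sum>k<n. kop {a..b} (K k) (v k) x) + (\<Sum>k<m. Z k x * z k)"
    "\<And>\<psi>u \<psi>z. pi_lift a b n m Op \<psi>u \<psi>z = (\<lambda>p. (\<Sum>k<n. R k (snd p) * \<psi>u k p) + (\<Sum>k<n. klift {a..b} (K k) (\<psi>u k) p) + (\<Sum>k<m. Z k (snd p) * \<psi>z k (fst p)))"
    by (rule pi_liftE[OF op]) blast
  let ?L = "\<lambda>f. LINT r|lborel_on {0..1}. f r"
  have "AE x in lborel_on {a..b}. \<forall>k\<in>{..<n}. integrable (lborel_on {0..1}) (\<lambda>r. \<psi>u k (r, x))"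
    using L2_sqint[OF \<psi>(1)] by (intro AE_finite_allI rect_AE_integrable_time) auto
  moreover have "AE x in lborel_on {a..b}. x \<in> {a..b}" by (intro AE_I2) simp
  ultimately show ?thesis
  proof eventually_elim
    case (elim x)
    have i1: "integrable (lborel_on {0..1}) (\<lambda>r. w r * \<psi>u k (r, x))" if "k < n" for k
      using elim that by (intro bddf_mult_integrable w) auto
    have i1': "integrable (lborel_on {0..1}) (\<lambda>r. R k x * (w r * \<psi>u k (r, x)))" if "k < n" for k
      using i1[OF that] by simp
    have k: "integrable (lborel_on {0..1}) (\<lambda>r. w r * klift {a..b} (K k) (\<psi>u k) (r, x))"
      "?L (\<lambda>r. w r * klift {a..b} (K k) (\<psi>u k) (r, x)) = kop {a..b} (K k) (\<lambda>y. ?L (\<lambda>r. w r * \<psi>u k (r, y))) x" if "k < n" for k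
      using integral_klift[OF _ _ _ 1(2)[OF that] w L2_integrable[OF \<psi>(1) that compact_Times[OF compact_Icc compact_Icc]] elim(2)] by auto
    have i3: "integrable (lborel_on {0..1}) (\<lambda>r. w r * \<psi>z k r)" if "k < m" for k
      using L2_integrable[OF \<psi>(2) that] by (intro bddf_mult_integrable w) auto
    have i3': "integrable (lborel_on {0..1}) (\<lambda>r. Z k x * (w r * \<psi>z k r))" if "k < m" for k
      using i3[OF that] by simp
    have s: "integrable (lborel_on {0..1}) (\<lambda>r. \<Sum>k<n. R k x * (w r * \<psi>u k (r, x)))"
      "integrable (lborel_on {0..1}) (\<lambda>r. \<Sum>k<n. w r * klift {a..b} (K k) (\<psi>u k) (r, x))"
      "integrable (lborel_on {0..1}) (\<lambda>r. \<Sum>k<m. Z k x * (w r * \<psi>z k r))"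
      using i1' k i3' by (auto intro!: Bochner_Integration.integrable_sum)
    have "?L (\<lambda>r. w r * pi_lift a b n m Op \<psi>u \<psi>z (r, x)) = ?L (\<lambda>r. (\<Sum>k<n. R k x * (w r * \<psi>u k (r, x)))
        + (\<Sum>k<n. w r * klift {a..b} (K k) (\<psi>u k) (r, x)) + (\<Sum>k<m. Z k x * (w r * \<psi>z k r)))"
      unfolding 1(5) by (simp add: distrib_left sum_distrib_left mult.left_commute)
    also have "\<dots> = (\<Sum>k<n. ?L (\<lambda>r. R k x * (w r * \<psi>u k (r, x)))) + (\<Sum>k<n. ?L (\<lambda>r. w r * klift {a..b} (K k) (\<psi>u k) (r, x)))
        + (\<Sum>k<m. ?L (\<lambda>r. Z k x * (w r * \<psi>z k r)))"
      unfolding Bochner_Integration.integral_add[OF Bochner_Integration.integrable_add[OF s(1,2)] s(3)]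
        Bochner_Integration.integral_add[OF s(1,2)]
      using i1' k i3' by (subst (1 2 3) Bochner_Integration.integral_sum) auto
    also have "\<dots> = Op (\<lambda>k y. ?L (\<lambda>r. w r * \<psi>u k (r, y))) (\<lambda>k. ?L (\<lambda>r. w r * \<psi>z k r)) x"
      using k(2) by (subst 1(4)[OF time_integral_L2[OF \<psi>(1) w] elim(2)]) simp
    finally show ?case .
  qed
qed

text \<open>
  The function \<open>g\<close> extends the values of the functional measurably to those \<open>s\<close> at which the section of
  \<open>\<psi>\<^sub>u\<close> is not square integrable.
\<close>

lemma pi_fun_time_integral:
  assumes F: "pi_fun a b n m F" and ab: "a \<le> b"
    and \<psi>: "\<psi>u \<in> L2 n ({0..1} \<times> {a..b})" "\<psi>z \<in> L2 m {0..1}" and w: "w \<in> bddf {0..1}"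
  obtains g where "g \<in> borel_measurable (lborel_on {0..1})"
    "\<And>s. section2_at \<psi>u s \<in> L2 n {a..b} \<Longrightarrow> g s = F (section2_at \<psi>u s) (section_at \<psi>z s)"
    "(LINT r|lborel_on {0..1}. w r * g r)
      = F (\<lambda>k y. LINT r|lborel_on {0..1}. w r * \<psi>u k (r, y)) (\<lambda>k. LINT r|lborel_on {0..1}. w r * \<psi>z k r)"
proof -
  obtain \<kappa> \<zeta> where 1: "\<And>k. k < n \<Longrightarrow> \<kappa> k \<in> bddf {a..b}"
    "\<And>v z. v\<in>L2 n {a..b} \<Longrightarrow> F v z = (\<Sum>k<n. LINT y|lborel_on {a..b}. \<kappa> k y * v k y) + (\<Sum>k<m. \<zeta> k * z k)"
    using F unfolding pi_fun_def by blast
  let ?L = "\<lambda>f. LINT r|lborel_on {0..1}. f r"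
  \<comment> \<open>The functional as a kernel that is constant in its first variable, evaluated at \<open>a\<close>.\<close>
  define K where "K k = (\<lambda>p::real \<times> real. \<kappa> k (snd p))" for k
  have K: "K k \<in> bddf ({a..b} \<times> {a..b})" if "k < n" for k
    unfolding K_def using 1(1)[OF that] by (intro rect_bddf_snd) auto
  have kop: "kop {a..b} (K k) f x = (LINT y|lborel_on {a..b}. \<kappa> k y * f y)" for k f x
    by (simp add: kop_def K_def)
  define g where "g s = (\<Sum>k<n. klift {a..b} (K k) (\<psi>u k) (s, a)) + (\<Sum>k<m. \<zeta> k * \<psi>z k s)" for s
  have a: "a \<in> {a..b}" using ab by simp
  have k: "integrable (lborel_on {0..1}) (\<lambda>r. w r * klift {a..b} (K k) (\<psi>u k) (r, a))"
    "?L (\<lambda>r. w r * klift {a..b} (K k) (\<psi>u k) (r, a)) = kop {a..b} (K k) (\<lambda>y. ?L (\<lambda>r. w r * \<psi>u k (r, y))) a"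
    if "k < n" "w \<in> bddf {0..1}" for k w
    using integral_klift[OF _ _ _ K[OF that(1)] that(2) L2_integrable[OF \<psi>(1) that(1) compact_Times[OF compact_Icc compact_Icc]] a] by auto
  have "integrable (lborel_on {0..1}) (\<lambda>r. klift {a..b} (K k) (\<psi>u k) (r, a))" if "k < n" for k
    using k(1)[OF that bddf_const[of 1]] by simp
  moreover have zi: "integrable (lborel_on {0..1}) (\<psi>z k)" if "k < m" for k
    using L2_integrable[OF \<psi>(2) that] by simp
  ultimately have "g \<in> borel_measurable (lborel_on {0..1})"
    unfolding g_def[abs_def] by (intro borel_measurable_add borel_measurable_sum borel_measurable_times) auto
  moreover have "g s = F (section2_at \<psi>u s) (section_at \<psi>z s)" if "section2_at \<psi>u s \<in> L2 n {a..b}" for s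
    unfolding g_def 1(2)[OF that] by (simp add: klift_def kop section2_at_def section_at_def)
  moreover have "?L (\<lambda>r. w r * g r) = F (\<lambda>k y. ?L (\<lambda>r. w r * \<psi>u k (r, y))) (\<lambda>k. ?L (\<lambda>r. w r * \<psi>z k r))"
  proof -
    have i3': "integrable (lborel_on {0..1}) (\<lambda>r. \<zeta> k * (w r * \<psi>z k r))" if "k < m" for k
      using bddf_mult_integrable[OF w zi[OF that]] by simp
    have s: "integrable (lborel_on {0..1}) (\<lambda>r. \<Sum>k<n. w r * klift {a..b} (K k) (\<psi>u k) (r, a))"
      "integrable (lborel_on {0..1}) (\<lambda>r. \<Sum>k<m. \<zeta> k * (w r * \<psi>z k r))"
      using k(1)[OF _ w] i3' by (auto intro!: Bochner_Integration.integrable_sum)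
    have "?L (\<lambda>r. w r * g r) = ?L (\<lambda>r. (\<Sum>k<n. w r * klift {a..b} (K k) (\<psi>u k) (r, a)) + (\<Sum>k<m. \<zeta> k * (w r * \<psi>z k r)))"
      by (simp add: g_def distrib_left sum_distrib_left mult.left_commute)
    also have "\<dots> = (\<Sum>k<n. ?L (\<lambda>r. w r * klift {a..b} (K k) (\<psi>u k) (r, a))) + (\<Sum>k<m. ?L (\<lambda>r. \<zeta> k * (w r * \<psi>z k r)))"
      unfolding Bochner_Integration.integral_add[OF s]
      using k(1)[OF _ w] i3' by (subst (1 2) Bochner_Integration.integral_sum) auto
    also have "\<dots> = F (\<lambda>k y. ?L (\<lambda>r. w r * \<psi>u k (r, y))) (\<lambda>k. ?L (\<lambda>r. w r * \<psi>z k r))"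
      using k(2)[OF _ w] by (subst 1(2)[OF time_integral_L2[OF \<psi>(1) w]]) (simp add: kop)
    finally show ?thesis .
  qed
  ultimately show thesis by (rule that)
qed

section \<open>Reconstruction of a state from its top derivative and its values at the left end\<close>

text \<open>
  The derivative of order \<open>\<beta>\<close> of component \<open>i\<close> of the state with top derivative \<open>v\<close> and left boundary
  values \<open>c\<close>. The vector \<open>c\<close> is ordered like \<open>bvals\<close>: first the values of \<open>u\<^sub>2\<close> and \<open>u\<^sub>3\<close>, then those of
  \<open>\<partial>u\<^sub>3\<close>.
\<close>

definition recon :: "('m) bc_data_scheme \<Rightarrow> rvec \<Rightarrow> real vfun \<Rightarrow> nat \<Rightarrow> nat \<Rightarrow> real \<Rightarrow> real"
  where "recon G c v \<beta> i =
    (if \<beta> = reg G i then v i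
     else if \<beta> + 1 = reg G i then
       (\<lambda>x. (if reg G i = 1 then c (i - n1 G) else c (n2 G + n3 G + (i - (n1 G + n2 G)))) + prim (lo G) (v i) x)
     else (\<lambda>x. c (i - n1 G) + prim (lo G) (\<lambda>y. c (n2 G + n3 G + (i - (n1 G + n2 G))) + prim (lo G) (v i) y) x))"

text \<open>\<open>D_int\<close>, \<open>bvals\<close> and \<open>Lambda_bf\<close> in terms of the reconstruction data.\<close>

definition recon_int :: "('m) bc_data_scheme \<Rightarrow> rvec \<Rightarrow> real vfun \<Rightarrow> nat \<Rightarrow> real \<Rightarrow> real"
  where "recon_int G c v k =
    (if k < ntot G then recon G c v 0 k
     else if k < ntot G + n2 G + n3 G then recon G c v 1 (n1 G + (k - ntot G))
     else recon G c v 2 (n1 G + n2 G + (k - (ntot G + n2 G + n3 G))))"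

definition recon_bv :: "('m) bc_data_scheme \<Rightarrow> rvec \<Rightarrow> real vfun \<Rightarrow> real \<Rightarrow> nat \<Rightarrow> real"
  where "recon_bv G c v x k =
    (if k < n2 G + n3 G then recon G c v 0 (n1 G + k) x
     else recon G c v 1 (n1 G + n2 G + (k - (n2 G + n3 G))) x)"

definition recon_bf :: "('m) bc_data_scheme \<Rightarrow> rvec \<Rightarrow> real vfun \<Rightarrow> nat \<Rightarrow> real"
  where "recon_bf G c v k = (if k < nbc G then c k else recon_bv G c v (hi G) (k - nbc G))"

lemma reg_cases: "reg G i = 0 \<or> reg G i = 1 \<or> reg G i = 2"
  by (simp add: reg_def)

lemma reg_order_cases:
  assumes "\<beta> \<le> reg G i"
  obtains "\<beta> = 0" "reg G i = 0" | "\<beta> = 0" "reg G i = 1" | "\<beta> = 1" "reg G i = 1"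
    | "\<beta> = 0" "reg G i = 2" | "\<beta> = 1" "reg G i = 2" | "\<beta> = 2" "reg G i = 2"
  using reg_cases[of G i] assms by force

lemma prim_sqint: "f \<in> sqint {a..b} \<Longrightarrow> prim a f \<in> sqint {a..b}"
  using prim_bddf[OF sqint_integrable[OF _ compact_Icc]] by (intro bddf_sqint) auto

lemma const_prim_sqint: "f \<in> sqint {a..b} \<Longrightarrow> (\<lambda>x. c + prim a f x) \<in> sqint {a..b}"
  by (intro sqint_add sqint_const prim_sqint) auto

lemma recon_weak_pd:
  assumes "v i \<in> sqint (dom1 G)" "\<beta> \<le> reg G i"
  shows "recon G c v \<beta> i \<in> sqint (dom1 G)"
    and "weak_pd (dom1 G) (replicate \<beta> 1) (recon G c v 0 i) (recon G c v \<beta> i)"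
proof -
  from assms(2) have "recon G c v \<beta> i \<in> sqint (dom1 G) \<and> weak_pd (dom1 G) (replicate \<beta> 1) (recon G c v 0 i) (recon G c v \<beta> i)"
  proof (cases rule: reg_order_cases)
    case 6
    have "weak_pd (dom1 G) ([1] @ [1])
        (\<lambda>x. c (i - n1 G) + prim (lo G) (\<lambda>y. c (n2 G + n3 G + (i - (n1 G + n2 G))) + prim (lo G) (v i) y) x) (v i)"
      by (rule weak_pd_append[OF weak_pd_prim[OF const_prim_sqint[OF assms(1)]] weak_pd_prim[OF assms(1)]]) simp
    with 6 assms(1) show ?thesis by (simp add: recon_def numeral_2_eq_2)
  qed (use assms(1) in \<open>auto simp: recon_def weak_pd_Nil intro!: const_prim_sqint weak_pd_prim\<close>)
  then show "recon G c v \<beta> i \<in> sqint (dom1 G)"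
    "weak_pd (dom1 G) (replicate \<beta> 1) (recon G c v 0 i) (recon G c v \<beta> i)" by auto
qed

lemma recon_continuous:
  assumes "v i \<in> sqint (dom1 G)" "\<beta> < reg G i"
  shows "continuous_on (dom1 G) (recon G c v \<beta> i)"
proof -
  have "continuous_on (dom1 G) (\<lambda>x. c + prim (lo G) f x)" if "f \<in> sqint (dom1 G)" for c f
    by (intro continuous_intros prim_continuous that)
  with assms reg_cases[of G i] show ?thesis
    by (auto simp: recon_def const_prim_sqint)
qed

lemma prim_at_left: "prim a f a = 0"
proof -
  have "(LINT y|lborel_on {a..a}. f y) = (LINT y|lborel. indicator {a} y *\<^sub>R f y)"
    by (subst integral_restrict_space) auto
  also have "\<dots> = 0"
  proof (rule integral_eq_zero_AE)
    have "AE y in lborel. y \<noteq> a" by (rule AE_lborel_singleton)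
    then show "AE y in lborel. indicator {a} y *\<^sub>R f y = 0" by eventually_elim simp
  qed
  finally show ?thesis by (simp add: prim_def)
qed

lemma ord1_Basis: "ds \<in> ord1 k \<Longrightarrow> set ds \<subseteq> Basis"
  by (auto simp: ord1_def)

lemma replicate_Basis: "set (replicate \<beta> (1::real)) \<subseteq> Basis"
  by auto

text \<open>
  The choices behind \<open>wpd\<close> and \<open>cont_rep\<close> are resolved here once and for all: what the equations use of
  a state is an explicit expression in its top derivative and its left boundary values.
\<close>

lemma
  fixes G :: "('m) bc_data_scheme"
  assumes ab: "lo G < hi G" and v: "v \<in> L2 (ntot G) (dom1 G)"
    and u: "\<And>i. i < ntot G \<Longrightarrow> u i \<in> borel_measurable (lborel_on (dom1 G))"
      "\<And>i. i < ntot G \<Longrightarrow> AE x in lborel_on (dom1 G). u i x = recon G c v 0 i x"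
  shows recon_wpd: "i < ntot G \<Longrightarrow> \<beta> \<le> reg G i \<Longrightarrow>
      AE x in lborel_on (dom1 G). wpd (dom1 G) (replicate \<beta> 1) (u i) x = recon G c v \<beta> i x"
    and recon_U_space: "u \<in> U_space G"
    and recon_D_int: "k < nint G \<Longrightarrow> AE x in lborel_on (dom1 G). D_int G u k x = recon_int G c v k x"
    and recon_D_int_sqint: "k < nint G \<Longrightarrow> D_int G u k \<in> sqint (dom1 G)"
    and recon_Lambda_bf: "k < nbf G \<Longrightarrow> Lambda_bf G u k = recon_bf G c v k"
    and recon_D_op: "eqf (ntot G) (dom1 G) (D_op G u) v"
proof -
  have r: "recon G c v \<beta> i \<in> sqint (dom1 G)" "weak_pd (dom1 G) (replicate \<beta> 1) (u i) (recon G c v \<beta> i)"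
    if "i < ntot G" "\<beta> \<le> reg G i" for i \<beta>
  proof -
    note 1 = recon_weak_pd[where v=v and i=i and c=c, OF L2_sqint[OF v that(1)]]
    show "recon G c v \<beta> i \<in> sqint (dom1 G)" by (rule 1(1)[OF that(2)])
    show "weak_pd (dom1 G) (replicate \<beta> 1) (u i) (recon G c v \<beta> i)"
      using 1(2)[OF that(2)] weak_pd_cong_left[OF u(2)[OF that(1)] u(1)[OF that(1)] sqint_measurable[OF 1(1)[OF le0]] replicate_Basis compact_Icc]
      by simp
  qed
  have us: "u i \<in> sqint (dom1 G)" if "i < ntot G" for i
    by (rule sqint_cong_AE[OF _ r(1)[OF that, of 0] u(1)[OF that]]) (use u(2)[OF that] in auto)
  show w: "AE x in lborel_on (dom1 G). wpd (dom1 G) (replicate \<beta> 1) (u i) x = recon G c v \<beta> i x"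
    if "i < ntot G" "\<beta> \<le> reg G i" for i \<beta>
    by (rule wpd_interval_eqI[OF r[OF that]])
  have ws: "wpd (dom1 G) (replicate \<beta> 1) (u i) \<in> sqint (dom1 G)" if "i < ntot G" "\<beta> \<le> reg G i" for i \<beta>
    by (rule wpd_spec(1)[OF r[OF that]])
  show "u \<in> U_space G"
    unfolding U_space_def sobolev_def ord1_def
  proof (intro CollectI allI impI conjI ballI)
    fix i assume i: "i < ntot G"
    show "u i \<in> sqint (dom1 G)" by (rule us[OF i])
    fix ds assume "ds \<in> (\<lambda>\<beta>. replicate \<beta> (1::real)) ` {..reg G i}"
    then obtain \<beta> where "ds = replicate \<beta> 1" "\<beta> \<le> reg G i" by auto
    with r[OF i] show "\<exists>g\<in>sqint (dom1 G). weak_pd (dom1 G) ds (u i) g" by auto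
  qed
  show "eqf (ntot G) (dom1 G) (D_op G u) v"
    using w[OF _ order_refl] by (simp add: eqf_def D_op_def dx_def recon_def)
  have dx: "i < ntot G" "1 \<le> reg G i" if "k < ntot G + n2 G + n3 G" "\<not> k < ntot G" "i = n1 G + (k - ntot G)" for k i
    using that by (auto simp: reg_def)
  have dx2: "i < ntot G" "2 \<le> reg G i" if "k < nint G" "\<not> k < ntot G + n2 G + n3 G" "i = n1 G + n2 G + (k - (ntot G + n2 G + n3 G))" for k i
    using that by (auto simp: reg_def)
  show "AE x in lborel_on (dom1 G). D_int G u k x = recon_int G c v k x" if "k < nint G" for k
    using that u(2) w[OF dx] w[OF dx2] by (auto simp: D_int_def recon_int_def dx_def)
  show "D_int G u k \<in> sqint (dom1 G)" if "k < nint G" for k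
    using that us ws[OF dx] ws[OF dx2] by (auto simp: D_int_def dx_def)
  have cont: "cont_rep (lo G) (hi G) (wpd (dom1 G) (replicate \<beta> 1) (u i)) x = recon G c v \<beta> i x"
    if "i < ntot G" "\<beta> < reg G i" "x \<in> dom1 G" for i \<beta> x
    using that by (intro cont_rep_eq ab recon_continuous L2_sqint[OF v] w) auto
  have cont0: "cont_rep (lo G) (hi G) (u i) x = recon G c v 0 i x"
    if "i < ntot G" "0 < reg G i" "x \<in> dom1 G" for i x
    using that by (intro cont_rep_eq ab recon_continuous L2_sqint[OF v] u(2)) auto
  have bv: "bvals G x u k = recon_bv G c v x k" if x: "x \<in> dom1 G" and k: "k < nbc G" for x k
  proof (cases "k < n2 G + n3 G")
    case True
    then show ?thesis using cont0[of "n1 G + k" x] x by (simp add: bvals_def recon_bv_def reg_def)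
  next
    case False
    then show ?thesis using cont[of "n1 G + n2 G + (k - (n2 G + n3 G))" 1 x] x k
      by (simp add: bvals_def recon_bv_def reg_def dx_def)
  qed
  have left: "recon_bv G c v (lo G) k = c k" if "k < nbc G" for k
    using that by (auto simp: recon_bv_def recon_def prim_at_left reg_def)
  show "Lambda_bf G u k = recon_bf G c v k" if "k < nbf G" for k
    using that ab bv left by (auto simp: Lambda_bf_def recon_bf_def)
qed

text \<open>
  Every state arises from its top derivative by integration. The entries of \<open>c\<close> beyond the number of
  boundary conditions are set to zero, as the left inverse of the boundary matrix requires.
\<close>

lemma recon_complete:
  fixes G :: "('m) bc_data_scheme"
  assumes ab: "lo G < hi G" and v: "v \<in> L2 (ntot G) (dom1 G)"
    and u: "u \<in> U_space G" "eqf (ntot G) (dom1 G) (D_op G u) v"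
  obtains c where "\<And>k. nbc G \<le> k \<Longrightarrow> c k = 0"
    "\<And>i. i < ntot G \<Longrightarrow> AE x in lborel_on (dom1 G). u i x = recon G c v 0 i x"
proof -
  \<comment> \<open>A primitive depends only on the class of its integrand.\<close>
  have prim_cong: "prim (lo G) f x = prim (lo G) g x"
    if "AE x in lborel_on (dom1 G). f x = g x" "f \<in> sqint (dom1 G)" "g \<in> sqint (dom1 G)" "x \<in> dom1 G" for f g x
    using that kernel_times_integrable[OF compact_Icc compact_Icc step_kernel_bddf that(4) sqint_integrable[OF that(2) compact_Icc]]
      kernel_times_integrable[OF compact_Icc compact_Icc step_kernel_bddf that(4) sqint_integrable[OF that(3) compact_Icc]]
    unfolding prim_kop[OF that(4)] kop_def by (intro integral_cong_AE) auto
  have in_dom: "AE x in lborel_on (dom1 G). x \<in> dom1 G" by (intro AE_I2) simp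
  have us: "u i \<in> sqint (dom1 G)" if "i < ntot G" for i
    using u(1) that by (auto simp: U_space_def intro: sobolev_sqint)
  have top: "AE x in lborel_on (dom1 G). wpd (dom1 G) (replicate (reg G i) 1) (u i) x = v i x" if "i < ntot G" for i
    using u(2) that by (simp add: eqf_def D_op_def dx_def)
  have wp: "wpd (dom1 G) (replicate \<beta> 1) (u i) \<in> sqint (dom1 G)" "weak_pd (dom1 G) (replicate \<beta> 1) (u i) (wpd (dom1 G) (replicate \<beta> 1) (u i))"
    if "i < ntot G" "\<beta> \<le> reg G i" for i \<beta>
    using u(1) that sobolev_wpd[of "u i" "dom1 G" "ord1 (reg G i)" "replicate \<beta> 1"] by (auto simp: U_space_def ord1_def)
  define P where "P i c0 c1 \<longleftrightarrow> (AE x in lborel_on (dom1 G). u i x = (if reg G i = 0 then v i x else if reg G i = 1 then c0 + prim (lo G) (v i) x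
      else c0 + prim (lo G) (\<lambda>y. c1 + prim (lo G) (v i) y) x))" for i c0 c1
  have ex: "\<exists>c0 c1. P i c0 c1" if i: "i < ntot G" for i
  proof -
    note vi = L2_sqint[OF v i]
    consider "reg G i = 0" | "reg G i = 1" | "reg G i = 2" using reg_cases[of G i] by fastforce
    then show ?thesis
    proof cases
      case 1
      then have "AE x in lborel_on (dom1 G). wpd (dom1 G) [] (u i) x = v i x" using top[OF i] by simp
      moreover have "AE x in lborel_on (dom1 G). wpd (dom1 G) [] (u i) x = u i x"
        by (rule wpd_interval_eqI[OF us[OF i] weak_pd_Nil])
      ultimately have "AE x in lborel_on (dom1 G). u i x = v i x" by eventually_elim simp
      with 1 show ?thesis by (simp add: P_def)
    next
      case 2
      from weak_pd_imp_prim[OF ab us[OF i] wp(1)[OF i, of 1]] wp(2)[OF i, of 1] 2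
      obtain c0 where "AE x in lborel_on (dom1 G). u i x = c0 + prim (lo G) (wpd (dom1 G) [1] (u i)) x"
        by auto
      with in_dom have "AE x in lborel_on (dom1 G). u i x = c0 + prim (lo G) (v i) x"
        by eventually_elim (use prim_cong[of "wpd (dom1 G) [1] (u i)" "v i"] wp(1)[OF i, of 1] vi top[OF i] 2 in simp)
      with 2 show ?thesis by (auto simp: P_def)
    next
      case 3
      let ?g = "wpd (dom1 G) [1] (u i)" and ?h = "wpd (dom1 G) [1, 1] (u i)"
      have g: "?g \<in> sqint (dom1 G)" "weak_pd (dom1 G) [1] (u i) ?g" using wp[OF i, of 1] 3 by simp_all
      have h: "?h \<in> sqint (dom1 G)" "weak_pd (dom1 G) [1, 1] (u i) ?h" "AE x in lborel_on (dom1 G). ?h x = v i x"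
        using wp[OF i, of 2] top[OF i] 3 by (simp_all add: numeral_2_eq_2)
      have gh: "weak_pd (dom1 G) [1] ?g ?h"
        by (rule weak_pd_append_cancel[OF _ g(2)]) (use h(2) in auto)
      obtain c1 where "AE x in lborel_on (dom1 G). ?g x = c1 + prim (lo G) ?h x"
        using weak_pd_imp_prim[OF ab g(1) h(1) gh] by blast
      with in_dom have g1: "AE x in lborel_on (dom1 G). ?g x = c1 + prim (lo G) (v i) x"
        by eventually_elim (use prim_cong[OF h(3) h(1) vi] in simp)
      obtain c0 where "AE x in lborel_on (dom1 G). u i x = c0 + prim (lo G) ?g x"
        using weak_pd_imp_prim[OF ab us[OF i] g] by blast
      with in_dom have "AE x in lborel_on (dom1 G). u i x = c0 + prim (lo G) (\<lambda>y. c1 + prim (lo G) (v i) y) x"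
        by eventually_elim (use prim_cong[OF g1 g(1) const_prim_sqint[OF vi]] in simp)
      with 3 show ?thesis by (auto simp: P_def)
    qed
  qed
  obtain c0 c1 where "\<And>i. i < ntot G \<Longrightarrow> P i (c0 i) (c1 i)"
    using ex by metis
  note c = this[unfolded P_def]
  define cc where "cc k = (if k < n2 G + n3 G then c0 (n1 G + k) else if k < nbc G then c1 (n1 G + n2 G + (k - (n2 G + n3 G))) else 0)" for k
  show thesis
  proof
    show "cc k = 0" if "nbc G \<le> k" for k using that by (simp add: cc_def)
    fix i assume i: "i < ntot G"
    have "recon G cc v 0 i x = (if reg G i = 0 then v i x else if reg G i = 1 then c0 i + prim (lo G) (v i) x
      else c0 i + prim (lo G) (\<lambda>y. c1 i + prim (lo G) (v i) y) x)" for x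
      using i by (auto simp: recon_def cc_def reg_def)
    with c[OF i] show "AE x in lborel_on (dom1 G). u i x = recon G cc v 0 i x" by simp
  qed
qed

section \<open>The solution operator of the boundary value problem\<close>

text \<open>
  For boundary values that are themselves functionals of \<open>(v, z)\<close>; with \<open>c\<close> as the input this covers
  the reconstruction itself, and with the solution of the boundary conditions the operator \<open>T v + T\<^sub>z z\<close>.
\<close>

lemma recon_pi_op:
  assumes c: "\<And>k. k < nbc G \<Longrightarrow> pi_fun (lo G) (hi G) (ntot G) m (\<lambda>v z. c v z k)" and i: "i < ntot G" "\<beta> \<le> reg G i"
  shows "pi_op (lo G) (hi G) (ntot G) m (\<lambda>v z. recon G (c v z) v \<beta> i)"
proof -
  have p: "pi_op (lo G) (hi G) (ntot G) m (\<lambda>v z. v i)" by (rule pi_op_proj[OF i(1)])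
  have c0: "pi_fun (lo G) (hi G) (ntot G) m (\<lambda>v z. c v z (i - n1 G))" if "0 < reg G i"
    using that i by (intro c) (auto simp: reg_def split: if_splits)
  have c1: "pi_fun (lo G) (hi G) (ntot G) m (\<lambda>v z. c v z (n2 G + n3 G + (i - (n1 G + n2 G))))" if "reg G i = 2"
    using that i by (intro c) (auto simp: reg_def split: if_splits)
  have cp: "pi_op (lo G) (hi G) (ntot G) m (\<lambda>v z x. f v z + prim (lo G) (Op v z) x)"
    if "pi_fun (lo G) (hi G) (ntot G) m f" "pi_op (lo G) (hi G) (ntot G) m Op" for f Op
    by (intro pi_op_add pi_fun_imp_op that pi_op_prim)
  from i(2) show ?thesis
    using p c0 c1 cp[OF c0 p] cp[OF c1 p] cp[OF c0 cp[OF c1 p]]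
    by (cases rule: reg_order_cases) (simp_all add: recon_def)
qed

lemma prim_right: "prim a f b = (LINT y|lborel_on {a..b}. f y)"
  by (simp add: prim_def)

lemma recon_bv_pi_fun:
  assumes ab: "lo G < hi G"
    and c: "\<And>k. k < nbc G \<Longrightarrow> pi_fun (lo G) (hi G) (ntot G) m (\<lambda>v z. c v z k)" and k: "k < nbc G"
  shows "pi_fun (lo G) (hi G) (ntot G) m (\<lambda>v z. recon_bv G (c v z) v (hi G) k)"
proof -
  have int: "pi_fun (lo G) (hi G) (ntot G) m (\<lambda>v z. prim (lo G) (Op v z) (hi G))"
    if "pi_op (lo G) (hi G) (ntot G) m Op" for Op
    using pi_fun_integral[OF _ that bddf_const[of 1]] ab by (simp add: prim_right)
  have r1: "pi_fun (lo G) (hi G) (ntot G) m (\<lambda>v z. recon G (c v z) v \<beta> i (hi G))"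
    if i: "i < ntot G" "\<beta> < reg G i" for i \<beta>
  proof -
    have c0: "pi_fun (lo G) (hi G) (ntot G) m (\<lambda>v z. c v z (i - n1 G))"
      using i by (intro c) (auto simp: reg_def split: if_splits)
    have c1: "pi_fun (lo G) (hi G) (ntot G) m (\<lambda>v z. c v z (n2 G + n3 G + (i - (n1 G + n2 G))))" if "reg G i = 2"
      using that i by (intro c) (auto simp: reg_def split: if_splits)
    note p = pi_op_proj[OF i(1), of "lo G" "hi G" m]
    have "pi_fun (lo G) (hi G) (ntot G) m (\<lambda>v z. c v z (i - n1 G) + prim (lo G) (v i) (hi G))"
      by (intro pi_fun_add c0 int p)
    moreover have "pi_fun (lo G) (hi G) (ntot G) m (\<lambda>v z. c v z (n2 G + n3 G + (i - (n1 G + n2 G))) + prim (lo G) (v i) (hi G))"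
      if "reg G i = 2"
      by (intro pi_fun_add c1 int p that)
    moreover have "pi_fun (lo G) (hi G) (ntot G) m (\<lambda>v z. c v z (i - n1 G) + prim (lo G) (\<lambda>y. c v z (n2 G + n3 G + (i - (n1 G + n2 G))) + prim (lo G) (v i) y) (hi G))"
      if "reg G i = 2"
      by (intro pi_fun_add c0 int pi_op_add pi_fun_imp_op[OF c1] pi_op_prim p that)
    ultimately show ?thesis
      using i(2) by (cases rule: reg_order_cases[OF less_imp_le[OF i(2)]]) (simp_all add: recon_def)
  qed
  show ?thesis
  proof (cases "k < n2 G + n3 G")
    case True
    then show ?thesis using r1[of "n1 G + k" 0] by (simp add: recon_bv_def reg_def)
  next
    case False
    then show ?thesis using r1[of "n1 G + n2 G + (k - (n2 G + n3 G))" 1] k by (simp add: recon_bv_def reg_def)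
  qed
qed

lemma recon_bf_pi_fun:
  assumes ab: "lo G < hi G"
    and c: "\<And>k. k < nbc G \<Longrightarrow> pi_fun (lo G) (hi G) (ntot G) m (\<lambda>v z. c v z k)" and k: "k < nbf G"
  shows "pi_fun (lo G) (hi G) (ntot G) m (\<lambda>v z. recon_bf G (c v z) v k)"
  using c recon_bv_pi_fun[where c=c and k="k - nbc G", OF ab c] k by (cases "k < nbc G") (simp_all add: recon_bf_def)

lemma recon_int_pi_op:
  assumes c: "\<And>k. k < nbc G \<Longrightarrow> pi_fun (lo G) (hi G) (ntot G) m (\<lambda>v z. c v z k)" and k: "k < nint G"
  shows "pi_op (lo G) (hi G) (ntot G) m (\<lambda>v z. recon_int G (c v z) v k)"
proof -
  consider "k < ntot G" | "\<not> k < ntot G" "k < ntot G + n2 G + n3 G" | "\<not> k < ntot G + n2 G + n3 G" by blast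
  then show ?thesis
  proof cases
    case 1
    then show ?thesis using recon_pi_op[where c=c and i="k" and \<beta>=0, OF c] by (simp add: recon_int_def)
  next
    case 2
    then have "n1 G + (k - ntot G) < ntot G" "1 \<le> reg G (n1 G + (k - ntot G))" by (auto simp: reg_def)
    from recon_pi_op[where c=c, OF c this] 2 show ?thesis by (simp add: recon_int_def)
  next
    case 3
    with k have "n1 G + n2 G + (k - (ntot G + n2 G + n3 G)) < ntot G" "2 \<le> reg G (n1 G + n2 G + (k - (ntot G + n2 G + n3 G)))"
      by (auto simp: reg_def)
    from recon_pi_op[where c=c, OF c this] 3 show ?thesis by (simp add: recon_int_def)
  qed
qed

text \<open>
  Extending the injective map by the identity to the coordinates from \<open>N\<close> on gives an injective linear map
  on all sequences, which has a linear left inverse; its values at the first unit vectors are the matrix.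
\<close>

lemma left_inverse_matrix:
  fixes M :: "rvec \<Rightarrow> rvec"
  assumes lin: "\<And>c d s. M (\<lambda>k. c k + s * d k) = (\<lambda>k. M c k + s * M d k)"
    and inj: "\<And>c. (\<And>k. N \<le> k \<Longrightarrow> c k = 0) \<Longrightarrow> (\<And>k. k < N \<Longrightarrow> M c k = 0) \<Longrightarrow> c = (\<lambda>k. 0)"
  obtains L :: rmat where "\<And>c. (\<And>k. N \<le> k \<Longrightarrow> c k = 0) \<Longrightarrow> c = (\<lambda>k. \<Sum>l<N. L k l * M c l)"
proof -
  define M' where "M' c = (\<lambda>k. if k < N then M c k else c k)" for c
  have lin': "linear M'"
  proof (rule linearI)
    fix c d :: rvec and s :: real
    have "M (c + d) = M c + M d" using lin[of c 1 d] by (simp add: plus_fun_def)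
    then show "M' (c + d) = M' c + M' d" by (auto simp: M'_def fun_eq_iff)
    have "M (\<lambda>k. 0) = (\<lambda>k. 0)" using lin[of c "-1" c] by (simp add: fun_eq_iff)
    with lin[of "\<lambda>k. 0" s c] have "M (s *\<^sub>R c) = (\<lambda>k. s * M c k)" by (simp add: scaleR_fun_def)
    then show "M' (s *\<^sub>R c) = s *\<^sub>R M' c" by (auto simp: M'_def fun_eq_iff)
  qed
  have "inj M'"
  proof (subst linear_injective_0[OF lin'], intro allI impI)
    fix c assume 0: "M' c = 0"
    have "c k = 0" if "N \<le> k" for k using fun_cong[OF 0, of k] that by (simp add: M'_def)
    moreover have "M c k = 0" if "k < N" for k using fun_cong[OF 0, of k] that by (simp add: M'_def)
    ultimately have "c = (\<lambda>k. 0)" by (rule inj)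
    then show "c = 0" by (simp add: zero_fun_def)
  qed
  then obtain g where g: "linear g" "g \<circ> M' = id"
    using linear_injective_left_inverse[OF lin'] by blast
  define e :: "nat \<Rightarrow> rvec" where "e l = (\<lambda>k. if k = l then 1 else 0)" for l
  have fun_sum: "(\<Sum>l\<in>I. f l) k = (\<Sum>l\<in>I. f l k)" for I and f :: "nat \<Rightarrow> rvec" and k
    by (induction I rule: infinite_finite_induct) auto
  show thesis
  proof
    fix c :: rvec assume c: "\<And>k. N \<le> k \<Longrightarrow> c k = 0"
    have "M' c = (\<Sum>l<N. M c l *\<^sub>R e l)"
    proof
      fix k
      have "(\<Sum>l<N. M c l *\<^sub>R e l) k = (\<Sum>l<N. if l = k then M c l else 0)"
        unfolding fun_sum by (intro sum.cong) (auto simp: e_def)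
      also have "\<dots> = M' c k" using c by (simp add: M'_def)
      finally show "M' c k = (\<Sum>l<N. M c l *\<^sub>R e l) k" ..
    qed
    then have "g (M' c) = (\<Sum>l<N. M c l *\<^sub>R g (e l))"
      by (simp add: linear_sum[OF g(1)] linear_scale[OF g(1)])
    moreover have "g (M' c) = c" using fun_cong[OF g(2), of c] by simp
    ultimately have c_eq: "c = (\<Sum>l<N. M c l *\<^sub>R g (e l))" by simp
    show "c = (\<lambda>k. \<Sum>l<N. g (e l) k * M c l)"
    proof
      fix k
      show "c k = (\<Sum>l<N. g (e l) k * M c l)"
        by (subst c_eq) (simp add: fun_sum mult.commute)
    qed
  qed
qed

lemma pi_fun_restrict:
  assumes "pi_fun a b n m F"
  shows "pi_fun a b n m' (\<lambda>v z. F v (\<lambda>k. 0))"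
proof -
  obtain \<kappa> \<zeta> where 1: "\<And>k. k < n \<Longrightarrow> \<kappa> k \<in> bddf {a..b}"
    "\<And>v z. v\<in>L2 n {a..b} \<Longrightarrow> F v z = (\<Sum>k<n. LINT y|lborel_on {a..b}. \<kappa> k y * v k y) + (\<Sum>k<m. \<zeta> k * z k)"
    using assms unfolding pi_fun_def by blast
  then show ?thesis
    unfolding pi_fun_def by (intro exI[of _ \<kappa>] exI[of _ "\<lambda>k. 0"]) auto
qed

lemma pi_fun_Ez: "pi_fun a b n m (\<lambda>v z. mult_cc m E z k)"
  unfolding mult_cc_def by (intro pi_fun_sum pi_fun_cmult pi_fun_coord) auto

text \<open>The left side of the boundary conditions for the state with data \<open>(v, c)\<close>, without the input term.\<close>

definition bc_res :: "('m) bc_data_scheme \<Rightarrow> real vfun \<Rightarrow> rvec \<Rightarrow> nat \<Rightarrow> real"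
  where "bc_res G v c k =
    mult_int (dom1 G) (nint G) (Ep G) (recon_int G c v) k + mult_cc (nbf G) (Eb G) (recon_bf G c v) k"

lemma mult_int_cong_AE:
  assumes "\<And>k. k < n \<Longrightarrow> AE x in lborel_on S. f k x = g k x"
    "\<And>k. k < n \<Longrightarrow> A i k \<in> Linf S" "\<And>k. k < n \<Longrightarrow> f k \<in> borel_measurable (lborel_on S)" "\<And>k. k < n \<Longrightarrow> g k \<in> borel_measurable (lborel_on S)"
  shows "mult_int S n A f i = mult_int S n A g i"
  unfolding mult_int_def
proof (rule integral_cong_AE)
  have [measurable]: "A i k \<in> borel_measurable (lborel_on S)" if "k < n" for k
    using assms(2)[OF that] by (simp add: Linf_def)
  show "(\<lambda>x. \<Sum>k<n. A i k x * f k x) \<in> borel_measurable (lborel_on S)"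
    "(\<lambda>x. \<Sum>k<n. A i k x * g k x) \<in> borel_measurable (lborel_on S)"
    using assms by (auto intro!: borel_measurable_sum borel_measurable_times)
  have "AE x in lborel_on S. \<forall>k\<in>{..<n}. f k x = g k x"
    using assms(1) by (intro AE_finite_allI) auto
  then show "AE x in lborel_on S. (\<Sum>k<n. A i k x * f k x) = (\<Sum>k<n. A i k x * g k x)"
    by eventually_elim (auto intro!: sum.cong)
qed

lemma L2_zero: "(\<lambda>k x. 0) \<in> L2 n S"
  by (simp add: L2_def sqint_zero)

lemma L2_lin: "v \<in> L2 n S \<Longrightarrow> v' \<in> L2 n S \<Longrightarrow> (\<lambda>k x. v k x + c * v' k x) \<in> L2 n S"
  unfolding L2_def by (auto intro!: sqint_add sqint_cmult)

context
  fixes G :: "('m) bc_data_scheme"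
  assumes ab: "lo G < hi G" and Ep: "Ep G \<in> Linf_mat G (nbc G) (nint G)"
begin

text \<open>
  The unknown \<open>c\<close> plays the role of the input. The essentially bounded coefficients are replaced by
  bounded ones, which changes no integral.
\<close>

lemma bc_res_pi_fun:
  assumes k: "k < nbc G"
  shows "pi_fun (lo G) (hi G) (ntot G) (nbc G) (\<lambda>v c. bc_res G v c k)"
proof -
  have Epl: "Ep G k l \<in> Linf (dom1 G)" if "l < nint G" for l
    using Ep k that by (simp add: Linf_mat_def)
  define E where "E l = (SOME g. g \<in> bddf (dom1 G) \<and> (AE x in lborel_on (dom1 G). Ep G k l x = g x))" for l
  have E: "E l \<in> bddf (dom1 G)" "AE x in lborel_on (dom1 G). Ep G k l x = E l x" if "l < nint G" for l
  proof -
    have "\<exists>g. g \<in> bddf (dom1 G) \<and> (AE x in lborel_on (dom1 G). Ep G k l x = g x)"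
      using Linf_bddf[OF Epl[OF that]] by metis
    from someI_ex[OF this, folded E_def]
    show "E l \<in> bddf (dom1 G)" "AE x in lborel_on (dom1 G). Ep G k l x = E l x" by auto
  qed
  have coord: "pi_fun (lo G) (hi G) (ntot G) (nbc G) (\<lambda>v z. z k)" if "k < nbc G" for k
    by (rule pi_fun_coord[OF that])
  have op: "pi_op (lo G) (hi G) (ntot G) (nbc G) (\<lambda>v c. recon_int G c v l)" if "l < nint G" for l
    by (rule recon_int_pi_op[where c="\<lambda>v z. z", OF coord that])
  have "pi_op (lo G) (hi G) (ntot G) (nbc G) (\<lambda>v c x. \<Sum>l<nint G. E l x * recon_int G c v l x)"
    by (intro pi_op_sum pi_op_bddf_mult op E) auto
  from pi_fun_integral[OF less_imp_le[OF ab] this bddf_const[of 1]]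
  have "pi_fun (lo G) (hi G) (ntot G) (nbc G) (\<lambda>v c. LINT x|lborel_on (dom1 G). (\<Sum>l<nint G. E l x * recon_int G c v l x))"
    by simp
  then have 1: "pi_fun (lo G) (hi G) (ntot G) (nbc G) (\<lambda>v c. mult_int (dom1 G) (nint G) (Ep G) (recon_int G c v) k)"
  proof (rule pi_fun_cong)
    fix v :: "real vfun" and c :: rvec assume v: "v \<in> L2 (ntot G) (dom1 G)"
    have m: "recon_int G c v l \<in> borel_measurable (lborel_on (dom1 G))" if "l < nint G" for l
      using pi_op_sqint[OF op[OF that] v] by (rule sqint_measurable)
    show "mult_int (dom1 G) (nint G) (Ep G) (recon_int G c v) k = (LINT x|lborel_on (dom1 G). (\<Sum>l<nint G. E l x * recon_int G c v l x))"
      unfolding mult_int_def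
    proof (rule integral_cong_AE)
      show "(\<lambda>x. \<Sum>l<nint G. Ep G k l x * recon_int G c v l x) \<in> borel_measurable (lborel_on (dom1 G))"
        "(\<lambda>x. \<Sum>l<nint G. E l x * recon_int G c v l x) \<in> borel_measurable (lborel_on (dom1 G))"
        using m Epl E(1)[THEN bddf_measurable]
        by (auto intro!: borel_measurable_sum borel_measurable_times simp: Linf_def)
      have "AE x in lborel_on (dom1 G). \<forall>l\<in>{..<nint G}. Ep G k l x = E l x"
        using E by (intro AE_finite_allI) auto
      then show "AE x in lborel_on (dom1 G). (\<Sum>l<nint G. Ep G k l x * recon_int G c v l x) = (\<Sum>l<nint G. E l x * recon_int G c v l x)"
        by eventually_elim (auto intro!: sum.cong)
    qed
  qed
  have 2: "pi_fun (lo G) (hi G) (ntot G) (nbc G) (\<lambda>v c. mult_cc (nbf G) (Eb G) (recon_bf G c v) k)"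
    unfolding mult_cc_def
    by (intro pi_fun_sum pi_fun_cmult recon_bf_pi_fun[where c="\<lambda>v z. z", OF ab coord]) auto
  show ?thesis unfolding bc_res_def by (rule pi_fun_add[OF 1 2])
qed

lemma X_space_recon:
  assumes v: "v \<in> L2 (ntot G) (dom1 G)"
    and u: "\<And>i. i < ntot G \<Longrightarrow> u i \<in> borel_measurable (lborel_on (dom1 G))"
      "\<And>i. i < ntot G \<Longrightarrow> AE x in lborel_on (dom1 G). u i x = recon G c v 0 i x"
  shows "u \<in> X_space G z \<longleftrightarrow> (\<forall>k<nbc G. bc_res G v c k + mult_cc (nz G) (Ez G) z k = 0)"
proof -
  have coord: "pi_fun (lo G) (hi G) (ntot G) (nbc G) (\<lambda>v z. z k)" if "k < nbc G" for k
    by (rule pi_fun_coord[OF that])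
  have "mult_int (dom1 G) (nint G) (Ep G) (D_int G u) k = mult_int (dom1 G) (nint G) (Ep G) (recon_int G c v) k" if "k < nbc G" for k
    using Ep that recon_D_int[OF ab v u] recon_D_int_sqint[OF ab v u]
      pi_op_sqint[OF recon_int_pi_op[where c="\<lambda>v z. z", OF coord] v, of _ c]
    by (intro mult_int_cong_AE) (auto simp: Linf_mat_def intro: sqint_measurable)
  moreover have "mult_cc (nbf G) (Eb G) (Lambda_bf G u) k = mult_cc (nbf G) (Eb G) (recon_bf G c v) k" for k
    unfolding mult_cc_def using recon_Lambda_bf[OF ab v u] by (intro sum.cong) auto
  ultimately show ?thesis
    using recon_U_space[OF ab v u] by (simp add: X_space_def eqv_def bc_res_def)
qed

context
  assumes wp: "well_posed G"
begin

text \<open>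
  A vector \<open>c\<close> in the kernel gives a solution of the homogeneous problem with \<open>v = 0\<close>, and so does zero. By
  uniqueness they agree, and their left boundary values are \<open>c\<close> and zero.
\<close>

lemma bc_res_injective:
  assumes c: "\<And>k. nbc G \<le> k \<Longrightarrow> c k = 0" and 0: "\<And>k. k < nbc G \<Longrightarrow> bc_res G (\<lambda>i x. 0) c k = 0"
  shows "c = (\<lambda>k. 0)"
proof
  fix k
  define u where "u = recon G c (\<lambda>i x. 0) 0"
  \<comment> \<open>Two solutions for the data \<open>(0, 0)\<close>: the one with left boundary values \<open>c\<close>, and the trivial one.\<close>
  define u0 where "u0 = recon G (\<lambda>k. 0) (\<lambda>i x. 0) 0"
  note z = L2_zero[of "ntot G" "dom1 G"]
  have m: "recon G c (\<lambda>i x. 0) 0 i \<in> borel_measurable (lborel_on (dom1 G))" if "i < ntot G" for c i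
    by (intro sqint_measurable recon_weak_pd(1)) (auto simp: sqint_zero)
  have 00: "bc_res G (\<lambda>i x. 0) (\<lambda>k. 0) k = 0" if "k < nbc G" for k
    using pi_fun_lin[OF bc_res_pi_fun[OF that] z z less_imp_le[OF ab], where c="-1" and z="\<lambda>k. 0" and z'="\<lambda>k. 0"] by simp
  have "u \<in> X_space G 0" "u0 \<in> X_space G 0"
    using X_space_recon[where c=c and u=u and z=0, OF z] X_space_recon[where c="\<lambda>k. 0" and u=u0 and z=0, OF z] 0 00 m
    by (auto simp: u_def u0_def mult_cc_def)
  moreover have "eqf (ntot G) (dom1 G) (D_op G u) (\<lambda>i x. 0)" "eqf (ntot G) (dom1 G) (D_op G u0) (\<lambda>i x. 0)"
    using recon_D_op[where c=c and u=u, OF ab z] recon_D_op[where c="\<lambda>k. 0" and u=u0, OF ab z] m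
    by (auto simp: u_def u0_def)
  ultimately have "\<exists>u1. eqf (ntot G) (dom1 G) u u1 \<and> eqf (ntot G) (dom1 G) u0 u1"
    using wp z unfolding well_posed_def by blast
  then have eq: "AE x in lborel_on (dom1 G). u0 i x = u i x" if "i < ntot G" for i
    using that unfolding eqf_def by (auto elim!: allE[of _ i] eventually_elim2)
  show "c k = 0"
  proof (cases "k < nbc G")
    case True
    have "Lambda_bf G u0 k = recon_bf G c (\<lambda>i x. 0) k"
      by (rule recon_Lambda_bf[OF ab z]) (use m eq True in \<open>auto simp: u0_def u_def\<close>)
    moreover have "Lambda_bf G u0 k = recon_bf G (\<lambda>k. 0) (\<lambda>i x. 0) k"
      by (rule recon_Lambda_bf[OF ab z]) (use m True in \<open>auto simp: u0_def\<close>)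
    ultimately show ?thesis using True by (simp add: recon_bf_def)
  qed (use c in simp)
qed

text \<open>The boundary conditions read \<open>M c = - (res(v, 0) + E\<^sub>z z)\<close>; apply the left inverse of \<open>M\<close>.\<close>

lemma bc_data_exists:
  "\<exists>cs. (\<forall>k<nbc G. pi_fun (lo G) (hi G) (ntot G) (nz G) (\<lambda>v z. cs v z k)) \<and>
    (\<forall>v\<in>L2 (ntot G) (dom1 G). \<forall>z. \<forall>u\<in>X_space G z. eqf (ntot G) (dom1 G) (D_op G u) v \<longrightarrow>
      (\<forall>i<ntot G. AE x in lborel_on (dom1 G). u i x = recon G (cs v z) v 0 i x))"
proof -
  note z0 = L2_zero[of "ntot G" "dom1 G"]
  \<comment> \<open>The matrix of the boundary conditions; \<open>L\<close> is its left inverse.\<close>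
  define M where "M c = (\<lambda>k. if k < nbc G then bc_res G (\<lambda>i x. 0) c k else 0)" for c
  obtain L where L: "\<And>c. (\<And>k. nbc G \<le> k \<Longrightarrow> c k = 0) \<Longrightarrow> c = (\<lambda>k. \<Sum>l<nbc G. L k l * M c l)"
  proof (rule left_inverse_matrix[of M "nbc G"])
    show "M (\<lambda>k. c k + s * d k) = (\<lambda>k. M c k + s * M d k)" for c d s
      using pi_fun_lin[OF bc_res_pi_fun z0 z0 less_imp_le[OF ab], where c=s and z=c and z'=d] by (auto simp: M_def fun_eq_iff)
    show "c = (\<lambda>k. 0)" if "\<And>k. nbc G \<le> k \<Longrightarrow> c k = 0" "\<And>k. k < nbc G \<Longrightarrow> M c k = 0" for c
      using that by (intro bc_res_injective) (auto simp: M_def)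
  qed blast
  define cs where "cs v z k = (\<Sum>l<nbc G. L k l * (- 1 * (bc_res G v (\<lambda>k. 0) l + mult_cc (nz G) (Ez G) z l)))" for v z k
  have "pi_fun (lo G) (hi G) (ntot G) (nz G) (\<lambda>v z. cs v z k)" for k
    unfolding cs_def
    by (intro pi_fun_sum pi_fun_cmult pi_fun_add pi_fun_Ez pi_fun_restrict[OF bc_res_pi_fun]) auto
  moreover have "AE x in lborel_on (dom1 G). u i x = recon G (cs v z) v 0 i x"
    if v: "v \<in> L2 (ntot G) (dom1 G)" and u: "u \<in> X_space G z" "eqf (ntot G) (dom1 G) (D_op G u) v" and i: "i < ntot G" for v z u i
  proof -
    have U: "u \<in> U_space G" using u(1) by (simp add: X_space_def)
    obtain c where c: "\<And>k. nbc G \<le> k \<Longrightarrow> c k = 0" "\<And>i. i < ntot G \<Longrightarrow> AE x in lborel_on (dom1 G). u i x = recon G c v 0 i x"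
      using recon_complete[OF ab v U u(2)] by blast
    have m: "u i \<in> borel_measurable (lborel_on (dom1 G))" if "i < ntot G" for i
      using U that by (auto simp: U_space_def intro!: sqint_measurable sobolev_sqint)
    have res: "bc_res G v c k + mult_cc (nz G) (Ez G) z k = 0" if "k < nbc G" for k
      using X_space_recon[OF v m c(2), of z] u(1) that by blast
    have "M c k = - 1 * (bc_res G v (\<lambda>k. 0) k + mult_cc (nz G) (Ez G) z k)" if k: "k < nbc G" for k
      using pi_fun_lin[OF bc_res_pi_fun[OF k] v z0 less_imp_le[OF ab], where c=1 and z="\<lambda>k. 0" and z'=c] res[OF k] k
      by (simp add: M_def)
    then have "c = cs v z"
      by (subst L[OF c(1)]) (auto simp: cs_def fun_eq_iff intro!: sum.cong)
    with c(2)[OF i] show ?thesis by simp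
  qed
  ultimately show ?thesis by (intro exI[of _ cs]) blast
qed

end
end

text \<open>
  The left boundary values of the solution for \<open>(v, z)\<close>, and from them its derivatives,
  \<open>D_int\<close> and \<open>Lambda_bf\<close>.
\<close>

definition bc_left :: "('m) bc_data_scheme \<Rightarrow> real vfun \<Rightarrow> rvec \<Rightarrow> rvec"
  where "bc_left G = (SOME cs. (\<forall>k<nbc G. pi_fun (lo G) (hi G) (ntot G) (nz G) (\<lambda>v z. cs v z k)) \<and>
    (\<forall>v\<in>L2 (ntot G) (dom1 G). \<forall>z. \<forall>u\<in>X_space G z. eqf (ntot G) (dom1 G) (D_op G u) v \<longrightarrow>
      (\<forall>i<ntot G. AE x in lborel_on (dom1 G). u i x = recon G (cs v z) v 0 i x)))"

definition bc_op :: "('m) bc_data_scheme \<Rightarrow> nat \<Rightarrow> nat \<Rightarrow> real vfun \<Rightarrow> rvec \<Rightarrow> real \<Rightarrow> real"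
  where "bc_op G \<beta> i v z = recon G (bc_left G v z) v \<beta> i"

definition int_op :: "('m) bc_data_scheme \<Rightarrow> nat \<Rightarrow> real vfun \<Rightarrow> rvec \<Rightarrow> real \<Rightarrow> real"
  where "int_op G k v z = recon_int G (bc_left G v z) v k"

definition bf_fun :: "('m) bc_data_scheme \<Rightarrow> nat \<Rightarrow> real vfun \<Rightarrow> rvec \<Rightarrow> real"
  where "bf_fun G k v z = recon_bf G (bc_left G v z) v k"

abbreviation pio :: "('m) bc_data_scheme \<Rightarrow> (real vfun \<Rightarrow> rvec \<Rightarrow> real \<Rightarrow> real) \<Rightarrow> bool"
  where "pio G \<equiv> pi_op (lo G) (hi G) (ntot G) (nz G)"

abbreviation pif :: "('m) bc_data_scheme \<Rightarrow> (real vfun \<Rightarrow> rvec \<Rightarrow> real) \<Rightarrow> bool"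
  where "pif G \<equiv> pi_fun (lo G) (hi G) (ntot G) (nz G)"

definition well_posed_bc :: "('m) bc_data_scheme \<Rightarrow> bool"
  where "well_posed_bc G \<longleftrightarrow> lo G < hi G \<and> Ep G \<in> Linf_mat G (nbc G) (nint G) \<and> well_posed G"

context
  fixes G :: "('m) bc_data_scheme"
  assumes G: "well_posed_bc G"
begin

lemma lo_less_hi: "lo G < hi G" and lo_le_hi: "lo G \<le> hi G" and Ep_Linf: "Ep G \<in> Linf_mat G (nbc G) (nint G)"
  and wp_G: "well_posed G"
  using G by (simp_all add: well_posed_bc_def)

lemma bc_left_pi_fun: "k < nbc G \<Longrightarrow> pif G (\<lambda>v z. bc_left G v z k)"
  and bc_left_recon: "v \<in> L2 (ntot G) (dom1 G) \<Longrightarrow> u \<in> X_space G z \<Longrightarrow> eqf (ntot G) (dom1 G) (D_op G u) v \<Longrightarrow>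
    i < ntot G \<Longrightarrow> AE x in lborel_on (dom1 G). u i x = bc_op G 0 i v z x"
  using someI_ex[OF bc_data_exists[OF lo_less_hi Ep_Linf wp_G], folded bc_left_def]
  unfolding bc_op_def by blast+

lemma bc_op_pi_op: "i < ntot G \<Longrightarrow> \<beta> \<le> reg G i \<Longrightarrow> pio G (bc_op G \<beta> i)"
  using recon_pi_op[where c="bc_left G", OF bc_left_pi_fun] by (simp add: bc_op_def[abs_def])

lemma int_op_pi_op: "k < nint G \<Longrightarrow> pio G (int_op G k)"
  using recon_int_pi_op[where c="bc_left G", OF bc_left_pi_fun] by (simp add: int_op_def[abs_def])

lemma bf_fun_pi_fun: "k < nbf G \<Longrightarrow> pif G (bf_fun G k)"
  using recon_bf_pi_fun[where c="bc_left G", OF lo_less_hi bc_left_pi_fun] by (simp add: bf_fun_def[abs_def])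

lemma bc_solution_spec:
  assumes "v \<in> L2 (ntot G) (dom1 G)"
  shows "bc_solution G v z \<in> X_space G z" "eqf (ntot G) (dom1 G) (D_op G (bc_solution G v z)) v"
proof -
  have "\<exists>u. u \<in> X_space G z \<and> eqf (ntot G) (dom1 G) (D_op G u) v"
    using wp_G assms unfolding well_posed_def by blast
  from someI_ex[OF this, folded bc_solution_def]
  show "bc_solution G v z \<in> X_space G z" "eqf (ntot G) (dom1 G) (D_op G (bc_solution G v z)) v" by auto
qed

lemma X_space_measurable: "u \<in> X_space G z \<Longrightarrow> i < ntot G \<Longrightarrow> u i \<in> borel_measurable (lborel_on (dom1 G))"
  by (auto simp: X_space_def U_space_def intro!: sqint_measurable sobolev_sqint)

lemma bc_solution_measurable:
  "v \<in> L2 (ntot G) (dom1 G) \<Longrightarrow> i < ntot G \<Longrightarrow> bc_solution G v z i \<in> borel_measurable (lborel_on (dom1 G))"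
  by (rule X_space_measurable[OF bc_solution_spec(1)])

lemma bc_solution_AE:
  "v \<in> L2 (ntot G) (dom1 G) \<Longrightarrow> i < ntot G \<Longrightarrow> AE x in lborel_on (dom1 G). bc_solution G v z i x = bc_op G 0 i v z x"
  by (rule bc_left_recon[OF _ bc_solution_spec])

text \<open>
  The representatives of \<open>T v + T\<^sub>z z\<close> and of the slices of histories are not under control; only their
  classes are. Hence these facts are stated for every representative.
\<close>

lemma
  assumes v: "v \<in> L2 (ntot G) (dom1 G)"
    and u: "\<And>i. i < ntot G \<Longrightarrow> u i \<in> borel_measurable (lborel_on (dom1 G))"
      "\<And>i. i < ntot G \<Longrightarrow> AE x in lborel_on (dom1 G). u i x = bc_op G 0 i v z x"
  shows bc_op_X_space: "u \<in> X_space G z"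
    and bc_op_wpd: "i < ntot G \<Longrightarrow> \<beta> \<le> reg G i \<Longrightarrow> AE x in lborel_on (dom1 G). wpd (dom1 G) (replicate \<beta> 1) (u i) x = bc_op G \<beta> i v z x"
    and bc_op_D_int: "k < nint G \<Longrightarrow> AE x in lborel_on (dom1 G). D_int G u k x = int_op G k v z x"
    and bc_op_D_int_sqint: "k < nint G \<Longrightarrow> D_int G u k \<in> sqint (dom1 G)"
    and bc_op_Lambda_bf: "k < nbf G \<Longrightarrow> Lambda_bf G u k = bf_fun G k v z"
    and bc_op_U_space: "u \<in> U_space G"
proof -
  note r = u(2)[unfolded bc_op_def]
  note s = bc_solution_AE[OF v, unfolded bc_op_def]
  have "\<forall>k<nbc G. bc_res G v (bc_left G v z) k + mult_cc (nz G) (Ez G) z k = 0"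
    using X_space_recon[OF lo_less_hi Ep_Linf v bc_solution_measurable[OF v] s, of z z] bc_solution_spec(1)[OF v, of z]
    by blast
  then show "u \<in> X_space G z"
    using X_space_recon[OF lo_less_hi Ep_Linf v u(1) r, of z] by blast
  then show "u \<in> U_space G" by (simp add: X_space_def)
  show "i < ntot G \<Longrightarrow> \<beta> \<le> reg G i \<Longrightarrow> AE x in lborel_on (dom1 G). wpd (dom1 G) (replicate \<beta> 1) (u i) x = bc_op G \<beta> i v z x"
    using recon_wpd[OF lo_less_hi v u(1) r] by (simp add: bc_op_def)
  show "k < nint G \<Longrightarrow> AE x in lborel_on (dom1 G). D_int G u k x = int_op G k v z x"
    using recon_D_int[OF lo_less_hi v u(1) r] by (simp add: int_op_def)
  show "k < nint G \<Longrightarrow> D_int G u k \<in> sqint (dom1 G)"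
    by (rule recon_D_int_sqint[OF lo_less_hi v u(1) r])
  show "k < nbf G \<Longrightarrow> Lambda_bf G u k = bf_fun G k v z"
    using recon_Lambda_bf[OF lo_less_hi v u(1) r] by (simp add: bf_fun_def)
qed

lemma bc_op_weak_pd:
  assumes "v \<in> L2 (ntot G) (dom1 G)" "i < ntot G" "\<beta> \<le> reg G i"
  shows "weak_pd (dom1 G) (replicate \<beta> 1) (bc_op G 0 i v z) (bc_op G \<beta> i v z)"
  unfolding bc_op_def by (rule recon_weak_pd(2)[where v=v and i=i, OF L2_sqint[OF assms(1,2)] assms(3)])

lemma bc_op_top: "bc_op G (reg G i) i v z = v i"
  by (simp add: bc_op_def recon_def)

text \<open>\<open>T\<close> and \<open>T\<^sub>z\<close> are the solutions for \<open>(v, 0)\<close> and \<open>(0, z)\<close>.\<close>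

lemma pif_split:
  assumes "pif G F" "v \<in> L2 (ntot G) (dom1 G)"
  shows "F v z = F v 0 + F 0 z"
  using pi_fun_lin[OF assms(1) assms(2) L2_zero lo_le_hi, where c=1 and z=0 and z'=z]
  by (simp add: zero_fun_def)

lemma pio_split:
  assumes "pio G Op" "v \<in> L2 (ntot G) (dom1 G)" "x \<in> dom1 G"
  shows "Op v z x = Op v 0 x + Op 0 z x"
  using pi_op_lin[OF assms(1) assms(2) L2_zero assms(3), where c=1 and z=0 and z'=z]
  by (simp add: zero_fun_def)

lemma L2_0: "0 \<in> L2 n S"
  using L2_zero by (simp add: zero_fun_def)

lemma
  assumes v: "v \<in> L2 (ntot G) (dom1 G)"
  shows T_op_measurable: "i < ntot G \<Longrightarrow> T_op G v i \<in> borel_measurable (lborel_on (dom1 G))"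
    and Tz_op_measurable: "i < ntot G \<Longrightarrow> Tz_op G z i \<in> borel_measurable (lborel_on (dom1 G))"
    and T_Tz_op_AE: "i < ntot G \<Longrightarrow> AE x in lborel_on (dom1 G). T_op G v i x + Tz_op G z i x = bc_op G 0 i v z x"
    and T_Tz_int_AE: "k < nint G \<Longrightarrow> AE x in lborel_on (dom1 G). Tint_op G v k x + Tintz_op G z k x = int_op G k v z x"
    and Tint_op_sqint: "k < nint G \<Longrightarrow> Tint_op G v k \<in> sqint (dom1 G)"
    and Tintz_op_sqint: "k < nint G \<Longrightarrow> Tintz_op G z k \<in> sqint (dom1 G)"
    and T_Tz_bf: "k < nbf G \<Longrightarrow> Tbf_op G v k + Tbfz_op G z k = bf_fun G k v z"
proof -
  note m1 = bc_solution_measurable[OF v, of _ 0] and m2 = bc_solution_measurable[OF L2_0, of _ z]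
  note e1 = bc_solution_AE[OF v, of _ 0] and e2 = bc_solution_AE[OF L2_0, of _ z]
  have dom: "AE x in lborel_on (dom1 G). x \<in> dom1 G" by (intro AE_I2) simp
  show "i < ntot G \<Longrightarrow> T_op G v i \<in> borel_measurable (lborel_on (dom1 G))"
    "i < ntot G \<Longrightarrow> Tz_op G z i \<in> borel_measurable (lborel_on (dom1 G))"
    using m1 m2 by (simp_all add: T_op_def Tz_op_def)
  show "AE x in lborel_on (dom1 G). T_op G v i x + Tz_op G z i x = bc_op G 0 i v z x" if "i < ntot G"
    using e1[OF that] e2[OF that] dom
    by eventually_elim (simp add: T_op_def Tz_op_def pio_split[OF bc_op_pi_op[OF that le0] v, of _ z])
  show "AE x in lborel_on (dom1 G). Tint_op G v k x + Tintz_op G z k x = int_op G k v z x" if "k < nint G"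
  proof -
    have "AE x in lborel_on (dom1 G). D_int G (bc_solution G v 0) k x = int_op G k v 0 x"
      by (rule bc_op_D_int[OF v m1 e1 that])
    moreover have "AE x in lborel_on (dom1 G). D_int G (bc_solution G 0 z) k x = int_op G k 0 z x"
      by (rule bc_op_D_int[OF L2_0 m2 e2 that])
    ultimately show ?thesis
      using dom by eventually_elim (simp add: Tint_op_def Tintz_op_def T_op_def Tz_op_def pio_split[OF int_op_pi_op[OF that] v, of _ z])
  qed
  show "k < nint G \<Longrightarrow> Tint_op G v k \<in> sqint (dom1 G)" "k < nint G \<Longrightarrow> Tintz_op G z k \<in> sqint (dom1 G)"
    using bc_op_D_int_sqint[OF v m1 e1] bc_op_D_int_sqint[OF L2_0 m2 e2]
    by (simp_all add: Tint_op_def Tintz_op_def T_op_def Tz_op_def)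
  show "Tbf_op G v k + Tbfz_op G z k = bf_fun G k v z" if "k < nbf G"
    using bc_op_Lambda_bf[OF v m1 e1 that] bc_op_Lambda_bf[OF L2_0 m2 e2 that]
    by (simp add: Tbf_op_def Tbfz_op_def T_op_def Tz_op_def pif_split[OF bf_fun_pi_fun[OF that] v, of z])
qed

end

section \<open>Weak derivatives on the rectangle\<close>

lemma rect_cbox: "{0..1::real} \<times> {a..b::real} = cbox (0, a) (1, b)"
  by (simp add: cbox_Pair_eq box_real)

lemma wpd_rect_eqI:
  "g \<in> sqint ({0..1::real} \<times> {a..b::real}) \<Longrightarrow> weak_pd ({0..1} \<times> {a..b}) ds f g \<Longrightarrow>
    AE p in lborel_on ({0..1} \<times> {a..b}). wpd ({0..1} \<times> {a..b}) ds f p = g p"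
  unfolding rect_cbox by (rule wpd_eqI)

lemma compact_rect: "compact ({0..1::real} \<times> {a..b::real})"
  by (intro compact_Times) auto

lemma test_function_section:
  assumes \<eta>: "test_function ({0..1::real} \<times> {a..b::real}) \<eta>"
  shows "test_function {a..b} (\<lambda>x. \<eta> (s, x))" "test_function {0..1} (\<lambda>s. \<eta> (s, x))"
proof -
  let ?K = "closure {p. \<eta> p \<noteq> 0}"
  have sm: "smooth \<eta>" and K: "compact ?K" "?K \<subseteq> {0<..<1} \<times> {a<..<b}"
    using \<eta> by (auto simp: test_function_def interior_Times)
  have sub: "{p. \<eta> p \<noteq> 0} \<subseteq> ?K" by (rule closure_subset)
  have im: "(\<lambda>p. snd p) ` ?K \<subseteq> {a<..<b}" "(\<lambda>p. fst p) ` ?K \<subseteq> {0<..<1}" using K(2) by auto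
  have 1: "compact ((\<lambda>p. snd p) ` ?K)" "compact ((\<lambda>p. fst p) ` ?K)"
    by (intro compact_continuous_image continuous_intros K)+
  have c: "closure {x. \<eta> (s, x) \<noteq> 0} \<subseteq> (\<lambda>p. snd p) ` ?K" "closure {s. \<eta> (s, x) \<noteq> 0} \<subseteq> (\<lambda>p. fst p) ` ?K"
    using sub by (intro closure_minimal compact_imp_closed 1; force)+
  have "compact (closure {x. \<eta> (s, x) \<noteq> 0})" "compact (closure {s. \<eta> (s, x) \<noteq> 0})"
    using compact_Int_closed[OF 1(1) closed_closure, of "{x. \<eta> (s, x) \<noteq> 0}"]
      compact_Int_closed[OF 1(2) closed_closure, of "{s. \<eta> (s, x) \<noteq> 0}"] c by (simp_all add: Int_absorb1)
  then show "test_function {a..b} (\<lambda>x. \<eta> (s, x))" "test_function {0..1} (\<lambda>s. \<eta> (s, x))"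
    using smooth_section(1,2)[OF sm] subset_trans[OF c(1) im(1)] subset_trans[OF c(2) im(2)]
    unfolding test_function_def by simp_all
qed

lemma foldr_pd_section:
  assumes "test_function ({0..1::real} \<times> {a..b::real}) \<eta>"
  shows "foldr pd (replicate \<beta> (0, 1)) \<eta> (s, x) = foldr pd (replicate \<beta> 1) (\<lambda>x. \<eta> (s, x)) x"
proof (induction \<beta> arbitrary: x)
  case (Suc \<beta>)
  have "smooth (foldr pd (replicate \<beta> (0, 1)) \<eta>)"
  proof -
    have "set (replicate \<beta> (0::real, 1::real)) \<subseteq> Basis" using Basis_prod_real by auto
    from test_function_foldr_pd[OF assms this] show ?thesis by (simp add: test_function_def)
  qed
  from smooth_section(3)[OF this, of s]
  have "pd (0, 1) (foldr pd (replicate \<beta> (0, 1)) \<eta>) (s, x) = pd 1 (\<lambda>x. foldr pd (replicate \<beta> (0, 1)) \<eta> (s, x)) x"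
    by metis
  with Suc show ?case by simp
qed simp

text \<open>Fubini's theorem: a section of a test function is a test function on the interval.\<close>

lemma weak_pd_rect_x:
  fixes f g :: "real \<times> real \<Rightarrow> real"
  assumes f: "f \<in> sqint ({0..1} \<times> {a..b})" and g: "g \<in> sqint ({0..1} \<times> {a..b})"
    and w: "AE s in lborel_on {0..1}. weak_pd {a..b} (replicate \<beta> 1) (\<lambda>x. f (s, x)) (\<lambda>x. g (s, x))"
  shows "weak_pd ({0..1} \<times> {a..b}) (replicate \<beta> (0, 1)) f g"
  unfolding weak_pd_def
proof (intro allI impI)
  fix \<eta> :: "real \<times> real \<Rightarrow> real" assume \<eta>: "test_function ({0..1} \<times> {a..b}) \<eta>"
  have ds: "set (replicate \<beta> (0, 1)) \<subseteq> (Basis :: (real \<times> real) set)" using Basis_prod_real by auto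
  note i1 = weak_pd_integrable[OF \<eta> ds f compact_rect]
  have i2: "integrable (lborel_on ({0..1} \<times> {a..b})) (\<lambda>p. g p * \<eta> p)"
    using weak_pd_integrable[OF \<eta> _ g compact_rect, of "[]"] by simp
  have "(LINT p|lborel_on ({0..1} \<times> {a..b}). f p * foldr pd (replicate \<beta> (0, 1)) \<eta> p)
      = (LINT s|lborel_on {0..1}. LINT x|lborel_on {a..b}. f (s, x) * foldr pd (replicate \<beta> (0, 1)) \<eta> (s, x))"
    by (rule rect_integral1[OF compact_Icc compact_Icc i1, symmetric])
  also have "\<dots> = (LINT s|lborel_on {0..1}. (-1) ^ \<beta> * (LINT x|lborel_on {a..b}. g (s, x) * \<eta> (s, x)))"
  proof (rule integral_cong_AE)
    show "AE s in lborel_on {0..1}. (LINT x|lborel_on {a..b}. f (s, x) * foldr pd (replicate \<beta> (0, 1)) \<eta> (s, x))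
        = (-1) ^ \<beta> * (LINT x|lborel_on {a..b}. g (s, x) * \<eta> (s, x))"
      using w
    proof eventually_elim
      case (elim s)
      from elim[unfolded weak_pd_def, rule_format, OF test_function_section(1)[OF \<eta>]]
      show ?case by (simp only: foldr_pd_section[OF \<eta>] length_replicate)
    qed
  qed (use rect_integrable1[OF compact_Icc compact_Icc i1] rect_integrable1[OF compact_Icc compact_Icc i2] in auto)
  also have "\<dots> = (-1) ^ \<beta> * (LINT p|lborel_on ({0..1} \<times> {a..b}). g p * \<eta> p)"
    using rect_integral1[OF compact_Icc compact_Icc i2] by simp
  finally show "(LINT p|lborel_on ({0..1} \<times> {a..b}). f p * foldr pd (replicate \<beta> (0, 1)) \<eta> p)
      = (-1) ^ length (replicate \<beta> (0::real, 1::real)) * (LINT p|lborel_on ({0..1} \<times> {a..b}). g p * \<eta> p)" by simp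
qed

lemma weak_pd_rect_s:
  fixes f g :: "real \<times> real \<Rightarrow> real"
  assumes f: "f \<in> sqint ({0..1} \<times> {a..b})" and g: "g \<in> sqint ({0..1} \<times> {a..b})"
    and w: "AE x in lborel_on {a..b}. weak_pd {0..1} [1] (\<lambda>s. f (s, x)) (\<lambda>s. g (s, x))"
  shows "weak_pd ({0..1} \<times> {a..b}) [(1, 0)] f g"
  unfolding weak_pd_def
proof (intro allI impI)
  fix \<eta> :: "real \<times> real \<Rightarrow> real" assume \<eta>: "test_function ({0..1} \<times> {a..b}) \<eta>"
  have ds: "set [(1, 0)] \<subseteq> (Basis :: (real \<times> real) set)" using Basis_prod_real by auto
  have sm: "smooth \<eta>" using \<eta> by (simp add: test_function_def)
  note i1 = weak_pd_integrable[OF \<eta> ds f compact_rect]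
  have i2: "integrable (lborel_on ({0..1} \<times> {a..b})) (\<lambda>p. g p * \<eta> p)"
    using weak_pd_integrable[OF \<eta> _ g compact_rect, of "[]"] by simp
  have sec: "pd (1, 0) \<eta> (s, x) = pd 1 (\<lambda>s. \<eta> (s, x)) s" for s x
    using smooth_section(4)[OF sm, of x] by metis
  have "(LINT p|lborel_on ({0..1} \<times> {a..b}). f p * foldr pd [(1, 0)] \<eta> p)
      = (LINT x|lborel_on {a..b}. LINT s|lborel_on {0..1}. f (s, x) * foldr pd [(1, 0)] \<eta> (s, x))"
    by (rule rect_integral2[OF compact_Icc compact_Icc i1, symmetric])
  also have "\<dots> = (LINT x|lborel_on {a..b}. (-1) * (LINT s|lborel_on {0..1}. g (s, x) * \<eta> (s, x)))"
  proof (rule integral_cong_AE)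
    show "AE x in lborel_on {a..b}. (LINT s|lborel_on {0..1}. f (s, x) * foldr pd [(1, 0)] \<eta> (s, x))
        = (-1) * (LINT s|lborel_on {0..1}. g (s, x) * \<eta> (s, x))"
      using w by eventually_elim
        (use test_function_section(2)[OF \<eta>] in \<open>auto simp: weak_pd_def sec\<close>)
  qed (use rect_integrable2[OF compact_Icc compact_Icc i1] rect_integrable2[OF compact_Icc compact_Icc i2] in auto)
  also have "\<dots> = (-1) * (LINT p|lborel_on ({0..1} \<times> {a..b}). g p * \<eta> p)"
    using rect_integral2[OF compact_Icc compact_Icc i2] by simp
  finally show "(LINT p|lborel_on ({0..1} \<times> {a..b}). f p * foldr pd [(1, 0)] \<eta> p)
      = (-1) ^ length [(1::real, 0::real)] * (LINT p|lborel_on ({0..1} \<times> {a..b}). g p * \<eta> p)" by simp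
qed

lemma weak_pd_tprim:
  assumes c: "c \<in> sqint {a..b}" and f: "f \<in> sqint ({0..1} \<times> {a..b})"
  shows "weak_pd ({0..1} \<times> {a..b}) [(1, 0)] (\<lambda>p. c (snd p) + tprim f p) f"
proof (rule weak_pd_rect_s)
  show "(\<lambda>p. c (snd p) + tprim f p) \<in> sqint ({0..1} \<times> {a..b})"
    by (intro sqint_add sqint_rect_snd tprim_sqint c f) auto
  show "AE x in lborel_on {a..b}. weak_pd {0..1} [1] (\<lambda>s. c (snd (s, x)) + tprim f (s, x)) (\<lambda>s. f (s, x))"
    using rect_AE_sqint2[OF compact_Icc compact_Icc f]
    by eventually_elim (simp add: tprim_prim weak_pd_prim)
qed (rule f)

section \<open>Curves of classes\<close>

text \<open>No point of \<open>[0,1]\<close> has a neighbourhood of measure zero.\<close>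

lemma exists_near_AE:
  assumes s: "s \<in> {0..1::real}" and P: "eventually P (at s within {0..1})" and Q: "AE r in lborel_on {0..1}. Q r"
  shows "\<exists>r\<in>{0..1}. P r \<and> Q r"
proof (rule ccontr)
  assume no: "\<not> ?thesis"
  from P obtain d where d: "d > 0" "\<And>r. r \<in> {0..1} \<Longrightarrow> r \<noteq> s \<Longrightarrow> dist r s < d \<Longrightarrow> P r"
    by (auto simp: eventually_at)
  define p q where "p = (if s < 1 then s else max 0 (1 - d))" and "q = (if s < 1 then min 1 (s + d) else 1)"
  have pq: "p < q" "0 \<le> p" "q \<le> 1" using s d(1) by (auto simp: p_def q_def)
  have "P r" if "r \<in> {p<..<q}" for r
    using that s pq by (intro d(2)) (auto simp: p_def q_def dist_real_def split: if_splits)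
  with no pq have nQ: "\<not> Q r" if "r \<in> {p<..<q}" for r using that by force
  have "AE r in lborel. r \<in> {0..1} \<longrightarrow> Q r" using Q by (simp add: AE_restrict_space_iff)
  then have "AE r in lborel. r \<notin> {p<..<q}"
    by eventually_elim (use nQ pq in auto)
  then have "{p<..<q} \<in> null_sets lborel" by (subst AE_iff_null_sets) auto
  then show False using pq by (simp add: null_sets_def)
qed

text \<open>At \<open>s\<close> both curves are limits along parameters \<open>r\<close> at which they agree.\<close>

lemma L2_continuous_curve_unique:
  assumes c: "\<And>r. r \<in> {0..1} \<Longrightarrow> c r \<in> sqint S" "\<And>r. r \<in> {0..1} \<Longrightarrow> d r \<in> sqint S"
    and lim: "((\<lambda>r. normsq S (c r - c s)) \<longlongrightarrow> 0) (at s within {0..1})" "((\<lambda>r. normsq S (d r - d s)) \<longlongrightarrow> 0) (at s within {0..1})"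
    and ae: "AE r in lborel_on {0..1}. AE x in lborel_on S. c r x = d r x" and s: "s \<in> {0..1::real}"
  shows "AE x in lborel_on S. c s x = d s x"
proof -
  let ?N = "normsq S (\<lambda>x. c s x - d s x)"
  \<comment> \<open>By \<open>c s - d s = (d r - d s) - (c r - c s)\<close> almost everywhere, for a suitable \<open>r\<close> near \<open>s\<close>.\<close>
  have "?N \<le> e" if e: "e > 0" for e
  proof -
    have "eventually (\<lambda>r. normsq S (c r - c s) < e / 4 \<and> normsq S (d r - d s) < e / 4) (at s within {0..1})"
      using order_tendstoD(2)[OF lim(1), of "e / 4"] order_tendstoD(2)[OF lim(2), of "e / 4"] e
      by (simp add: eventually_conj_iff)
    from exists_near_AE[OF s this ae] obtain r where r: "r \<in> {0..1}" "normsq S (c r - c s) < e / 4" "normsq S (d r - d s) < e / 4"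
      "AE x in lborel_on S. c r x = d r x" by blast
    have sq: "(\<lambda>x. d r x - d s x) \<in> sqint S" "(\<lambda>x. c r x - c s x) \<in> sqint S"
      using c r s by (auto intro!: sqint_diff)
    have "?N = normsq S (\<lambda>x. (d r x - d s x) + (-1) * (c r x - c s x))"
    proof (rule normsq_cong_AE)
      show "AE x in lborel_on S. c s x - d s x = (d r x - d s x) + (-1) * (c r x - c s x)"
        using r(4) by eventually_elim simp
    next
      show "(\<lambda>x. c s x - d s x) \<in> sqint S" by (intro sqint_diff c s)
      show "(\<lambda>x. (d r x - d s x) + (-1) * (c r x - c s x)) \<in> sqint S"
        by (intro sqint_add sqint_cmult sq)
    qed
    also have "\<dots> \<le> 2 * normsq S (\<lambda>x. d r x - d s x) + 2 * normsq S (\<lambda>x. (-1) * (c r x - c s x))"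
      by (intro normsq_add_le sqint_cmult sq)
    also have "normsq S (\<lambda>x. (-1) * (c r x - c s x)) = normsq S (\<lambda>x. c r x - c s x)"
      by (subst normsq_cmult) simp
    finally show ?thesis using r(2,3) by (simp add: fun_diff_def)
  qed
  then have "?N \<le> 0" by (rule field_le_epsilon[of _ 0, simplified])
  then have "?N = 0" using normsq_nonneg[of S "\<lambda>x. c s x - d s x"] by linarith
  then have "AE x in lborel_on S. c s x - d s x = 0"
    using c s by (intro normsq_zero_imp_AE sqint_diff) auto
  then show ?thesis by eventually_elim simp
qed

text \<open>An \<open>L\<^sub>2\<close>-continuous curve that represents \<open>\<phi>\<close> determines the class of the chosen slice.\<close>

lemma slice_eq:
  assumes c: "\<And>r. r \<in> {0..1} \<Longrightarrow> c r \<in> sqint {a..b}"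
    and lim: "\<And>r. r \<in> {0..1} \<Longrightarrow> ((\<lambda>r'. normsq {a..b} (c r' - c r)) \<longlongrightarrow> 0) (at r within {0..1})"
    and ae: "AE r in lborel_on {0..1}. AE x in lborel_on {a..b}. c r x = \<phi> i (r, x)"
    and s: "s \<in> {0..1}"
  shows "slice a b \<phi> s i \<in> sqint {a..b}" "AE x in lborel_on {a..b}. slice a b \<phi> s i x = c s x"
proof -
  let ?P = "\<lambda>c. (\<forall>r\<in>{0..1}. c r \<in> sqint {a..b}) \<and>
    (\<forall>r\<in>{0..1}. ((\<lambda>r'. normsq {a..b} (c r' - c r)) \<longlongrightarrow> 0) (at r within {0..1})) \<and>
    (AE r in lborel_on {0..1}. AE x in lborel_on {a..b}. c r x = \<phi> i (r, x))"
  define d where "d = (SOME c. ?P c)"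
  have "?P c" using c lim ae by blast
  then have d: "?P d" unfolding d_def by (rule someI[of ?P])
  have sl: "slice a b \<phi> s i = d s" unfolding slice_def d_def ..
  show "slice a b \<phi> s i \<in> sqint {a..b}" using d s by (simp add: sl)
  have "AE r in lborel_on {0..1}. AE x in lborel_on {a..b}. d r x = c r x"
    using ae conjunct2[OF conjunct2[OF d]]
  proof eventually_elim
    case (elim r)
    show ?case using elim(1,2) by eventually_elim simp
  qed
  with d c lim s show "AE x in lborel_on {a..b}. slice a b \<phi> s i x = c s x"
    unfolding sl by (intro L2_continuous_curve_unique) auto
qed

text \<open>
  The choice in \<open>joint\<close> is over functions with the same slices up to null sets, and these agree almost
  everywhere by Fubini's theorem.
\<close>

lemma joint_eq:
  assumes h: "h \<in> L2 n ({0..1} \<times> {a..b})" and ae: "AE s in lborel_on {0..1}. eqf n {a..b} (\<lambda>i x. h i (s, x)) (F s)"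
  shows "joint n a b F \<in> L2 n ({0..1} \<times> {a..b})" "eqf n ({0..1} \<times> {a..b}) (joint n a b F) h"
proof -
  let ?P = "\<lambda>h. h \<in> L2 n ({0..1} \<times> {a..b}) \<and> (AE s in lborel_on {0..1}. eqf n {a..b} (\<lambda>i x. h i (s, x)) (F s))"
  have j: "?P (joint n a b F)"
    unfolding joint_def by (rule someI[of ?P h]) (use h ae in blast)
  then show "joint n a b F \<in> L2 n ({0..1} \<times> {a..b})" by blast
  have "AE p in lborel_on ({0..1} \<times> {a..b}). joint n a b F i p = h i p" if i: "i < n" for i
  proof (rule rect_AE_eqI)
    show "AE s in lborel_on {0..1}. AE x in lborel_on {a..b}. joint n a b F i (s, x) = h i (s, x)"
      using ae conjunct2[OF j]
    proof eventually_elim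
      case (elim s)
      then have "AE x in lborel_on {a..b}. h i (s, x) = F s i x" "AE x in lborel_on {a..b}. joint n a b F i (s, x) = F s i x"
        using i by (auto simp: eqf_def)
      then show ?case by eventually_elim simp
    qed
  qed (use j h i in \<open>auto intro: sqint_measurable L2_sqint\<close>)
  then show "eqf n ({0..1} \<times> {a..b}) (joint n a b F) h" by (simp add: eqf_def)
qed

section \<open>Histories\<close>

text \<open>
  For the operator \<open>(v, z) \<mapsto> T v + T\<^sub>z z\<close> this is the history of the state up to null sets. Admitting
  any operator treats the derivatives of the history and \<open>D_int\<close> of it in the same way.
\<close>

definition hist :: "('m) bc_data_scheme \<Rightarrow> (real vfun \<Rightarrow> rvec \<Rightarrow> real \<Rightarrow> real) \<Rightarrow> real vfun \<Rightarrow> rvec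
    \<Rightarrow> (real \<times> real) vfun \<Rightarrow> real vfun \<Rightarrow> real \<times> real \<Rightarrow> real"
  where "hist G Op v z \<psi>u \<psi>z p = Op v z (snd p) + tprim (pi_lift (lo G) (hi G) (ntot G) (nz G) Op \<psi>u \<psi>z) p"

text \<open>
  The top derivative and the input at delay parameter \<open>s\<close>: \<open>v + \<integral>\<^sub>0\<^sup>s \<psi>\<^sub>u\<close> and \<open>z + \<integral>\<^sub>0\<^sup>s \<psi>\<^sub>z\<close>. The
  factor one matches the form in which linearity is stated.
\<close>

definition v_at :: "real vfun \<Rightarrow> (real \<times> real) vfun \<Rightarrow> real \<Rightarrow> real vfun"
  where "v_at v \<psi>u s = (\<lambda>k y. v k y + 1 * (LINT r|lborel_on {0..1}. step_kernel (s, r) * \<psi>u k (r, y)))"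

definition z_at :: "rvec \<Rightarrow> real vfun \<Rightarrow> real \<Rightarrow> rvec"
  where "z_at z \<psi>z s = (\<lambda>k. z k + 1 * (LINT r|lborel_on {0..1}. step_kernel (s, r) * \<psi>z k r))"

lemma integral_step_end: "(LINT r|lborel_on {0..1}. step_kernel (1, r) * f r) = (LINT r|lborel_on {0..1}. f r)"
  by (rule Bochner_Integration.integral_cong) (auto simp: step_kernel_def)

text \<open>
  The two components of \<open>\<phi>\<close> as the operators of the integral equation produce them; the summation
  follows their definition.
\<close>

definition hist_u :: "('m) bc_data_scheme \<Rightarrow> real vfun \<Rightarrow> rvec \<Rightarrow> (real \<times> real) vfun \<Rightarrow> real vfun \<Rightarrow> (real \<times> real) vfun"
  where "hist_u G v z \<psi>u \<psi>z = const_in_s (T_op G v) + fst (Tbar_op G (\<psi>u, \<psi>z)) + const_in_s (Tz_op G z)"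

definition hist_z :: "('m) bc_data_scheme \<Rightarrow> rvec \<Rightarrow> (real \<times> real) vfun \<Rightarrow> real vfun \<Rightarrow> real vfun"
  where "hist_z G z \<psi>u \<psi>z = 0 + snd (Tbar_op G (\<psi>u, \<psi>z)) + (\<lambda>i s. z i)"

lemma hist_u_apply: "hist_u G v z \<psi>u \<psi>z i (s, x) = T_op G v i x + tprim (T_curve G (\<psi>u, \<psi>z) i) (s, x) + Tz_op G z i x"
  by (simp add: hist_u_def const_in_s_def Tbar_op_def tprim_def)

lemma hist_z_apply: "hist_z G z \<psi>u \<psi>z i s = z i + prim 0 (\<psi>z i) s"
  by (simp add: hist_z_def Tbar_op_def prim_def)

abbreviation lift :: "('m) bc_data_scheme \<Rightarrow> (real vfun \<Rightarrow> rvec \<Rightarrow> real \<Rightarrow> real) \<Rightarrow> (real \<times> real) vfun \<Rightarrow> real vfun \<Rightarrow> real \<times> real \<Rightarrow> real"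
  where "lift G \<equiv> pi_lift (lo G) (hi G) (ntot G) (nz G)"

context
  fixes G :: "('m) bc_data_scheme" and v :: "real vfun" and z :: rvec and \<psi>u :: "(real \<times> real) vfun" and \<psi>z :: "real vfun"
  assumes G: "well_posed_bc G" and v: "v \<in> L2 (ntot G) (dom1 G)"
    and \<psi>u: "\<psi>u \<in> L2 (ntot G) (dom2 G)" and \<psi>z: "\<psi>z \<in> L2 (nz G) {0..1}"
begin

lemma v_at_L2: "v_at v \<psi>u s \<in> L2 (ntot G) (dom1 G)"
  unfolding v_at_def by (rule L2_lin[OF v time_integral_L2[OF \<psi>u step_weight_bddf]])

lemma lift_sqint: "pio G Op \<Longrightarrow> lift G Op \<psi>u \<psi>z \<in> sqint (dom2 G)"
  by (rule pi_lift_sqint[OF _ \<psi>u \<psi>z])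

lemma hist_sqint: "pio G Op \<Longrightarrow> hist G Op v z \<psi>u \<psi>z \<in> sqint (dom2 G)"
  unfolding hist_def[abs_def]
  by (intro sqint_add sqint_rect_snd tprim_sqint lift_sqint pi_op_sqint[OF _ v]) auto

lemma hist_section_sqint: "pio G Op \<Longrightarrow> s \<in> {0..1} \<Longrightarrow> (\<lambda>x. hist G Op v z \<psi>u \<psi>z (s, x)) \<in> sqint (dom1 G)"
  unfolding hist_def using tprim_section_sqint[OF lift_sqint] pi_op_sqint[OF _ v] by (auto intro!: sqint_add)

text \<open>Integration over the delay variable commutes with the operator.\<close>

lemma hist_section:
  assumes op: "pio G Op" and s: "s \<in> {0..1}"
  shows "AE x in lborel_on (dom1 G). hist G Op v z \<psi>u \<psi>z (s, x) = Op (v_at v \<psi>u s) (z_at z \<psi>z s) x"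
proof -
  have "AE x in lborel_on (dom1 G). x \<in> dom1 G" by (intro AE_I2) simp
  with pi_lift_time_integral[OF op \<psi>u \<psi>z step_weight_bddf[of s]] show ?thesis
  proof eventually_elim
    case (elim x)
    show ?case
      \<comment> \<open>Linearity separates \<open>(v, z)\<close> from the time integrals of \<open>\<psi>\<close>.\<close>
      unfolding v_at_def z_at_def pi_op_lin[OF op v time_integral_L2[OF \<psi>u step_weight_bddf] elim(2)]
      using elim(1) by (simp add: hist_def tprim_weight[OF s])
  qed
qed

lemma lift_section:
  assumes op: "pio G Op"
  shows "AE s in lborel_on {0..1}. section2_at \<psi>u s \<in> L2 (ntot G) (dom1 G) \<and>
    (\<forall>x\<in>dom1 G. lift G Op \<psi>u \<psi>z (s, x) = Op (section2_at \<psi>u s) (section_at \<psi>z s) x)"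
  using section_L2[OF \<psi>u] by eventually_elim (simp add: pi_lift_section[OF op])

lemma hist_weak_pd_s: "pio G Op \<Longrightarrow> weak_pd (dom2 G) [(1, 0)] (hist G Op v z \<psi>u \<psi>z) (lift G Op \<psi>u \<psi>z)"
  unfolding hist_def[abs_def] by (intro weak_pd_tprim lift_sqint pi_op_sqint[OF _ v])

text \<open>
  Slice by slice: each slice of \<open>hist\<close> is a solution of the boundary value problem, and almost every
  slice of \<open>lift\<close> is one.
\<close>

lemma hist_weak_pd_x:
  assumes i: "i < ntot G" "\<beta> \<le> reg G i"
  shows "weak_pd (dom2 G) (replicate \<beta> (0, 1)) (hist G (bc_op G 0 i) v z \<psi>u \<psi>z) (hist G (bc_op G \<beta> i) v z \<psi>u \<psi>z)"
    and "weak_pd (dom2 G) (replicate \<beta> (0, 1)) (lift G (bc_op G 0 i) \<psi>u \<psi>z) (lift G (bc_op G \<beta> i) \<psi>u \<psi>z)"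
proof -
  note op0 = bc_op_pi_op[OF G i(1) le0] and op = bc_op_pi_op[OF G i]
  note B = replicate_Basis
  show "weak_pd (dom2 G) (replicate \<beta> (0, 1)) (hist G (bc_op G 0 i) v z \<psi>u \<psi>z) (hist G (bc_op G \<beta> i) v z \<psi>u \<psi>z)"
  proof (rule weak_pd_rect_x[OF hist_sqint[OF op0] hist_sqint[OF op]], rule AE_I2)
    fix s :: real assume "s \<in> space (lborel_on {0..1})"
    then have s: "s \<in> {0..1}" by simp
    have "weak_pd (dom1 G) (replicate \<beta> 1) (bc_op G 0 i (v_at v \<psi>u s) (z_at z \<psi>z s)) (bc_op G \<beta> i (v_at v \<psi>u s) (z_at z \<psi>z s))"
      by (rule bc_op_weak_pd[OF G v_at_L2 i])
    then show "weak_pd (dom1 G) (replicate \<beta> 1) (\<lambda>x. hist G (bc_op G 0 i) v z \<psi>u \<psi>z (s, x)) (\<lambda>x. hist G (bc_op G \<beta> i) v z \<psi>u \<psi>z (s, x))"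
      using weak_pd_cong_left[OF hist_section[OF op0 s] sqint_measurable[OF hist_section_sqint[OF op0 s]]
          sqint_measurable[OF pi_op_sqint[OF op0 v_at_L2]] B compact_Icc]
        weak_pd_cong_right[OF hist_section[OF op s] sqint_measurable[OF hist_section_sqint[OF op s]]
          sqint_measurable[OF pi_op_sqint[OF op v_at_L2]] compact_Icc]
      by blast
  qed
  show "weak_pd (dom2 G) (replicate \<beta> (0, 1)) (lift G (bc_op G 0 i) \<psi>u \<psi>z) (lift G (bc_op G \<beta> i) \<psi>u \<psi>z)"
  proof (rule weak_pd_rect_x[OF lift_sqint[OF op0] lift_sqint[OF op]])
    have "AE s in lborel_on {0..1}. s \<in> {0..1::real}" by (intro AE_I2) simp
    with lift_section[OF op0] lift_section[OF op]
    show "AE s in lborel_on {0..1}. weak_pd (dom1 G) (replicate \<beta> 1) (\<lambda>x. lift G (bc_op G 0 i) \<psi>u \<psi>z (s, x)) (\<lambda>x. lift G (bc_op G \<beta> i) \<psi>u \<psi>z (s, x))"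
    proof eventually_elim
      case (elim s)
      let ?v = "section2_at \<psi>u s" and ?z = "section_at \<psi>z s"
      have sec: "?v \<in> L2 (ntot G) (dom1 G)" using elim by blast
      have w: "weak_pd (dom1 G) (replicate \<beta> 1) (bc_op G 0 i ?v ?z) (bc_op G \<beta> i ?v ?z)"
        by (rule bc_op_weak_pd[OF G sec i])
      have e: "AE x in lborel_on (dom1 G). lift G (bc_op G 0 i) \<psi>u \<psi>z (s, x) = bc_op G 0 i ?v ?z x"
        "AE x in lborel_on (dom1 G). lift G (bc_op G \<beta> i) \<psi>u \<psi>z (s, x) = bc_op G \<beta> i ?v ?z x"
        using elim by (auto intro!: AE_I2)
      have m: "(\<lambda>x. lift G Op \<psi>u \<psi>z (s, x)) \<in> borel_measurable (lborel_on (dom1 G))" if "pio G Op" for Op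
        using rect_section1[OF compact_Icc compact_Icc sqint_measurable[OF lift_sqint[OF that]] elim(3)] .
      show ?case
        using w weak_pd_cong_left[OF e(1) m[OF op0] sqint_measurable[OF pi_op_sqint[OF op0 sec]] B compact_Icc]
          weak_pd_cong_right[OF e(2) m[OF op] sqint_measurable[OF pi_op_sqint[OF op sec]] compact_Icc]
        by blast
    qed
  qed
qed

text \<open>
  At almost every \<open>s\<close> the slice of \<open>\<psi>\<^sub>u\<close> is square integrable, and there the lifted operator is
  \<open>T \<psi>\<^sub>u(s) + T\<^sub>z \<psi>\<^sub>z(s)\<close>.
\<close>

lemma T_curve_eq:
  shows "T_curve G (\<psi>u, \<psi>z) \<in> L2 (ntot G) (dom2 G)"
    and "eqf (ntot G) (dom2 G) (T_curve G (\<psi>u, \<psi>z)) (\<lambda>i. lift G (bc_op G 0 i) \<psi>u \<psi>z)"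
proof -
  have h: "(\<lambda>i. lift G (bc_op G 0 i) \<psi>u \<psi>z) \<in> L2 (ntot G) (dom2 G)"
    unfolding L2_def by (auto intro!: lift_sqint bc_op_pi_op[OF G])
  have "AE s in lborel_on {0..1}. \<forall>i\<in>{..<ntot G}. section2_at \<psi>u s \<in> L2 (ntot G) (dom1 G) \<and>
      (\<forall>x\<in>dom1 G. lift G (bc_op G 0 i) \<psi>u \<psi>z (s, x) = bc_op G 0 i (section2_at \<psi>u s) (section_at \<psi>z s) x)"
    by (intro AE_finite_allI lift_section bc_op_pi_op[OF G]) auto
  then have ae: "AE s in lborel_on {0..1}. eqf (ntot G) (dom1 G) (\<lambda>i x. lift G (bc_op G 0 i) \<psi>u \<psi>z (s, x))
      (T_op G (section2_at \<psi>u s) + Tz_op G (section_at \<psi>z s))"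
  proof eventually_elim
    case (elim s)
    have dom: "AE x in lborel_on (dom1 G). x \<in> dom1 G" by (intro AE_I2) simp
    have "AE x in lborel_on (dom1 G). lift G (bc_op G 0 i) \<psi>u \<psi>z (s, x) = (T_op G (section2_at \<psi>u s) + Tz_op G (section_at \<psi>z s)) i x"
      if i: "i < ntot G" for i
    proof -
      have sec: "section2_at \<psi>u s \<in> L2 (ntot G) (dom1 G)" using elim i by blast
      from T_Tz_op_AE[OF G sec i, of "section_at \<psi>z s"] dom show ?thesis
        by eventually_elim (use elim i in simp)
    qed
    then show ?case by (simp add: eqf_def)
  qed
  from joint_eq[OF h ae] show "T_curve G (\<psi>u, \<psi>z) \<in> L2 (ntot G) (dom2 G)"
    "eqf (ntot G) (dom2 G) (T_curve G (\<psi>u, \<psi>z)) (\<lambda>i. lift G (bc_op G 0 i) \<psi>u \<psi>z)"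
    unfolding T_curve_def prod.case .
qed

lemma Tint_curve_eq:
  shows "Tint_curve G (\<psi>u, \<psi>z) \<in> L2 (nint G) (dom2 G)"
    and "eqf (nint G) (dom2 G) (Tint_curve G (\<psi>u, \<psi>z)) (\<lambda>i. lift G (int_op G i) \<psi>u \<psi>z)"
proof -
  have h: "(\<lambda>i. lift G (int_op G i) \<psi>u \<psi>z) \<in> L2 (nint G) (dom2 G)"
    unfolding L2_def by (auto intro!: lift_sqint int_op_pi_op[OF G])
  have "AE s in lborel_on {0..1}. \<forall>i\<in>{..<nint G}. section2_at \<psi>u s \<in> L2 (ntot G) (dom1 G) \<and>
      (\<forall>x\<in>dom1 G. lift G (int_op G i) \<psi>u \<psi>z (s, x) = int_op G i (section2_at \<psi>u s) (section_at \<psi>z s) x)"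
    by (intro AE_finite_allI lift_section int_op_pi_op[OF G]) auto
  then have ae: "AE s in lborel_on {0..1}. eqf (nint G) (dom1 G) (\<lambda>i x. lift G (int_op G i) \<psi>u \<psi>z (s, x))
      (Tint_op G (section2_at \<psi>u s) + Tintz_op G (section_at \<psi>z s))"
  proof eventually_elim
    case (elim s)
    have dom: "AE x in lborel_on (dom1 G). x \<in> dom1 G" by (intro AE_I2) simp
    have "AE x in lborel_on (dom1 G). lift G (int_op G i) \<psi>u \<psi>z (s, x) = (Tint_op G (section2_at \<psi>u s) + Tintz_op G (section_at \<psi>z s)) i x"
      if i: "i < nint G" for i
    proof -
      have sec: "section2_at \<psi>u s \<in> L2 (ntot G) (dom1 G)" using elim i by blast
      from T_Tz_int_AE[OF G sec i, of "section_at \<psi>z s"] dom show ?thesis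
        by eventually_elim (use elim i in simp)
    qed
    then show ?case by (simp add: eqf_def)
  qed
  from joint_eq[OF h ae] show "Tint_curve G (\<psi>u, \<psi>z) \<in> L2 (nint G) (dom2 G)"
    "eqf (nint G) (dom2 G) (Tint_curve G (\<psi>u, \<psi>z)) (\<lambda>i. lift G (int_op G i) \<psi>u \<psi>z)"
    unfolding Tint_curve_def prod.case .
qed

lemma T_Tz_sqint: "i < ntot G \<Longrightarrow> (\<lambda>x. T_op G v i x + Tz_op G z i x) \<in> sqint (dom1 G)"
  by (rule sqint_cong_AE[where f="bc_op G 0 i v z"])
    (use T_Tz_op_AE[OF G v, of i z] pi_op_sqint[OF bc_op_pi_op[OF G _ le0] v] T_op_measurable[OF G v] Tz_op_measurable[OF G v]
      in \<open>auto intro!: borel_measurable_add\<close>)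

lemma hist_u_eq_sum: "(hist_u G v z \<psi>u \<psi>z) i = (\<lambda>p. (T_op G v i (snd p) + Tz_op G z i (snd p)) + tprim (T_curve G (\<psi>u, \<psi>z) i) p)"
  by (auto simp: fun_eq_iff hist_u_apply)

lemma hist_u_sqint: "i < ntot G \<Longrightarrow> (hist_u G v z \<psi>u \<psi>z) i \<in> sqint (dom2 G)"
  unfolding hist_u_eq_sum
  by (rule sqint_add[OF sqint_rect_snd[OF compact_Icc compact_Icc T_Tz_sqint] tprim_sqint[OF L2_sqint[OF T_curve_eq(1)]]])

lemma hist_u_section_sqint:
  "i < ntot G \<Longrightarrow> s \<in> {0..1} \<Longrightarrow> (\<lambda>x. (hist_u G v z \<psi>u \<psi>z) i (s, x)) \<in> sqint (dom1 G)"
  using T_Tz_sqint[of i] tprim_section_sqint[OF L2_sqint[OF T_curve_eq(1), of i], of s]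
  by (simp add: hist_u_eq_sum sqint_add)

lemma hist_u_section_AE:
  assumes i: "i < ntot G"
  shows "AE x in lborel_on (dom1 G). \<forall>s\<in>{0..1}. (hist_u G v z \<psi>u \<psi>z) i (s, x) = hist G (bc_op G 0 i) v z \<psi>u \<psi>z (s, x)"
proof -
  have "AE x in lborel_on (dom1 G). \<forall>s\<in>{0..1}. tprim (T_curve G (\<psi>u, \<psi>z) i) (s, x) = tprim (lift G (bc_op G 0 i) \<psi>u \<psi>z) (s, x)"
    using T_curve_eq(2) i by (intro tprim_cong_AE(2) L2_sqint[OF T_curve_eq(1)] lift_sqint bc_op_pi_op[OF G]) (auto simp: eqf_def)
  with T_Tz_op_AE[OF G v i, of z] show ?thesis
    by eventually_elim (simp add: hist_u_eq_sum hist_def)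
qed

lemma hist_u_AE:
  assumes i: "i < ntot G"
  shows "AE p in lborel_on (dom2 G). (hist_u G v z \<psi>u \<psi>z) i p = hist G (bc_op G 0 i) v z \<psi>u \<psi>z p"
proof (rule rect_AE_eqI)
  show "AE s in lborel_on {0..1}. AE x in lborel_on (dom1 G). (hist_u G v z \<psi>u \<psi>z) i (s, x) = hist G (bc_op G 0 i) v z \<psi>u \<psi>z (s, x)"
  proof (rule AE_I2)
    fix s :: real assume "s \<in> space (lborel_on {0..1})"
    with hist_u_section_AE[OF i] show "AE x in lborel_on (dom1 G). (hist_u G v z \<psi>u \<psi>z) i (s, x) = hist G (bc_op G 0 i) v z \<psi>u \<psi>z (s, x)"
      by (auto elim: eventually_mono)
  qed
qed (use hist_u_sqint[OF i] hist_sqint[OF bc_op_pi_op[OF G i le0]] in \<open>auto intro: sqint_measurable\<close>)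

lemma hist_u_weak_pd:
  assumes i: "i < ntot G" "\<beta> \<le> reg G i"
  shows "weak_pd (dom2 G) (replicate \<beta> (0, 1)) ((hist_u G v z \<psi>u \<psi>z) i) (hist G (bc_op G \<beta> i) v z \<psi>u \<psi>z)"
    and "weak_pd (dom2 G) ([(1, 0)] @ replicate \<beta> (0, 1)) ((hist_u G v z \<psi>u \<psi>z) i) (lift G (bc_op G \<beta> i) \<psi>u \<psi>z)"
proof -
  note op0 = bc_op_pi_op[OF G i(1) le0]
  have B: "set (replicate \<beta> (0::real, 1::real)) \<subseteq> Basis" "set ([(1::real, 0::real)] @ replicate \<beta> (0, 1)) \<subseteq> Basis"
    using Basis_prod_real by auto
  note cong = weak_pd_cong_left[OF hist_u_AE[OF i(1)] sqint_measurable[OF hist_u_sqint[OF i(1)]] sqint_measurable[OF hist_sqint[OF op0]] _ compact_rect]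
  show "weak_pd (dom2 G) (replicate \<beta> (0, 1)) ((hist_u G v z \<psi>u \<psi>z) i) (hist G (bc_op G \<beta> i) v z \<psi>u \<psi>z)"
    using cong[OF B(1)] hist_weak_pd_x(1)[OF i] by blast
  show "weak_pd (dom2 G) ([(1, 0)] @ replicate \<beta> (0, 1)) ((hist_u G v z \<psi>u \<psi>z) i) (lift G (bc_op G \<beta> i) \<psi>u \<psi>z)"
    using cong[OF B(2)] weak_pd_append[OF hist_weak_pd_s[OF op0] hist_weak_pd_x(2)[OF i] B(1)] by blast
qed

lemma hist_u_V_space: "(hist_u G v z \<psi>u \<psi>z) \<in> V_space G"
  unfolding V_space_def sobolev_def
proof (intro CollectI allI impI conjI ballI)
  fix i assume i: "i < ntot G"
  show "(hist_u G v z \<psi>u \<psi>z) i \<in> sqint (dom2 G)" by (rule hist_u_sqint[OF i])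
  fix ds assume "ds \<in> ord2 (reg G i)"
  then obtain \<alpha> \<beta> where ds: "ds = replicate \<alpha> (1, 0) @ replicate \<beta> (0, 1)" and ab: "\<alpha> \<le> 1" "\<beta> \<le> reg G i"
    by (auto simp: ord2_def)
  show "\<exists>g\<in>sqint (dom2 G). weak_pd (dom2 G) ds ((hist_u G v z \<psi>u \<psi>z) i) g"
  proof (cases "\<alpha> = 0")
    case True
    then show ?thesis using hist_u_weak_pd(1)[OF i ab(2)] hist_sqint[OF bc_op_pi_op[OF G i ab(2)]] ds by auto
  next
    case False
    then have "\<alpha> = 1" using ab by simp
    then show ?thesis using hist_u_weak_pd(2)[OF i ab(2)] lift_sqint[OF bc_op_pi_op[OF G i ab(2)]] ds by auto
  qed
qed

lemma hist_u_wpd: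
  assumes i: "i < ntot G" "\<beta> \<le> reg G i"
  shows "AE p in lborel_on (dom2 G). wpd (dom2 G) (replicate \<beta> (0, 1)) ((hist_u G v z \<psi>u \<psi>z) i) p = hist G (bc_op G \<beta> i) v z \<psi>u \<psi>z p"
    and "AE p in lborel_on (dom2 G). wpd (dom2 G) ([(1, 0)] @ replicate \<beta> (0, 1)) ((hist_u G v z \<psi>u \<psi>z) i) p = lift G (bc_op G \<beta> i) \<psi>u \<psi>z p"
  by (intro wpd_rect_eqI hist_u_weak_pd i hist_sqint lift_sqint bc_op_pi_op[OF G])+

text \<open>The history is a continuous curve in \<open>L\<^sub>2\<close>, being a primitive in \<open>s\<close>.\<close>

lemma hist_u_slice:
  assumes i: "i < ntot G" and s: "s \<in> {0..1}"
  shows "slice (lo G) (hi G) (hist_u G v z \<psi>u \<psi>z) s i \<in> sqint (dom1 G)"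
    and "AE x in lborel_on (dom1 G). slice (lo G) (hi G) (hist_u G v z \<psi>u \<psi>z) s i x = (hist_u G v z \<psi>u \<psi>z) i (s, x)"
proof -
  let ?T = "T_curve G (\<psi>u, \<psi>z) i"
  note T = L2_sqint[OF T_curve_eq(1) i]
  have lim: "((\<lambda>r'. normsq (dom1 G) ((\<lambda>x. (hist_u G v z \<psi>u \<psi>z) i (r', x)) - (\<lambda>x. (hist_u G v z \<psi>u \<psi>z) i (r, x)))) \<longlongrightarrow> 0) (at r within {0..1})"
    if r: "r \<in> {0..1}" for r
  proof (rule tendsto_sandwich[OF _ _ tendsto_const])
    have "((\<lambda>r'. \<bar>r' - r\<bar> * normsq (dom2 G) ?T) \<longlongrightarrow> \<bar>r - r\<bar> * normsq (dom2 G) ?T) (at r within {0..1})"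
      by (intro tendsto_intros)
    then show "((\<lambda>r'. \<bar>r' - r\<bar> * normsq (dom2 G) ?T) \<longlongrightarrow> 0) (at r within {0..1})" by simp
    show "eventually (\<lambda>r'. normsq (dom1 G) ((\<lambda>x. (hist_u G v z \<psi>u \<psi>z) i (r', x)) - (\<lambda>x. (hist_u G v z \<psi>u \<psi>z) i (r, x))) \<le> \<bar>r' - r\<bar> * normsq (dom2 G) ?T) (at r within {0..1})"
      using tprim_section_continuous[OF T r] by (auto simp: eventually_at_filter hist_u_eq_sum fun_diff_def)
  qed (simp add: normsq_nonneg)
  from slice_eq[of "\<lambda>r x. (hist_u G v z \<psi>u \<psi>z) i (r, x)" "lo G" "hi G" "hist_u G v z \<psi>u \<psi>z" i s, OF hist_u_section_sqint[OF i] lim _ s]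
  show "slice (lo G) (hi G) (hist_u G v z \<psi>u \<psi>z) s i \<in> sqint (dom1 G)"
    "AE x in lborel_on (dom1 G). slice (lo G) (hi G) (hist_u G v z \<psi>u \<psi>z) s i x = (hist_u G v z \<psi>u \<psi>z) i (s, x)" by auto
qed

text \<open>In this form all facts about representatives of solutions of the boundary value problem apply to the slices.\<close>

lemma hist_u_slice_bc:
  assumes s: "s \<in> {0..1}"
  shows "i < ntot G \<Longrightarrow> slice (lo G) (hi G) (hist_u G v z \<psi>u \<psi>z) s i \<in> borel_measurable (lborel_on (dom1 G))"
    and "i < ntot G \<Longrightarrow> AE x in lborel_on (dom1 G). slice (lo G) (hi G) (hist_u G v z \<psi>u \<psi>z) s i x = bc_op G 0 i (v_at v \<psi>u s) (z_at z \<psi>z s) x"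
proof -
  show "i < ntot G \<Longrightarrow> slice (lo G) (hi G) (hist_u G v z \<psi>u \<psi>z) s i \<in> borel_measurable (lborel_on (dom1 G))"
    using hist_u_slice(1)[OF _ s] by (rule sqint_measurable)
  assume i: "i < ntot G"
  show "AE x in lborel_on (dom1 G). slice (lo G) (hi G) (hist_u G v z \<psi>u \<psi>z) s i x = bc_op G 0 i (v_at v \<psi>u s) (z_at z \<psi>z s) x"
    using hist_u_slice(2)[OF i s] hist_u_section_AE[OF i] hist_section[OF bc_op_pi_op[OF G i le0] s]
    by eventually_elim (use s in simp)
qed

lemma z_at_eq: "s \<in> {0..1} \<Longrightarrow> z_at z \<psi>z s k = (hist_z G z \<psi>u \<psi>z) k s"
  by (simp add: z_at_def hist_z_apply prim_weight)

lemma hist_z_facts: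
  assumes k: "k < nz G"
  shows "(hist_z G z \<psi>u \<psi>z) k \<in> sqint {0..1}" "weak_pd {0..1} [1] ((hist_z G z \<psi>u \<psi>z) k) (\<psi>z k)" "s \<in> {0..1} \<Longrightarrow> cont_rep 0 1 ((hist_z G z \<psi>u \<psi>z) k) s = (hist_z G z \<psi>u \<psi>z) k s"
proof -
  have e: "(hist_z G z \<psi>u \<psi>z) k = (\<lambda>s. z k + prim 0 (\<psi>z k) s)" by (simp add: fun_eq_iff hist_z_apply)
  note \<psi> = L2_sqint[OF \<psi>z k]
  show "(hist_z G z \<psi>u \<psi>z) k \<in> sqint {0..1}" "weak_pd {0..1} [1] ((hist_z G z \<psi>u \<psi>z) k) (\<psi>z k)"
    unfolding e by (rule const_prim_sqint[OF \<psi>], rule weak_pd_prim[OF \<psi>])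
  show "s \<in> {0..1} \<Longrightarrow> cont_rep 0 1 ((hist_z G z \<psi>u \<psi>z) k) s = (hist_z G z \<psi>u \<psi>z) k s"
    by (rule cont_rep_eq) (auto simp: e intro!: continuous_intros prim_continuous \<psi>)
qed

lemma hist_z_H1z: "(hist_z G z \<psi>u \<psi>z) \<in> H1z_space G"
  unfolding H1z_space_def sobolev_def
proof (intro CollectI allI impI conjI ballI)
  fix k assume k: "k < nz G"
  show "(hist_z G z \<psi>u \<psi>z) k \<in> sqint {0..1}" by (rule hist_z_facts(1)[OF k])
  fix ds assume "ds \<in> ord1 1"
  then have "ds = [] \<or> ds = [1]" by (auto simp: ord1_def le_Suc_eq)
  then show "\<exists>g\<in>sqint {0..1}. weak_pd {0..1} ds ((hist_z G z \<psi>u \<psi>z) k) g"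
    using hist_z_facts(1,2)[OF k] L2_sqint[OF \<psi>z k] weak_pd_Nil by blast
qed

lemma X_space_cong_z: "(\<And>k. k < nz G \<Longrightarrow> y k = y' k) \<Longrightarrow> X_space G y = X_space G y'"
  by (auto simp: X_space_def mult_cc_def eqv_def)

lemma hist_u_at_0: "i < ntot G \<Longrightarrow> (hist_u G v z \<psi>u \<psi>z) i (0, x) = T_op G v i x + Tz_op G z i x"
  by (simp add: hist_u_apply tprim_prim prim_at_left)

lemma hist_Y_space:
  assumes u: "\<And>i x. i < ntot G \<Longrightarrow> u i x = T_op G v i x + Tz_op G z i x"
  shows "((hist_u G v z \<psi>u \<psi>z), (hist_z G z \<psi>u \<psi>z)) \<in> Y_space G u z"
  unfolding Y_space_def
proof (intro CollectI case_prodI conjI ballI hist_u_V_space hist_z_H1z)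
  show "eqf (ntot G) (dom1 G) (slice (lo G) (hi G) (hist_u G v z \<psi>u \<psi>z) 0) u"
    using hist_u_slice(2)[of _ 0] by (simp add: eqf_def hist_u_at_0 u)
  show "eqv (nz G) (\<lambda>i. cont_rep 0 1 ((hist_z G z \<psi>u \<psi>z) i) 0) z"
    by (simp add: eqv_def hist_z_facts(3) hist_z_apply prim_at_left)
  fix s :: real assume s: "s \<in> {0..1}"
  have "slice (lo G) (hi G) (hist_u G v z \<psi>u \<psi>z) s \<in> X_space G (z_at z \<psi>z s)"
    by (rule bc_op_X_space[OF G v_at_L2 hist_u_slice_bc[OF s]])
  \<comment> \<open>\<open>\<phi>\<^sub>z\<close> is continuous, so it is its own continuous representative.\<close>
  also have "X_space G (z_at z \<psi>z s) = X_space G (\<lambda>i. cont_rep 0 1 ((hist_z G z \<psi>u \<psi>z) i) s)"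
    using s by (intro X_space_cong_z) (simp add: z_at_eq hist_z_facts(3))
  finally show "slice (lo G) (hi G) (hist_u G v z \<psi>u \<psi>z) s \<in> X_space G (\<lambda>i. cont_rep 0 1 ((hist_z G z \<psi>u \<psi>z) i) s)" .
qed

end

section \<open>The right-hand sides of the two systems\<close>

lemma sum_fun_apply: "(\<Sum>j\<in>J. f j) x = (\<Sum>j\<in>J. f j x)"
  by (induction J rule: infinite_finite_induct) auto

lemma sqint_section_set_measurable:
  fixes f :: "real \<times> real \<Rightarrow> real"
  assumes f: "f \<in> sqint ({0..1} \<times> {a..b})"
  shows "{s \<in> {0..1}. (\<lambda>x. f (s, x)) \<in> sqint {a..b}} \<in> sets (lborel_on {0..1})"
proof -
  have m: "f \<in> borel_measurable (lborel_on {0..1} \<Otimes>\<^sub>M lborel_on {a..b})"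
    using sqint_measurable[OF f] unfolding lborel_on_prod[OF compact_Icc compact_Icc] .
  then have m': "(\<lambda>(s, x). ennreal ((f (s, x))\<^sup>2)) \<in> borel_measurable (lborel_on {0..1} \<Otimes>\<^sub>M lborel_on {a..b})"
    by measurable
  have "(\<lambda>s. \<integral>\<^sup>+x. ennreal ((f (s, x))\<^sup>2) \<partial>lborel_on {a..b}) \<in> borel_measurable (lborel_on {0..1})"
    by (rule sigma_finite_measure.borel_measurable_nn_integral[OF sigma_finite_lborel_on[OF compact_Icc] m'])
  then have "{s \<in> space (lborel_on {0..1}). (\<integral>\<^sup>+x. ennreal ((f (s, x))\<^sup>2) \<partial>lborel_on {a..b}) < \<infinity>} \<in> sets (lborel_on {0..1})"
    by measurable
  also have "{s \<in> space (lborel_on {0..1}). (\<integral>\<^sup>+x. ennreal ((f (s, x))\<^sup>2) \<partial>lborel_on {a..b}) < \<infinity>}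
      = {s \<in> {0..1}. (\<lambda>x. f (s, x)) \<in> sqint {a..b}}"
    using rect_section1[OF compact_Icc compact_Icc sqint_measurable[OF f]]
    by (auto simp: sqint_def integrable_iff_bounded)
  finally show ?thesis .
qed

lemma L2_section_set_measurable:
  assumes \<psi>: "\<psi>u \<in> L2 n ({0..1} \<times> {a..b::real})"
  shows "{s \<in> {0..1}. section2_at \<psi>u s \<in> L2 n {a..b}} \<in> sets (lborel_on {0..1::real})"
proof -
  have "{s \<in> {0..1}. section2_at \<psi>u s \<in> L2 n {a..b}} =
      {0..1} \<inter> (\<Inter>k\<in>{..<n}. {s \<in> {0..1}. (\<lambda>x. \<psi>u k (s, x)) \<in> sqint {a..b}})"
    by (auto simp: L2_def section2_at_def)
  moreover have "{0..1} \<inter> (\<Inter>k\<in>{..<n}. {s \<in> {0..1}. (\<lambda>x. \<psi>u k (s, x)) \<in> sqint {a..b}}) \<in> sets (lborel_on {0..1::real})"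
  proof (cases "n = 0")
    case True
    then show ?thesis using sets.top[of "lborel_on {0..1::real}"] by simp
  next
    case False
    then show ?thesis
      using sets.top[of "lborel_on {0..1::real}"] \<psi>
      by (intro sets.Int sets.finite_INT sqint_section_set_measurable) (auto simp: L2_def)
  qed
  ultimately show ?thesis by simp
qed

text \<open>
  At the exceptional \<open>s\<close> the boundary value problem has no solution, and every choice of a solution is a
  choice from the empty set: a constant. This keeps the boundary values measurable in \<open>s\<close>.
\<close>

lemma bc_solution_not_L2:
  assumes v: "\<And>i. i < ntot G \<Longrightarrow> v i \<in> borel_measurable (lborel_on (dom1 G))" "v \<notin> L2 (ntot G) (dom1 G)"
  shows "bc_solution G v z = (SOME u. False)"
proof -
  have "\<not> (u \<in> X_space G z \<and> eqf (ntot G) (dom1 G) (D_op G u) v)" for u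
  proof
    assume u: "u \<in> X_space G z \<and> eqf (ntot G) (dom1 G) (D_op G u) v"
    have "v i \<in> sqint (dom1 G)" if i: "i < ntot G" for i
    proof (rule sqint_cong_AE)
      have "u i \<in> sobolev (dom1 G) (ord1 (reg G i))" using u i by (simp add: X_space_def U_space_def)
      then show "D_op G u i \<in> sqint (dom1 G)"
        unfolding D_op_def dx_def by (rule sobolev_wpd(1)) (auto simp: ord1_def)
      show "AE x in lborel_on (dom1 G). D_op G u i x = v i x" using u i by (simp add: eqf_def)
      show "v i \<in> borel_measurable (lborel_on (dom1 G))" by (rule v(1)[OF i])
    qed
    with v(2) show False by (simp add: L2_def)
  qed
  then have "(\<lambda>u. u \<in> X_space G z \<and> eqf (ntot G) (dom1 G) (D_op G u) v) = (\<lambda>u. False)" by blast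
  then show ?thesis unfolding bc_solution_def by (rule arg_cong)
qed

lemma Tbfz_op_eq:
  assumes G: "well_posed_bc G" and k: "k < nbf G"
  shows "Tbfz_op G z k = bf_fun G k 0 z"
  unfolding Tbfz_op_def Tz_op_def
  by (rule bc_op_Lambda_bf[OF G L2_0[OF G] _ _ k])
    (auto intro: bc_solution_measurable[OF G L2_0[OF G]] bc_solution_AE[OF G L2_0[OF G]])

text \<open>
  The integrand of the boundary part of \<open>Cbar_op\<close> consists of values of a chosen solution at single
  points and is not a function of classes of \<open>(s, x)\<close>. Off a measurable null set it is the functional
  \<open>bf_fun\<close> of the slices, and on that set it is a constant plus a measurable function of \<open>s\<close>.
\<close>

lemma integral_boundary_values:
  assumes G: "well_posed_bc G" and \<psi>: "\<psi>u \<in> L2 (ntot G) (dom2 G)" "\<psi>z \<in> L2 (nz G) {0..1}" and k: "k < nbf G"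
  shows "(LINT s|lborel_on {0..1}. (Tbf_op G (section2_at \<psi>u s) + Tbfz_op G (section_at \<psi>z s)) k)
    = bf_fun G k (\<lambda>i y. LINT r|lborel_on {0..1}. step_kernel (1, r) * \<psi>u i (r, y)) (\<lambda>i. LINT r|lborel_on {0..1}. step_kernel (1, r) * \<psi>z i r)"
proof -
  note F = bf_fun_pi_fun[OF G k] and le = lo_le_hi[OF G] and w = step_weight_bddf[of 1]
  obtain g where g: "g \<in> borel_measurable (lborel_on {0..1})"
    "\<And>s. section2_at \<psi>u s \<in> L2 (ntot G) (dom1 G) \<Longrightarrow> g s = bf_fun G k (section2_at \<psi>u s) (section_at \<psi>z s)"
    "(LINT r|lborel_on {0..1}. step_kernel (1, r) * g r) = bf_fun G k (\<lambda>i y. LINT r|lborel_on {0..1}. step_kernel (1, r) * \<psi>u i (r, y)) (\<lambda>i. LINT r|lborel_on {0..1}. step_kernel (1, r) * \<psi>z i r)"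
    by (rule pi_fun_time_integral[OF F le \<psi> w]) blast
  have 0: "section2_at (\<lambda>k p. 0) s \<in> L2 (ntot G) (dom1 G)" for s :: real
    using L2_zero by (simp add: section2_at_def)
  \<comment> \<open>The contribution of \<open>T\<^sub>z \<psi>\<^sub>z(s)\<close> alone, which exists at every \<open>s\<close>.\<close>
  obtain g0 where g0: "g0 \<in> borel_measurable (lborel_on {0..1})"
    "\<And>s. g0 s = bf_fun G k (section2_at (\<lambda>k p. 0) s) (section_at \<psi>z s)"
    by (rule pi_fun_time_integral[OF F le L2_zero \<psi>(2) w]) (use 0 in blast)
  have g0': "g0 s = Tbfz_op G (section_at \<psi>z s) k" for s
    unfolding g0(2) Tbfz_op_eq[OF G k] by (simp add: section2_at_def zero_fun_def)
  \<comment> \<open>The set of regular \<open>s\<close>; off it \<open>T\<close> returns the constant choice, with boundary value \<open>e\<close>.\<close>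
  define A where "A = {s \<in> {0..1}. section2_at \<psi>u s \<in> L2 (ntot G) (dom1 G)}"
  define e where "e = Lambda_bf G (SOME u. False) k"
  let ?h = "\<lambda>s. (Tbf_op G (section2_at \<psi>u s) + Tbfz_op G (section_at \<psi>z s)) k"
  have h: "?h s = (if s \<in> A then g s else e + g0 s)" if s: "s \<in> {0..1}" for s
  proof (cases "s \<in> A")
    case True
    then show ?thesis using T_Tz_bf[OF G _ k] g(2) by (simp add: A_def)
  next
    case False
    have "section2_at \<psi>u s i \<in> borel_measurable (lborel_on (dom1 G))" if "i < ntot G" for i
      using rect_section1[OF compact_Icc compact_Icc sqint_measurable[OF L2_sqint[OF \<psi>(1) that]] s]
      by (simp add: section2_at_def)
    then have "T_op G (section2_at \<psi>u s) = (SOME u. False)"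
      unfolding T_op_def using False s by (intro bc_solution_not_L2) (auto simp: A_def)
    with False show ?thesis by (simp add: Tbf_op_def e_def g0')
  qed
  have "A \<in> sets (lborel_on {0..1})"
    unfolding A_def by (rule L2_section_set_measurable[OF \<psi>(1)])
  then have "(\<lambda>s. if s \<in> A then g s else e + g0 s) \<in> borel_measurable (lborel_on {0..1})"
    using g(1) g0(1) by (intro measurable_If_set borel_measurable_add sets.Int sets.top) auto
  then have m: "?h \<in> borel_measurable (lborel_on {0..1})"
    by (rule measurable_cong[THEN iffD2, rotated]) (use h in simp)
  have "(LINT s|lborel_on {0..1}. ?h s) = (LINT s|lborel_on {0..1}. g s)"
  proof (rule integral_cong_AE[OF m g(1)])
    have "AE s in lborel_on {0..1}. s \<in> {0..1::real}" by (intro AE_I2) simp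
    with section_L2[OF \<psi>(1)] show "AE s in lborel_on {0..1}. ?h s = g s"
      by eventually_elim (use h in \<open>simp add: A_def\<close>)
  qed
  with g(3) show ?thesis by (simp add: integral_step_end)
qed

text \<open>
  The values of the state at the end of the delay split into the part \<open>p\<close> that depends on \<open>(v, \<psi>)\<close> and
  the part \<open>q\<close> that depends on the input. This is the formula behind the operators with hats.
\<close>

lemma hist_delayed:
  fixes G :: pdde_data and v :: "real vfun" and z :: rvec and \<psi>u :: "(real \<times> real) vfun" and \<psi>z :: "real vfun"
  assumes G: "well_posed_bc G" and v: "v \<in> L2 (ntot G) (dom1 G)"
    and \<psi>: "\<psi>u \<in> L2 (ntot G) (dom2 G)" "\<psi>z \<in> L2 (nz G) {0..1}"
  defines "r \<equiv> delayed G (hist_u G v z \<psi>u \<psi>z, hist_z G z \<psi>u \<psi>z)"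
    and "p \<equiv> Cq_op G v + Cbar_op G (\<psi>u, \<psi>z)" and "q \<equiv> Dqz_op G z"
  shows "k < nint G \<Longrightarrow> AE x in lborel_on (dom1 G). fst r k x = fst p k x + fst q k x"
    and "k < nint G \<Longrightarrow> fst r k \<in> sqint (dom1 G) \<and> fst p k \<in> sqint (dom1 G) \<and> fst q k \<in> sqint (dom1 G)"
    and "k < nbf G \<Longrightarrow> fst (snd r) k = fst (snd p) k + fst (snd q) k"
    and "k < nz G \<Longrightarrow> snd (snd r) k = snd (snd p) k + snd (snd q) k"
proof -
  have 1: "(1::real) \<in> {0..1}" by simp
  note bc = hist_u_slice_bc[OF G v \<psi> 1, of _ z]
  let ?s = "slice (lo G) (hi G) (hist_u G v z \<psi>u \<psi>z) 1"
  have r: "fst r = D_int G ?s" "fst (snd r) = Lambda_bf G ?s" "snd (snd r) = (\<lambda>i. cont_rep 0 1 (hist_z G z \<psi>u \<psi>z i) 1)"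
    by (simp_all add: r_def delayed_def)
  have tc: "tprim (Tint_curve G (\<psi>u, \<psi>z) k) (1, x) = (LINT s|lborel_on {0..1}. Tint_curve G (\<psi>u, \<psi>z) k (s, x))" for k x
    by (simp add: tprim_def)
  have p: "fst p k x = Tint_op G v k x + tprim (Tint_curve G (\<psi>u, \<psi>z) k) (1, x)"
    "fst (snd p) k = Tbf_op G v k + (LINT s|lborel_on {0..1}. (Tbf_op G (section2_at \<psi>u s) + Tbfz_op G (section_at \<psi>z s)) k)"
    "snd (snd p) k = (LINT s|lborel_on {0..1}. \<psi>z k s)" for k x
    by (simp_all add: p_def Cq_op_def Cbar_op_def tc)
  have q: "fst q = Tintz_op G z" "fst (snd q) = Tbfz_op G z" "snd (snd q) = z"
    by (simp_all add: q_def Dqz_op_def)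
  show "AE x in lborel_on (dom1 G). fst r k x = fst p k x + fst q k x" if k: "k < nint G"
  proof -
    have "AE x in lborel_on (dom1 G). D_int G ?s k x = int_op G k (v_at v \<psi>u 1) (z_at z \<psi>z 1) x"
      by (rule bc_op_D_int[OF G v_at_L2[OF G v \<psi>] bc k])
    moreover have "AE x in lborel_on (dom1 G). hist G (int_op G k) v z \<psi>u \<psi>z (1, x) = int_op G k (v_at v \<psi>u 1) (z_at z \<psi>z 1) x"
      by (rule hist_section[OF G v \<psi> int_op_pi_op[OF G k] 1])
    moreover have "AE x in lborel_on (dom1 G). \<forall>s\<in>{0..1}. tprim (Tint_curve G (\<psi>u, \<psi>z) k) (s, x) = tprim (lift G (int_op G k) \<psi>u \<psi>z) (s, x)"
      using Tint_curve_eq(2)[OF G v \<psi>] k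
      by (intro tprim_cong_AE(2) L2_sqint[OF Tint_curve_eq(1)[OF G v \<psi>]] lift_sqint[OF G v \<psi>] int_op_pi_op[OF G]) (auto simp: eqf_def)
    moreover note T_Tz_int_AE[OF G v k, of z]
    ultimately show ?thesis
      by eventually_elim (use 1 in \<open>simp add: r p q hist_def\<close>)
  qed
  show "fst r k \<in> sqint (dom1 G) \<and> fst p k \<in> sqint (dom1 G) \<and> fst q k \<in> sqint (dom1 G)" if k: "k < nint G"
  proof (intro conjI)
    show "fst r k \<in> sqint (dom1 G)"
      unfolding r by (rule bc_op_D_int_sqint[OF G v_at_L2[OF G v \<psi>] bc k])
    have "fst p k = (\<lambda>x. Tint_op G v k x + tprim (Tint_curve G (\<psi>u, \<psi>z) k) (1, x))" by (simp add: p fun_eq_iff)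
    then show "fst p k \<in> sqint (dom1 G)"
      using Tint_op_sqint[OF G v k] tprim_section_sqint[OF L2_sqint[OF Tint_curve_eq(1)[OF G v \<psi>] k] 1] by (simp add: sqint_add)
    show "fst q k \<in> sqint (dom1 G)" unfolding q by (rule Tintz_op_sqint[OF G v k])
  qed
  show "fst (snd r) k = fst (snd p) k + fst (snd q) k" if k: "k < nbf G"
  proof -
    have "Lambda_bf G ?s k = bf_fun G k (v_at v \<psi>u 1) (z_at z \<psi>z 1)"
      by (rule bc_op_Lambda_bf[OF G v_at_L2[OF G v \<psi>] bc k])
    also have "\<dots> = bf_fun G k v z + 1 * bf_fun G k (\<lambda>i y. LINT r|lborel_on {0..1}. step_kernel (1, r) * \<psi>u i (r, y)) (\<lambda>i. LINT r|lborel_on {0..1}. step_kernel (1, r) * \<psi>z i r)"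
      unfolding v_at_def z_at_def
      by (rule pi_fun_lin[OF bf_fun_pi_fun[OF G k] v time_integral_L2[OF \<psi>(1) step_weight_bddf] lo_le_hi[OF G]])
    finally show ?thesis
      using T_Tz_bf[OF G v k, of z] integral_boundary_values[OF G \<psi> k] by (simp add: r p q)
  qed
  show "snd (snd r) k = snd (snd p) k + snd (snd q) k" if k: "k < nz G"
    using hist_z_facts(3)[OF G v \<psi> k 1] by (simp add: r p q hist_z_apply prim_right)
qed

lemma mult_int_add:
  assumes A: "\<And>k. k < n \<Longrightarrow> A i k \<in> Linf S" and S: "compact S"
    and f: "\<And>k. k < n \<Longrightarrow> f k \<in> sqint S" and g: "\<And>k. k < n \<Longrightarrow> g k \<in> sqint S" and h: "\<And>k. k < n \<Longrightarrow> h k \<in> sqint S"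
    and ae: "\<And>k. k < n \<Longrightarrow> AE x in lborel_on S. h k x = f k x + g k x"
  shows "mult_int S n A h i = mult_int S n A f i + mult_int S n A g i"
proof -
  have i: "integrable (lborel_on S) (\<lambda>x. \<Sum>k<n. A i k x * f k x)" if "\<And>k. k < n \<Longrightarrow> f k \<in> sqint S" for f
    using that A by (intro Bochner_Integration.integrable_sum sqint_integrable[OF Linf_mult_sqint S]) auto
  have "mult_int S n A h i = mult_int S n A (\<lambda>k x. f k x + g k x) i"
    by (rule mult_int_cong_AE) (use assms in \<open>auto intro!: sqint_measurable sqint_add\<close>)
  also have "\<dots> = (LINT x|lborel_on S. (\<Sum>k<n. A i k x * f k x) + (\<Sum>k<n. A i k x * g k x))"
    by (simp add: mult_int_def distrib_left sum.distrib)
  also have "\<dots> = mult_int S n A f i + mult_int S n A g i"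
    unfolding mult_int_def by (rule Bochner_Integration.integral_add[OF i[OF f] i[OF g]])
  finally show ?thesis .
qed

lemma mult_cc_add: "(\<And>k. k < n \<Longrightarrow> h k = f k + g k) \<Longrightarrow> mult_cc n A h i = mult_cc n A f i + mult_cc n A g i"
  by (simp add: mult_cc_def distrib_left sum.distrib)

lemma mult_fc_add: "(\<And>k. k < n \<Longrightarrow> h k = f k + g k) \<Longrightarrow> mult_fc n A h i x = mult_fc n A f i x + mult_fc n A g i x"
  by (simp add: mult_fc_def distrib_left sum.distrib)

lemma mult_ff_add:
  assumes "\<And>k. k < n \<Longrightarrow> AE x in M. h k x = f k x + g k x"
  shows "AE x in M. mult_ff n A h i x = mult_ff n A f i x + mult_ff n A g i x"
proof -
  have "AE x in M. \<forall>k\<in>{..<n}. h k x = f k x + g k x" using assms by (intro AE_finite_allI) auto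
  then show ?thesis by eventually_elim (simp add: mult_ff_def distrib_left sum.distrib)
qed

text \<open>The state with top derivatives \<open>y\<close> and input \<open>z\<close>.\<close>

definition pdde_state :: "pdde_data \<Rightarrow> state \<Rightarrow> rvec \<Rightarrow> state"
  where "pdde_state G y z = That_op G y + Thatz_op G z"

lemma pdde_state_apply:
  "fst (pdde_state G (v, \<psi>) z) = T_op G v + Tz_op G z"
  "snd (pdde_state G (v, \<psi>) z) j = (hist_u G v z (fst (\<psi> j)) (snd (\<psi> j)), hist_z G z (fst (\<psi> j)) (snd (\<psi> j)))"
  by (simp_all add: pdde_state_def That_op_def Thatz_op_def hist_u_def hist_z_def zero_prod_def prod_eq_iff)

context
  fixes G :: pdde_data
  assumes adm: "admissible G" and wp: "well_posed G"
begin

lemma G_bc: "well_posed_bc G"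
  using adm wp by (simp add: well_posed_bc_def admissible_def)

context
  fixes v :: "real vfun" and \<psi> :: "nat \<Rightarrow> (real \<times> real) vfun \<times> real vfun" and z :: rvec
  assumes y: "(v, \<psi>) \<in> PIE_space G"
begin

lemma PIE_v: "v \<in> L2 (ntot G) (dom1 G)"
  and PIE_\<psi>: "j \<in> {1..delays G} \<Longrightarrow> fst (\<psi> j) \<in> L2 (ntot G) (dom2 G)" "j \<in> {1..delays G} \<Longrightarrow> snd (\<psi> j) \<in> L2 (nz G) {0..1}"
  using y by (auto simp: PIE_space_def)

lemma state_u:
  shows "i < ntot G \<Longrightarrow> (T_op G v + Tz_op G z) i \<in> borel_measurable (lborel_on (dom1 G))"
    and "i < ntot G \<Longrightarrow> AE x in lborel_on (dom1 G). (T_op G v + Tz_op G z) i x = bc_op G 0 i v z x"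
  using T_op_measurable[OF G_bc PIE_v] Tz_op_measurable[OF G_bc PIE_v] T_Tz_op_AE[OF G_bc PIE_v]
  by (auto simp: plus_fun_def intro!: borel_measurable_add)

lemma compatible_state: "compatible G z (pdde_state G (v, \<psi>) z)"
  unfolding compatible_def case_prod_beta pdde_state_apply
  using bc_op_X_space[where u="T_op G v + Tz_op G z", OF G_bc PIE_v state_u] hist_Y_space[OF G_bc PIE_v PIE_\<psi>] by auto

lemma state_PDDE_space: "pdde_state G (v, \<psi>) z \<in> PDDE_space G"
  unfolding PDDE_space_def mem_Collect_eq case_prod_beta pdde_state_apply
  using bc_op_U_space[where u="T_op G v + Tz_op G z", OF G_bc PIE_v state_u] hist_u_V_space[OF G_bc PIE_v PIE_\<psi>] hist_z_H1z[OF G_bc PIE_v PIE_\<psi>]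
  by auto

lemma Br_op_delayed:
  assumes j: "j \<in> {1..delays G}"
  shows "AE x in lborel_on (dom1 G). Br_op G j (delayed G (snd (pdde_state G (v, \<psi>) z) j)) i x
    = Br_op G j (Cq_op G v + Cbar_op G (\<psi> j)) i x + Br_op G j (Dqz_op G z) i x"
proof -
  let ?r = "delayed G (snd (pdde_state G (v, \<psi>) z) j)" and ?p = "Cq_op G v + Cbar_op G (\<psi> j)" and ?q = "Dqz_op G z"
  note d = hist_delayed[OF G_bc PIE_v PIE_\<psi>[OF j], of _ z, folded pdde_state_apply(2)[of G v \<psi> z j], unfolded prod.collapse]
  have br: "Br_op G j s i x = mult_ff (nint G) (Apd G j) (fst s) i x + mult_fc (nbf G) (Abd G j) (fst (snd s)) i x
      + mult_fc (nz G) (Bzd G j) (snd (snd s)) i x" for s x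
    by (simp add: Br_op_def case_prod_beta)
  have "AE x in lborel_on (dom1 G). mult_ff (nint G) (Apd G j) (fst ?r) i x
      = mult_ff (nint G) (Apd G j) (fst ?p) i x + mult_ff (nint G) (Apd G j) (fst ?q) i x"
    by (rule mult_ff_add[OF d(1)])
  then show ?thesis
  proof eventually_elim
    case (elim x)
    have "mult_fc (nbf G) (Abd G j) (fst (snd ?r)) i x = mult_fc (nbf G) (Abd G j) (fst (snd ?p)) i x + mult_fc (nbf G) (Abd G j) (fst (snd ?q)) i x"
      "mult_fc (nz G) (Bzd G j) (snd (snd ?r)) i x = mult_fc (nz G) (Bzd G j) (snd (snd ?p)) i x + mult_fc (nz G) (Bzd G j) (snd (snd ?q)) i x"
      by (rule mult_fc_add[OF d(3)], assumption, rule mult_fc_add[OF d(4)])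
    with elim show ?case unfolding br by linarith
  qed
qed

lemma Dwr_op_delayed:
  assumes j: "j \<in> {1..delays G}" and i: "i < nw G"
  shows "Dwr_op G j (delayed G (snd (pdde_state G (v, \<psi>) z) j)) i
    = Dwr_op G j (Cq_op G v + Cbar_op G (\<psi> j)) i + Dwr_op G j (Dqz_op G z) i"
proof -
  let ?r = "delayed G (snd (pdde_state G (v, \<psi>) z) j)" and ?p = "Cq_op G v + Cbar_op G (\<psi> j)" and ?q = "Dqz_op G z"
  note d = hist_delayed[OF G_bc PIE_v PIE_\<psi>[OF j], of _ z, folded pdde_state_apply(2)[of G v \<psi> z j], unfolded prod.collapse]
  have dw: "Dwr_op G j s i = mult_int (dom1 G) (nint G) (Cwpd G j) (fst s) i + mult_cc (nbf G) (Cwbd G j) (fst (snd s)) i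
      + mult_cc (nz G) (Dwzd G j) (snd (snd s)) i" for s
    by (simp add: Dwr_op_def case_prod_beta)
  have A: "Cwpd G j i k \<in> Linf (dom1 G)" if "k < nint G" for k
    using adm j i that by (simp add: admissible_def Linf_mat_def)
  have "mult_int (dom1 G) (nint G) (Cwpd G j) (fst ?r) i
      = mult_int (dom1 G) (nint G) (Cwpd G j) (fst ?p) i + mult_int (dom1 G) (nint G) (Cwpd G j) (fst ?q) i"
    by (rule mult_int_add[where A="Cwpd G j" and i=i, OF A compact_Icc]) (use d(1,2) in auto)
  moreover have "mult_cc (nbf G) (Cwbd G j) (fst (snd ?r)) i = mult_cc (nbf G) (Cwbd G j) (fst (snd ?p)) i + mult_cc (nbf G) (Cwbd G j) (fst (snd ?q)) i"
    "mult_cc (nz G) (Dwzd G j) (snd (snd ?r)) i = mult_cc (nz G) (Dwzd G j) (snd (snd ?p)) i + mult_cc (nz G) (Dwzd G j) (snd (snd ?q)) i"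
    by (rule mult_cc_add[OF d(3)], assumption, rule mult_cc_add[OF d(4)])
  ultimately show ?thesis unfolding dw by linarith
qed

lemma PDDE_rhs_state:
  "eqf (ntot G) (dom1 G) (PDDE_rhs G z (pdde_state G (v, \<psi>) z)) (fst (Ahat_op G (v, \<psi>) + Bhatz_op G z))"
  unfolding eqf_def
proof (intro allI impI)
  fix i assume "i < ntot G"
  let ?u = "T_op G v + Tz_op G z"
  have D: "AE x in lborel_on (dom1 G). D_int G ?u k x = Tint_op G v k x + Tintz_op G z k x" if k: "k < nint G" for k
  proof -
    have "AE x in lborel_on (dom1 G). D_int G ?u k x = int_op G k v z x"
      by (rule bc_op_D_int[OF G_bc PIE_v state_u k])
    with T_Tz_int_AE[OF G_bc PIE_v k, of z] show ?thesis by eventually_elim simp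
  qed
  have L: "Lambda_bf G ?u k = Tbf_op G v k + Tbfz_op G z k" if k: "k < nbf G" for k
    using bc_op_Lambda_bf[where u="T_op G v + Tz_op G z", OF G_bc PIE_v state_u k] T_Tz_bf[OF G_bc PIE_v k, of z] by simp
  have "AE x in lborel_on (dom1 G). \<forall>j\<in>{1..delays G}. Br_op G j (delayed G (snd (pdde_state G (v, \<psi>) z) j)) i x
      = Br_op G j (Cq_op G v + Cbar_op G (\<psi> j)) i x + Br_op G j (Dqz_op G z) i x"
    by (intro AE_finite_allI Br_op_delayed) auto
  moreover have "AE x in lborel_on (dom1 G). mult_ff (nint G) (Ap G) (D_int G ?u) i x
      = mult_ff (nint G) (Ap G) (Tint_op G v) i x + mult_ff (nint G) (Ap G) (Tintz_op G z) i x"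
    by (rule mult_ff_add[OF D])
  ultimately show "AE x in lborel_on (dom1 G). PDDE_rhs G z (pdde_state G (v, \<psi>) z) i x = fst (Ahat_op G (v, \<psi>) + Bhatz_op G z) i x"
    by eventually_elim
      (simp add: PDDE_rhs_def case_prod_beta pdde_state_apply Ahat_op_def Bhatz_op_def A_op_def Bz_op_def
        sum_fun_apply sum.distrib mult_fc_add[OF L])
qed

lemma PDDE_output_state:
  "eqv (nw G) (PDDE_output G z (pdde_state G (v, \<psi>) z)) (Chatw_op G (v, \<psi>) + Dhatwz_op G z)"
  unfolding eqv_def
proof (intro allI impI)
  fix i assume i: "i < nw G"
  let ?u = "T_op G v + Tz_op G z"
  have D: "AE x in lborel_on (dom1 G). D_int G ?u k x = Tint_op G v k x + Tintz_op G z k x" if k: "k < nint G" for k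
  proof -
    have "AE x in lborel_on (dom1 G). D_int G ?u k x = int_op G k v z x"
      by (rule bc_op_D_int[OF G_bc PIE_v state_u k])
    with T_Tz_int_AE[OF G_bc PIE_v k, of z] show ?thesis by eventually_elim simp
  qed
  have L: "Lambda_bf G ?u k = Tbf_op G v k + Tbfz_op G z k" if k: "k < nbf G" for k
    using bc_op_Lambda_bf[where u="T_op G v + Tz_op G z", OF G_bc PIE_v state_u k] T_Tz_bf[OF G_bc PIE_v k, of z] by simp
  have A: "Cwp G i k \<in> Linf (dom1 G)" if "k < nint G" for k
    using adm i that by (simp add: admissible_def Linf_mat_def)
  have "mult_int (dom1 G) (nint G) (Cwp G) (D_int G ?u) i
      = mult_int (dom1 G) (nint G) (Cwp G) (Tint_op G v) i + mult_int (dom1 G) (nint G) (Cwp G) (Tintz_op G z) i"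
    by (rule mult_int_add[where A="Cwp G" and i=i, OF A compact_Icc])
      (use D Tint_op_sqint[OF G_bc PIE_v] Tintz_op_sqint[OF G_bc PIE_v] bc_op_D_int_sqint[where u="T_op G v + Tz_op G z", OF G_bc PIE_v state_u] in auto)
  moreover have "(\<Sum>j\<in>{1..delays G}. Dwr_op G j (delayed G (snd (pdde_state G (v, \<psi>) z) j)) i)
      = (\<Sum>j\<in>{1..delays G}. Dwr_op G j (Cq_op G v + Cbar_op G (\<psi> j)) i + Dwr_op G j (Dqz_op G z) i)"
    by (intro sum.cong Dwr_op_delayed i) auto
  ultimately show "PDDE_output G z (pdde_state G (v, \<psi>) z) i = (Chatw_op G (v, \<psi>) + Dhatwz_op G z) i"
    by (simp add: PDDE_output_def case_prod_beta pdde_state_apply(1) Chatw_op_def Dhatwz_op_def Cw_op_def Dwz_op_def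
        sum_fun_apply sum.distrib mult_cc_add[OF L])
qed

lemma transport_state:
  assumes j: "j \<in> {1..delays G}"
  shows "eqhist G (transport G j (snd (pdde_state G (v, \<psi>) z) j)) (snd (Ahat_op G (v, \<psi>) + Bhatz_op G z) j)"
proof -
  have "AE p in lborel_on (dom2 G). wpd (dom2 G) [(1, 0)] (hist_u G v z (fst (\<psi> j)) (snd (\<psi> j)) i) p = T_curve G (\<psi> j) i p"
    if i: "i < ntot G" for i
  proof -
    have "AE p in lborel_on (dom2 G). T_curve G (\<psi> j) i p = lift G (bc_op G 0 i) (fst (\<psi> j)) (snd (\<psi> j)) p"
      using T_curve_eq(2)[OF G_bc PIE_v PIE_\<psi>[OF j]] i by (simp add: eqf_def)
    with hist_u_wpd(2)[OF G_bc PIE_v PIE_\<psi>[OF j] i le0, of z] show ?thesis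
      by (simp, eventually_elim) simp
  qed
  moreover have "AE s in lborel_on {0..1}. wpd {0..1} [1] (hist_z G z (fst (\<psi> j)) (snd (\<psi> j)) k) s = snd (\<psi> j) k s"
    if k: "k < nz G" for k
    by (rule wpd_interval_eqI[OF L2_sqint[OF PIE_\<psi>(2)[OF j] k] hist_z_facts(2)[OF G_bc PIE_v PIE_\<psi>[OF j] k]])
  ultimately show ?thesis
    by (auto simp: eqhist_def eqf_def transport_def pdde_state_apply(2) Ahat_op_def Bhatz_op_def case_prod_beta Abar_op_def)
qed

end
end

section \<open>Differentiability in the product norms\<close>

lemma tendsto_0_power2_iff:
  fixes f :: "'a \<Rightarrow> real"
  assumes "\<And>x. 0 \<le> f x"
  shows "(f \<longlongrightarrow> 0) F \<longleftrightarrow> ((\<lambda>x. (f x)\<^sup>2) \<longlongrightarrow> 0) F"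
proof
  assume "(f \<longlongrightarrow> 0) F"
  from tendsto_power[OF this, of 2] show "((\<lambda>x. (f x)\<^sup>2) \<longlongrightarrow> 0) F" by simp
next
  assume "((\<lambda>x. (f x)\<^sup>2) \<longlongrightarrow> 0) F"
  from tendsto_real_sqrt[OF this] show "(f \<longlongrightarrow> 0) F" using assms by simp
qed

lemma frechet_sqrt_iff:
  assumes "\<And>p. 0 \<le> E p"
  shows "frechet (\<lambda>p. sqrt (E p)) y y' t \<longleftrightarrow>
    ((\<lambda>r. E (y r - y t - (r - t) *\<^sub>R y') / (r - t)\<^sup>2) \<longlongrightarrow> 0) (at t within {0..})"
  unfolding frechet_def using assms
  by (subst tendsto_0_power2_iff) (simp_all add: power_divide)

lemma tendsto_0_add_iff:
  fixes f g :: "'a \<Rightarrow> real"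
  assumes "\<And>x. 0 \<le> f x" "\<And>x. 0 \<le> g x"
  shows "((\<lambda>x. f x + g x) \<longlongrightarrow> 0) F \<longleftrightarrow> (f \<longlongrightarrow> 0) F \<and> (g \<longlongrightarrow> 0) F"
proof
  assume s: "((\<lambda>x. f x + g x) \<longlongrightarrow> 0) F"
  have "(f \<longlongrightarrow> 0) F"
    by (rule tendsto_sandwich[OF _ _ tendsto_const s]) (use assms in \<open>auto simp: add_increasing2\<close>)
  moreover have "(g \<longlongrightarrow> 0) F"
    by (rule tendsto_sandwich[OF _ _ tendsto_const s]) (use assms in \<open>auto simp: add_increasing\<close>)
  ultimately show "(f \<longlongrightarrow> 0) F \<and> (g \<longlongrightarrow> 0) F" ..
next
  assume "(f \<longlongrightarrow> 0) F \<and> (g \<longlongrightarrow> 0) F"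
  then show "((\<lambda>x. f x + g x) \<longlongrightarrow> 0) F" using tendsto_add[of f 0 F g 0] by simp
qed

lemma tendsto_0_sum_iff:
  fixes f :: "'b \<Rightarrow> 'a \<Rightarrow> real"
  assumes "finite I" "\<And>i x. i \<in> I \<Longrightarrow> 0 \<le> f i x"
  shows "((\<lambda>x. \<Sum>i\<in>I. f i x) \<longlongrightarrow> 0) F \<longleftrightarrow> (\<forall>i\<in>I. (f i \<longlongrightarrow> 0) F)"
  using assms
proof (induction I rule: finite_induct)
  case (insert i I)
  have "((\<lambda>x. f i x + (\<Sum>i\<in>I. f i x)) \<longlongrightarrow> 0) F \<longleftrightarrow> (f i \<longlongrightarrow> 0) F \<and> ((\<lambda>x. \<Sum>i\<in>I. f i x) \<longlongrightarrow> 0) F"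
    using insert by (intro tendsto_0_add_iff) (auto intro: sum_nonneg)
  with insert show ?case by simp
qed simp

text \<open>
  The shape that \<open>PIE_norm\<close> and \<open>PDDE_norm\<close> have in common. A sum of nonnegative terms tends to zero
  iff each term does.
\<close>

lemma tendsto_0_state_sum_iff:
  fixes e :: "nat \<Rightarrow> 'a \<Rightarrow> real" and f g :: "nat \<Rightarrow> nat \<Rightarrow> 'a \<Rightarrow> real"
  assumes "\<And>i x. 0 \<le> e i x" "\<And>j i x. 0 \<le> f j i x" "\<And>j i x. 0 \<le> g j i x" "finite J"
  shows "((\<lambda>x. ((\<Sum>i<n. e i x) + (\<Sum>j\<in>J. (\<Sum>i<n. f j i x) + (\<Sum>i<m. g j i x))) / (d x)\<^sup>2) \<longlongrightarrow> 0) F \<longleftrightarrow>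
    (\<forall>i<n. ((\<lambda>x. e i x / (d x)\<^sup>2) \<longlongrightarrow> 0) F) \<and>
    (\<forall>j\<in>J. (\<forall>i<n. ((\<lambda>x. f j i x / (d x)\<^sup>2) \<longlongrightarrow> 0) F) \<and> (\<forall>i<m. ((\<lambda>x. g j i x / (d x)\<^sup>2) \<longlongrightarrow> 0) F))"
proof -
  have nn: "0 \<le> e i x / (d x)\<^sup>2" "0 \<le> f j i x / (d x)\<^sup>2" "0 \<le> g j i x / (d x)\<^sup>2" for i j x
    using assms by simp_all
  show ?thesis
    unfolding add_divide_distrib sum_divide_distrib
    by (subst tendsto_0_add_iff tendsto_0_sum_iff; (intro sum_nonneg add_nonneg_nonneg nn assms(4) finite_lessThan)?)+
      (auto simp: nn assms(4))
qed

lemma sobolev_normsq_nonneg: "0 \<le> sobolev_normsq S D f"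
  by (simp add: sobolev_normsq_def sum_nonneg normsq_nonneg)

lemma finite_ord: "finite (ord1 k)" "finite (ord2 k)"
  by (simp_all add: ord1_def ord2_def)

lemma ord2_Basis: "ds \<in> ord2 k \<Longrightarrow> set ds \<subseteq> Basis"
  using Basis_prod_real by (auto simp: ord2_def split: if_splits)

lemma increment_component:
  fixes f g h :: "'b \<Rightarrow> real"
  shows "f - g - c *\<^sub>R h = (\<lambda>x. f x - g x - c * h x)"
  by (simp add: fun_eq_iff)

lemma frechet_PIE_iff:
  "frechet (PIE_norm G) y y' t \<longleftrightarrow>
    (\<forall>i<ntot G. tdiff (dom1 G) (\<lambda>r. fst (y r) i) (fst y' i) t) \<and>
    (\<forall>j\<in>{1..delays G}. (\<forall>i<ntot G. tdiff (dom2 G) (\<lambda>r. fst (snd (y r) j) i) (fst (snd y' j) i) t) \<and>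
      (\<forall>i<nz G. tdiff {0..1} (\<lambda>r. snd (snd (y r) j) i) (snd (snd y' j) i) t))"
proof -
  have n: "PIE_norm G = (\<lambda>p. sqrt ((\<Sum>i<ntot G. normsq (dom1 G) (fst p i)) +
    (\<Sum>j\<in>{1..delays G}. (\<Sum>i<ntot G. normsq (dom2 G) (fst (snd p j) i)) + (\<Sum>i<nz G. normsq {0..1} (snd (snd p j) i)))))"
    by (simp add: PIE_norm_def case_prod_beta')
  show ?thesis
    unfolding n tdiff_def
    by (subst frechet_sqrt_iff)
      (auto intro!: add_nonneg_nonneg sum_nonneg simp: normsq_nonneg tendsto_0_state_sum_iff increment_component)
qed

lemma frechet_PDDE_iff:
  "frechet (PDDE_norm G) y y' t \<longleftrightarrow>
    (\<forall>i<ntot G. \<forall>ds\<in>ord1 (reg G i). ((\<lambda>r. normsq (dom1 G) (wpd (dom1 G) ds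
      (\<lambda>x. fst (y r) i x - fst (y t) i x - (r - t) * fst y' i x)) / (r - t)\<^sup>2) \<longlongrightarrow> 0) (at t within {0..})) \<and>
    (\<forall>j\<in>{1..delays G}. (\<forall>i<ntot G. \<forall>ds\<in>ord2 (reg G i). ((\<lambda>r. normsq (dom2 G) (wpd (dom2 G) ds
      (\<lambda>x. fst (snd (y r) j) i x - fst (snd (y t) j) i x - (r - t) * fst (snd y' j) i x)) / (r - t)\<^sup>2) \<longlongrightarrow> 0) (at t within {0..})) \<and>
      (\<forall>i<nz G. \<forall>ds\<in>ord1 1. ((\<lambda>r. normsq {0..1} (wpd {0..1} ds
      (\<lambda>x. snd (snd (y r) j) i x - snd (snd (y t) j) i x - (r - t) * snd (snd y' j) i x)) / (r - t)\<^sup>2) \<longlongrightarrow> 0) (at t within {0..})))"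
proof -
  have n: "PDDE_norm G = (\<lambda>p. sqrt ((\<Sum>i<ntot G. sobolev_normsq (dom1 G) (ord1 (reg G i)) (fst p i)) +
    (\<Sum>j\<in>{1..delays G}. (\<Sum>i<ntot G. sobolev_normsq (dom2 G) (ord2 (reg G i)) (fst (snd p j) i))
      + (\<Sum>i<nz G. sobolev_normsq {0..1} (ord1 1) (snd (snd p j) i)))))"
    by (simp add: PDDE_norm_def case_prod_beta')
  have s: "((\<lambda>r. sobolev_normsq S D (f r) / (r - t)\<^sup>2) \<longlongrightarrow> 0) F \<longleftrightarrow> (\<forall>ds\<in>D. ((\<lambda>r. normsq S (wpd S ds (f r)) / (r - t)\<^sup>2) \<longlongrightarrow> 0) F)"
    if "finite D" for S :: "'b::euclidean_space set" and D f F
    unfolding sobolev_normsq_def sum_divide_distrib using that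
    by (intro tendsto_0_sum_iff) (auto simp: normsq_nonneg)
  show ?thesis
    unfolding n
    by (subst frechet_sqrt_iff)
      (auto intro!: add_nonneg_nonneg sum_nonneg simp: sobolev_normsq_nonneg tendsto_0_state_sum_iff increment_component s finite_ord)
qed

text \<open>The weak derivative of the increment is the increment of the weak derivatives, up to a null set.\<close>

lemma sobolev_increment_tdiff:
  assumes S: "S = cbox A B" and f: "\<And>r. 0 \<le> r \<Longrightarrow> f r \<in> sobolev S D" "f' \<in> sobolev S D"
    and D: "\<And>ds. ds \<in> D \<Longrightarrow> set ds \<subseteq> Basis" and ds: "ds \<in> D" and t: "0 \<le> t"
  shows "((\<lambda>r. normsq S (wpd S ds (\<lambda>x. f r x - f t x - (r - t) * f' x)) / (r - t)\<^sup>2) \<longlongrightarrow> 0) (at t within {0..})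
    \<longleftrightarrow> tdiff S (\<lambda>r. wpd S ds (f r)) (wpd S ds f') t"
  unfolding tdiff_def
proof (rule tendsto_cong)
  have c: "compact S" by (simp add: S)
  have "normsq S (wpd S ds (\<lambda>x. f r x - f t x - (r - t) * f' x))
      = normsq S (\<lambda>x. wpd S ds (f r) x - wpd S ds (f t) x - (r - t) * wpd S ds f' x)" if r: "0 \<le> r" for r
  proof -
    let ?h = "\<lambda>x. f r x + (-1) * f t x"
    have h: "?h \<in> sobolev S D" by (rule sobolev_lin[OF f(1)[OF r] f(1)[OF t] D c])
    have 1: "weak_pd S ds ?h (\<lambda>x. wpd S ds (f r) x + (-1) * wpd S ds (f t) x)"
      by (rule sobolev_lin_weak_pd[OF f(1)[OF r] f(1)[OF t] D c ds])
    have w: "wpd S ds (f r) \<in> sqint S" "wpd S ds (f t) \<in> sqint S" "wpd S ds f' \<in> sqint S"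
      using f(1)[OF r] f(1)[OF t] f(2) ds by (auto intro: sobolev_wpd)
    have "weak_pd S ds (\<lambda>x. ?h x + (- (r - t)) * f' x) (\<lambda>x. (wpd S ds (f r) x + (-1) * wpd S ds (f t) x) + (- (r - t)) * wpd S ds f' x)"
      by (rule weak_pd_lin[OF 1 sobolev_wpd(2)[OF f(2) ds] D[OF ds] c sobolev_sqint[OF h] sobolev_sqint[OF f(2)]])
        (intro sqint_add sqint_cmult w)+
    then have wp: "weak_pd S ds (\<lambda>x. f r x - f t x - (r - t) * f' x) (\<lambda>x. wpd S ds (f r) x - wpd S ds (f t) x - (r - t) * wpd S ds f' x)"
      by (simp add: algebra_simps)
    have sq: "(\<lambda>x. wpd S ds (f r) x - wpd S ds (f t) x - (r - t) * wpd S ds f' x) \<in> sqint S"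
      by (intro sqint_diff sqint_cmult w)
    show ?thesis
      by (rule normsq_cong_AE[OF wpd_eqI[of _ A B, folded S, OF sq wp] wpd_spec(1)[OF sq wp] sq])
  qed
  note eq = this
  show "eventually (\<lambda>r. normsq S (wpd S ds (\<lambda>x. f r x - f t x - (r - t) * f' x)) / (r - t)\<^sup>2
      = normsq S (\<lambda>x. wpd S ds (f r) x - wpd S ds (f t) x - (r - t) * wpd S ds f' x) / (r - t)\<^sup>2) (at t within {0..})"
    using eventually_time[of t] by eventually_elim (simp add: eq)
qed

lemma frechet_PDDE_tdiff:
  assumes y: "\<And>r. 0 \<le> r \<Longrightarrow> y r \<in> PDDE_space G" "y' \<in> PDDE_space G" and t: "0 \<le> t"
  shows "frechet (PDDE_norm G) y y' t \<longleftrightarrow>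
    (\<forall>i<ntot G. \<forall>ds\<in>ord1 (reg G i). tdiff (dom1 G) (\<lambda>r. wpd (dom1 G) ds (fst (y r) i)) (wpd (dom1 G) ds (fst y' i)) t) \<and>
    (\<forall>j\<in>{1..delays G}. (\<forall>i<ntot G. \<forall>ds\<in>ord2 (reg G i).
        tdiff (dom2 G) (\<lambda>r. wpd (dom2 G) ds (fst (snd (y r) j) i)) (wpd (dom2 G) ds (fst (snd y' j) i)) t) \<and>
      (\<forall>i<nz G. \<forall>ds\<in>ord1 1. tdiff {0..1} (\<lambda>r. wpd {0..1} ds (snd (snd (y r) j) i)) (wpd {0..1} ds (snd (snd y' j) i)) t))"
proof -
  have s: "fst (y r) i \<in> sobolev (dom1 G) (ord1 (reg G i))" "fst y' i \<in> sobolev (dom1 G) (ord1 (reg G i))"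
    if "0 \<le> r" "i < ntot G" for r i
    using y(1)[OF that(1)] y(2) that by (auto simp: PDDE_space_def U_space_def)
  have sj: "fst (snd (y r) j) i \<in> sobolev (dom2 G) (ord2 (reg G i))" "fst (snd y' j) i \<in> sobolev (dom2 G) (ord2 (reg G i))"
    if "0 \<le> r" "i < ntot G" "j \<in> {1..delays G}" for r i j
    using y(1)[OF that(1)] y(2) that by (auto simp: PDDE_space_def V_space_def)
  have sz: "snd (snd (y r) j) i \<in> sobolev {0..1} (ord1 1)" "snd (snd y' j) i \<in> sobolev {0..1} (ord1 1)"
    if "0 \<le> r" "i < nz G" "j \<in> {1..delays G}" for r i j
    using y(1)[OF that(1)] y(2) that by (auto simp: PDDE_space_def H1z_space_def)
  note 1 = sobolev_increment_tdiff[OF interval_cbox _ _ ord1_Basis _ t]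
  note 2 = sobolev_increment_tdiff[OF rect_cbox _ _ ord2_Basis _ t]
  have e1: "((\<lambda>r. normsq (dom1 G) (wpd (dom1 G) ds (\<lambda>x. fst (y r) i x - fst (y t) i x - (r - t) * fst y' i x)) / (r - t)\<^sup>2) \<longlongrightarrow> 0) (at t within {0..})
      \<longleftrightarrow> tdiff (dom1 G) (\<lambda>r. wpd (dom1 G) ds (fst (y r) i)) (wpd (dom1 G) ds (fst y' i)) t"
    if "i < ntot G" "ds \<in> ord1 (reg G i)" for i ds
    by (rule 1[where f="\<lambda>r. fst (y r) i"]) (use s that t in auto)
  have e2: "((\<lambda>r. normsq (dom2 G) (wpd (dom2 G) ds (\<lambda>x. fst (snd (y r) j) i x - fst (snd (y t) j) i x - (r - t) * fst (snd y' j) i x)) / (r - t)\<^sup>2) \<longlongrightarrow> 0) (at t within {0..})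
      \<longleftrightarrow> tdiff (dom2 G) (\<lambda>r. wpd (dom2 G) ds (fst (snd (y r) j) i)) (wpd (dom2 G) ds (fst (snd y' j) i)) t"
    if "j \<in> {1..delays G}" "i < ntot G" "ds \<in> ord2 (reg G i)" for j i ds
    by (rule 2[where f="\<lambda>r. fst (snd (y r) j) i"]) (use sj that t in auto)
  have e3: "((\<lambda>r. normsq {0..1} (wpd {0..1} ds (\<lambda>x. snd (snd (y r) j) i x - snd (snd (y t) j) i x - (r - t) * snd (snd y' j) i x)) / (r - t)\<^sup>2) \<longlongrightarrow> 0) (at t within {0..})
      \<longleftrightarrow> tdiff {0..1} (\<lambda>r. wpd {0..1} ds (snd (snd (y r) j) i)) (wpd {0..1} ds (snd (snd y' j) i)) t"
    if "j \<in> {1..delays G}" "i < nz G" "ds \<in> ord1 1" for j i ds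
    by (rule 1[where f="\<lambda>r. snd (snd (y r) j) i"]) (use sz that t in auto)
  show ?thesis
    unfolding frechet_PDDE_iff using e1 e2 e3 by blast
qed

section \<open>Equivalence of the two notions of solution\<close>

text \<open>A left inverse of \<open>pdde_state\<close>, up to null sets: \<open>D u\<close>, \<open>\<partial>\<^sub>s D \<phi>\<^sub>u\<close> and \<open>\<partial>\<^sub>s \<phi>\<^sub>z\<close>.\<close>

definition top_deriv :: "pdde_data \<Rightarrow> state \<Rightarrow> state"
  where "top_deriv G p = (\<lambda>i. wpd (dom1 G) (replicate (reg G i) 1) (fst p i),
    \<lambda>j. (\<lambda>i. wpd (dom2 G) ([(1, 0)] @ replicate (reg G i) (0, 1)) (fst (snd p j) i), \<lambda>k. wpd {0..1} [1] (snd (snd p j) k)))"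

lemma PDDE_spaceD:
  assumes "p \<in> PDDE_space G"
  shows "i < ntot G \<Longrightarrow> fst p i \<in> sobolev (dom1 G) (ord1 (reg G i))"
    and "j \<in> {1..delays G} \<Longrightarrow> i < ntot G \<Longrightarrow> fst (snd p j) i \<in> sobolev (dom2 G) (ord2 (reg G i))"
    and "j \<in> {1..delays G} \<Longrightarrow> k < nz G \<Longrightarrow> snd (snd p j) k \<in> sobolev {0..1} (ord1 1)"
  using assms by (auto simp: PDDE_space_def U_space_def V_space_def H1z_space_def)

lemma ord1_cases: "ds \<in> ord1 k \<longleftrightarrow> (\<exists>\<beta>\<le>k. ds = replicate \<beta> 1)"
  by (auto simp: ord1_def)

lemma ord2_cases: "ds \<in> ord2 k \<longleftrightarrow> (\<exists>\<beta>\<le>k. ds = replicate \<beta> (0, 1) \<or> ds = [(1, 0)] @ replicate \<beta> (0, 1))"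
proof -
  have "ds \<in> ord2 k \<longleftrightarrow> (\<exists>\<alpha>\<le>1. \<exists>\<beta>\<le>k. ds = replicate \<alpha> (1, 0) @ replicate \<beta> (0, 1))"
    by (auto simp: ord2_def)
  also have "\<dots> \<longleftrightarrow> (\<exists>\<beta>\<le>k. ds = replicate \<beta> (0, 1) \<or> ds = [(1, 0)] @ replicate \<beta> (0, 1))"
    by (auto simp: le_Suc_eq)
  finally show ?thesis .
qed

lemma top_orders: "replicate (reg G i) 1 \<in> ord1 (reg G i)" "[(1, 0)] @ replicate (reg G i) (0, 1) \<in> ord2 (reg G i)" "[1] \<in> ord1 1"
  "[] \<in> ord1 m" "[] \<in> ord2 m"
  by (auto simp: ord1_cases ord2_cases intro: exI[of _ 1] exI[of _ 0])

lemma top_deriv_PIE_space: "p \<in> PDDE_space G \<Longrightarrow> top_deriv G p \<in> PIE_space G"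
  by (auto simp: PIE_space_def top_deriv_def L2_def intro!: sobolev_wpd(1)[OF PDDE_spaceD(1)] sobolev_wpd(1)[OF PDDE_spaceD(2)]
      sobolev_wpd(1)[OF PDDE_spaceD(3)] top_orders[simplified])

lemma lift_top:
  assumes "well_posed_bc G" "v \<in> L2 (ntot G) (dom1 G)" "\<psi>u \<in> L2 (ntot G) (dom2 G)" "\<psi>z \<in> L2 (nz G) {0..1}" and i: "i < ntot G"
  shows "AE p in lborel_on (dom2 G). lift G (bc_op G (reg G i) i) \<psi>u \<psi>z p = \<psi>u i p"
proof (rule rect_AE_eqI)
  show "AE s in lborel_on {0..1}. AE x in lborel_on (dom1 G). lift G (bc_op G (reg G i) i) \<psi>u \<psi>z (s, x) = \<psi>u i (s, x)"
    using lift_section[OF assms(1-4) bc_op_pi_op[OF assms(1) i order_refl]]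
    by eventually_elim (auto intro!: AE_I2 simp: bc_op_top[OF assms(1)] section2_at_def)
qed (use lift_sqint[OF assms(1-4) bc_op_pi_op[OF assms(1) i order_refl]] L2_sqint[OF assms(3) i] in \<open>auto intro: sqint_measurable\<close>)

text \<open>
  The input history \<open>z + \<integral>\<^sub>0\<^sup>s \<psi>\<^sub>z\<close> has the shape of a partial integral operator on the delay interval,
  so its differentiability in time and its invariance under changes on null sets are known.
\<close>

lemma hist_z_pi_op: "k < n \<Longrightarrow> pi_op 0 1 n n (\<lambda>v z x. z k + prim 0 (v k) x)"
  by (intro pi_op_add pi_fun_imp_op pi_fun_coord pi_op_prim pi_op_proj)

context
  fixes G :: pdde_data
  assumes adm: "admissible G" and wp: "well_posed G"
begin

lemma state_wpd_u:
  assumes y: "(v, \<psi>) \<in> PIE_space G" and i: "i < ntot G" "\<beta> \<le> reg G i"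
  shows "AE x in lborel_on (dom1 G). wpd (dom1 G) (replicate \<beta> 1) (fst (pdde_state G (v, \<psi>) z) i) x = bc_op G \<beta> i v z x"
  unfolding pdde_state_apply
  by (rule bc_op_wpd[where u="T_op G v + Tz_op G z", OF G_bc[OF adm wp] PIE_v[OF adm wp y] state_u[OF adm wp y] i])

lemma state_wpd_z:
  assumes y: "(v, \<psi>) \<in> PIE_space G" and j: "j \<in> {1..delays G}" and k: "k < nz G"
  shows "AE s in lborel_on {0..1}. wpd {0..1} [] (snd (snd (pdde_state G (v, \<psi>) z) j) k) s = z k + prim 0 (snd (\<psi> j) k) s"
    and "AE s in lborel_on {0..1}. wpd {0..1} [1] (snd (snd (pdde_state G (v, \<psi>) z) j) k) s = snd (\<psi> j) k s"
proof -
  note f = hist_z_facts[OF G_bc[OF adm wp] PIE_v[OF adm wp y] PIE_\<psi>[OF adm wp y j] k, where z=z]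
  show "AE s in lborel_on {0..1}. wpd {0..1} [] (snd (snd (pdde_state G (v, \<psi>) z) j) k) s = z k + prim 0 (snd (\<psi> j) k) s"
    using wpd_interval_eqI[OF f(1) weak_pd_Nil] by (simp add: pdde_state_apply hist_z_apply)
  show "AE s in lborel_on {0..1}. wpd {0..1} [1] (snd (snd (pdde_state G (v, \<psi>) z) j) k) s = snd (\<psi> j) k s"
    using wpd_interval_eqI[OF L2_sqint[OF PIE_\<psi>(2)[OF adm wp y j] k] f(2)] by (simp add: pdde_state_apply)
qed

lemma state_wpd_hist:
  assumes y: "(v, \<psi>) \<in> PIE_space G" and j: "j \<in> {1..delays G}" and i: "i < ntot G" "\<beta> \<le> reg G i"
  shows "AE p in lborel_on (dom2 G). wpd (dom2 G) (replicate \<beta> (0, 1)) (fst (snd (pdde_state G (v, \<psi>) z) j) i) p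
      = hist G (bc_op G \<beta> i) v z (fst (\<psi> j)) (snd (\<psi> j)) p"
    and "AE p in lborel_on (dom2 G). wpd (dom2 G) ([(1, 0)] @ replicate \<beta> (0, 1)) (fst (snd (pdde_state G (v, \<psi>) z) j) i) p
      = lift G (bc_op G \<beta> i) (fst (\<psi> j)) (snd (\<psi> j)) p"
  unfolding pdde_state_apply fst_conv
  by (rule hist_u_wpd[OF G_bc[OF adm wp] PIE_v[OF adm wp y] PIE_\<psi>[OF adm wp y j] i])+

text \<open>\<open>bc_op\<close> of top order is the identity in \<open>v\<close>.\<close>

lemma top_deriv_state:
  assumes "(v0, \<psi>0) \<in> PIE_space G"
  shows "eqstate G (top_deriv G (pdde_state G (v0, \<psi>0) z0)) (v0, \<psi>0)"
proof -
  note G = G_bc[OF adm wp] and v = PIE_v[OF adm wp assms] and \<psi> = PIE_\<psi>[OF adm wp assms]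
  have "AE x in lborel_on (dom1 G). wpd (dom1 G) (replicate (reg G i) 1) (fst (pdde_state G (v0, \<psi>0) z0) i) x = v0 i x" if "i < ntot G" for i
    using state_wpd_u[OF assms that order_refl, of z0] by (simp add: bc_op_top[OF G])
  moreover have "AE p in lborel_on (dom2 G). wpd (dom2 G) ([(1, 0)] @ replicate (reg G i) (0, 1)) (fst (snd (pdde_state G (v0, \<psi>0) z0) j) i) p = fst (\<psi>0 j) i p"
    if "j \<in> {1..delays G}" "i < ntot G" for i j
    using state_wpd_hist(2)[OF assms that order_refl, of z0] lift_top[OF G v \<psi>[OF that(1)] that(2)] by eventually_elim simp
  ultimately show ?thesis
    using state_wpd_z(2)[OF assms] by (simp add: eqstate_def eqhist_def eqf_def top_deriv_def)
qed

context
  fixes v :: "real \<Rightarrow> real vfun" and \<psi> :: "real \<Rightarrow> nat \<Rightarrow> (real \<times> real) vfun \<times> real vfun" and z :: "real \<Rightarrow> rvec"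
  assumes y: "\<And>t. 0 \<le> t \<Longrightarrow> (v t, \<psi> t) \<in> PIE_space G"
    and dz: "\<And>t i. 0 \<le> t \<Longrightarrow> i < nz G \<Longrightarrow> (\<lambda>r. z r i) differentiable (at t within {0..})"
begin

lemma z_derivative: "0 \<le> t \<Longrightarrow> k < nz G \<Longrightarrow> ((\<lambda>r. z r k) has_vector_derivative time_deriv z t k) (at t within {0..})"
  unfolding time_deriv_def using dz vector_derivative_works by blast

text \<open>
  Each weak derivative in \<open>PDDE_norm\<close> of \<open>u\<close> and \<open>\<phi>\<^sub>u\<close> is one of the operators \<open>bc_op\<close>,
  lifted or integrated over \<open>s\<close>, and all of these are bounded.
\<close>

lemma frechet_state:
  assumes t: "0 \<le> t" and y': "(v', \<psi>') \<in> PIE_space G" and d: "frechet (PIE_norm G) (\<lambda>t. (v t, \<psi> t)) (v', \<psi>') t"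
  shows "frechet (PDDE_norm G) (\<lambda>r. pdde_state G (v r, \<psi> r) (z r)) (pdde_state G (v', \<psi>') (time_deriv z t)) t"
proof -
  note G = G_bc[OF adm wp]
  note v = PIE_v[OF adm wp y] and v' = PIE_v[OF adm wp y']
  note \<psi> = PIE_\<psi>[OF adm wp y] and \<psi>' = PIE_\<psi>[OF adm wp y']
  note sp = state_PDDE_space[OF adm wp y] and sp' = state_PDDE_space[OF adm wp y']
  have dv: "tdiff (dom1 G) (\<lambda>r. v r i) (v' i) t" if "i < ntot G" for i
    using d that by (simp add: frechet_PIE_iff)
  have d\<psi>: "i < ntot G \<Longrightarrow> tdiff (dom2 G) (\<lambda>r. fst (\<psi> r j) i) (fst (\<psi>' j) i) t"
    "k < nz G \<Longrightarrow> tdiff {0..1} (\<lambda>r. snd (\<psi> r j) k) (snd (\<psi>' j) k) t" if "j \<in> {1..delays G}" for i j k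
    using d that by (auto simp: frechet_PIE_iff)
  have D1: "tdiff (dom1 G) (\<lambda>r. Op (v r) (z r)) (Op v' (time_deriv z t)) t" if "pio G Op" for Op
    by (rule pi_op_tdiff[OF that t v v' dv z_derivative[OF t]])
  have D2: "tdiff (dom2 G) (\<lambda>r. lift G Op (fst (\<psi> r j)) (snd (\<psi> r j))) (lift G Op (fst (\<psi>' j)) (snd (\<psi>' j))) t"
    if "pio G Op" "j \<in> {1..delays G}" for Op j
    using that \<psi> \<psi>' d\<psi> by (intro pi_lift_tdiff t) auto
  have l: "lift G Op (fst (\<psi> r j)) (snd (\<psi> r j)) \<in> sqint (dom2 G)" "lift G Op (fst (\<psi>' j)) (snd (\<psi>' j)) \<in> sqint (dom2 G)"
    "hist G Op (v r) (z r) (fst (\<psi> r j)) (snd (\<psi> r j)) \<in> sqint (dom2 G)"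
    "hist G Op v' (time_deriv z t) (fst (\<psi>' j)) (snd (\<psi>' j)) \<in> sqint (dom2 G)"
    if "pio G Op" "j \<in> {1..delays G}" "0 \<le> r" for Op j r
    using lift_sqint[OF G v[OF that(3)] \<psi>(1)[OF that(3,2)] \<psi>(2)[OF that(3,2)] that(1)]
      hist_sqint[OF G v[OF that(3)] \<psi>(1)[OF that(3,2)] \<psi>(2)[OF that(3,2)] that(1)]
      lift_sqint[OF G v' \<psi>'[OF that(2)] that(1)] hist_sqint[OF G v' \<psi>'[OF that(2)] that(1)] by auto
  have D3: "tdiff (dom2 G) (\<lambda>r. hist G Op (v r) (z r) (fst (\<psi> r j)) (snd (\<psi> r j))) (hist G Op v' (time_deriv z t) (fst (\<psi>' j)) (snd (\<psi>' j))) t"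
    if op: "pio G Op" and j: "j \<in> {1..delays G}" for Op j
    unfolding hist_def[abs_def]
    by (intro tdiff_add t tdiff_rect_snd compact_Icc D1 tprim_tdiff D2 op j l(1) l(2)[OF _ _ t] tprim_sqint sqint_rect_snd pi_op_sqint[OF op] v v')
  show ?thesis
    proof (rule frechet_PDDE_tdiff[THEN iffD2, OF _ sp' t], rule sp, assumption, intro conjI allI ballI impI)
    fix i ds assume i: "i < ntot G" and ds: "ds \<in> ord1 (reg G i)"
    then obtain \<beta> where \<beta>: "\<beta> \<le> reg G i" "ds = replicate \<beta> 1" by (auto simp: ord1_cases)
    note op = bc_op_pi_op[OF G i \<beta>(1)]
    show "tdiff (dom1 G) (\<lambda>r. wpd (dom1 G) ds (fst (pdde_state G (v r, \<psi> r) (z r)) i)) (wpd (dom1 G) ds (fst (pdde_state G (v', \<psi>') (time_deriv z t)) i)) t"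
    proof (rule tdiff_cong_AE[OF D1[OF op] t])
      fix r :: real assume r: "0 \<le> r"
      show "AE x in lborel_on (dom1 G). bc_op G \<beta> i (v r) (z r) x = wpd (dom1 G) ds (fst (pdde_state G (v r, \<psi> r) (z r)) i) x"
        using state_wpd_u[where z="z r", OF y[OF r] i \<beta>(1)] unfolding \<beta>(2) by eventually_elim simp
      show "wpd (dom1 G) ds (fst (pdde_state G (v r, \<psi> r) (z r)) i) \<in> sqint (dom1 G)"
        by (rule sobolev_wpd(1)[OF PDDE_spaceD(1)[OF sp[OF r] i] ds])
    next
      show "AE x in lborel_on (dom1 G). bc_op G \<beta> i v' (time_deriv z t) x = wpd (dom1 G) ds (fst (pdde_state G (v', \<psi>') (time_deriv z t)) i) x"
        using state_wpd_u[where z="time_deriv z t", OF y' i \<beta>(1)] unfolding \<beta>(2) by eventually_elim simp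
      show "wpd (dom1 G) ds (fst (pdde_state G (v', \<psi>') (time_deriv z t)) i) \<in> sqint (dom1 G)"
        by (rule sobolev_wpd(1)[OF PDDE_spaceD(1)[OF sp' i] ds])
    qed (use pi_op_sqint[OF op v] pi_op_sqint[OF op v'] in auto)
  next
    fix j i ds assume j: "j \<in> {1..delays G}" and i: "i < ntot G" and ds: "ds \<in> ord2 (reg G i)"
    have sq: "wpd (dom2 G) ds (fst (snd (pdde_state G (v r, \<psi> r) (z r)) j) i) \<in> sqint (dom2 G)" if "0 \<le> r" for r
      by (rule sobolev_wpd(1)[OF PDDE_spaceD(2)[OF sp[OF that] j i] ds])
    have sq': "wpd (dom2 G) ds (fst (snd (pdde_state G (v', \<psi>') (time_deriv z t)) j) i) \<in> sqint (dom2 G)"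
      by (rule sobolev_wpd(1)[OF PDDE_spaceD(2)[OF sp' j i] ds])
    obtain \<beta> where \<beta>: "\<beta> \<le> reg G i" "ds = replicate \<beta> (0, 1) \<or> ds = [(1, 0)] @ replicate \<beta> (0, 1)"
      using ds by (auto simp: ord2_cases)
    note op = bc_op_pi_op[OF G i \<beta>(1)]
    from \<beta>(2) show "tdiff (dom2 G) (\<lambda>r. wpd (dom2 G) ds (fst (snd (pdde_state G (v r, \<psi> r) (z r)) j) i)) (wpd (dom2 G) ds (fst (snd (pdde_state G (v', \<psi>') (time_deriv z t)) j) i)) t"
    proof
      assume e: "ds = replicate \<beta> (0, 1)"
      show ?thesis
      proof (rule tdiff_cong_AE[OF D3[OF op j] t l(3)[OF op j] l(4)[OF op j t] sq sq'])
        show "AE x in lborel_on (dom2 G). hist G (bc_op G \<beta> i) (v r) (z r) (fst (\<psi> r j)) (snd (\<psi> r j)) x = wpd (dom2 G) ds (fst (snd (pdde_state G (v r, \<psi> r) (z r)) j) i) x"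
          if "0 \<le> r" for r
          using state_wpd_hist(1)[where z="z r", OF y[OF that] j i \<beta>(1)] unfolding e by eventually_elim simp
        show "AE x in lborel_on (dom2 G). hist G (bc_op G \<beta> i) v' (time_deriv z t) (fst (\<psi>' j)) (snd (\<psi>' j)) x = wpd (dom2 G) ds (fst (snd (pdde_state G (v', \<psi>') (time_deriv z t)) j) i) x"
          using state_wpd_hist(1)[where z="time_deriv z t", OF y' j i \<beta>(1)] unfolding e by eventually_elim simp
      qed
    next
      assume e: "ds = [(1, 0)] @ replicate \<beta> (0, 1)"
      show ?thesis
      proof (rule tdiff_cong_AE[OF D2[OF op j] t l(1)[OF op j] l(2)[OF op j t] sq sq'])
        show "AE x in lborel_on (dom2 G). lift G (bc_op G \<beta> i) (fst (\<psi> r j)) (snd (\<psi> r j)) x = wpd (dom2 G) ds (fst (snd (pdde_state G (v r, \<psi> r) (z r)) j) i) x"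
          if "0 \<le> r" for r
          using state_wpd_hist(2)[where z="z r", OF y[OF that] j i \<beta>(1)] unfolding e by eventually_elim simp
        show "AE x in lborel_on (dom2 G). lift G (bc_op G \<beta> i) (fst (\<psi>' j)) (snd (\<psi>' j)) x = wpd (dom2 G) ds (fst (snd (pdde_state G (v', \<psi>') (time_deriv z t)) j) i) x"
          using state_wpd_hist(2)[where z="time_deriv z t", OF y' j i \<beta>(1)] unfolding e by eventually_elim simp
      qed
    qed
  next
    fix j k ds assume j: "j \<in> {1..delays G}" and k: "k < nz G" and ds: "ds \<in> ord1 1"
    have sq: "wpd {0..1} ds (snd (snd (pdde_state G (v r, \<psi> r) (z r)) j) k) \<in> sqint {0..1}" if "0 \<le> r" for r
      by (rule sobolev_wpd(1)[OF PDDE_spaceD(3)[OF sp[OF that] j k] ds])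
    have sq': "wpd {0..1} ds (snd (snd (pdde_state G (v', \<psi>') (time_deriv z t)) j) k) \<in> sqint {0..1}"
      by (rule sobolev_wpd(1)[OF PDDE_spaceD(3)[OF sp' j k] ds])
    have "ds = [] \<or> ds = [1]" using ds by (auto simp: ord1_def le_Suc_eq)
    then show "tdiff {0..1} (\<lambda>r. wpd {0..1} ds (snd (snd (pdde_state G (v r, \<psi> r) (z r)) j) k)) (wpd {0..1} ds (snd (snd (pdde_state G (v', \<psi>') (time_deriv z t)) j) k)) t"
    proof
      assume e: "ds = []"
      note op = hist_z_pi_op[OF k]
      have D: "tdiff {0..1} (\<lambda>r s. z r k + prim 0 (snd (\<psi> r j) k) s) (\<lambda>s. time_deriv z t k + prim 0 (snd (\<psi>' j) k) s) t"
        by (rule pi_op_tdiff[OF op t \<psi>(2)[OF _ j] \<psi>'(2)[OF j] d\<psi>(2)[OF j] z_derivative[OF t]])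
      show ?thesis
      proof (rule tdiff_cong_AE[OF D t _ _ sq sq'])
        show "(\<lambda>s. z r k + prim 0 (snd (\<psi> r j) k) s) \<in> sqint {0..1}" if "0 \<le> r" for r
          by (rule pi_op_sqint[OF op \<psi>(2)[OF that j]])
        show "(\<lambda>s. time_deriv z t k + prim 0 (snd (\<psi>' j) k) s) \<in> sqint {0..1}"
          by (rule pi_op_sqint[OF op \<psi>'(2)[OF j]])
        show "AE s in lborel_on {0..1}. z r k + prim 0 (snd (\<psi> r j) k) s = wpd {0..1} ds (snd (snd (pdde_state G (v r, \<psi> r) (z r)) j) k) s"
          if "0 \<le> r" for r
          using state_wpd_z(1)[where z="z r", OF y[OF that] j k] unfolding e by eventually_elim simp
        show "AE s in lborel_on {0..1}. time_deriv z t k + prim 0 (snd (\<psi>' j) k) s = wpd {0..1} ds (snd (snd (pdde_state G (v', \<psi>') (time_deriv z t)) j) k) s"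
          using state_wpd_z(1)[where z="time_deriv z t", OF y' j k] unfolding e by eventually_elim simp
      qed
    next
      assume e: "ds = [1]"
      show ?thesis
      proof (rule tdiff_cong_AE[OF d\<psi>(2)[OF j k] t L2_sqint[OF \<psi>(2)[OF _ j] k] L2_sqint[OF \<psi>'(2)[OF j] k] sq sq'])
        show "AE s in lborel_on {0..1}. snd (\<psi> r j) k s = wpd {0..1} ds (snd (snd (pdde_state G (v r, \<psi> r) (z r)) j) k) s"
          if "0 \<le> r" for r
          using state_wpd_z(2)[where z="z r", OF y[OF that] j k] unfolding e by eventually_elim simp
        show "AE s in lborel_on {0..1}. snd (\<psi>' j) k s = wpd {0..1} ds (snd (snd (pdde_state G (v', \<psi>') (time_deriv z t)) j) k) s"
          using state_wpd_z(2)[where z="time_deriv z t", OF y' j k] unfolding e by eventually_elim simp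
      qed
    qed
  qed
qed

end

end

lemma eqf_sym: "eqf n S f g \<Longrightarrow> eqf n S g f"
  by (simp add: eqf_def eq_commute)

lemma eqf_trans: "eqf n S f g \<Longrightarrow> eqf n S g h \<Longrightarrow> eqf n S f h"
  unfolding eqf_def
proof (intro allI impI)
  fix i assume "\<forall>i<n. AE x in lborel_on S. f i x = g i x" "\<forall>i<n. AE x in lborel_on S. g i x = h i x" "i < n"
  then have "AE x in lborel_on S. f i x = g i x" "AE x in lborel_on S. g i x = h i x" by auto
  then show "AE x in lborel_on S. f i x = h i x" by eventually_elim simp
qed

lemma eqhist_sym: "eqhist G p q \<Longrightarrow> eqhist G q p"
  by (simp add: eqhist_def eqf_sym)

lemma eqhist_trans: "eqhist G p q \<Longrightarrow> eqhist G q r \<Longrightarrow> eqhist G p r"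
  unfolding eqhist_def by (elim conjE, intro conjI; erule (1) eqf_trans)

lemma eqstate_sym: "eqstate G p q \<Longrightarrow> eqstate G q p"
  by (simp add: eqstate_def eqf_sym eqhist_sym)

lemma eqstate_trans: "eqstate G p q \<Longrightarrow> eqstate G q r \<Longrightarrow> eqstate G p r"
  unfolding eqstate_def
  by (elim conjE, intro conjI ballI, erule (1) eqf_trans) (drule (1) bspec, drule (1) bspec, erule (1) eqhist_trans)

lemma wpd_Nil_AE:
  "f \<in> sqint (cbox A B) \<Longrightarrow> AE x in lborel_on (cbox A B). wpd (cbox A B) [] f x = f x"
  by (rule wpd_eqI[OF _ weak_pd_Nil])

lemma tdiff_Nil_unique:
  assumes S: "S = cbox A B" and f: "\<And>r. 0 \<le> r \<Longrightarrow> f r \<in> sobolev S D" "f' \<in> sobolev S D" "g' \<in> sobolev S D" and D: "[] \<in> D"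
    and d: "tdiff S (\<lambda>r. wpd S [] (f r)) (wpd S [] f') t" "tdiff S (\<lambda>r. wpd S [] (f r)) (wpd S [] g') t" and t: "0 \<le> t"
  shows "AE x in lborel_on S. f' x = g' x"
proof -
  have "AE x in lborel_on S. wpd S [] f' x = wpd S [] g' x"
    by (rule tdiff_unique[OF d t]) (use f D in \<open>auto intro: sobolev_wpd(1)\<close>)
  moreover have "AE x in lborel_on S. wpd S [] f' x = f' x" "AE x in lborel_on S. wpd S [] g' x = g' x"
    using wpd_Nil_AE[of _ A B, folded S] f sobolev_sqint by blast+
  ultimately show ?thesis by eventually_elim simp
qed

text \<open>The derivatives of order zero are among those that \<open>PDDE_norm\<close> controls.\<close>

lemma frechet_PDDE_unique:
  assumes y: "\<And>r. 0 \<le> r \<Longrightarrow> y r \<in> PDDE_space G" "p \<in> PDDE_space G" "q \<in> PDDE_space G" and t: "0 \<le> t"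
    and d: "frechet (PDDE_norm G) y p t" "frechet (PDDE_norm G) y q t"
  shows "eqstate G p q"
  unfolding eqstate_def eqhist_def eqf_def
proof (intro conjI allI ballI impI)
  note d' = frechet_PDDE_tdiff[THEN iffD1, OF y(1,2) t d(1)] frechet_PDDE_tdiff[THEN iffD1, OF y(1,3) t d(2)]
  note o = top_orders(4,5)
  show "AE x in lborel_on (dom1 G). fst p i x = fst q i x" if i: "i < ntot G" for i
    by (rule tdiff_Nil_unique[OF interval_cbox, where f="\<lambda>r. fst (y r) i" and D="ord1 (reg G i)"])
      (use d' o i t PDDE_spaceD(1)[OF y(1)] PDDE_spaceD(1)[OF y(2)] PDDE_spaceD(1)[OF y(3)] in auto)
  show "AE x in lborel_on (dom2 G). fst (snd p j) i x = fst (snd q j) i x" if "j \<in> {1..delays G}" "i < ntot G" for j i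
    by (rule tdiff_Nil_unique[OF rect_cbox, where f="\<lambda>r. fst (snd (y r) j) i" and D="ord2 (reg G i)"])
      (use d' o that t PDDE_spaceD(2)[OF y(1)] PDDE_spaceD(2)[OF y(2)] PDDE_spaceD(2)[OF y(3)] in auto)
  show "AE x in lborel_on {0..1}. snd (snd p j) k x = snd (snd q j) k x" if "j \<in> {1..delays G}" "k < nz G" for j k
    by (rule tdiff_Nil_unique[OF interval_cbox, where f="\<lambda>r. snd (snd (y r) j) k" and D="ord1 1"])
      (use d' o that t PDDE_spaceD(3)[OF y(1)] PDDE_spaceD(3)[OF y(2)] PDDE_spaceD(3)[OF y(3)] in auto)
qed

lemma top_deriv_cong:
  assumes p: "p \<in> PDDE_space G" and q: "q \<in> PDDE_space G" and eq: "eqstate G p q"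
  shows "eqstate G (top_deriv G p) (top_deriv G q)"
proof -
  have B: "set ([(1, 0)] @ replicate k (0, 1)) \<subseteq> (Basis :: (real \<times> real) set)" for k
    using Basis_prod_real by auto
  have "wpd (dom1 G) (replicate (reg G i) 1) (fst p i) = wpd (dom1 G) (replicate (reg G i) 1) (fst q i)" if i: "i < ntot G" for i
    by (rule wpd_cong[OF _ _ _ replicate_Basis compact_Icc])
      (use eq i PDDE_spaceD(1)[OF p i] PDDE_spaceD(1)[OF q i] in \<open>auto simp: eqstate_def eqf_def intro: sqint_measurable sobolev_sqint\<close>)
  moreover have "wpd (dom2 G) ([(1, 0)] @ replicate (reg G i) (0, 1)) (fst (snd p j) i) = wpd (dom2 G) ([(1, 0)] @ replicate (reg G i) (0, 1)) (fst (snd q j) i)"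
    if "j \<in> {1..delays G}" "i < ntot G" for i j
    by (rule wpd_cong[OF _ _ _ B compact_rect])
      (use eq that PDDE_spaceD(2)[OF p that] PDDE_spaceD(2)[OF q that] in \<open>auto simp: eqstate_def eqhist_def eqf_def intro: sqint_measurable sobolev_sqint\<close>)
  moreover have "wpd {0..1} [1] (snd (snd p j) k) = wpd {0..1} [1] (snd (snd q j) k)" if "j \<in> {1..delays G}" "k < nz G" for k j
    by (rule wpd_cong)
      (use eq that PDDE_spaceD(3)[OF p that] PDDE_spaceD(3)[OF q that] in \<open>auto simp: eqstate_def eqhist_def eqf_def intro: sqint_measurable sobolev_sqint\<close>)
  ultimately show ?thesis
    by (simp add: eqstate_def eqhist_def eqf_def top_deriv_def)
qed

context
  fixes G :: pdde_data
  assumes adm: "admissible G" and wp: "well_posed G"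
begin

lemma hist_cong:
  assumes y: "(v0, \<psi>0) \<in> PIE_space G" "(v1, \<psi>1) \<in> PIE_space G" and eq: "eqstate G (v0, \<psi>0) (v1, \<psi>1)"
    and j: "j \<in> {1..delays G}" and op: "pio G Op"
  shows "AE p in lborel_on (dom2 G). hist G Op v0 z (fst (\<psi>0 j)) (snd (\<psi>0 j)) p = hist G Op v1 z (fst (\<psi>1 j)) (snd (\<psi>1 j)) p"
proof (rule rect_AE_eqI)
  note G = G_bc[OF adm wp]
  note v = PIE_v[OF adm wp y(1)] PIE_v[OF adm wp y(2)]
  note \<psi> = PIE_\<psi>[OF adm wp y(1) j] PIE_\<psi>[OF adm wp y(2) j]
  have e: "eqf (ntot G) (dom1 G) v0 v1" "eqf (ntot G) (dom2 G) (fst (\<psi>0 j)) (fst (\<psi>1 j))" "eqf (nz G) {0..1} (snd (\<psi>0 j)) (snd (\<psi>1 j))"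
    using eq j by (auto simp: eqstate_def eqhist_def)
  have "AE x in lborel_on (dom1 G). Op v0 z x = Op v1 z x"
    by (rule pi_op_cong_AE[OF op v e(1)]) (simp add: eqv_def)
  moreover have "AE x in lborel_on (dom1 G). \<forall>s\<in>{0..1}. tprim (lift G Op (fst (\<psi>0 j)) (snd (\<psi>0 j))) (s, x) = tprim (lift G Op (fst (\<psi>1 j)) (snd (\<psi>1 j))) (s, x)"
    by (rule tprim_cong_AE(2)[OF lift_sqint[OF G v(1) \<psi>(1,2) op] lift_sqint[OF G v(2) \<psi>(3,4) op]
          pi_lift_cong_AE[OF op \<psi> e(2,3)]])
  ultimately have ae: "AE x in lborel_on (dom1 G). \<forall>s\<in>{0..1}. hist G Op v0 z (fst (\<psi>0 j)) (snd (\<psi>0 j)) (s, x) = hist G Op v1 z (fst (\<psi>1 j)) (snd (\<psi>1 j)) (s, x)"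
    by eventually_elim (simp add: hist_def)
  show "AE s in lborel_on {0..1}. AE x in lborel_on (dom1 G). hist G Op v0 z (fst (\<psi>0 j)) (snd (\<psi>0 j)) (s, x) = hist G Op v1 z (fst (\<psi>1 j)) (snd (\<psi>1 j)) (s, x)"
  proof (rule AE_I2)
    fix s :: real assume "s \<in> space (lborel_on {0..1})"
    with ae show "AE x in lborel_on (dom1 G). hist G Op v0 z (fst (\<psi>0 j)) (snd (\<psi>0 j)) (s, x) = hist G Op v1 z (fst (\<psi>1 j)) (snd (\<psi>1 j)) (s, x)"
      by (auto elim: eventually_mono)
  qed
  show "hist G Op v0 z (fst (\<psi>0 j)) (snd (\<psi>0 j)) \<in> borel_measurable (lborel_on (dom2 G))"
    "hist G Op v1 z (fst (\<psi>1 j)) (snd (\<psi>1 j)) \<in> borel_measurable (lborel_on (dom2 G))"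
    by (rule sqint_measurable[OF hist_sqint[OF G v(1) \<psi>(1,2) op]], rule sqint_measurable[OF hist_sqint[OF G v(2) \<psi>(3,4) op]])
qed auto

lemma state_cong:
  assumes y: "(v0, \<psi>0) \<in> PIE_space G" "(v1, \<psi>1) \<in> PIE_space G" and eq: "eqstate G (v0, \<psi>0) (v1, \<psi>1)"
  shows "eqstate G (pdde_state G (v0, \<psi>0) z) (pdde_state G (v1, \<psi>1) z)"
  unfolding eqstate_def eqhist_def eqf_def
proof (intro conjI allI ballI impI)
  note G = G_bc[OF adm wp]
  note v = PIE_v[OF adm wp y(1)] PIE_v[OF adm wp y(2)]
  fix i assume i: "i < ntot G"
  have "AE x in lborel_on (dom1 G). bc_op G 0 i v0 z x = bc_op G 0 i v1 z x"
    by (rule pi_op_cong_AE[OF bc_op_pi_op[OF G i le0] v]) (use eq in \<open>auto simp: eqstate_def eqv_def\<close>)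
  with state_u(2)[OF adm wp y(1) i, of z] state_u(2)[OF adm wp y(2) i, of z]
  show "AE x in lborel_on (dom1 G). fst (pdde_state G (v0, \<psi>0) z) i x = fst (pdde_state G (v1, \<psi>1) z) i x"
    unfolding pdde_state_apply by eventually_elim simp
next
  note G = G_bc[OF adm wp]
  note v = PIE_v[OF adm wp y(1)] PIE_v[OF adm wp y(2)]
  fix j i assume j: "j \<in> {1..delays G}" and i: "i < ntot G"
  note \<psi> = PIE_\<psi>[OF adm wp y(1) j] PIE_\<psi>[OF adm wp y(2) j]
  from hist_u_AE[OF G v(1) \<psi>(1,2) i, of z] hist_u_AE[OF G v(2) \<psi>(3,4) i, of z] hist_cong[OF y eq j bc_op_pi_op[OF G i le0], of z]
  show "AE p in lborel_on (dom2 G). fst (snd (pdde_state G (v0, \<psi>0) z) j) i p = fst (snd (pdde_state G (v1, \<psi>1) z) j) i p"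
    unfolding pdde_state_apply fst_conv by eventually_elim simp
next
  fix j k assume j: "j \<in> {1..delays G}" and k: "k < nz G"
  note \<psi> = PIE_\<psi>[OF adm wp y(1) j] PIE_\<psi>[OF adm wp y(2) j]
  have "AE s in lborel_on {0..1}. z k + prim 0 (snd (\<psi>0 j) k) s = z k + prim 0 (snd (\<psi>1 j) k) s"
    by (rule pi_op_cong_AE[OF hist_z_pi_op[OF k] \<psi>(2,4)]) (use eq j in \<open>auto simp: eqstate_def eqhist_def eqv_def\<close>)
  then show "AE s in lborel_on {0..1}. snd (snd (pdde_state G (v0, \<psi>0) z) j) k s = snd (snd (pdde_state G (v1, \<psi>1) z) j) k s"
    by (simp add: pdde_state_apply hist_z_apply)
qed

text \<open>The data can be recovered as top derivatives.\<close>

lemma state_inj: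
  assumes y: "(v0, \<psi>0) \<in> PIE_space G" "(v1, \<psi>1) \<in> PIE_space G"
    and eq: "eqstate G (pdde_state G (v0, \<psi>0) z) (pdde_state G (v1, \<psi>1) z)"
  shows "eqstate G (v0, \<psi>0) (v1, \<psi>1)"
  by (rule eqstate_trans[OF eqstate_trans[OF eqstate_sym[OF top_deriv_state[OF adm wp y(1)]]
        top_deriv_cong[OF state_PDDE_space[OF adm wp y(1)] state_PDDE_space[OF adm wp y(2)] eq]]
        top_deriv_state[OF adm wp y(2)]])

lemma evolution_iff:
  assumes y: "(v, \<psi>) \<in> PIE_space G"
  shows "eqstate G Y (Ahat_op G (v, \<psi>) + Bhatz_op G z) \<longleftrightarrow>
    (\<forall>j\<in>{1..delays G}. eqhist G (snd Y j) (transport G j (snd (pdde_state G (v, \<psi>) z) j))) \<and>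
    eqf (ntot G) (dom1 G) (fst Y) (PDDE_rhs G z (pdde_state G (v, \<psi>) z))"
  unfolding eqstate_def
proof (intro iffI conjI ballI)
  note r = PDDE_rhs_state[OF adm wp y, of z] and tr = transport_state[OF adm wp y, of _ z]
  let ?s = "pdde_state G (v, \<psi>) z" and ?R = "Ahat_op G (v, \<psi>) + Bhatz_op G z"
  {
    assume "eqf (ntot G) (dom1 G) (fst Y) (fst ?R) \<and> (\<forall>j\<in>{1..delays G}. eqhist G (snd Y j) (snd ?R j))"
    then have 1: "eqf (ntot G) (dom1 G) (fst Y) (fst ?R)" "\<And>j. j \<in> {1..delays G} \<Longrightarrow> eqhist G (snd Y j) (snd ?R j)" by auto
    show "eqhist G (snd Y j) (transport G j (snd ?s j))" if "j \<in> {1..delays G}" for j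
      by (rule eqhist_trans[OF 1(2)[OF that] eqhist_sym[OF tr[OF that]]])
    show "eqf (ntot G) (dom1 G) (fst Y) (PDDE_rhs G z ?s)"
      by (rule eqf_trans[OF 1(1) eqf_sym[OF r]])
  }
  {
    assume "(\<forall>j\<in>{1..delays G}. eqhist G (snd Y j) (transport G j (snd ?s j))) \<and> eqf (ntot G) (dom1 G) (fst Y) (PDDE_rhs G z ?s)"
    then have 1: "\<And>j. j \<in> {1..delays G} \<Longrightarrow> eqhist G (snd Y j) (transport G j (snd ?s j))" "eqf (ntot G) (dom1 G) (fst Y) (PDDE_rhs G z ?s)" by auto
    show "eqf (ntot G) (dom1 G) (fst Y) (fst ?R)"
      by (rule eqf_trans[OF 1(2) r])
    show "eqhist G (snd Y j) (snd ?R j)" if "j \<in> {1..delays G}" for j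
      by (rule eqhist_trans[OF 1(1)[OF that] tr[OF that]])
  }
qed

text \<open>Top derivatives are among the components that \<open>PDDE_norm\<close> controls.\<close>

lemma frechet_top_deriv:
  assumes y: "\<And>t. 0 \<le> t \<Longrightarrow> (v t, \<psi> t) \<in> PIE_space G" and t: "0 \<le> t" and p: "p \<in> PDDE_space G"
    and d: "frechet (PDDE_norm G) (\<lambda>r. pdde_state G (v r, \<psi> r) (z r)) p t"
  shows "frechet (PIE_norm G) (\<lambda>t. (v t, \<psi> t)) (top_deriv G p) t"
proof -
  note v = PIE_v[OF adm wp y] and \<psi> = PIE_\<psi>[OF adm wp y] and sp = state_PDDE_space[OF adm wp y]
  note d' = frechet_PDDE_tdiff[THEN iffD1, OF sp p t d]
  have top: "eqstate G (top_deriv G (pdde_state G (v r, \<psi> r) (z r))) (v r, \<psi> r)" if "0 \<le> r" for r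
    by (rule top_deriv_state[OF adm wp y[OF that]])
  have ts: "top_deriv G (pdde_state G (v r, \<psi> r) (z r)) \<in> PIE_space G" if "0 \<le> r" for r
    by (rule top_deriv_PIE_space[OF sp[OF that]])
  have tp: "top_deriv G p \<in> PIE_space G" by (rule top_deriv_PIE_space[OF p])
  have sq: "i < ntot G \<Longrightarrow> fst q i \<in> sqint (dom1 G)"
    "j \<in> {1..delays G} \<Longrightarrow> i < ntot G \<Longrightarrow> fst (snd q j) i \<in> sqint (dom2 G)"
    "j \<in> {1..delays G} \<Longrightarrow> k < nz G \<Longrightarrow> snd (snd q j) k \<in> sqint {0..1}" if "q \<in> PIE_space G" for q i j k
    using that by (auto simp: PIE_space_def L2_def)
  show ?thesis
    unfolding frechet_PIE_iff
  proof (intro conjI allI ballI impI)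
    fix i assume i: "i < ntot G"
    show "tdiff (dom1 G) (\<lambda>r. fst (v r, \<psi> r) i) (fst (top_deriv G p) i) t"
    proof (rule tdiff_cong_AE[where f="\<lambda>r. fst (top_deriv G (pdde_state G (v r, \<psi> r) (z r))) i" and f'="fst (top_deriv G p) i"])
      show "tdiff (dom1 G) (\<lambda>r. fst (top_deriv G (pdde_state G (v r, \<psi> r) (z r))) i) (fst (top_deriv G p) i) t"
        using d' i top_orders(1)[of G i] by (simp add: top_deriv_def)
    qed (use t top i sq(1)[OF ts i] sq(1)[OF tp i] sq(1)[OF y i] in \<open>auto simp: eqstate_def eqf_def\<close>)
  next
    fix j i assume j: "j \<in> {1..delays G}" and i: "i < ntot G"
    show "tdiff (dom2 G) (\<lambda>r. fst (snd (v r, \<psi> r) j) i) (fst (snd (top_deriv G p) j) i) t"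
    proof (rule tdiff_cong_AE[where f="\<lambda>r. fst (snd (top_deriv G (pdde_state G (v r, \<psi> r) (z r))) j) i" and f'="fst (snd (top_deriv G p) j) i"])
      show "tdiff (dom2 G) (\<lambda>r. fst (snd (top_deriv G (pdde_state G (v r, \<psi> r) (z r))) j) i) (fst (snd (top_deriv G p) j) i) t"
        using d' i j top_orders(2)[of G i] by (simp add: top_deriv_def)
    qed (use t top i j sq(2)[OF ts j i] sq(2)[OF tp j i] sq(2)[OF y j i] in \<open>auto simp: eqstate_def eqhist_def eqf_def\<close>)
  next
    fix j k assume j: "j \<in> {1..delays G}" and k: "k < nz G"
    show "tdiff {0..1} (\<lambda>r. snd (snd (v r, \<psi> r) j) k) (snd (snd (top_deriv G p) j) k) t"
    proof (rule tdiff_cong_AE[where f="\<lambda>r. snd (snd (top_deriv G (pdde_state G (v r, \<psi> r) (z r))) j) k" and f'="snd (snd (top_deriv G p) j) k"])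
      show "tdiff {0..1} (\<lambda>r. snd (snd (top_deriv G (pdde_state G (v r, \<psi> r) (z r))) j) k) (snd (snd (top_deriv G p) j) k) t"
        using d' k j top_orders(3) by (simp add: top_deriv_def)
    qed (use t top k j sq(3)[OF ts j k] sq(3)[OF tp j k] sq(3)[OF y j k] in \<open>auto simp: eqstate_def eqhist_def eqf_def\<close>)
  qed
qed

end

theorem corollary23:
  fixes G :: pdde_data
    and z w :: "real \<Rightarrow> rvec"
    and v0 :: "real vfun"
    and \<psi>0 :: "nat \<Rightarrow> (real \<times> real) vfun \<times> real vfun"
    and v :: "real \<Rightarrow> real vfun"
    and \<psi> :: "real \<Rightarrow> nat \<Rightarrow> (real \<times> real) vfun \<times> real vfun"
  assumes "admissible G"
    and "well_posed G"
    and "\<forall>t\<ge>0. \<forall>i<nz G. (\<lambda>r. z r i) differentiable (at t within {0..})"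
    and "(v0, \<psi>0) \<in> PIE_space G"
    and "\<forall>t\<ge>0. (v t, \<psi> t) \<in> PIE_space G"
  shows "PIE_solution G z (v0, \<psi>0) (\<lambda>t. (v t, \<psi> t)) w \<longleftrightarrow>
    PDDE_solution G z (That_op G (v0, \<psi>0) + Thatz_op G (z 0))
      (\<lambda>t. That_op G (v t, \<psi> t) + Thatz_op G (z t)) w"
proof -
  note adm = assms(1) and wp = assms(2) and y0 = assms(4)
  have y: "(v t, \<psi> t) \<in> PIE_space G" if "0 \<le> t" for t using assms(5) that by blast
  have dz: "(\<lambda>r. z r i) differentiable (at t within {0..})" if "0 \<le> t" "i < nz G" for t i
    using assms(3) that by blast
  let ?s = "\<lambda>t. pdde_state G (v t, \<psi> t) (z t)"
  have out: "eqv (nw G) (w t) (PDDE_output G (z t) (?s t)) \<longleftrightarrow> eqv (nw G) (w t) (Chatw_op G (v t, \<psi> t) + Dhatwz_op G (z t))"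
    if "0 \<le> t" for t
    using PDDE_output_state[OF adm wp y[OF that], of "z t"] by (auto simp: eqv_def)
  \<comment> \<open>The initial conditions correspond because the change of variables is well defined and injective on classes.\<close>
  have init: "eqstate G (v 0, \<psi> 0) (v0, \<psi>0) \<longleftrightarrow> eqstate G (?s 0) (pdde_state G (v0, \<psi>0) (z 0))"
    using state_cong[OF adm wp y[OF order_refl] y0] state_inj[OF adm wp y[OF order_refl] y0] by blast
  have fre: "frechet (PDDE_norm G) ?s (pdde_state G y' (time_deriv z t)) t"
    if "0 \<le> t" "y' \<in> PIE_space G" "frechet (PIE_norm G) (\<lambda>t. (v t, \<psi> t)) y' t" for t y'
    using frechet_state[where v'="fst y'" and \<psi>'="snd y'", OF adm wp y dz that(1)] that(2,3) by simp
  have sp': "pdde_state G y' x \<in> PDDE_space G" if "y' \<in> PIE_space G" for y' x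
    using state_PDDE_space[OF adm wp, of "fst y'" "snd y'" x] that by simp
  have "PIE_solution G z (v0, \<psi>0) (\<lambda>t. (v t, \<psi> t)) w \<longleftrightarrow> PDDE_solution G z (pdde_state G (v0, \<psi>0) (z 0)) ?s w"
  proof
    assume "PIE_solution G z (v0, \<psi>0) (\<lambda>t. (v t, \<psi> t)) w"
    then obtain y' where i: "eqstate G (v 0, \<psi> 0) (v0, \<psi>0)"
      and y': "\<And>t. 0 \<le> t \<Longrightarrow> y' t \<in> PIE_space G" "\<And>t. 0 \<le> t \<Longrightarrow> frechet (PIE_norm G) (\<lambda>t. (v t, \<psi> t)) (y' t) t"
        "\<And>t. 0 \<le> t \<Longrightarrow> eqstate G (Thatz_op G (time_deriv z t) + That_op G (y' t)) (Ahat_op G (v t, \<psi> t) + Bhatz_op G (z t))"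
        "\<And>t. 0 \<le> t \<Longrightarrow> eqv (nw G) (w t) (Chatw_op G (v t, \<psi> t) + Dhatwz_op G (z t))"
      unfolding PIE_solution_def by blast
    show "PDDE_solution G z (pdde_state G (v0, \<psi>0) (z 0)) ?s w"
      unfolding PDDE_solution_def
    proof (intro conjI allI impI exI[of _ "\<lambda>t. pdde_state G (y' t) (time_deriv z t)"])
      show "compatible G (z 0) (pdde_state G (v0, \<psi>0) (z 0))" by (rule compatible_state[OF adm wp y0])
      show "eqstate G (?s 0) (pdde_state G (v0, \<psi>0) (z 0))" using init i by blast
    next
      fix t :: real assume t: "0 \<le> t"
      show "compatible G (z t) (?s t)" by (rule compatible_state[OF adm wp y[OF t]])
      show "pdde_state G (y' t) (time_deriv z t) \<in> PDDE_space G" by (rule sp'[OF y'(1)[OF t]])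
      show "frechet (PDDE_norm G) ?s (pdde_state G (y' t) (time_deriv z t)) t" by (rule fre[OF t y'(1,2)[OF t]])
      have "eqstate G (pdde_state G (y' t) (time_deriv z t)) (Ahat_op G (v t, \<psi> t) + Bhatz_op G (z t))"
        using y'(3)[OF t] by (simp only: pdde_state_def add.commute)
      then show "\<forall>j\<in>{1..delays G}. eqhist G (snd (pdde_state G (y' t) (time_deriv z t)) j) (transport G j (snd (?s t) j))"
        "eqf (ntot G) (dom1 G) (fst (pdde_state G (y' t) (time_deriv z t))) (PDDE_rhs G (z t) (?s t))"
        unfolding evolution_iff[OF adm wp y[OF t]] by blast+
      show "eqv (nw G) (w t) (PDDE_output G (z t) (?s t))" using out[OF t] y'(4)[OF t] by blast
    qed
  next
    assume "PDDE_solution G z (pdde_state G (v0, \<psi>0) (z 0)) ?s w"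
    then obtain p where i: "eqstate G (?s 0) (pdde_state G (v0, \<psi>0) (z 0))"
      and p: "\<And>t. 0 \<le> t \<Longrightarrow> p t \<in> PDDE_space G" "\<And>t. 0 \<le> t \<Longrightarrow> frechet (PDDE_norm G) ?s (p t) t"
        "\<And>t. 0 \<le> t \<Longrightarrow> \<forall>j\<in>{1..delays G}. eqhist G (snd (p t) j) (transport G j (snd (?s t) j))"
        "\<And>t. 0 \<le> t \<Longrightarrow> eqf (ntot G) (dom1 G) (fst (p t)) (PDDE_rhs G (z t) (?s t))"
        "\<And>t. 0 \<le> t \<Longrightarrow> eqv (nw G) (w t) (PDDE_output G (z t) (?s t))"
      unfolding PDDE_solution_def by blast
    \<comment> \<open>The derivative of \<open>(v, \<psi>)\<close> has to be recovered from that of the state.\<close>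
    define y' where "y' t = top_deriv G (p t)" for t
    show "PIE_solution G z (v0, \<psi>0) (\<lambda>t. (v t, \<psi> t)) w"
      unfolding PIE_solution_def
    proof (intro conjI allI impI exI[of _ y'])
      show "(v0, \<psi>0) \<in> PIE_space G" by (rule y0)
      show "eqstate G (v 0, \<psi> 0) (v0, \<psi>0)" using init i by blast
    next
      fix t :: real assume t: "0 \<le> t"
      show "(v t, \<psi> t) \<in> PIE_space G" by (rule y[OF t])
      show s: "y' t \<in> PIE_space G" unfolding y'_def by (rule top_deriv_PIE_space[OF p(1)[OF t]])
      show f: "frechet (PIE_norm G) (\<lambda>t. (v t, \<psi> t)) (y' t) t"
        unfolding y'_def by (rule frechet_top_deriv[OF adm wp y t p(1)[OF t] p(2)[OF t]])
      have "eqstate G (p t) (Ahat_op G (v t, \<psi> t) + Bhatz_op G (z t))"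
        unfolding evolution_iff[OF adm wp y[OF t]] using p(3,4)[OF t] by blast
      \<comment> \<open>Both are derivatives of the state at \<open>t\<close>: one by the forward direction, the other by assumption.\<close>
      moreover have "eqstate G (pdde_state G (y' t) (time_deriv z t)) (p t)"
        by (rule frechet_PDDE_unique[OF _ sp'[OF s] p(1)[OF t] t fre[OF t s f] p(2)[OF t]])
          (rule state_PDDE_space[OF adm wp y])
      ultimately have "eqstate G (pdde_state G (y' t) (time_deriv z t)) (Ahat_op G (v t, \<psi> t) + Bhatz_op G (z t))"
        by (rule eqstate_trans[rotated])
      then show "eqstate G (Thatz_op G (time_deriv z t) + That_op G (y' t)) (Ahat_op G (v t, \<psi> t) + Bhatz_op G (z t))"
        by (simp only: pdde_state_def add.commute)
      show "eqv (nw G) (w t) (Chatw_op G (v t, \<psi> t) + Dhatwz_op G (z t))" using out[OF t] p(5)[OF t] by blast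
    qed
  qed
  then show ?thesis by (simp only: pdde_state_def)
qed

end
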